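(* The rectilinear crossing number of the complete graph $K_{30}$ is $\overline{\mathrm{cr}}(K_{30})=9726$.
   Context: A geometric drawing of a graph is a drawing in the plane in which the vertices are points in general position and the edges are straight line segments. The rectilinear crossing number $\overline{\mathrm{cr}}(G)$ of a graph $G$ is the minimum number of edge crossings over all geometric drawings of $G$. *)

theory Defs
  imports "HOL-Analysis.Analysis"
begin

text \<open>A graph is given by a vertex set V and a set E of edges, each edge a 2-element
subset of V. A geometric drawing places the vertices injectively at points of the plane
in general position (no three collinear); edges are straight segments.\<close>

definition geometric_drawing :: "'v set \<Rightarrow> ('v \<Rightarrow> real^2) \<Rightarrow> bool" where
  "geometric_drawing V p \<longleftrightarrow> inj_on p V \<and>
     (\<forall>a\<in>V. \<forall>b\<in>V. \<forall>c\<in>V. distinct [a, b, c] \<longrightarrow> \<not> collinear {p a, p b, p c})"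

text \<open>Crossings: unordered pairs of edges without common endpoint whose segments meet.
(In general position, edges sharing an endpoint meet only there, so this counts exactly
the edge crossings.)\<close>

definition crossings :: "'v set set \<Rightarrow> ('v \<Rightarrow> real^2) \<Rightarrow> nat" where
  "crossings E p = card {{e, f} | e f. e \<in> E \<and> f \<in> E \<and> e \<inter> f = {} \<and>
       convex hull (p ` e) \<inter> convex hull (p ` f) \<noteq> {}}"

definition rect_crossing_number :: "'v set \<Rightarrow> 'v set set \<Rightarrow> nat" where
  "rect_crossing_number V E = (LEAST k. \<exists>p. geometric_drawing V p \<and> crossings E p = k)"

definition complete_graph_edges :: "'v set \<Rightarrow> 'v set set" where
  "complete_graph_edges V = {e. e \<subseteq> V \<and> card e = 2}"

end

theory Submission
  imports Defs
begin

text \<open>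
Sweeping a direction through a set of \<open>30\<close> points produces a circular sequence of permutations in which
consecutive ones differ by a transposition, and the number of crossings is a positive combination of the numbers
\<open>a\<^sub>k\<close> of transpositions at distance at most \<open>k\<close> from the ends (\<open>k \<le> 14\<close>), minus a constant. Removing three
extremal points inductively bounds \<open>a\<^sub>k\<close> from below for \<open>k \<le> 13\<close>, and since two transpositions of the middle
pair of positions are separated by one of a neighbouring pair, \<open>a\<^sub>1\<^sub>4\<close> is bounded as well. Together this gives
\<open>9723\<close> crossings.

With fewer than \<open>9726\<close> crossings, \<open>a\<^sub>1\<^sub>0\<close>, \<open>a\<^sub>1\<^sub>2\<close> and \<open>a\<^sub>1\<^sub>3\<close> attain their bounds. Tightness of \<open>a\<^sub>1\<^sub>0\<close> splits
the points into three classes of ten that become consecutive in turn. Tightness of \<open>a\<^sub>1\<^sub>2\<close> and \<open>a\<^sub>1\<^sub>3\<close> forces the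
pattern in which tokens enter the four middle positions while a class passes, and forces every token that enters
to be transposed there with all tokens it meets. A finite potential argument then shows that each of the three
passages contains at least \<open>25\<close> transpositions of the two outer pairs of these positions. These \<open>75\<close>
transpositions push \<open>a\<^sub>1\<^sub>4\<close> to at least \<open>366\<close>, which is incompatible with fewer than \<open>9726\<close> crossings.
\<close>

section \<open>Circular sequences\<close>

text \<open>One crossing corresponds to one unit of the sum of
  \<open>(29 - 2 * k) * A_le V k\<close>. The bounds for \<open>k <= 13\<close> contribute 12405,
  and the alternation argument only gives \<open>A_le V 14 >= 363\<close>; a drawing with fewer than
  9726 crossings therefore has at most two units of slack. The weights 9, 5 and 3 at the levels 10,
  12 and 13 exceed that slack, whereas level 14 has weight 1, so the three missing units have to be
  found there.

  The obstacle is that alternation cannot exclude 72 transpositions of the middle pair and 72 of its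
  neighbours among the 144 in the middle. What helps is that a half turn has 192 transpositions at
  levels 13 to 17, hence 48 entries into the four middle positions, and \<open>3 * 48 = 144\<close>
  leaves no waste. The transpositions still due among the tokens present are thus described by six
  bits, one for each pair of positions, and the cost of a passage is bounded by a shortest path
  problem on these bits. The bound is 25, the three passages are disjoint in time, and 75 exceeds 72
  by the required three.\<close>

text \<open>Time is discrete: \<open>bef t\<close> is the order of the projected points after \<open>t\<close> transpositions of a
rotating sweep, and \<open>N\<close> is half a turn. The level of a transposition is the position (counted from \<open>0\<close>)
of the token that moves left, so a transposition at level \<open>k\<close> corresponds to an edge with \<open>k - 1\<close> points on
one side.\<close>

locale circular_seq =
  fixes V :: "'a set" and N :: int and bef :: "int \<Rightarrow> 'a \<Rightarrow> 'a \<Rightarrow> bool"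
  assumes fin: "finite V"
    and N_pos: "0 < N"
    and irr: "p \<in> V \<Longrightarrow> \<not> bef t p p"
    and tot: "p \<in> V \<Longrightarrow> q \<in> V \<Longrightarrow> p \<noteq> q \<Longrightarrow> bef t p q \<or> bef t q p"
    and tr: "p \<in> V \<Longrightarrow> q \<in> V \<Longrightarrow> r \<in> V \<Longrightarrow> bef t p q \<Longrightarrow> bef t q r \<Longrightarrow> bef t p r"
    and flip: "p \<in> V \<Longrightarrow> q \<in> V \<Longrightarrow> bef (t + N) p q \<longleftrightarrow> bef t q p"
    and one': "p \<in> V \<Longrightarrow> q \<in> V \<Longrightarrow> r \<in> V \<Longrightarrow> s \<in> V \<Longrightarrow> bef t p q \<Longrightarrow> bef (t + 1) q p \<Longrightarrow>
           bef t r s \<Longrightarrow> bef (t + 1) s r \<Longrightarrow> p = r \<and> q = s"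
    and once': "p \<in> V \<Longrightarrow> q \<in> V \<Longrightarrow> bef t p q \<Longrightarrow> bef (t + 1) q p \<Longrightarrow> t < t' \<Longrightarrow> t' \<le> t + N \<Longrightarrow> bef t' q p"
begin

definition swp :: "int \<Rightarrow> 'a \<Rightarrow> 'a \<Rightarrow> bool" where
  "swp t p q \<longleftrightarrow> p \<in> V \<and> q \<in> V \<and> bef t p q \<and> bef (t + 1) q p"

definition cnt :: "'a set \<Rightarrow> int \<Rightarrow> 'a \<Rightarrow> nat" where
  "cnt S t p = card {q \<in> S. bef t q p}"

definition ev :: "'a set \<Rightarrow> nat \<Rightarrow> int \<Rightarrow> bool" where
  "ev S k t \<longleftrightarrow> (\<exists>p\<in>S. \<exists>q\<in>S. swp t p q \<and> cnt S t q = k)"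

definition fst_set :: "'a set \<Rightarrow> nat \<Rightarrow> int \<Rightarrow> 'a set" where
  "fst_set S k t = {x \<in> S. cnt S t x < k}"

lemma swpD: "swp t p q \<Longrightarrow> p \<in> V" "swp t p q \<Longrightarrow> q \<in> V" "swp t p q \<Longrightarrow> bef t p q"
  "swp t p q \<Longrightarrow> bef (t + 1) q p"
  by (auto simp: swp_def)

lemma asym: "p \<in> V \<Longrightarrow> q \<in> V \<Longrightarrow> bef t p q \<Longrightarrow> \<not> bef t q p"
  using irr tr by blast

lemma bef_neq: "p \<in> V \<Longrightarrow> bef t p q \<Longrightarrow> p \<noteq> q"
  using irr by blast

lemma not_bef: "p \<in> V \<Longrightarrow> q \<in> V \<Longrightarrow> p \<noteq> q \<Longrightarrow> \<not> bef t p q \<longleftrightarrow> bef t q p"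
  using asym tot by blast

lemma swp_neq: "swp t p q \<Longrightarrow> p \<noteq> q"
  by (metis swpD(1,3) bef_neq)

lemma one: "swp t p q \<Longrightarrow> swp t r s \<Longrightarrow> p = r \<and> q = s"
  unfolding swp_def using one' by blast

lemma once: "swp t p q \<Longrightarrow> t < t' \<Longrightarrow> t' \<le> t + N \<Longrightarrow> bef t' q p"
  unfolding swp_def using once' by blast

lemma flip2: "p \<in> V \<Longrightarrow> q \<in> V \<Longrightarrow> bef (t + 2 * N) p q \<longleftrightarrow> bef t p q"
  using flip[of p q "t + N"] flip[of q p t] by (simp add: algebra_simps)

lemma flipm: "p \<in> V \<Longrightarrow> q \<in> V \<Longrightarrow> bef (t - N) p q \<longleftrightarrow> bef t q p"
  using flip[of q p "t - N"] by simp

lemma swp_flip: "swp (t + N) p q \<longleftrightarrow> swp t q p"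
  unfolding swp_def using flip[of p q t] flip[of q p "t + 1"] by (auto simp: algebra_simps)

lemma swp_flip2: "swp (t + 2 * N) p q \<longleftrightarrow> swp t p q"
  using swp_flip[of "t + N" p q] swp_flip[of t q p] by (simp add: algebra_simps)

lemma nochange: "p \<in> V \<Longrightarrow> q \<in> V \<Longrightarrow> \<not> swp t p q \<Longrightarrow> \<not> swp t q p \<Longrightarrow> bef (t + 1) p q \<longleftrightarrow> bef t p q"
  unfolding swp_def using not_bef irr by metis

lemma swp_other:
  assumes "swp t p q" "x \<in> V" "y \<in> V" "{x, y} \<noteq> {p, q}"
  shows "bef (t + 1) x y \<longleftrightarrow> bef t x y"
  using nochange[of x y t] one[OF assms(1), of x y] one[OF assms(1), of y x] assms by blast

text \<open>Only one pair changes its order in a step. A token strictly between the two would keep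
  both its comparisons, and transitivity at \<open>t + 1\<close> would then leave \<open>p\<close>
  before \<open>q\<close>.\<close>

lemma swp_adj:
  assumes "swp t p q" "r \<in> V" "r \<noteq> p" "r \<noteq> q"
  shows "bef t r p \<longleftrightarrow> bef t r q"
proof -
  have pq: "p \<in> V" "q \<in> V" "bef t p q" "bef (t + 1) q p" using assms swpD by auto
  show ?thesis
  proof
    assume "bef t r p" then show "bef t r q" using tr pq assms by blast
  next
    assume rq: "bef t r q"
    show "bef t r p"
    proof (rule ccontr)
      assume "\<not> bef t r p"
      then have "bef t p r" using not_bef assms pq by metis
      then have "bef (t + 1) p r" "bef (t + 1) r q"
        using swp_other[OF assms(1), of p r] swp_other[OF assms(1), of r q] rq assms pq
        by (simp_all add: doubleton_eq_iff)
      then have "bef (t + 1) p q" using tr pq assms by blast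
      then show False using asym pq by blast
    qed
  qed
qed

text \<open>Half a turn after \<open>e\<close> the pair is reversed, so there is a first moment of
  reversed order; \<open>once\<close> then freezes the pair for another half turn.\<close>

lemma swap_time:
  assumes "p \<in> V" "q \<in> V" "bef e p q"
  obtains s where "e \<le> s" "s < e + N" "swp s p q"
    "\<forall>t. e \<le> t \<and> t \<le> s \<longrightarrow> bef t p q" "\<forall>t. s < t \<and> t \<le> s + N \<longrightarrow> bef t q p"
proof -
  define P where "P k \<longleftrightarrow> bef (e + int k) q p" for k
  have PN: "P (nat N)" unfolding P_def using flip[of q p e] assms N_pos by simp
  define k where "k = (LEAST k. P k)"
  have Pk: "P k" unfolding k_def using PN by (rule LeastI)
  have kN: "k \<le> nat N" unfolding k_def using PN by (rule Least_le)
  have k0: "k \<noteq> 0" using Pk asym[OF assms] by (cases k) (auto simp: P_def)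
  have less: "\<not> P j" if "j < k" for j using that not_less_Least unfolding k_def by blast
  define s where "s = e + int k - 1"
  have neq: "p \<noteq> q" using assms bef_neq by blast
  have bf: "bef t p q" if "e \<le> t" "t \<le> s" for t
  proof -
    have "nat (t - e) < k" using that k0 unfolding s_def by linarith
    then have "\<not> bef t q p" using less[of "nat (t - e)"] that by (simp add: P_def)
    then show ?thesis using not_bef assms neq by metis
  qed
  have es: "e \<le> s" using k0 unfolding s_def by linarith
  have sw: "swp s p q" unfolding swp_def using assms bf[OF es] Pk unfolding P_def s_def by simp
  have sN: "s < e + N" using kN N_pos unfolding s_def by linarith
  have "\<forall>t. e \<le> t \<and> t \<le> s \<longrightarrow> bef t p q" "\<forall>t. s < t \<and> t \<le> s + N \<longrightarrow> bef t q p"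
    using bf once[OF sw] by blast+
  then show thesis using that[OF es sN sw] by blast
qed

text \<open>A pair is exchanged only once within half a turn, so the moments at which it has a given
  order form an interval there.\<close>

lemma bef_between:
  assumes "p \<in> V" "q \<in> V" "bef e p q" "bef e' p q" "e \<le> t" "t \<le> e'" "e' \<le> e + N"
  shows "bef t p q"
proof -
  obtain s where s: "e \<le> s" "s < e + N" "swp s p q" "\<forall>t. e \<le> t \<and> t \<le> s \<longrightarrow> bef t p q"
    "\<forall>t. s < t \<and> t \<le> s + N \<longrightarrow> bef t q p" by (rule swap_time[OF assms(1-3)])
  have "\<not> s < e'" using s(1) s(5) asym[OF assms(1,2,4)] assms(6,7) by auto
  then have "e' \<le> s" by simp
  then show ?thesis using s(4) assms(5,6) by auto
qed

lemma bef_after: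
  assumes "p \<in> V" "q \<in> V" "bef e p q" "bef t q p" "e \<le> t" "t \<le> t'" "t' \<le> e + N"
  shows "bef t' q p"
proof (rule ccontr)
  assume "\<not> bef t' q p"
  then have "bef t' p q" using not_bef[of q p t'] assms bef_neq by blast
  then have "bef t p q" using bef_between[of p q e t' t] assms by auto
  then show False using asym assms by blast
qed

lemma fin_sub: "S \<subseteq> V \<Longrightarrow> finite S"
  using fin finite_subset by blast

section \<open>Positions as counting functions\<close>

lemma cnt_less:
  assumes "S \<subseteq> V" "p \<in> S" "q \<in> V" "bef t p q"
  shows "cnt S t p < cnt S t q"
proof -
  have "{x \<in> S. bef t x p} \<subset> {x \<in> S. bef t x q}" using tr irr assms by blast
  then show ?thesis unfolding cnt_def using fin_sub[OF assms(1)] by (simp add: psubset_card_mono)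
qed

lemma cnt_le:
  assumes "S \<subseteq> V" "p \<in> V" "q \<in> V" "bef t p q"
  shows "cnt S t p \<le> cnt S t q"
proof -
  have "{x \<in> S. bef t x p} \<subseteq> {x \<in> S. bef t x q}" using tr assms by blast
  then show ?thesis unfolding cnt_def using fin_sub[OF assms(1)] by (simp add: card_mono)
qed

lemma cnt_iff:
  assumes "S \<subseteq> V" "p \<in> S" "q \<in> V" "p \<noteq> q"
  shows "bef t p q \<longleftrightarrow> cnt S t p < cnt S t q"
proof
  assume "bef t p q" then show "cnt S t p < cnt S t q" using cnt_less assms by blast
next
  assume a: "cnt S t p < cnt S t q"
  show "bef t p q"
  proof (rule ccontr)
    assume "\<not> bef t p q"
    then have "bef t q p" using not_bef assms by blast
    then have "cnt S t q \<le> cnt S t p" using cnt_le[of S q p t] assms by blast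
    then show False using a by simp
  qed
qed

lemma cnt_bound: "S \<subseteq> V \<Longrightarrow> p \<in> S \<Longrightarrow> cnt S t p < card S"
proof -
  assume a: "S \<subseteq> V" "p \<in> S"
  have "{q \<in> S. bef t q p} \<subset> S" using a irr by blast
  then show ?thesis unfolding cnt_def using fin_sub[OF a(1)] by (simp add: psubset_card_mono)
qed

lemma cnt_inj: "S \<subseteq> V \<Longrightarrow> inj_on (cnt S t) S"
proof (rule inj_onI)
  fix x y assume a: "S \<subseteq> V" "x \<in> S" "y \<in> S" "cnt S t x = cnt S t y"
  show "x = y"
  proof (rule ccontr)
    assume "x \<noteq> y"
    then have "bef t x y \<or> bef t y x" using tot a by blast
    then show False using cnt_less[of S x y t] cnt_less[of S y x t] a by auto
  qed
qed

lemma cnt_bij: "S \<subseteq> V \<Longrightarrow> bij_betw (cnt S t) S {..<card S}"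
proof -
  assume a: "S \<subseteq> V"
  have "cnt S t ` S \<subseteq> {..<card S}" using cnt_bound[OF a] by auto
  moreover have "card (cnt S t ` S) = card S" using cnt_inj[OF a] by (simp add: card_image)
  ultimately have "cnt S t ` S = {..<card S}" by (intro card_subset_eq) auto
  then show ?thesis using cnt_inj[OF a] by (simp add: bij_betw_def)
qed

lemma tok_at: 
  assumes "S \<subseteq> V" "i < card S"
  obtains x where "x \<in> S" "cnt S t x = i"
  using cnt_bij[OF assms(1), of t] assms(2) unfolding bij_betw_def by (metis imageE lessThan_iff)

lemma cnt_flip_out: "S \<subseteq> V \<Longrightarrow> p \<in> V \<Longrightarrow> p \<notin> S \<Longrightarrow> cnt S (t + N) p = card S - cnt S t p"
proof -
  assume a: "S \<subseteq> V" "p \<in> V" "p \<notin> S"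
  have "bef (t + N) q p \<longleftrightarrow> \<not> bef t q p" if "q \<in> S" for q
    using flip[of q p t] not_bef[of q p t] a that by auto
  then have "{q \<in> S. bef (t + N) q p} = S - {q \<in> S. bef t q p}" by blast
  then show ?thesis unfolding cnt_def using fin_sub[OF a(1)] by (simp add: card_Diff_subset)
qed

lemma cnt_le_card: "S \<subseteq> V \<Longrightarrow> cnt S t p \<le> card S"
  unfolding cnt_def by (intro card_mono fin_sub) auto

lemma cnt_remove: "S \<subseteq> V \<Longrightarrow> p \<in> V \<Longrightarrow> cnt (S - {p}) t p = cnt S t p"
  unfolding cnt_def using irr by (metis (no_types, lifting) Diff_iff singletonD)

lemma cnt_flip_in: "S \<subseteq> V \<Longrightarrow> p \<in> S \<Longrightarrow> cnt S (t + N) p = card S - 1 - cnt S t p"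
proof -
  assume a: "S \<subseteq> V" "p \<in> S"
  have "cnt (S - {p}) (t + N) p = card (S - {p}) - cnt (S - {p}) t p"
    by (rule cnt_flip_out) (use a in auto)
  then show ?thesis using cnt_remove[OF a(1)] a fin_sub[OF a(1)] by auto
qed

lemma cnt_flip2: "S \<subseteq> V \<Longrightarrow> p \<in> V \<Longrightarrow> cnt S (t + 2 * N) p = cnt S t p"
  unfolding cnt_def by (rule arg_cong[where f = card]) (use flip2 in blast)

lemma cnt_step_right:
  assumes "swp t p q" "S \<subseteq> V"
  shows "cnt S (t + 1) p = cnt S t p + (if q \<in> S then 1 else 0)"
proof -
  have pq: "p \<in> V" "q \<in> V" "bef t p q" "bef (t + 1) q p" using assms swpD by auto
  have e: "bef (t + 1) x p \<longleftrightarrow> bef t x p" if "x \<in> S" "x \<noteq> q" for x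
    using that swp_other[OF assms(1), of x p] subsetD[OF assms(2)] pq irr by (cases "x = p") (simp_all add: doubleton_eq_iff)
  have "bef (t + 1) x p \<longleftrightarrow> x = q \<or> bef t x p" if "x \<in> S" for x
    using e[OF that] pq(4) by (cases "x = q") simp_all
  then have "{x \<in> S. bef (t + 1) x p} = {x \<in> S. x = q \<or> bef t x p}" by blast
  also have "\<dots> = (if q \<in> S then insert q {x \<in> S. bef t x p} else {x \<in> S. bef t x p})" by auto
  finally have "{x \<in> S. bef (t + 1) x p} = (if q \<in> S then insert q {x \<in> S. bef t x p} else {x \<in> S. bef t x p})" .
  moreover have "q \<notin> {x \<in> S. bef t x p}" using pq asym by blast
  ultimately show ?thesis unfolding cnt_def using fin_sub[OF assms(2)] by auto
qed

lemma cnt_step_left: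
  assumes "swp t p q" "S \<subseteq> V"
  shows "cnt S t q = cnt S (t + 1) q + (if p \<in> S then 1 else 0)"
proof -
  have pq: "p \<in> V" "q \<in> V" "bef t p q" "bef (t + 1) q p" using assms swpD by auto
  have e: "bef (t + 1) x q \<longleftrightarrow> bef t x q" if "x \<in> S" "x \<noteq> p" for x
    using that swp_other[OF assms(1), of x q] subsetD[OF assms(2)] pq irr by (cases "x = q") (simp_all add: doubleton_eq_iff)
  have "bef t x q \<longleftrightarrow> x = p \<or> bef (t + 1) x q" if "x \<in> S" for x
    using e[OF that] pq(3) by (cases "x = p") simp_all
  then have "{x \<in> S. bef t x q} = {x \<in> S. x = p \<or> bef (t + 1) x q}" by blast
  also have "\<dots> = (if p \<in> S then insert p {x \<in> S. bef (t + 1) x q} else {x \<in> S. bef (t + 1) x q})" by auto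
  finally have "{x \<in> S. bef t x q} = (if p \<in> S then insert p {x \<in> S. bef (t + 1) x q} else {x \<in> S. bef (t + 1) x q})" .
  moreover have "p \<notin> {x \<in> S. bef (t + 1) x q}" using pq asym by blast
  ultimately show ?thesis unfolding cnt_def using fin_sub[OF assms(2)] by auto
qed

lemma cnt_step_adj:
  assumes "swp t p q" "S \<subseteq> V"
  shows "cnt S t q = cnt S t p + (if p \<in> S then 1 else 0)"
proof -
  have pq: "p \<in> V" "q \<in> V" "bef t p q" "bef (t + 1) q p" using assms swpD by auto
  have e: "bef t x q \<longleftrightarrow> bef t x p" if "x \<in> S" "x \<noteq> p" for x
    using that swp_adj[OF assms(1), of x] subsetD[OF assms(2)] pq irr asym[of p q t] by (cases "x = q") simp_all
  have "bef t x q \<longleftrightarrow> x = p \<or> bef t x p" if "x \<in> S" for x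
    using e[OF that] pq(3) by (cases "x = p") simp_all
  then have "{x \<in> S. bef t x q} = {x \<in> S. x = p \<or> bef t x p}" by blast
  also have "\<dots> = (if p \<in> S then insert p {x \<in> S. bef t x p} else {x \<in> S. bef t x p})" by auto
  finally have "{x \<in> S. bef t x q} = (if p \<in> S then insert p {x \<in> S. bef t x p} else {x \<in> S. bef t x p})" .
  moreover have "p \<notin> {x \<in> S. bef t x p}" using pq irr by blast
  ultimately show ?thesis unfolding cnt_def using fin_sub[OF assms(2)] by auto
qed

lemma cnt_step_other:
  assumes "S \<subseteq> V" "x \<in> V" "\<And>y. y \<in> S \<Longrightarrow> \<not> swp t x y \<and> \<not> swp t y x"
  shows "cnt S (t + 1) x = cnt S t x"
  unfolding cnt_def by (rule arg_cong[where f = card]) (use nochange assms in blast)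

lemma cnt_step_swp:
  assumes "swp t p q" "S \<subseteq> V" "x \<in> V" "x \<noteq> p" "x \<noteq> q"
  shows "cnt S (t + 1) x = cnt S t x"
  by (rule cnt_step_other) (use assms one in blast)+

lemma cnt_change:
  assumes "S \<subseteq> V" "x \<in> V" "cnt S (t + 1) x \<noteq> cnt S t x"
  obtains y where "y \<in> S" "swp t x y" "cnt S (t + 1) x = cnt S t x + 1"
  | y where "y \<in> S" "swp t y x" "cnt S t x = cnt S (t + 1) x + 1"
proof -
  obtain y where "y \<in> S" "swp t x y \<or> swp t y x" using cnt_step_other assms by blast
  then show thesis using that cnt_step_left cnt_step_right assms(1) by (metis (full_types))
qed

section \<open>The first \<open>k\<close> tokens and the events that change them\<close>

lemma card_fst_set: "S \<subseteq> V \<Longrightarrow> k \<le> card S \<Longrightarrow> card (fst_set S k t) = k"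
proof -
  assume a: "S \<subseteq> V" "k \<le> card S"
  have "i \<in> cnt S t ` fst_set S k t" if "i < k" for i
    by (rule tok_at[OF a(1), of i t]) (use that a(2) in \<open>auto simp: fst_set_def\<close>)
  then have "{..<k} \<subseteq> cnt S t ` fst_set S k t" by blast
  moreover have "cnt S t ` fst_set S k t \<subseteq> {..<k}" unfolding fst_set_def by blast
  ultimately have "cnt S t ` fst_set S k t = {..<k}" by blast
  moreover have "inj_on (cnt S t) (fst_set S k t)" using cnt_inj[OF a(1)]
    by (rule inj_on_subset) (auto simp: fst_set_def)
  ultimately show ?thesis by (metis card_image card_lessThan)
qed

lemma fst_set_cut:
  assumes "S \<subseteq> V" "v \<in> V" "v \<notin> S" 
  shows "fst_set S (cnt S t v) t = {x \<in> S. bef t x v}"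
  unfolding fst_set_def using cnt_iff[OF assms(1) _ assms(2)] assms(3) by blast

lemma fst_set_step:
  assumes "S \<subseteq> V" "\<not> ev S k t"
  shows "fst_set S k (t + 1) = fst_set S k t"
proof -
  have "(cnt S (t + 1) x < k) = (cnt S t x < k)" if "x \<in> S" for x
  proof (cases "cnt S (t + 1) x = cnt S t x")
    case False
    then show ?thesis
    proof (cases rule: cnt_change[OF assms(1) subsetD[OF assms(1) that] False])
      case (1 y)
      have "cnt S t y = cnt S t x + 1" using cnt_step_adj[OF 1(2) assms(1)] that by simp
      moreover have "cnt S t y \<noteq> k" using assms(2) 1 that unfolding ev_def by blast
      ultimately show ?thesis using 1(3) by linarith
    next
      case (2 y)
      have "cnt S t x \<noteq> k" using assms(2) 2 that unfolding ev_def by blast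
      then show ?thesis using 2(3) by linarith
    qed
  qed simp
  then show ?thesis unfolding fst_set_def by blast
qed

lemma fst_set_ev:
  assumes "S \<subseteq> V" "swp t p q" "p \<in> S" "q \<in> S" "cnt S t q = k"
  shows "fst_set S k (t + 1) = insert q (fst_set S k t - {p})" "p \<in> fst_set S k t" "q \<notin> fst_set S k t"
proof -
  have 1: "cnt S t p + 1 = k" using cnt_step_adj[OF assms(2,1)] assms by simp
  have 2: "cnt S (t + 1) p = k" using cnt_step_right[OF assms(2,1)] assms 1 by simp
  have 3: "cnt S (t + 1) q < k" using cnt_step_left[OF assms(2,1)] assms by simp
  have 4: "cnt S (t + 1) x = cnt S t x" if "x \<in> S" "x \<noteq> p" "x \<noteq> q" for x
    using cnt_step_swp[OF assms(2,1)] that assms(1) by blast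
  have "(cnt S (t + 1) x < k) = (x = q \<or> cnt S t x < k \<and> x \<noteq> p)" if "x \<in> S" for x
    using 4[OF that] 2 3 by (cases "x = p"; cases "x = q") (use swp_neq[OF assms(2)] in auto)
  then have "fst_set S k (t + 1) = {x \<in> S. x = q \<or> cnt S t x < k \<and> x \<noteq> p}"
    unfolding fst_set_def by blast
  also have "\<dots> = insert q (fst_set S k t - {p})" unfolding fst_set_def using assms(4) swp_neq[OF assms(2)] by blast
  finally show "fst_set S k (t + 1) = insert q (fst_set S k t - {p})" .
  show "p \<in> fst_set S k t" "q \<notin> fst_set S k t" using 1 assms by (auto simp: fst_set_def)
qed

text \<open>Only an event at level \<open>k\<close> alters the first \<open>k\<close> tokens, and it
  brings in a single new one. This is how disjoint prefixes become lower bounds for numbers of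
  events.\<close>

lemma fst_set_diff_le:
  assumes "S \<subseteq> V" "a \<le> b"
  shows "card (fst_set S k b - fst_set S k a) \<le> card {t \<in> {a..<b}. ev S k t}"
  using assms(2)
proof (induction b rule: int_ge_induct)
  case base show ?case by simp
next
  case (step b)
  have finS: "finite (fst_set S k x)" for x unfolding fst_set_def using fin_sub[OF assms(1)] by simp
  have split: "{t \<in> {a..<b+1}. ev S k t} = (if ev S k b then insert b {t \<in> {a..<b}. ev S k t} else {t \<in> {a..<b}. ev S k t})"
    using step.hyps by (auto simp: order_less_le)
  show ?case
  proof (cases "ev S k b")
    case False
    then show ?thesis using step fst_set_step[OF assms(1)] split by simp
  next
    case True
    then obtain p q where pq: "p \<in> S" "q \<in> S" "swp b p q" "cnt S b q = k" unfolding ev_def by blast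
    have "fst_set S k (b + 1) - fst_set S k a \<subseteq> insert q (fst_set S k b - fst_set S k a)"
      using fst_set_ev(1)[OF assms(1) pq(3,1,2,4)] by blast
    then have "card (fst_set S k (b + 1) - fst_set S k a) \<le> card (insert q (fst_set S k b - fst_set S k a))"
      using finS by (intro card_mono) auto
    also have "\<dots> \<le> Suc (card (fst_set S k b - fst_set S k a))"
      by (rule card_insert_le_m1) auto
    also have "\<dots> \<le> Suc (card {t \<in> {a..<b}. ev S k t})" using step.IH by simp
    also have "\<dots> = card {t \<in> {a..<b+1}. ev S k t}" proof -
      have "finite {t \<in> {a..<b}. ev S k t}" "b \<notin> {t \<in> {a..<b}. ev S k t}"
        by (rule finite_subset[of _ "{a..<b}"]) auto
      then show ?thesis unfolding split if_P[OF True] by (simp only: card_insert_disjoint not_False_eq_True)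
    qed
    finally show ?thesis .
  qed
qed

text \<open>After half a turn the same two tokens are exchanged in the other direction, so the level
  is read off at the former right-mover, which stood one position further to the front. Hence the
  complement is \<open>card S - k\<close> and not \<open>card S - 1 - k\<close>.\<close>

lemma ev_flip:
  assumes "S \<subseteq> V" 
  shows "ev S k (t + N) \<longleftrightarrow> k < card S \<and> 0 < k \<and> ev S (card S - k) t"
proof
  assume "ev S k (t + N)"
  then obtain p q where pq: "p \<in> S" "q \<in> S" "swp t q p" "cnt S (t + N) q = k" unfolding ev_def using swp_flip by blast
  have "k = card S - 1 - cnt S t q" using cnt_flip_in[OF assms pq(2)] pq(4) by simp
  moreover have "cnt S t p = cnt S t q + 1" using cnt_step_adj[OF pq(3) assms] pq by simp
  moreover have "cnt S t p < card S" using cnt_bound[OF assms pq(1)] .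
  ultimately show "k < card S \<and> 0 < k \<and> ev S (card S - k) t" unfolding ev_def using pq by force
next
  assume a: "k < card S \<and> 0 < k \<and> ev S (card S - k) t"
  then obtain p q where pq: "p \<in> S" "q \<in> S" "swp t p q" "cnt S t q = card S - k" unfolding ev_def by blast
  have "swp (t + N) q p" using pq swp_flip by blast
  moreover have "cnt S (t + N) p = k" using cnt_flip_in[OF assms pq(1)] cnt_step_adj[OF pq(3) assms] pq a by auto
  ultimately show "ev S k (t + N)" unfolding ev_def using pq by blast
qed

lemma ev_flip2:
  assumes "S \<subseteq> V"
  shows "ev S k (t + 2 * N) \<longleftrightarrow> ev S k t"
proof -
  have "cnt S (t + 2 * N) q = cnt S t q" if "q \<in> S" for q
    using cnt_flip2[OF assms, of q t] assms that by auto
  then show ?thesis unfolding ev_def swp_flip2 by simp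
qed

lemma ev_unique:
  assumes "ev S k t" "ev S k' t"
  shows "k = k'"
proof -
  obtain p q p' q' where "swp t p q" "cnt S t q = k" "swp t p' q'" "cnt S t q' = k'"
    using assms unfolding ev_def by blast
  then show ?thesis using one by blast
qed

lemma ev_bounds:
  assumes "S \<subseteq> V" "ev S k t"
  shows "0 < k \<and> k < card S"
proof -
  obtain p q where "p \<in> S" "q \<in> S" "swp t p q" "cnt S t q = k"
    using assms unfolding ev_def by blast
  then show ?thesis using cnt_step_adj[of t p q S] cnt_bound[of S q t] assms by simp
qed

end

section \<open>Extremal swaps\<close>

lemma finite_int_Collect [simp]:
  fixes a b :: int
  shows "finite {t. a \<le> t \<and> t < b \<and> P t}" "finite {t. a \<le> t \<and> t \<le> b \<and> P t}"
  by (rule finite_subset[of _ "{a..b}"]; auto)+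

lemma card_period:
  fixes P :: "int \<Rightarrow> bool"
  assumes per: "\<And>t. P (t + T) \<longleftrightarrow> P t" and T: "0 < T"
  shows "card {t \<in> {a..<a + T}. P t} = card {t \<in> {b..<b + T}. P t}"
proof -
  have step: "card {t \<in> {a + 1..<a + 1 + T}. P t} = card {t \<in> {a..<a + T}. P t}" for a
  proof -
    define M where "M = {t \<in> {a + 1..<a + T}. P t}"
    have fM: "finite M" "a \<notin> M" "a + T \<notin> M" by (auto simp: M_def)
    have e1: "{t \<in> {a..<a + T}. P t} = (if P a then insert a M else M)"
    proof -
      have "{a..<a + T} = insert a {a + 1..<a + T}" using T by auto
      then show ?thesis unfolding M_def by auto
    qed
    have e2: "{t \<in> {a + 1..<a + 1 + T}. P t} = (if P a then insert (a + T) M else M)"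
    proof -
      have "{a + 1..<a + 1 + T} = insert (a + T) {a + 1..<a + T}" using T by auto
      then show ?thesis using per[of a] unfolding M_def by auto
    qed
    show ?thesis unfolding e1 e2 using fM by simp
  qed
  have "card {t \<in> {a..<a + T}. P t} = card {t \<in> {0..<0 + T}. P t}" for a
  proof (induction a rule: int_induct[of _ 0])
    case (step2 i)
    then show ?case using step[of "i - 1"] by simp
  qed (use step in auto)
  then show ?thesis by simp
qed

context circular_seq
begin

section \<open>The time an extremal token spends near the front\<close>

lemma cnt_step_le: "S \<subseteq> V \<Longrightarrow> x \<in> V \<Longrightarrow> cnt S (t + 1) x \<le> cnt S t x + 1 \<and> cnt S t x \<le> cnt S (t + 1) x + 1"
  by (cases "cnt S (t + 1) x = cnt S t x") (auto elim: cnt_change[of S x t])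

lemma cnt_mono:
  assumes "T \<subseteq> V" "v \<in> V" "\<And>x. x \<in> T \<Longrightarrow> bef e v x" "e \<le> t" "t \<le> t'" "t' \<le> e + N"
  shows "cnt T t v \<le> cnt T t' v"
proof -
  have "{x \<in> T. bef t x v} \<subseteq> {x \<in> T. bef t' x v}"
    using bef_after[of v _ e t t'] assms by blast
  then show ?thesis unfolding cnt_def using fin_sub[OF assms(1)] by (simp add: card_mono)
qed

lemma cnt_flipm_out: "S \<subseteq> V \<Longrightarrow> p \<in> V \<Longrightarrow> p \<notin> S \<Longrightarrow> cnt S (t - N) p = card S - cnt S t p"
  using cnt_flip_out[of S p "t - N"] cnt_le_card[of S "t - N" p] by simp

lemma fst_set_flip2: "S \<subseteq> V \<Longrightarrow> fst_set S k (t + 2 * N) = fst_set S k t"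
  unfolding fst_set_def using cnt_flip2[of S] by (auto simp: subset_iff)

text \<open>The times after \<open>w\<close> up to \<open>a\<close> are the stretch in which fewer
  than \<open>k\<close> tokens of \<open>T\<close> precede \<open>v\<close>; the rest of the period
  runs from \<open>a + 1\<close> to \<open>w + 2 * N\<close>. The last conjunct carries its
  condition because two sets of \<open>k\<close> tokens of \<open>T\<close> must meet when
  \<open>2 * k\<close> exceeds \<open>card T\<close>.\<close>

definition arc :: "'a set \<Rightarrow> nat \<Rightarrow> 'a \<Rightarrow> int \<Rightarrow> int \<Rightarrow> bool" where
  "arc T k v w a \<longleftrightarrow> v \<in> V \<and> v \<notin> T \<and> w < a \<and> a \<le> w + N \<and>
     (\<forall>t. w < t \<and> t \<le> a \<longrightarrow> cnt T t v < k) \<and> (\<forall>t. a < t \<and> t \<le> w + 2 * N \<longrightarrow> k \<le> cnt T t v) \<and>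
     cnt T (a + 1) v = k \<and> cnt T w v = k \<and>
     (2 * k \<le> card T \<longrightarrow> a < w + N \<and> fst_set T k (a + 1) \<inter> fst_set T k (w + 2 * N) = {})"

text \<open>From \<open>e\<close> on, \<open>v\<close> meets every token of \<open>T\<close> once,
  so its count rises from 0 to \<open>card T\<close> in \<open>[e, e + N]\<close>; by reversal it
  falls in \<open>[e - N, e]\<close>. Tokens that \<open>v\<close> has passed when the arc ends stay
  in front of it until \<open>w + N\<close>, hence are behind it at \<open>w\<close>. This makes the
  prefixes at the two ends disjoint.\<close>

lemma arc_ex:
  assumes T: "T \<subseteq> V" "v \<in> V" "v \<notin> T" and e: "\<And>x. x \<in> T \<Longrightarrow> bef e v x"
    and k: "0 < k" "k \<le> card T" "2 * k \<le> card T + 1"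
  shows "\<exists>w a. arc T k v w a \<and> w < e \<and> e \<le> a"
proof -
  let ?c = "\<lambda>t. cnt T t v"
  have c_e: "?c e = 0"
  proof -
    have "{x \<in> T. bef e x v} = {}" using e asym T by blast
    then show ?thesis unfolding cnt_def by (simp only: card.empty)
  qed
  have c_eN: "?c (e + N) = card T" "?c (e - N) = card T"
    using cnt_flip_out[OF T, of e] cnt_flipm_out[OF T, of e] c_e by auto
  have mono: "?c t \<le> ?c t'" if "e \<le> t" "t \<le> t'" "t' \<le> e + N" for t t'
    by (rule cnt_mono[OF T(1,2) e]) (use that in auto)
  have cle: "?c t \<le> card T" for t using cnt_le_card[OF T(1)] .
  have flipc: "?c (t + N) = card T - ?c t" for t using cnt_flip_out[OF T] .
  have anti: "?c t' \<le> ?c t" if "e - N \<le> t" "t \<le> t'" "t' \<le> e" for t t'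
    using mono[of "t + N" "t' + N"] that flipc[of t] flipc[of t'] cle[of t] cle[of t'] by auto
  define A where "A = {t \<in> {e..e + N}. ?c t < k}"
  have "finite A" "e \<in> A" using N_pos c_e k by (auto simp: A_def)
  define a where "a = Max A"
  have aA: "a \<in> A" unfolding a_def using \<open>finite A\<close> \<open>e \<in> A\<close> by (intro Max_in) auto
  have amax: "t \<le> a" if "t \<in> A" for t unfolding a_def using \<open>finite A\<close> that by simp
  have a1: "e \<le> a" "a < e + N" "?c a < k" using aA c_eN(1) k(2) by (auto simp: A_def order_le_less)
  have a2: "k \<le> ?c (a + 1)" using amax[of "a + 1"] a1 by (force simp: A_def not_less)
  have a3: "?c (a + 1) = k" using cnt_step_le[OF T(1,2), of a] a1(3) a2 by linarith
  define W where "W = {t \<in> {e - N..e}. k \<le> ?c t}"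
  have "finite W" "e - N \<in> W" using N_pos c_eN k by (auto simp: W_def)
  define w where "w = Max W"
  have wW: "w \<in> W" unfolding w_def using \<open>finite W\<close> \<open>e - N \<in> W\<close> by (intro Max_in) auto
  have wmax: "t \<le> w" if "t \<in> W" for t unfolding w_def using \<open>finite W\<close> that by simp
  have w1: "e - N \<le> w" "w < e" "k \<le> ?c w" using wW c_e k(1) by (auto simp: W_def order_le_less)
  have w2: "?c (w + 1) < k" using wmax[of "w + 1"] w1 by (force simp: W_def)
  have w3: "?c w = k" using cnt_step_le[OF T(1,2), of w] w1(3) w2 by linarith
  have low: "?c t < k" if "w < t" "t \<le> a" for t
  proof (cases "e \<le> t")
    case True then show ?thesis using mono[of t a] that a1 by simp
  next
    case False
    then show ?thesis using anti[of "w + 1" t] that w1 w2 by simp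
  qed
  have c2: "?c (t + 2 * N) = ?c t" for t using cnt_flip2[OF T(1,2)] .
  have high: "k \<le> ?c t" if "a < t" "t \<le> w + 2 * N" for t
  proof (cases "t \<le> e + N")
    case True then show ?thesis using mono[of "a + 1" t] that a1 a3 by simp
  next
    case False
    then have "?c w \<le> ?c (t - 2 * N)" using anti[of "t - 2 * N" w] that w1 by simp
    then show ?thesis using c2[of "t - 2 * N"] w3 by simp
  qed
  \<comment> \<open>At \<open>w + 1\<close> fewer than \<open>k\<close> tokens precede
    \<open>v\<close>, so at \<open>w + 1 + N\<close> at least \<open>card T + 1 - k\<close> do,
    which is at least \<open>k\<close>. The arc is over by then.\<close>
  have len: "a \<le> w + N"
  proof (rule ccontr)
    assume "\<not> a \<le> w + N"
    then have "?c (w + 1 + N) \<le> ?c a" using mono[of "w + 1 + N" a] a1 w1 by simp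
    then show False using flipc[of "w + 1"] w2 a1 k by linarith
  qed
  have dis: "a < w + N \<and> fst_set T k (a + 1) \<inter> fst_set T k (w + 2 * N) = {}" if k2: "2 * k \<le> card T"
  proof
    have "?c (w + N) = card T - k" using flipc[of w] w3 by simp
    then show l: "a < w + N" using len a1(3) k2 by (cases "a = w + N") auto
    have f1: "fst_set T k (a + 1) = {x \<in> T. bef (a + 1) x v}" using fst_set_cut[OF T, of "a + 1"] a3 by simp
    have f2: "fst_set T k (w + 2 * N) = {x \<in> T. bef w x v}"
      using fst_set_cut[OF T, of w] w3 fst_set_flip2[OF T(1), of k w] by simp
    have "\<not> bef w x v" if x: "x \<in> T" "bef (a + 1) x v" for x
    proof -
      have "bef (w + N) x v"
        by (rule bef_after[of v x e "a + 1"]) (use x e T l a1 w1 in auto)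
      then have "bef w v x" using flip[of x v w] T x by auto
      then show ?thesis using asym[of v x w] T x by blast
    qed
    then show "fst_set T k (a + 1) \<inter> fst_set T k (w + 2 * N) = {}" unfolding f1 f2 by blast
  qed
  have "arc T k v w a" unfolding arc_def
    using T(2,3) w1 a1 len low high a3 w3 dis by (intro conjI allI impI) auto
  then show ?thesis using w1 a1 by blast
qed

lemma arcD:
  assumes "arc T k v w a"
  shows "v \<in> V" "v \<notin> T" "w < a" "a \<le> w + N" "w < t \<Longrightarrow> t \<le> a \<Longrightarrow> cnt T t v < k"
    "a < t \<Longrightarrow> t \<le> w + 2 * N \<Longrightarrow> k \<le> cnt T t v" "cnt T (a + 1) v = k" "cnt T w v = k"
    "2 * k \<le> card T \<Longrightarrow> a < w + N" "2 * k \<le> card T \<Longrightarrow> fst_set T k (a + 1) \<inter> fst_set T k (w + 2 * N) = {}"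
  using assms unfolding arc_def by blast+

section \<open>Three extremal tokens in cyclic order\<close>

lemma first_ex:
  assumes "S \<subseteq> V" "S \<noteq> {}"
  obtains v where "v \<in> S" "cnt S t v = 0" "\<And>x. x \<in> S - {v} \<Longrightarrow> bef t v x"
proof -
  have "0 < card S" using assms fin_sub by (simp add: card_gt_0_iff)
  then obtain v where v: "v \<in> S" "cnt S t v = 0" using tok_at[OF assms(1)] by blast
  have "bef t v x" if "x \<in> S - {v}" for x
  proof (rule ccontr)
    assume "\<not> bef t v x"
    then have "bef t x v" using not_bef[of v x t] that v assms by blast
    then have "cnt S t x < cnt S t v" using cnt_less[of S x v t] that v assms by blast
    then show False using v by simp
  qed
  then show thesis using that v by blast
qed

text \<open>\<open>card S div 2\<close> is the largest level to which \<open>arc_ex\<close> applies,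
  so that the arcs of the lower levels needed later fit inside. The moment \<open>e\<close> records
  that \<open>v\<close> is extremal.\<close>

definition half_arc :: "'a set \<Rightarrow> 'a \<Rightarrow> int \<Rightarrow> int \<Rightarrow> bool" where
  "half_arc S v x y \<longleftrightarrow> v \<in> S \<and> arc (S - {v}) (card S div 2) v x y \<and>
     (\<exists>e. x < e \<and> e \<le> y \<and> (\<forall>u \<in> S - {v}. bef e v u))"

lemma harc_at:
  assumes S: "S \<subseteq> V" "2 \<le> card S"
  obtains v x y where "half_arc S v x y" "x < e" "e \<le> y" "cnt S e v = 0"
proof -
  have "S \<noteq> {}" using S by auto
  obtain v where v: "v \<in> S" "cnt S e v = 0" "\<And>u. u \<in> S - {v} \<Longrightarrow> bef e v u"
    using first_ex[OF S(1) \<open>S \<noteq> {}\<close>, of e] by blast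
  have c: "card (S - {v}) = card S - 1" using v(1) fin_sub[OF S(1)] by simp
  have "\<exists>x y. arc (S - {v}) (card S div 2) v x y \<and> x < e \<and> e \<le> y"
    by (rule arc_ex) (use S v c in auto)
  then show thesis using that v unfolding half_arc_def by blast
qed

lemma harcD:
  assumes "half_arc S v x y" "S \<subseteq> V"
  shows "v \<in> S" "x < y" "y \<le> x + N" "x < t \<Longrightarrow> t \<le> y \<Longrightarrow> cnt S t v < card S div 2"
    "y < t \<Longrightarrow> t \<le> x + 2 * N \<Longrightarrow> card S div 2 \<le> cnt S t v" "cnt S x v = card S div 2"
proof -
  have v: "v \<in> S" and a: "arc (S - {v}) (card S div 2) v x y" using assms unfolding half_arc_def by auto
  have c: "cnt (S - {v}) t v = cnt S t v" for t using cnt_remove[of S v t] assms v by blast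
  show "v \<in> S" "x < y" "y \<le> x + N" "x < t \<Longrightarrow> t \<le> y \<Longrightarrow> cnt S t v < card S div 2"
    "y < t \<Longrightarrow> t \<le> x + 2 * N \<Longrightarrow> card S div 2 \<le> cnt S t v" "cnt S x v = card S div 2"
    using v arcD[OF a] by (auto simp: c)
qed

text \<open>Greedy covering of the circle: among the arcs containing the moment after
  \<open>p\<close>'s arc, \<open>q\<close> has the one that reaches farthest, and \<open>r\<close>
  leads at the moment after that. An arc of \<open>r\<close> starting before \<open>yp + 1\<close>
  would contradict this choice. The wrap-around inequalities follow from the length bound
  \<open>N\<close>.\<close>

lemma harc_triple:
  assumes S: "S \<subseteq> V" "4 \<le> card S"
  obtains p q r xp yp xq yq xr yr where "half_arc S p xp yp" "half_arc S q xq yq" "half_arc S r xr yr"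
    "distinct [p, q, r]" "yp \<le> xr" "yq \<le> xp + 2 * N" "yr \<le> xq + 2 * N"
proof -
  have S2: "2 \<le> card S" and h2: "2 \<le> card S div 2" using S by auto
  obtain p xp yp where p: "half_arc S p xp yp" using harc_at[OF S(1) S2, of 0] by blast
  define C where "C = {y. \<exists>v x. half_arc S v x y \<and> x < yp + 1 \<and> yp + 1 \<le> y}"
  have "C \<subseteq> {yp + 1..yp + 1 + N}" unfolding C_def using harcD(3)[OF _ S(1)] by fastforce
  then have finC: "finite C" using finite_subset by blast
  have "C \<noteq> {}" unfolding C_def using harc_at[OF S(1) S2, of "yp + 1"] by blast
  define yq where "yq = Max C"
  have "yq \<in> C" unfolding yq_def using finC \<open>C \<noteq> {}\<close> by simp
  then obtain q xq where q: "half_arc S q xq yq" "xq < yp + 1" "yp + 1 \<le> yq" unfolding C_def by blast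
  have ymax: "y \<le> yq" if "y \<in> C" for y unfolding yq_def using finC that by simp
  obtain r xr yr where r: "half_arc S r xr yr" "xr < yq + 1" "yq + 1 \<le> yr" "cnt S (yq + 1) r = 0"
    using harc_at[OF S(1) S2, of "yq + 1"] by blast
  have xr: "yp + 1 \<le> xr"
  proof (rule ccontr)
    assume "\<not> yp + 1 \<le> xr"
    then have "yr \<in> C" unfolding C_def using r q by force
    then show False using ymax r by force
  qed
  note P = harcD[OF p S(1)] and Q = harcD[OF q(1) S(1)] and R = harcD[OF r(1) S(1)]
  have c2: "cnt S (t + 2 * N) v = cnt S t v" if "v \<in> S" for t v using cnt_flip2[OF S(1)] that S(1) by blast
  have "p \<noteq> q" using P(5)[of "yp + 1"] P(2,3) Q(4)[of "yp + 1"] q by fastforce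
  moreover have "q \<noteq> r" using Q(5)[of "yq + 1"] Q(2,3) R(4)[of "yq + 1"] r by fastforce
  moreover have "p \<noteq> r"
  proof
    assume e: "p = r"
    show False
    proof (cases "yq + 1 \<le> xp + 2 * N")
      case True
      then show False using P(5)[of "yq + 1"] q r e h2 by simp
    next
      case False
      \<comment> \<open>The period can be overshot by a single step only. There \<open>p\<close> has
        just left position \<open>card S div 2\<close>, which is at least 2, and one transposition
        does not bring it to the front.\<close>
      then have yq1: "yq + 1 = xp + 2 * N + 1" using Q(3) q(2) P(3) by linarith
      have "cnt S (xp + 2 * N) p = card S div 2" using c2[OF P(1)] P(6) by simp
      then have "card S div 2 \<le> cnt S (yq + 1) p + 1"
        using cnt_step_le[OF S(1), of p "xp + 2 * N"] P(1) S(1) unfolding yq1 by auto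
      then show False using e r(4) h2 by simp
    qed
  qed
  ultimately show thesis
    by (intro that[OF p q(1) r(1)]) (use xr P Q R q r in auto)
qed

text \<open>In the cyclic order \<open>p\<close>, \<open>q\<close>, \<open>r\<close> each arc ends
  before the arc of the token two places later begins. Neighbouring arcs may overlap, but no moment
  lies in all three.\<close>

definition tri :: "'a set \<Rightarrow> nat \<Rightarrow> 'a \<Rightarrow> 'a \<Rightarrow> 'a \<Rightarrow> int \<Rightarrow> int \<Rightarrow> int \<Rightarrow> int \<Rightarrow> int \<Rightarrow> int \<Rightarrow> bool" where
  "tri S k p q r wp ap wq aq wr ar \<longleftrightarrow> p \<in> S \<and> q \<in> S \<and> r \<in> S \<and> distinct [p, q, r] \<and>
     arc (S - {p, q, r}) k p wp ap \<and> arc (S - {p, q, r}) k q wq aq \<and> arc (S - {p, q, r}) k r wr ar \<and>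
     ap < wr \<and> aq < wp + 2 * N \<and> ar < wq + 2 * N \<and>
     (\<forall>v\<in>{p, q, r}. \<exists>e. \<forall>x\<in>S - {v}. bef e v x)"

lemma arc_shift: "T \<subseteq> V \<Longrightarrow> arc T k v w a \<Longrightarrow> arc T k v (w + 2 * N) (a + 2 * N)"
proof -
  assume T: "T \<subseteq> V" and a: "arc T k v w a"
  have v: "v \<in> V" using arcD(1)[OF a] .
  have c: "cnt T t v = cnt T (t - 2 * N) v" for t using cnt_flip2[OF T v, of "t - 2 * N"] by simp
  have f: "fst_set T k t = fst_set T k (t - 2 * N)" for t using fst_set_flip2[OF T, of k "t - 2 * N"] by simp
  have e: "a + 2 * N + 1 - 2 * N = a + 1" "w + 2 * N + 2 * N - 2 * N = w + 2 * N" by auto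
  note A = arcD[OF a]
  show ?thesis unfolding arc_def
  proof (intro conjI allI impI)
    show "cnt T (a + 2 * N + 1) v = k" using A(7) by (subst c) (simp add: e)
    show "cnt T (w + 2 * N) v = k" using A(8) by (subst c) simp
    show "cnt T t v < k" if "w + 2 * N < t \<and> t \<le> a + 2 * N" for t
      using A(5)[of "t - 2 * N"] that by (subst c) simp
    show "k \<le> cnt T t v" if "a + 2 * N < t \<and> t \<le> w + 2 * N + 2 * N" for t
      using A(6)[of "t - 2 * N"] that by (subst c) simp
    show "fst_set T k (a + 2 * N + 1) \<inter> fst_set T k (w + 2 * N + 2 * N) = {}" if "2 * k \<le> card T"
      using A(10)[OF that] f[of "a + 2 * N + 1"] f[of "w + 2 * N + 2 * N"] by (simp only: e)
  qed (use A in auto)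
qed

text \<open>Both ends of an arc are transpositions of its token with a token of \<open>T\<close>,
  and only one pair is exchanged at a time. This makes the inequalities of \<open>tri\<close>
  strict.\<close>

lemma arc_neq:
  assumes "T \<subseteq> V" "arc T k p wp ap" "arc T k r wr ar" "p \<noteq> r"
  shows "ap \<noteq> wr"
proof
  assume e: "ap = wr"
  note P = arcD[OF assms(2)] and R = arcD[OF assms(3)]
  have "cnt T (ap + 1) p \<noteq> cnt T ap p" using P(5)[of ap] P(3,7) by simp
  then obtain x where x: "x \<in> T" "swp ap p x \<or> swp ap x p" using cnt_change[OF assms(1) P(1)] by blast
  have "cnt T (wr + 1) r \<noteq> cnt T wr r" using R(5)[of "wr + 1"] R(3,8) by simp
  then obtain y where y: "y \<in> T" "swp ap r y \<or> swp ap y r" using cnt_change[OF assms(1) R(1)] e by blast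
  show False using x y one P(2) R(2) assms(4) by blast
qed

text \<open>Removing the other two tokens lowers a position by at most 2, and
  \<open>k + 1 < card S div 2\<close>. So while a token is in its arc at level \<open>k\<close>
  relative to the reduced set, it is also in its half arc, and the cyclic order of the half arcs is
  inherited.\<close>

lemma tri_ex:
  assumes S: "S \<subseteq> V" and k: "0 < k" "2 * k + 4 \<le> card S"
  obtains p q r wp ap wq aq wr ar where "tri S k p q r wp ap wq aq wr ar"
proof -
  obtain p q r xp yp xq yq xr yr where H: "half_arc S p xp yp" "half_arc S q xq yq" "half_arc S r xr yr"
    "distinct [p, q, r]" "yp \<le> xr" "yq \<le> xp + 2 * N" "yr \<le> xq + 2 * N"
    by (rule harc_triple[OF S]) (use k in auto)
  define T where "T = S - {p, q, r}"
  have TV: "T \<subseteq> V" using S by (auto simp: T_def)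
  have pS: "p \<in> S" "q \<in> S" "r \<in> S" using H(1-3) harcD(1)[OF _ S] by auto
  have cT: "card T = card S - 3" unfolding T_def using pS H(4) fin_sub[OF S]
    by (subst card_Diff_subset) auto
  have in_arc: "\<exists>w a. arc T k v w a \<and> x \<le> w \<and> a \<le> y" if h: "half_arc S v x y" and v: "v \<in> {p, q, r}" for v x y
  proof -
    obtain e where e: "x < e" "e \<le> y" "\<forall>u \<in> S - {v}. bef e v u" using h unfolding half_arc_def by blast
    have vS: "v \<in> S" using v pS by auto
    have "\<exists>w a. arc T k v w a \<and> w < e \<and> e \<le> a"
    proof (rule arc_ex[OF TV])
      show "v \<in> V" using vS S by auto
      show "v \<notin> T" using v by (auto simp: T_def)
      show "bef e v u" if "u \<in> T" for u using e that v by (auto simp: T_def)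
    qed (use k cT in auto)
    then obtain w a where wa: "arc T k v w a" "w < e" "e \<le> a" by blast
    have cS: "cnt S t v \<le> cnt T t v + 2" for t
    proof -
      have "{u \<in> S. bef t u v} \<subseteq> {u \<in> T. bef t u v} \<union> ({p, q, r} - {v})"
        using irr vS S by (auto simp: T_def)
      then have "cnt S t v \<le> card ({u \<in> T. bef t u v} \<union> ({p, q, r} - {v}))"
        unfolding cnt_def using fin_sub[OF TV] by (intro card_mono) auto
      also have "\<dots> \<le> cnt T t v + card ({p, q, r} - {v})" unfolding cnt_def by (rule card_Un_le)
      also have "card ({p, q, r} - {v}) = 2" using v H(4) by (auto simp: card_Diff_singleton_if)
      finally show ?thesis .
    qed
    note D = harcD[OF h S] and A = arcD[OF wa(1)]
    have "cnt S t v < card S div 2" if "w < t" "t \<le> a" for t using A(5)[OF that] cS[of t] k by linarith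
    note small = this
    have "x \<le> w"
    proof (rule ccontr)
      assume "\<not> x \<le> w"
      then have "cnt S x v < card S div 2" using small[of x] wa e by auto
      then show False using D(6) by simp
    qed
    moreover have "a \<le> y"
    proof (rule ccontr)
      assume "\<not> a \<le> y"
      then have "cnt S (y + 1) v < card S div 2" using small[of "y + 1"] wa e by auto
      then show False using D(5)[of "y + 1"] D(2,3) N_pos by auto
    qed
    ultimately show ?thesis using wa by blast
  qed
  obtain wp ap where P: "arc T k p wp ap" "xp \<le> wp" "ap \<le> yp" using in_arc[OF H(1)] by blast
  obtain wq aq where Q: "arc T k q wq aq" "xq \<le> wq" "aq \<le> yq" using in_arc[OF H(2)] by blast
  obtain wr ar where R: "arc T k r wr ar" "xr \<le> wr" "ar \<le> yr" using in_arc[OF H(3)] by blast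
  have hull: "\<forall>v\<in>{p, q, r}. \<exists>e. \<forall>x\<in>S - {v}. bef e v x"
    using H(1-3) unfolding half_arc_def by blast
  have d: "p \<noteq> q" "q \<noteq> r" "r \<noteq> q" "p \<noteq> r" "q \<noteq> p" using H(4) by auto
  have n: "ap \<noteq> wr" "aq \<noteq> wp + 2 * N" "ar \<noteq> wq + 2 * N"
    using arc_neq[OF TV P(1) R(1) d(4)] arc_neq[OF TV Q(1) arc_shift[OF TV P(1)] d(5)]
      arc_neq[OF TV R(1) arc_shift[OF TV Q(1)] d(3)] by auto
  show thesis
    by (rule that[of p q r wp ap wq aq wr ar]) (unfold tri_def, use P Q R n H pS hull in \<open>simp add: T_def\<close>)
qed

lemma tri_rot:
  assumes S: "S \<subseteq> V" and t: "tri S k p q r wp ap wq aq wr ar"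
  shows "tri S k q r p wq aq wr ar (wp + 2 * N) (ap + 2 * N)"
proof -
  have e: "S - {q, r, p} = S - {p, q, r}" by auto
  have "S - {p, q, r} \<subseteq> V" using S by auto
  then show ?thesis using t arc_shift[of "S - {p, q, r}" k p wp ap] unfolding tri_def e by auto
qed

end

section \<open>Lower bounds for the number of swaps near the ends\<close>

context circular_seq
begin

text \<open>A full period shows every edge from both sides, so \<open>A_le V K\<close> is the number of \<open>(\<le> K - 1)\<close>-edges
as long as \<open>2 * K < card V\<close>.\<close>

definition A_le :: "'a set \<Rightarrow> nat \<Rightarrow> nat" where
  "A_le S K = card {t \<in> {0..<2 * N}. \<exists>j\<le>K. ev S j t}"

definition low :: "'a set \<Rightarrow> nat \<Rightarrow> 'a set \<Rightarrow> int \<Rightarrow> nat" where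
  "low T k H t = card {v \<in> H. cnt T t v < k}"

text \<open>A level-\<open>k\<close> event of \<open>T\<close> rises in the larger set by at most
  the number of removed tokens near the front. The events counted here therefore stay at levels up
  to \<open>k + 1\<close>.\<close>

definition G_low :: "'a set \<Rightarrow> nat \<Rightarrow> 'a set \<Rightarrow> nat" where
  "G_low T k H = card {t \<in> {0..<2 * N}. ev T k t \<and> low T k H t \<le> 1}"

lemma low_per: "T \<subseteq> V \<Longrightarrow> H \<subseteq> V \<Longrightarrow> low T k H (t + 2 * N) = low T k H t"
proof -
  assume a: "T \<subseteq> V" "H \<subseteq> V"
  have "cnt T (t + 2 * N) v = cnt T t v" if "v \<in> H" for v
    using cnt_flip2[OF a(1), of v t] a that by auto
  then show ?thesis unfolding low_def by (intro arg_cong[where f = card] Collect_cong) auto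
qed

lemma G_low_base:
  assumes "T \<subseteq> V" "H \<subseteq> V"
  shows "G_low T k H = card {t \<in> {a..<a + 2 * N}. ev T k t \<and> low T k H t \<le> 1}"
proof -
  have "ev T k (t + 2 * N) \<and> low T k H (t + 2 * N) \<le> 1 \<longleftrightarrow> ev T k t \<and> low T k H t \<le> 1" for t
    by (simp only: low_per[OF assms] ev_flip2[OF assms(1)])
  from card_period[of "\<lambda>t. ev T k t \<and> low T k H t \<le> 1", OF this, of 0 a] show ?thesis
    unfolding G_low_def using N_pos by simp
qed

lemma crossing_up:
  fixes f :: "int \<Rightarrow> nat"
  assumes "a \<le> b" "f a < j" "j \<le> f b"
  obtains t where "a \<le> t" "t < b" "f t < j" "j \<le> f (t + 1)"
proof -
  define A where "A = {t \<in> {a..b}. f t < j}"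
  have "finite A" "a \<in> A" using assms by (auto simp: A_def)
  define t where "t = Max A"
  have tA: "t \<in> A" unfolding t_def using \<open>finite A\<close> \<open>a \<in> A\<close> by (intro Max_in) auto
  then have t: "a \<le> t" "t < b" "f t < j" using assms(3) by (auto simp: A_def order_le_less)
  have "t + 1 \<notin> A" using Max_ge[OF \<open>finite A\<close>, of "t + 1"] unfolding t_def by auto
  then have "j \<le> f (t + 1)" using t by (simp add: A_def)
  then show thesis using that t by blast
qed

lemma crossing_down:
  fixes f :: "int \<Rightarrow> nat"
  assumes "a \<le> b" "j \<le> f a" "f b < j"
  obtains t where "a \<le> t" "t < b" "j \<le> f t" "f (t + 1) < j"
proof -
  define A where "A = {t \<in> {a..b}. j \<le> f t}"
  have "finite A" "a \<in> A" using assms by (auto simp: A_def)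
  define t where "t = Max A"
  have tA: "t \<in> A" unfolding t_def using \<open>finite A\<close> \<open>a \<in> A\<close> by (intro Max_in) auto
  then have t: "a \<le> t" "t < b" "j \<le> f t" using assms(3) by (auto simp: A_def order_le_less)
  have "t + 1 \<notin> A" using Max_ge[OF \<open>finite A\<close>, of "t + 1"] unfolding t_def by auto
  then have "f (t + 1) < j" using t by (simp add: A_def)
  then show thesis using that t by blast
qed

lemma swp_up:
  assumes "S \<subseteq> V" "v \<in> S" "cnt S t v < j" "j \<le> cnt S (t + 1) v"
  obtains x where "x \<in> S" "swp t v x" "cnt S t x = j" "ev S j t"
proof -
  have v: "v \<in> V" using assms by auto
  have ne: "cnt S (t + 1) v \<noteq> cnt S t v" using assms by simp
  have "\<exists>x\<in>S. swp t v x \<and> cnt S (t + 1) v = cnt S t v + 1"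
    by (rule cnt_change[OF assms(1) v ne]) (use assms(3,4) in auto)
  then obtain x where x: "x \<in> S" "swp t v x" "cnt S (t + 1) v = cnt S t v + 1" by blast
  have c: "cnt S t x = j" using cnt_step_adj[OF x(2) assms(1)] assms x by simp
  have "ev S j t" unfolding ev_def using assms(2) x(1,2) c by (intro bexI[of _ v] bexI[of _ x]) auto
  then show thesis using that[OF x(1,2) c] by simp
qed

lemma swp_down:
  assumes "S \<subseteq> V" "v \<in> S" "j \<le> cnt S t v" "cnt S (t + 1) v < j"
  obtains x where "x \<in> S" "swp t x v" "cnt S t v = j" "ev S j t"
proof -
  have v: "v \<in> V" using assms by auto
  have ne: "cnt S (t + 1) v \<noteq> cnt S t v" using assms by simp
  have "\<exists>x\<in>S. swp t x v \<and> cnt S t v = cnt S (t + 1) v + 1"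
    by (rule cnt_change[OF assms(1) v ne]) (use assms(3,4) in auto)
  then obtain x where x: "x \<in> S" "swp t x v" "cnt S t v = cnt S (t + 1) v + 1" by blast
  have c: "cnt S t v = j" using assms x by simp
  have "ev S j t" unfolding ev_def using assms(2) x(1,2) c by (intro bexI[of _ x] bexI[of _ v]) auto
  then show thesis using that[OF x(1,2) c] by simp
qed

section \<open>Low events of extremal tokens and the removal of three of them\<close>

definition tok_ev :: "'a set \<Rightarrow> nat \<Rightarrow> 'a \<Rightarrow> int \<Rightarrow> bool" where
  "tok_ev S K v t \<longleftrightarrow> (\<exists>j\<le>K. ev S j t) \<and> (\<exists>x\<in>S. swp t v x \<or> swp t x v)"

lemma tok_ev_per: "S \<subseteq> V \<Longrightarrow> tok_ev S K v (t + 2 * N) \<longleftrightarrow> tok_ev S K v t"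
  unfolding tok_ev_def using ev_flip2[of S] swp_flip2 by simp

text \<open>An extremal token climbs through every level on its way to the other end and descends
  through every level on its way back; the direction keeps the two families of \<open>K\<close>
  events apart.\<close>

lemma tok_ev_card:
  assumes S: "S \<subseteq> V" "v \<in> S" "\<And>x. x \<in> S - {v} \<Longrightarrow> bef e v x" and K: "K < card S"
  shows "2 * K \<le> card {t \<in> {0..<2 * N}. tok_ev S K v t}"
proof -
  have v: "v \<in> V" using S by auto
  have "{x \<in> S. bef e x v} = {}"
  proof -
    have "\<not> bef e x v" if "x \<in> S" for x
      using S(3)[of x] that asym[of v x e] irr[OF v, of e] v S(1) by (cases "x = v") auto
    then show ?thesis by blast
  qed
  then have c0: "cnt S e v = 0" unfolding cnt_def by (simp only: card.empty)
  have cN: "cnt S (e + N) v = card S - 1" using cnt_flip_in[OF S(1,2), of e] c0 by simp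
  have c2: "cnt S (e + 2 * N) v = 0" using cnt_flip2[OF S(1) v, of e] c0 by simp
  define B where "B = {t \<in> {e..<e + 2 * N}. tok_ev S K v t}"
  have "\<exists>t. t \<in> B \<and> ev S j t \<and> (\<exists>x\<in>S. swp t v x)" if j: "j \<in> {1..K}" for j
  proof -
    obtain t where t: "e \<le> t" "t < e + N" "cnt S t v < j" "j \<le> cnt S (t + 1) v"
      using crossing_up[of e "e + N" "\<lambda>t. cnt S t v" j] c0 cN j K N_pos by force
    obtain x where x: "x \<in> S" "swp t v x" "ev S j t" using swp_up[OF S(1,2) t(3,4)] by blast
    have "tok_ev S K v t" unfolding tok_ev_def using x j by auto
    then have "t \<in> B" using t N_pos unfolding B_def by auto
    then show ?thesis using x by blast
  qed
  then obtain u where u: "\<And>j. j \<in> {1..K} \<Longrightarrow> u j \<in> B \<and> ev S j (u j) \<and> (\<exists>x\<in>S. swp (u j) v x)" by metis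
  have "\<exists>t. t \<in> B \<and> ev S j t \<and> (\<exists>x\<in>S. swp t x v)" if j: "j \<in> {1..K}" for j
  proof -
    obtain t where t: "e + N \<le> t" "t < e + 2 * N" "j \<le> cnt S t v" "cnt S (t + 1) v < j"
      using crossing_down[of "e + N" "e + 2 * N" j "\<lambda>t. cnt S t v"] c2 cN j K N_pos by force
    obtain x where x: "x \<in> S" "swp t x v" "ev S j t" using swp_down[OF S(1,2) t(3,4)] by blast
    have "tok_ev S K v t" unfolding tok_ev_def using x j by auto
    then have "t \<in> B" using t N_pos unfolding B_def by auto
    then show ?thesis using x by blast
  qed
  then obtain d where d: "\<And>j. j \<in> {1..K} \<Longrightarrow> d j \<in> B \<and> ev S j (d j) \<and> (\<exists>x\<in>S. swp (d j) x v)" by metis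
  have iu: "inj_on u {1..K}"
  proof (rule inj_onI)
    fix i j assume "i \<in> {1..K}" "j \<in> {1..K}" "u i = u j"
    then show "i = j" using u[of i] u[of j] ev_unique[of S i "u i" j] by simp
  qed
  have id: "inj_on d {1..K}"
  proof (rule inj_onI)
    fix i j assume "i \<in> {1..K}" "j \<in> {1..K}" "d i = d j"
    then show "i = j" using d[of i] d[of j] ev_unique[of S i "d i" j] by simp
  qed
  have dis: "u ` {1..K} \<inter> d ` {1..K} = {}"
  proof -
    have "u i \<noteq> d j" if ij: "i \<in> {1..K}" "j \<in> {1..K}" for i j
    proof
      assume e: "u i = d j"
      obtain x where x: "swp (u i) v x" using u[OF ij(1)] by blast
      obtain y where y: "swp (u i) y v" using d[OF ij(2)] e by auto
      show False using one[OF x y] swp_neq[OF x] by simp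
    qed
    then show ?thesis by blast
  qed
  have finB: "finite B" unfolding B_def by simp
  have "2 * K = card (u ` {1..K} \<union> d ` {1..K})"
    using dis iu id by (subst card_Un_disjoint) (auto simp: card_image)
  also have "\<dots> \<le> card B" using u d finB by (intro card_mono) blast+
  also have "\<dots> = card {t \<in> {0..<2 * N}. tok_ev S K v t}"
    unfolding B_def using card_period[of "tok_ev S K v", OF tok_ev_per[OF S(1)], of e 0] N_pos by simp
  finally show ?thesis .
qed

lemma swp_next:
  assumes "swp t p q" "t < t'" "t' \<le> t + N" "swp t' p q \<or> swp t' q p"
  shows "t' = t + N"
proof (rule ccontr)
  assume "t' \<noteq> t + N"
  then have "bef t' q p" "bef (t' + 1) q p" using once[OF assms(1), of t'] once[OF assms(1), of "t' + 1"] assms by auto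
  then show False using assms(4) asym swpD by metis
qed

lemma swp_next2:
  assumes "swp t p q" "t < t'" "t' < t + 2 * N" "swp t' p q \<or> swp t' q p"
  shows "t' = t + N"
proof (cases "t' \<le> t + N")
  case True then show ?thesis using swp_next assms by blast
next
  case False
  have "swp (t + N) q p" using assms swp_flip by blast
  then show ?thesis using swp_next[of "t + N" q p t'] assms False by auto
qed

text \<open>The two exchanges of a pair in a full period are half a turn apart and have
  complementary levels. For \<open>2 * K < card S\<close> at most one of them is low.\<close>

lemma tok_ev_pair:
  assumes S: "S \<subseteq> V" "p \<in> S" "q \<in> S" "p \<noteq> q" and K: "2 * K < card S"
  shows "card {t \<in> {0..<2 * N}. tok_ev S K p t \<and> tok_ev S K q t} \<le> 1"
proof -
  have F: "finite {t \<in> {0..<2 * N}. tok_ev S K p t \<and> tok_ev S K q t}" by simp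
  have lt: False if t: "t \<in> {0..<2 * N}" "tok_ev S K p t" "tok_ev S K q t"
      and t': "t' \<in> {0..<2 * N}" "tok_ev S K p t'" "tok_ev S K q t'" and l: "t < t'" for t t'
  proof -
    have pq: "swp s p q \<or> swp s q p" if "tok_ev S K p s" "tok_ev S K q s" for s
      using that one S(4) unfolding tok_ev_def by metis
    have "t' = t + N" using pq[OF t(2,3)] pq[OF t'(2,3)] swp_next2[of t p q t'] swp_next2[of t q p t'] l t t' by auto
    moreover obtain i j where "i \<le> K" "ev S i t" "j \<le> K" "ev S j t'" using t t' unfolding tok_ev_def by blast
    ultimately have "ev S (card S - j) t" "i \<le> K" "j \<le> K" "ev S i t" "j < card S" using ev_flip[OF S(1)] by auto
    then show False using ev_unique[of S "card S - j" t i] K by linarith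
  qed
  show ?thesis
  proof (rule ccontr)
    assume "\<not> ?thesis"
    then obtain a b where "a \<in> {t \<in> {0..<2 * N}. tok_ev S K p t \<and> tok_ev S K q t}"
      "b \<in> {t \<in> {0..<2 * N}. tok_ev S K p t \<and> tok_ev S K q t}" "a \<noteq> b"
      using F by (metis (no_types, lifting) One_nat_def card_le_Suc0_iff_eq)
    then show False using lt[of a b] lt[of b a] by (cases "a < b") auto
  qed
qed

lemma card_Un3_ge:
  assumes "finite A" "finite B" "finite C"
  shows "card A + card B + card C \<le> card (A \<union> B \<union> C) + card (A \<inter> B) + card (A \<inter> C) + card (B \<inter> C)"
proof -
  have "card A + card B = card (A \<union> B) + card (A \<inter> B)" by (rule card_Un_Int[OF assms(1,2)])
  moreover have "card (A \<union> B) + card C = card (A \<union> B \<union> C) + card ((A \<union> B) \<inter> C)"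
    by (rule card_Un_Int) (use assms in auto)
  moreover have "card ((A \<union> B) \<inter> C) \<le> card (A \<inter> C) + card (B \<inter> C)"
    unfolding Int_Un_distrib2 by (rule card_Un_le)
  ultimately show ?thesis by linarith
qed

text \<open>Each removed token has \<open>2 * (k + 1)\<close> low events and at most three are
  shared, which gives \<open>6 * k + 3\<close>. To these come events between remaining tokens:
  levels up to \<open>k - 1\<close> rise by at most 2, and level \<open>k\<close> rises by at most 1
  where \<open>low\<close> is at most 1.\<close>

lemma removal:
  assumes S: "S \<subseteq> V" and H: "H = {p, q, r}" "H \<subseteq> S" "distinct [p, q, r]"
    and hull: "\<And>v. v \<in> H \<Longrightarrow> \<exists>e. \<forall>x\<in>S - {v}. bef e v x"
    and n: "2 * k + 2 < card S"
    and low2: "\<And>t. low (S - H) k H t \<le> 2"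
  shows "6 * k + 3 + A_le (S - H) (k - 1) + G_low (S - H) k H \<le> A_le S (k + 1)"
proof -
  define T where "T = S - H"
  have TV: "T \<subseteq> V" and HV: "H \<subseteq> V" using S H by (auto simp: T_def)
  define E where "E v = {t \<in> {0..<2 * N}. tok_ev S (k + 1) v t}" for v
  have fE: "finite (E v)" for v unfolding E_def by simp
  have cE: "2 * (k + 1) \<le> card (E v)" if v: "v \<in> H" for v
  proof -
    obtain e where e: "\<forall>x\<in>S - {v}. bef e v x" using hull[OF v] by blast
    show ?thesis unfolding E_def by (rule tok_ev_card[OF S, of v e]) (use e v H n in auto)
  qed
  have pr: "card (E u \<inter> E v) \<le> 1" if "u \<in> H" "v \<in> H" "u \<noteq> v" for u v
  proof -
    have "E u \<inter> E v = {t \<in> {0..<2 * N}. tok_ev S (k + 1) u t \<and> tok_ev S (k + 1) v t}"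
      unfolding E_def by blast
    then show ?thesis using tok_ev_pair[OF S, of u v "k + 1"] that H n by auto
  qed
  have "p \<noteq> q" "p \<noteq> r" "q \<noteq> r" using H by auto
  then have E3: "6 * k + 3 \<le> card (E p \<union> E q \<union> E r)"
    using card_Un3_ge[OF fE[of p] fE[of q] fE[of r]] cE[of p] cE[of q] cE[of r]
      pr[of p q] pr[of p r] pr[of q r] H(1) by simp
  define M where "M = {t \<in> {0..<2 * N}. \<exists>j\<le>k - 1. ev T j t}"
  define G where "G = {t \<in> {0..<2 * N}. ev T k t \<and> low T k H t \<le> 1}"
  define A where "A = {t \<in> {0..<2 * N}. \<exists>j\<le>k + 1. ev S j t}"
  have fin: "finite M" "finite G" "finite A" by (auto simp: M_def G_def A_def)
  have EA: "E v \<subseteq> A" for v unfolding E_def A_def tok_ev_def by blast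
  have lift: "\<exists>i. ev S i t \<and> i \<le> j + low T k H t" if j: "ev T j t" "j \<le> k" for j t
  proof -
    obtain a b where ab: "a \<in> T" "b \<in> T" "swp t a b" "cnt T t b = j" using j unfolding ev_def by blast
    have abS: "a \<in> S" "b \<in> S" using ab by (auto simp: T_def)
    have "cnt T t a + 1 = j" using cnt_step_adj[OF ab(3) TV] ab by simp
    then have aj: "cnt T t a < j" by simp
    \<comment> \<open>The exchanged tokens are adjacent, so a removed token in front of
      \<open>b\<close> is also in front of \<open>a\<close>. It then has fewer than
      \<open>j\<close>, hence fewer than \<open>k\<close>, tokens of \<open>T\<close> before
      it.\<close>
    have sub: "{x \<in> S. bef t x b} \<subseteq> {x \<in> T. bef t x b} \<union> {v \<in> H. cnt T t v < k}"
    proof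
      fix x assume x: "x \<in> {x \<in> S. bef t x b}"
      show "x \<in> {x \<in> T. bef t x b} \<union> {v \<in> H. cnt T t v < k}"
      proof (cases "x \<in> H")
        case True
        have xV: "x \<in> V" using True HV by auto
        have "x \<noteq> a" "x \<noteq> b" using True ab by (auto simp: T_def)
        then have "bef t x a" using swp_adj[OF ab(3) xV] x by blast
        then have "cnt T t x \<le> cnt T t a" using cnt_le[OF TV xV, of a t] swpD(1)[OF ab(3)] by blast
        then show ?thesis using True aj j by auto
      qed (use x in \<open>auto simp: T_def\<close>)
    qed
    have fH: "finite {v \<in> H. cnt T t v < k}" using H(1) by simp
    have fT: "finite {x \<in> T. bef t x b}" using fin_sub[OF TV] by simp
    have "card {x \<in> S. bef t x b} \<le> card ({x \<in> T. bef t x b} \<union> {v \<in> H. cnt T t v < k})"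
      by (rule card_mono[OF _ sub]) (use fH fT in auto)
    also have "\<dots> \<le> card {x \<in> T. bef t x b} + low T k H t" unfolding low_def by (rule card_Un_le)
    finally have "cnt S t b \<le> cnt T t b + low T k H t" unfolding cnt_def .
    then have "cnt S t b \<le> j + low T k H t" using ab by simp
    moreover have "ev S (cnt S t b) t" unfolding ev_def
      using ab(3) abS by (intro bexI[of _ a] bexI[of _ b]) auto
    ultimately show ?thesis by blast
  qed
  have MA: "M \<subseteq> A"
  proof
    fix t assume "t \<in> M"
    then obtain j where j: "j \<le> k - 1" "ev T j t" "t \<in> {0..<2 * N}" unfolding M_def by blast
    have "j \<noteq> 0" using ev_bounds[OF TV j(2)] by simp
    then have "j + 2 \<le> k + 1" "j \<le> k" using j by auto
    then obtain i where "ev S i t" "i \<le> k + 1" using lift[OF j(2)] low2[of t] unfolding T_def by (meson add_le_mono le_refl le_trans)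
    then show "t \<in> A" using j unfolding A_def by blast
  qed
  have GA: "G \<subseteq> A"
  proof
    fix t assume "t \<in> G"
    then have g: "ev T k t" "low T k H t \<le> 1" "t \<in> {0..<2 * N}" unfolding G_def by auto
    then obtain i where "ev S i t" "i \<le> k + low T k H t" using lift[OF g(1)] by blast
    then show "t \<in> A" using g unfolding A_def by (auto intro!: exI[of _ i])
  qed
  have MG: "M \<inter> G = {}"
  proof -
    have False if "ev T j t" "j \<le> k - 1" "ev T k t" for t j
      using ev_unique[OF that(1,3)] ev_bounds[OF TV that(1)] that(2) by linarith
    then show ?thesis unfolding M_def G_def by blast
  qed
  have notT: "\<not> ev T j t" if tv: "t \<in> E v" "v \<in> H" for t v j
  proof
    assume "ev T j t"
    then obtain a b where ab: "a \<in> T" "b \<in> T" "swp t a b" unfolding ev_def by blast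
    have "\<exists>x. swp t v x \<or> swp t x v" using tv(1) unfolding E_def tok_ev_def by blast
    then have "v = a \<or> v = b" using one[OF ab(3)] by blast
    then show False using tv(2) ab unfolding T_def by blast
  qed
  have "(E p \<union> E q \<union> E r) \<inter> (M \<union> G) = {}" using notT H(1) unfolding M_def G_def by blast
  then have "card (E p \<union> E q \<union> E r) + (card M + card G) = card (E p \<union> E q \<union> E r \<union> (M \<union> G))"
    using fin fE MG by (simp add: card_Un_disjoint)
  also have "\<dots> \<le> card A" by (rule card_mono) (use fin EA MA GA in auto)
  finally show ?thesis using E3 unfolding M_def G_def A_def A_le_def G_low_def T_def by linarith
qed

end

context circular_seq
begin

section \<open>Events gained outside the overlaps of the three arcs\<close>

lemma per_into:
  assumes "\<And>t. P (t + 2 * N) \<longleftrightarrow> P t" "P t"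
  obtains t' where "a < t'" "t' \<le> a + 2 * N" "P t'"
proof -
  have "t \<in> {s \<in> {t..<t + 2 * N}. P s}" using assms(2) N_pos by simp
  then have "card {s \<in> {t..<t + 2 * N}. P s} \<noteq> 0" by (subst card_0_eq) (simp, blast)
  moreover have "card {s \<in> {t..<t + 2 * N}. P s} = card {s \<in> {a + 1..<a + 1 + 2 * N}. P s}"
    by (rule card_period) (use assms(1) N_pos in auto)
  ultimately have "card {s \<in> {a + 1..<a + 1 + 2 * N}. P s} \<noteq> 0" by (simp only: not_False_eq_True)
  then have "{s \<in> {a + 1..<a + 1 + 2 * N}. P s} \<noteq> {}" by (metis card.empty)
  then obtain x where "a + 1 \<le> x" "x < a + 1 + 2 * N" "P x" by auto
  then show thesis using that[of x] by simp
qed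

context
  fixes S k p q r wp ap wq aq wr ar T H
  assumes S: "S \<subseteq> V" and k: "0 < k" "2 * k + 4 \<le> card S"
    and tri: "tri S k p q r wp ap wq aq wr ar"
    and H: "H = {p, q, r}" and T: "T = S - H"
begin

lemma tri_basic:
  shows "T \<subseteq> V" "H \<subseteq> S" "card T = card S - 3" "2 * k \<le> card T" "finite T"
    "p \<in> V" "q \<in> V" "r \<in> V" "p \<notin> T" "q \<notin> T" "r \<notin> T" "p \<noteq> q" "p \<noteq> r" "q \<noteq> r" "finite H" "H \<subseteq> V"
    "ap < wr" "aq < wp + 2 * N" "ar < wq + 2 * N"
proof -
  have t: "p \<in> S" "q \<in> S" "r \<in> S" "distinct [p, q, r]" using tri unfolding tri_def by auto
  have c: "card H = 3" using t H by auto
  show HS: "H \<subseteq> S" using t H by auto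
  show "card T = card S - 3" unfolding T using c HS fin_sub[OF S] by (metis card_Diff_subset finite_subset)
  then show "2 * k \<le> card T" using k by simp
  show "T \<subseteq> V" using S T by auto
  then show "finite T" by (rule fin_sub)
  show "ap < wr" "aq < wp + 2 * N" "ar < wq + 2 * N" using tri unfolding tri_def by auto
  show "H \<subseteq> V" using HS S by blast
  show "p \<in> V" "q \<in> V" "r \<in> V" using t S by auto
  show "p \<notin> T" "q \<notin> T" "r \<notin> T" using T H by auto
  show "p \<noteq> q" "p \<noteq> r" "q \<noteq> r" using t by auto
  show "finite H" using H by simp
qed

lemma tri_arcs: "arc T k p wp ap" "arc T k q wq aq" "arc T k r wr ar"
  using tri unfolding tri_def T H by auto

lemma tri_hi:
  "ap < t \<Longrightarrow> t \<le> wp + 2 * N \<Longrightarrow> k \<le> cnt T t p" "aq < t \<Longrightarrow> t \<le> wq + 2 * N \<Longrightarrow> k \<le> cnt T t q"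
  "ar < t \<Longrightarrow> t \<le> wr + 2 * N \<Longrightarrow> k \<le> cnt T t r"
  "ap + 2 * N < t \<Longrightarrow> t \<le> wp + 4 * N \<Longrightarrow> k \<le> cnt T t p" "aq + 2 * N < t \<Longrightarrow> t \<le> wq + 4 * N \<Longrightarrow> k \<le> cnt T t q"
  "ar - 2 * N < t \<Longrightarrow> t \<le> wr \<Longrightarrow> k \<le> cnt T t r"
proof -
  note A = arcD(6)[OF tri_arcs(1)] arcD(6)[OF tri_arcs(2)] arcD(6)[OF tri_arcs(3)]
  have c2: "cnt T (t + 2 * N) v = cnt T t v" if "v \<in> V" for t v using cnt_flip2[OF tri_basic(1) that] .
  show "ap < t \<Longrightarrow> t \<le> wp + 2 * N \<Longrightarrow> k \<le> cnt T t p" "aq < t \<Longrightarrow> t \<le> wq + 2 * N \<Longrightarrow> k \<le> cnt T t q"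
    "ar < t \<Longrightarrow> t \<le> wr + 2 * N \<Longrightarrow> k \<le> cnt T t r" using A by auto
  show "k \<le> cnt T t p" if "ap + 2 * N < t" "t \<le> wp + 4 * N"
    using A(1)[of "t - 2 * N"] c2[of p "t - 2 * N"] tri_basic(6) that by simp
  show "k \<le> cnt T t q" if "aq + 2 * N < t" "t \<le> wq + 4 * N"
    using A(2)[of "t - 2 * N"] c2[of q "t - 2 * N"] tri_basic(7) that by simp
  show "k \<le> cnt T t r" if "ar - 2 * N < t" "t \<le> wr"
    using A(3)[of "t + 2 * N"] c2[of r t] tri_basic(8) that by simp
qed

lemma low_le1I:
  assumes "k \<le> cnt T t p \<and> k \<le> cnt T t q \<or> k \<le> cnt T t p \<and> k \<le> cnt T t r \<or> k \<le> cnt T t q \<and> k \<le> cnt T t r"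
  shows "low T k H t \<le> 1"
proof -
  have "\<exists>z. {v \<in> H. cnt T t v < k} \<subseteq> {z}" using assms H by (auto simp: not_less)
  then obtain z where "{v \<in> H. cnt T t v < k} \<subseteq> {z}" by blast
  then have "card {v \<in> H. cnt T t v < k} \<le> card {z}" by (intro card_mono) auto
  then show ?thesis unfolding low_def by simp
qed

text \<open>Take a moment in the period after \<open>wr\<close>. If \<open>r\<close> is low it is at
  most \<open>ar\<close>; if \<open>p\<close> is low it is past \<open>wp + 2 * N\<close>, hence
  past \<open>aq\<close>; then \<open>q\<close> can only be low after \<open>wq + 2 * N\<close>,
  which is beyond \<open>ar\<close>.\<close>

lemma low_le2: "low T k H t \<le> 2"
proof -
  have "\<not> (cnt T t p < k \<and> cnt T t q < k \<and> cnt T t r < k)"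
  proof
    assume a: "cnt T t p < k \<and> cnt T t q < k \<and> cnt T t r < k"
    note c2 = cnt_flip2[OF tri_basic(1) tri_basic(6)] cnt_flip2[OF tri_basic(1) tri_basic(7)]
      cnt_flip2[OF tri_basic(1) tri_basic(8)]
    obtain t' where t': "wr < t'" "t' \<le> wr + 2 * N" "cnt T t' p < k \<and> cnt T t' q < k \<and> cnt T t' r < k"
      by (rule per_into[of "\<lambda>t. cnt T t p < k \<and> cnt T t q < k \<and> cnt T t r < k" t wr]) (use a c2 in auto)
    have "t' \<le> ar" using tri_hi(3)[of t'] t' by linarith
    moreover have "wp + 2 * N < t'" using tri_hi(1)[of t'] tri_basic(17) t' by linarith
    ultimately show False using tri_hi(2)[of t'] tri_basic(18,19) t' by linarith
  qed
  then obtain z where z: "z \<in> H" "\<not> cnt T t z < k" using H by auto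
  have "card {v \<in> H. cnt T t v < k} \<le> card (H - {z})" using z tri_basic(15) by (intro card_mono) auto
  also have "\<dots> = 2" using z H tri_basic(12-14) by (auto simp: card_Diff_singleton_if)
  finally show ?thesis unfolding low_def .
qed

text \<open>The prefixes at the two ends of the arc are disjoint. So along the complement of the arc
  all \<open>k\<close> tokens in front are replaced, one per event.\<close>

lemma G_ge_k:
  assumes "arc T k v w a" "\<And>t. a < t \<Longrightarrow> t \<le> w + 2 * N \<Longrightarrow> low T k H t \<le> 1"
  shows "k \<le> G_low T k H"
proof -
  note A = arcD[OF assms(1)]
  have cF: "card (fst_set T k t) = k" for t by (rule card_fst_set) (use tri_basic in auto)
  have "k = card (fst_set T k (w + 2 * N) - fst_set T k (a + 1))"
    using A(10)[OF tri_basic(4)] cF by (metis Diff_triv Int_commute)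
  also have "\<dots> \<le> card {t \<in> {a + 1..<w + 2 * N}. ev T k t}"
    by (rule fst_set_diff_le[OF tri_basic(1)]) (use A(4) N_pos in simp)
  also have "\<dots> \<le> card {t \<in> {a + 1..<a + 1 + 2 * N}. ev T k t \<and> low T k H t \<le> 1}"
    by (rule card_mono) (use assms(2) A(3) in auto)
  also have "\<dots> = G_low T k H" using G_low_base[OF tri_basic(1,16), of k "a + 1"] by simp
  finally show ?thesis .
qed

text \<open>Outside the arc of \<open>r\<close> two low tokens could only be \<open>p\<close> and
  \<open>q\<close>, whose arcs are disjoint here, including their copies in neighbouring
  periods.\<close>

lemma G_nonoverlap:
  assumes "ap \<le> wq"
  shows "k \<le> G_low T k H"
proof (rule G_ge_k[OF tri_arcs(3)])
  fix t assume t: "ar < t" "t \<le> wr + 2 * N"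
  have r: "k \<le> cnt T t r" using tri_hi(3) t .
  note b = tri_basic(17-19) arcD(3,4)[OF tri_arcs(1)] arcD(3,4)[OF tri_arcs(2)] arcD(3,4)[OF tri_arcs(3)]
  have "k \<le> cnt T t p \<or> k \<le> cnt T t q"
  proof (cases "t \<le> wp + 2 * N")
    case True
    then show ?thesis using tri_hi(1)[of t] b t by linarith
  next
    case f1: False
    show ?thesis
    proof (cases "t \<le> wq + 2 * N")
      case True
      then show ?thesis using tri_hi(2)[of t] b t f1 by linarith
    next
      case f2: False
      show ?thesis
      proof (cases "t \<le> wp + 4 * N")
        case True
        then show ?thesis using tri_hi(4)[of t] assms f2 by linarith
      next
        case False
        then show ?thesis using tri_hi(5)[of t] b t by linarith
      qed
    qed
  qed
  then show "low T k H t \<le> 1" using r low_le1I by blast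
qed

text \<open>Between the end of \<open>p\<close>'s arc and the start of \<open>r\<close>'s arc only
  \<open>q\<close> can be low. With the rotations this provides three stretches of time on which
  events count.\<close>

lemma low_piece:
  assumes "wq < ap" "wr < aq" "ap < t" "t \<le> wr"
  shows "low T k H t \<le> 1"
proof -
  note b = tri_basic(17-19)
  have "k \<le> cnt T t p" using tri_hi(1)[of t] assms b by linarith
  moreover have "k \<le> cnt T t r" using tri_hi(6)[of t] assms b by linarith
  ultimately show ?thesis using low_le1I by blast
qed

end

text \<open>What the three \<open>k\<close>-sets exceed \<open>card T\<close> by is found in their
  pairwise intersections. Since \<open>X1\<close> misses \<open>Y2\<close>, a token in
  \<open>X1\<close> and \<open>X2\<close> has to leave \<open>X2\<close> on the way to
  \<open>Y2\<close>, and similarly for the other two pairs. In the application \<open>X\<close> and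
  \<open>Y\<close> are the prefixes at the two ends of a stretch between arcs.\<close>

lemma card3_ge:
  assumes "finite T" "X1 \<subseteq> T" "X2 \<subseteq> T" "X3 \<subseteq> T" "Y1 \<subseteq> T" "Y2 \<subseteq> T" "Y3 \<subseteq> T"
    "card X1 = k" "card X2 = k" "card X3 = k" "card Y1 = k" "card Y2 = k" "card Y3 = k"
    "X1 \<inter> Y2 = {}" "X2 \<inter> Y3 = {}" "X3 \<inter> Y1 = {}"
  shows "3 * k \<le> card T + (card (Y1 - X1) + card (Y2 - X2) + card (Y3 - X3))"
proof -
  have fin: "finite X1" "finite X2" "finite X3" "finite Y1" "finite Y2" "finite Y3"
    using assms(1-7) finite_subset by blast+
  have sym: "card (X - Y) = card (Y - X)" if "finite X" "finite Y" "card X = k" "card Y = k" for X Y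
    using that card_Diff_subset_Int[of X Y] card_Diff_subset_Int[of Y X] by (simp add: Int_commute)
  have "card X1 + card X2 + card X3 \<le> card (X1 \<union> X2 \<union> X3) + card (X1 \<inter> X2) + card (X1 \<inter> X3) + card (X2 \<inter> X3)"
    by (rule card_Un3_ge[OF fin(1-3)])
  moreover have "card (X1 \<union> X2 \<union> X3) \<le> card T" by (rule card_mono) (use assms in auto)
  moreover have "card (X1 \<inter> X2) \<le> card (X2 - Y2)" by (rule card_mono) (use assms fin in auto)
  moreover have "card (X1 \<inter> X3) \<le> card (X1 - Y1)" by (rule card_mono) (use assms fin in auto)
  moreover have "card (X2 \<inter> X3) \<le> card (X3 - Y3)" by (rule card_mono) (use assms fin in auto)
  ultimately show ?thesis using sym[OF fin(1,4) assms(8,11)] sym[OF fin(2,5) assms(9,12)]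
      sym[OF fin(3,6) assms(10,13)] assms(8-13) by linarith
qed

lemma tri_overlap_pieces:
  assumes S: "S \<subseteq> V" and k: "0 < k" "2 * k + 4 \<le> card S"
    and tri: "tri S k p q r wp ap wq aq wr ar" and H: "H = {p, q, r}" and T: "T = S - H"
    and o: "wq < ap" "wr < aq" "wp + 2 * N < ar"
  shows "card {t \<in> {ap + 1..<wr}. ev T k t} + card {t \<in> {aq + 1..<wp + 2 * N}. ev T k t} +
      card {t \<in> {ar + 1..<wq + 2 * N}. ev T k t} \<le> G_low T k H"
proof -
  note B = tri_basic[OF S k tri H T]
  have tri2: "tri S k q r p wq aq wr ar (wp + 2 * N) (ap + 2 * N)" by (rule tri_rot[OF S tri])
  have tri3: "tri S k r p q wr ar (wp + 2 * N) (ap + 2 * N) (wq + 2 * N) (aq + 2 * N)" by (rule tri_rot[OF S tri2])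
  have H2: "H = {q, r, p}" "H = {r, p, q}" using H by auto
  have l1: "low T k H t \<le> 1" if "ap < t" "t \<le> wr" for t
    by (rule low_piece[OF S k tri H T]) (use o that in auto)
  have l2: "low T k H t \<le> 1" if "aq < t" "t \<le> wp + 2 * N" for t
    by (rule low_piece[OF S k tri2 H2(1) T]) (use o that in auto)
  have l3: "low T k H t \<le> 1" if "ar < t" "t \<le> wq + 2 * N" for t
    by (rule low_piece[OF S k tri3 H2(2) T]) (use o that in auto)
  let ?E1 = "{t \<in> {ap + 1..<wr}. ev T k t}" and ?E2 = "{t \<in> {aq + 1..<wp + 2 * N}. ev T k t}"
    and ?E3 = "{t \<in> {ar + 1..<wq + 2 * N}. ev T k t}"
  have "?E1 \<inter> ?E2 = {}" "(?E1 \<union> ?E2) \<inter> ?E3 = {}" using o B(17-19) by auto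
  then have "card ?E1 + card ?E2 + card ?E3 = card (?E1 \<union> ?E2 \<union> ?E3)"
    by (subst card_Un_disjoint, simp, simp, simp, subst card_Un_disjoint) auto
  also have "\<dots> \<le> card {t \<in> {ap + 1..<ap + 1 + 2 * N}. ev T k t \<and> low T k H t \<le> 1}"
  proof (rule card_mono)
    show "?E1 \<union> ?E2 \<union> ?E3 \<subseteq> {t \<in> {ap + 1..<ap + 1 + 2 * N}. ev T k t \<and> low T k H t \<le> 1}"
      using l1 l2 l3 o B(17-19) by force
  qed simp
  also have "\<dots> = G_low T k H" using G_low_base[OF B(1,16), of k "ap + 1"] by simp
  finally show ?thesis .
qed

lemma tri_cases:
  assumes S: "S \<subseteq> V" and k: "0 < k" "2 * k + 4 \<le> card S"
    and tri: "tri S k p q r wp ap wq aq wr ar" and H: "H = {p, q, r}" and T: "T = S - H"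
  shows "k \<le> G_low T k H \<or> wq < ap \<and> wr < aq \<and> wp + 2 * N < ar"
proof -
  have tri2: "tri S k q r p wq aq wr ar (wp + 2 * N) (ap + 2 * N)" by (rule tri_rot[OF S tri])
  have tri3: "tri S k r p q wr ar (wp + 2 * N) (ap + 2 * N) (wq + 2 * N) (aq + 2 * N)" by (rule tri_rot[OF S tri2])
  have H2: "H = {q, r, p}" "H = {r, p, q}" using H by auto
  show ?thesis using G_nonoverlap[OF S k tri H T] G_nonoverlap[OF S k tri2 H2(1) T]
      G_nonoverlap[OF S k tri3 H2(2) T] by linarith
qed

lemma tri_sets:
  assumes S: "S \<subseteq> V" and k: "0 < k" "2 * k + 4 \<le> card S"
    and tri: "tri S k p q r wp ap wq aq wr ar" and T: "T = S - {p, q, r}"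
  shows "fst_set T k (ap + 1) \<inter> fst_set T k (wp + 2 * N) = {}"
    "fst_set T k (aq + 1) \<inter> fst_set T k (wq + 2 * N) = {}"
    "fst_set T k (ar + 1) \<inter> fst_set T k wr = {}"
proof -
  note B = tri_basic[OF S k tri refl T] and A = tri_arcs[OF S k tri refl T]
  show "fst_set T k (ap + 1) \<inter> fst_set T k (wp + 2 * N) = {}"
    "fst_set T k (aq + 1) \<inter> fst_set T k (wq + 2 * N) = {}"
    using arcD(10)[OF A(1) B(4)] arcD(10)[OF A(2) B(4)] by auto
  show "fst_set T k (ar + 1) \<inter> fst_set T k wr = {}"
    using arcD(10)[OF A(3) B(4)] fst_set_flip2[OF B(1), of k wr] by simp
qed

text \<open>If two neighbouring arcs are disjoint, \<open>k\<close> events are gained, which is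
  enough because \<open>card S - 3\<close> is at least \<open>2 * k\<close>. Otherwise the changes
  of the prefix on the three stretches are added up.\<close>

lemma G_low_ge:
  assumes S: "S \<subseteq> V" and k: "0 < k" "2 * k + 4 \<le> card S"
    and tri: "tri S k p q r wp ap wq aq wr ar" and H: "H = {p, q, r}" and T: "T = S - H"
  shows "3 * k - (card S - 3) \<le> G_low T k H"
proof -
  note B = tri_basic[OF S k tri H T]
  show ?thesis using tri_cases[OF S k tri H T]
  proof
    assume "k \<le> G_low T k H" then show ?thesis using k by linarith
  next
    assume "wq < ap \<and> wr < aq \<and> wp + 2 * N < ar"
    then have o: "wq < ap" "wr < aq" "wp + 2 * N < ar" by auto
    let ?F = "fst_set T k"
    have cF: "card (?F t) = k" for t by (rule card_fst_set) (use B in auto)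
    have sF: "?F t \<subseteq> T" for t unfolding fst_set_def by blast
    have T': "T = S - {p, q, r}" using T H by simp
    note D = tri_sets[OF S k tri T']
    have "3 * k \<le> card T + (card (?F wr - ?F (ap + 1)) + card (?F (wp + 2 * N) - ?F (aq + 1))
      + card (?F (wq + 2 * N) - ?F (ar + 1)))"
      by (rule card3_ge) (use D cF sF B(5) in auto)
    moreover have "card (?F wr - ?F (ap + 1)) \<le> card {t \<in> {ap + 1..<wr}. ev T k t}"
      by (rule fst_set_diff_le[OF B(1)]) (use B(17) in auto)
    moreover have "card (?F (wp + 2 * N) - ?F (aq + 1)) \<le> card {t \<in> {aq + 1..<wp + 2 * N}. ev T k t}"
      by (rule fst_set_diff_le[OF B(1)]) (use B(18) in auto)
    moreover have "card (?F (wq + 2 * N) - ?F (ar + 1)) \<le> card {t \<in> {ar + 1..<wq + 2 * N}. ev T k t}"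
      by (rule fst_set_diff_le[OF B(1)]) (use B(19) in auto)
    ultimately show ?thesis using tri_overlap_pieces[OF S k tri H T o] B(3) by linarith
  qed
qed

lemma tri_removal:
  assumes S: "S \<subseteq> V" and k: "0 < k" "2 * k + 4 \<le> card S"
    and tri: "tri S k p q r wp ap wq aq wr ar" and H: "H = {p, q, r}" and T: "T = S - H"
  shows "6 * k + 3 + A_le T (k - 1) + G_low T k H \<le> A_le S (k + 1)"
  unfolding T
proof (rule removal[OF S H])
  note B = tri_basic[OF S k tri H T]
  show "H \<subseteq> S" using B by blast
  show "distinct [p, q, r]" using B by simp
  show "\<exists>e. \<forall>x\<in>S - {v}. bef e v x" if "v \<in> H" for v
    using tri that H unfolding tri_def by blast
  show "2 * k + 2 < card S" using k by simp
  show "low (S - H) k H t \<le> 2" for t using low_le2[OF S k tri H T] T by simp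
qed

text \<open>The recursion removes three extremal tokens. The last summand uses truncated subtraction on purpose: it is
the extra contribution that appears only beyond a third of the points.\<close>

fun A_bound :: "nat \<Rightarrow> nat \<Rightarrow> nat" where
  "A_bound n 0 = 0"
| "A_bound n (Suc k) = 6 * k + 3 + A_bound (n - 3) (k - 1) + (3 * k - (n - 3))"

lemma A_le_1:
  assumes S: "S \<subseteq> V" and n: "4 \<le> card S"
  shows "3 \<le> A_le S 1"
proof -
  obtain p q r xp yp xq yq xr yr where h: "half_arc S p xp yp" "half_arc S q xq yq" "half_arc S r xr yr" "distinct [p, q, r]"
    by (rule harc_triple[OF S n])
  have "6 * 0 + 3 + A_le (S - {p, q, r}) (0 - 1) + G_low (S - {p, q, r}) 0 {p, q, r} \<le> A_le S (0 + 1)"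
  proof (rule removal[OF S refl])
    show "{p, q, r} \<subseteq> S" using h harcD(1)[OF _ S] by auto
    show "\<exists>e. \<forall>x\<in>S - {v}. bef e v x" if "v \<in> {p, q, r}" for v
      using that h unfolding half_arc_def by blast
    show "low (S - {p, q, r}) 0 {p, q, r} t \<le> 2" for t unfolding low_def by simp
  qed (use n h in auto)
  then show ?thesis by simp
qed

text \<open>The size hypothesis survives the recursion, in which \<open>K\<close> drops by 2 and the
  number of tokens by 3.\<close>

lemma A_lower:
  assumes "S \<subseteq> V" "2 * K + 2 \<le> card S"
  shows "A_bound (card S) K \<le> A_le S K"
  using assms
proof (induction "card S" K arbitrary: S rule: A_bound.induct)
  case (1 S)
  then show ?case by simp
next
  case (2 k S)
  show ?case
  proof (cases "k = 0")
    case True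
    then show ?thesis using A_le_1[of S] 2 by simp
  next
    case False
    then have k: "0 < k" "2 * k + 4 \<le> card S" using 2 by auto
    obtain p q r wp ap wq aq wr ar where t: "tri S k p q r wp ap wq aq wr ar"
      by (rule tri_ex[OF 2(2) k])
    define H where "H = {p, q, r}"
    define T where "T = S - H"
    note B = tri_basic[OF 2(2) k t H_def T_def]
    have "A_bound (card T) (k - 1) \<le> A_le T (k - 1)"
      using 2(1)[of T] B k by auto
    then show ?thesis using tri_removal[OF 2(2) k t H_def T_def] G_low_ge[OF 2(2) k t H_def T_def] B(3)
      by simp
  qed
qed

section \<open>Three consecutive classes forced by tightness\<close>

definition layered :: "int \<Rightarrow> 'a set \<Rightarrow> 'a set \<Rightarrow> 'a set \<Rightarrow> bool" where
  "layered t A B C \<longleftrightarrow> (\<forall>a\<in>A. \<forall>b\<in>B. bef t a b) \<and> (\<forall>b\<in>B. \<forall>c\<in>C. bef t b c) \<and> (\<forall>a\<in>A. \<forall>c\<in>C. bef t a c)"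

lemma dec_flip:
  assumes "A \<subseteq> V" "B \<subseteq> V" "C \<subseteq> V"
  shows "layered (t + N) A B C \<longleftrightarrow> layered t C B A" "layered (t - N) A B C \<longleftrightarrow> layered t C B A"
proof -
  have "bef (t + N) x y \<longleftrightarrow> bef t y x" "bef (t - N) x y \<longleftrightarrow> bef t y x" if "x \<in> V" "y \<in> V" for x y
    using flip flipm that by auto
  then show "layered (t + N) A B C \<longleftrightarrow> layered t C B A" "layered (t - N) A B C \<longleftrightarrow> layered t C B A"
    unfolding layered_def using assms by (meson subsetD)+
qed

lemma fst_set_eqI:
  assumes S: "S \<subseteq> V" and Z: "Z \<subseteq> S" and b: "\<And>z y. z \<in> Z \<Longrightarrow> y \<in> S - Z \<Longrightarrow> bef t z y"
  shows "fst_set S (card Z) t = Z"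
proof -
  have fZ: "finite Z" using Z fin_sub[OF S] finite_subset by blast
  have "cnt S t x < card Z" if x: "x \<in> Z" for x
  proof -
    have "{y \<in> S. bef t y x} \<subset> Z" using b[OF x] asym irr x Z S by blast
    then show ?thesis unfolding cnt_def using fZ by (simp add: psubset_card_mono)
  qed
  moreover have "\<not> cnt S t x < card Z" if x: "x \<in> S - Z" for x
  proof -
    have "Z \<subseteq> {y \<in> S. bef t y x}" using b[OF _ x] Z by blast
    then have "card Z \<le> cnt S t x" unfolding cnt_def using fin_sub[OF S] by (intro card_mono) auto
    then show ?thesis by simp
  qed
  ultimately show ?thesis unfolding fst_set_def using Z by blast
qed

text \<open>A token with fewer than \<open>k\<close> tokens of \<open>T\<close> in front precedes
  every token with at least \<open>k\<close>, and \<open>q\<close> is the only removed token of the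
  first kind.\<close>

lemma first_block:
  assumes S: "S \<subseteq> V" and H: "H = {p, q, r}" "H \<subseteq> S" and T: "T = S - H"
    and c: "cnt T t q < k" "k \<le> cnt T t p" "k \<le> cnt T t r" "k \<le> card T"
  shows "\<And>z y. z \<in> insert q (fst_set T k t) \<Longrightarrow> y \<in> S - insert q (fst_set T k t) \<Longrightarrow> bef t z y"
proof -
  have TV: "T \<subseteq> V" using S T by auto
  have HV: "p \<in> V" "q \<in> V" "r \<in> V" using S H by auto
  fix z y assume zy: "z \<in> insert q (fst_set T k t)" "y \<in> S - insert q (fst_set T k t)"
  have ck: "cnt T t z < k" using zy(1) c(1) unfolding fst_set_def by auto
  have cy: "k \<le> cnt T t y"
  proof (cases "y \<in> T")
    case True then show ?thesis using zy(2) unfolding fst_set_def by auto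
  next
    case False then show ?thesis using zy(2) c T H by auto
  qed
  have V: "z \<in> V" "y \<in> V" using zy S HV TV unfolding fst_set_def by auto
  show "bef t z y"
  proof (rule ccontr)
    assume "\<not> bef t z y"
    moreover have "z \<noteq> y" using zy by auto
    ultimately have "bef t y z" using not_bef V by blast
    then have "cnt T t y \<le> cnt T t z" using cnt_le[OF TV V(2,1)] by blast
    then show False using ck cy by simp
  qed
qed

text \<open>Just after the arc of \<open>p\<close> only \<open>q\<close> is low, so \<open>q\<close>
  leads together with the prefix \<open>X1\<close>. Half a turn later only \<open>r\<close> is low
  and leads together with \<open>X2\<close>; undoing the half turn puts this block at the end. The
  remaining tokens form the middle layer.\<close>

lemma tri_dec:
  assumes S: "S \<subseteq> V" and k: "0 < k" "2 * k + 4 \<le> card S"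
    and tri: "tri S k p q r wp ap wq aq wr ar" and H: "H = {p, q, r}" and T: "T = S - H"
    and o: "wq < ap" "wr < aq" "wp + 2 * N < ar"
    and const: "\<And>t. aq < t \<Longrightarrow> t \<le> wp + 2 * N \<Longrightarrow> fst_set T k t = X2" and X1: "X1 = fst_set T k (ap + 1)"
  shows "layered (ap + 1) (insert q X1) (S - insert q X1 - insert r X2) (insert r X2)" "ap < aq" "aq < ap + N"
proof -
  note B = tri_basic[OF S k tri H T] and A = tri_arcs[OF S k tri H T]
  note hi = tri_hi[OF S k tri H T]
  have len: "ap < wp + N" "aq < wq + N" "ar < wr + N" using arcD(9)[OF A(1) B(4)] arcD(9)[OF A(2) B(4)] arcD(9)[OF A(3) B(4)] by auto
  show "ap < aq" using o B(17) by simp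
  show "aq < ap + N" using o len by simp
  have f1: "bef (ap + 1) z y" if "z \<in> insert q X1" "y \<in> S - insert q X1" for z y
  proof (rule first_block[OF S H B(2) T])
    show "cnt T (ap + 1) q < k" using arcD(5)[OF A(2), of "ap + 1"] o B(17) by simp
    show "k \<le> cnt T (ap + 1) p" using arcD(7)[OF A(1)] by simp
    show "k \<le> cnt T (ap + 1) r" using hi(6)[of "ap + 1"] o B(17,19) by simp
    show "k \<le> card T" using B(4) by simp
  qed (use that X1 in auto)
  \<comment> \<open>The reflected moment has to fall into the stretch on which the prefix is
    constantly \<open>X2\<close>; the overlap of the arcs and the bound on their length ensure
    this.\<close>
  have tr: "aq < ap + 1 + N" "ap + 1 + N \<le> wp + 2 * N" using o len by auto
  have H2: "H = {q, r, p}" using H by auto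
  have f2: "bef (ap + 1 + N) z y" if "z \<in> insert r X2" "y \<in> S - insert r X2" for z y
  proof (rule first_block[OF S H2 B(2) T])
    show "cnt T (ap + 1 + N) r < k" using arcD(5)[OF A(3), of "ap + 1 + N"] o B(17,18) tr by simp
    show "k \<le> cnt T (ap + 1 + N) q" using hi(2)[of "ap + 1 + N"] tr B o by simp
    show "k \<le> cnt T (ap + 1 + N) p" using hi(1)[of "ap + 1 + N"] tr N_pos by simp
    show "k \<le> card T" using B(4) by simp
    show "z \<in> insert r (fst_set T k (ap + 1 + N))" "y \<in> S - insert r (fst_set T k (ap + 1 + N))"
      using that const[OF tr] by auto
  qed
  have f2': "bef (ap + 1) y z" if "z \<in> insert r X2" "y \<in> S - insert r X2" for z y
  proof -
    have "X2 \<subseteq> T" using const[OF tr] unfolding fst_set_def by blast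
    then have "z \<in> V" "y \<in> V" using that B S by auto
    then show ?thesis using f2[OF that] flip[of z y "ap + 1"] by (simp add: algebra_simps)
  qed
  have X: "X1 \<subseteq> T" "X2 \<subseteq> T" using const[OF tr] X1 unfolding fst_set_def by blast+
  have HS: "q \<in> S" "r \<in> S" using B(2) H by auto
  have "a \<in> S - insert r X2" if "a \<in> insert q X1" for a
  proof -
    have "a \<in> S" using that X HS T by auto
    moreover have "a \<notin> insert r X2"
    proof
      assume a: "a \<in> insert r X2"
      \<comment> \<open>The two blocks have at most \<open>2 * k + 2\<close> tokens, fewer than
        \<open>S\<close>. A token common to both would have to be before and after any token outside
        both.\<close>
      obtain y where y: "y \<in> S - (insert q X1 \<union> insert r X2)"
      proof -
        have "card (insert q X1 \<union> insert r X2) \<le> card (insert q X1) + card (insert r X2)" by (rule card_Un_le)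
        moreover have "finite X1" "finite X2" using X B(5) finite_subset by blast+
        moreover have "card X1 = k" "card X2 = k" using X1 const[OF tr] card_fst_set[OF B(1), of k] B(4) by auto
        moreover have "card (insert q X1) \<le> Suc (card X1)" "card (insert r X2) \<le> Suc (card X2)"
          by (rule card_insert_le_m1; simp)+
        ultimately have "card (insert q X1 \<union> insert r X2) \<le> 2 * k + 2" by linarith
        then have "\<not> S \<subseteq> insert q X1 \<union> insert r X2" using k(2) card_mono[of "insert q X1 \<union> insert r X2" S]
            \<open>finite X1\<close> \<open>finite X2\<close> by auto
        then show thesis using that by blast
      qed
      have "bef (ap + 1) a y" using f1[OF that] y by blast
      moreover have "bef (ap + 1) y a" using f2'[OF a] y by blast
      ultimately show False using asym[of a y] y \<open>a \<in> S\<close> S by blast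
    qed
    ultimately show ?thesis by blast
  qed
  note sub = this
  show "layered (ap + 1) (insert q X1) (S - insert q X1 - insert r X2) (insert r X2)"
    unfolding layered_def using f1 f2' sub by blast
qed

text \<open>No room is left for \<open>G_low\<close>. So all neighbouring arcs overlap and no
  level-\<open>k\<close> event happens on the three stretches between them. The prefixes are
  constant there, and as three disjoint \<open>k\<close>-sets they partition \<open>T\<close>; each
  forms a class together with one extremal token.\<close>

lemma tight_dec:
  assumes n: "card V = 3 * k + 3" and k: "1 < k" and tight: "A_le V (k + 1) \<le> 6 * k + 3 + A_bound (3 * k) (k - 1)"
  obtains P Q R s1 s2 s3 where "P \<union> Q \<union> R = V" "P \<inter> Q = {}" "P \<inter> R = {}" "Q \<inter> R = {}"
    "card P = k + 1" "card Q = k + 1" "card R = k + 1"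
    "s1 \<le> s2" "s2 < s3" "s3 < s1 + N" "layered s1 Q P R" "layered s2 Q R P" "layered s3 R Q P"
proof -
  have S: "V \<subseteq> V" by simp
  have k': "0 < k" "2 * k + 4 \<le> card V" using n k by auto
  obtain p q r wp ap wq aq wr ar where t: "tri V k p q r wp ap wq aq wr ar"
    by (rule tri_ex[OF S k'])
  define H where "H = {p, q, r}"
  define T where "T = V - H"
  have T': "T = V - {p, q, r}" using T_def H_def by simp
  note B = tri_basic[OF S k' t H_def T_def] and A = tri_arcs[OF S k' t H_def T_def]
  have cT: "card T = 3 * k" using B(3) n by simp
  have "A_bound (card T) (k - 1) \<le> A_le T (k - 1)" by (rule A_lower[OF B(1)]) (use cT k in auto)
  then have G0: "G_low T k H = 0" using tri_removal[OF S k' t H_def T_def] tight cT by simp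
  then have o: "wq < ap" "wr < aq" "wp + 2 * N < ar" using tri_cases[OF S k' t H_def T_def] k by auto
  let ?F = "fst_set T k"
  have cF: "card (?F t) = k" for t by (rule card_fst_set) (use B in auto)
  have sF: "?F t \<subseteq> T" for t unfolding fst_set_def by blast
  have fF: "finite (?F t)" for t using sF B(5) finite_subset by blast
  have const: "?F t = ?F a" if z: "card {t \<in> {a..<b}. ev T k t} = 0" "a \<le> t" "t \<le> b" for a b t
  proof -
    have "card (?F t - ?F a) \<le> card {s \<in> {a..<t}. ev T k s}" by (rule fst_set_diff_le[OF B(1) that(2)])
    also have "\<dots> \<le> card {s \<in> {a..<b}. ev T k s}" by (rule card_mono) (use that in auto)
    finally have "card (?F t - ?F a) = 0" by (simp only: z(1) le_zero_eq)
    then have "?F t - ?F a = {}" using fF[of t] by (simp only: card_eq_0_iff finite_Diff simp_thms)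
    then show ?thesis using card_subset_eq[OF fF[of a], of "?F t"] cF[of t] cF[of a] by auto
  qed
  note pieces = tri_overlap_pieces[OF S k' t H_def T_def o]
  define X1 where "X1 = ?F (ap + 1)"
  define X2 where "X2 = ?F (aq + 1)"
  define X3 where "X3 = ?F (ar + 1)"
  have c1: "?F t = X1" if "ap < t" "t \<le> wr" for t
    unfolding X1_def by (rule const[of "ap + 1" wr]) (use pieces G0 that in auto)
  have c2: "?F t = X2" if "aq < t" "t \<le> wp + 2 * N" for t
    unfolding X2_def by (rule const[of "aq + 1" "wp + 2 * N"]) (use pieces G0 that in auto)
  have c3: "?F t = X3" if "ar < t" "t \<le> wq + 2 * N" for t
    unfolding X3_def by (rule const[of "ar + 1" "wq + 2 * N"]) (use pieces G0 that in auto)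
  have dis: "X1 \<inter> X2 = {}" "X2 \<inter> X3 = {}" "X3 \<inter> X1 = {}"
    using tri_sets[OF S k' t T'] c1[of wr] c2[of "wp + 2 * N"] c3[of "wq + 2 * N"] B(17-19) X1_def X2_def X3_def by auto
  have XT: "X1 \<subseteq> T" "X2 \<subseteq> T" "X3 \<subseteq> T" using sF X1_def X2_def X3_def by auto
  have cX: "card X1 = k" "card X2 = k" "card X3 = k" using cF X1_def X2_def X3_def by auto
  have fX: "finite X1" "finite X2" "finite X3" using fF X1_def X2_def X3_def by auto
  have "card (X1 \<union> X2 \<union> X3) = 3 * k" using dis cX fX
    by (subst card_Un_disjoint, simp, simp, blast, subst card_Un_disjoint) auto
  then have XU: "X1 \<union> X2 \<union> X3 = T" using XT B(5) cT by (intro card_subset_eq) auto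
  define Q where "Q = insert q X1"
  define R where "R = insert r X2"
  define P where "P = insert p X3"
  have HV: "p \<in> V" "q \<in> V" "r \<in> V" using B by auto
  have part: "P \<union> Q \<union> R = V" using XU T' HV unfolding P_def Q_def R_def by auto
  have pd: "P \<inter> Q = {}" "P \<inter> R = {}" "Q \<inter> R = {}"
    using dis XT B(9-14) unfolding P_def Q_def R_def by blast+
  have cc: "card P = k + 1" "card Q = k + 1" "card R = k + 1"
    using cX fX XT B(9-11) unfolding P_def Q_def R_def by (auto simp: card_insert_if)
  have rest: "V - Q - R = P" "V - R - P = Q" "V - P - Q = R" using part pd by auto
  have tri2: "tri V k q r p wq aq wr ar (wp + 2 * N) (ap + 2 * N)" by (rule tri_rot[OF S t])
  have tri3: "tri V k r p q wr ar (wp + 2 * N) (ap + 2 * N) (wq + 2 * N) (aq + 2 * N)" by (rule tri_rot[OF S tri2])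
  have H2: "H = {q, r, p}" "H = {r, p, q}" using H_def by auto
  have F2: "?F t = ?F (t - 2 * N)" for t using fst_set_flip2[OF B(1), of k "t - 2 * N"] by simp
  have d1: "layered (ap + 1) Q P R" and e1: "ap < aq" "aq < ap + N"
    using tri_dec[OF S k' t H_def T_def o c2 X1_def] rest unfolding Q_def R_def by auto
  have d2: "layered (aq + 1) R Q P" and e2: "aq < ar" "ar < aq + N"
    using tri_dec[OF S k' tri2 H2(1) T_def _ _ _ c3 X2_def] o rest unfolding P_def R_def by auto
  have c1': "?F t = X1" if "ap + 2 * N < t" "t \<le> wr + 2 * N" for t
    using c1[of "t - 2 * N"] F2[of t] that by simp
  have d3: "layered (ar + 1) P R Q" and e3: "ar < ap + 2 * N" "ap + 2 * N < ar + N"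
    using tri_dec[OF S k' tri3 H2(2) T_def _ _ _ c1' X3_def] o rest unfolding P_def Q_def by auto
  have sub: "P \<subseteq> V" "Q \<subseteq> V" "R \<subseteq> V" using part by auto
  \<comment> \<open>The second rotation gives its layering too late. Going back by \<open>N\<close>
    reverses it and brings the three moments into one half turn.\<close>
  have d3': "layered (ar + 1 - N) Q R P" using d3 dec_flip(2)[OF sub(2,3,1), of "ar + 1"] by blast
  show thesis
    by (rule that[OF part pd cc _ _ _ d1 d3' d2]) (use e1 e2 e3 in auto)
qed

end

section \<open>Swaps within half a period\<close>

text \<open>Vertex \<open>i\<close> has at most \<open>9 - i\<close> successors, and at most
  \<open>i + c\<close> because it has at most \<open>i\<close> predecessors. Using the second bound
  for \<open>i <= 2\<close> and the first one otherwise gives \<open>24 + 3 * c\<close>. At equality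
  every out-degree is known; for \<open>c = 3\<close> both bounds agree at \<open>i = 3\<close>, so
  that the in-degrees of 1, 2 and 3 are maximal as well.\<close>

lemma digraph_bound:
  fixes E :: "(nat \<times> nat) set"
  assumes E: "\<And>i j. (i, j) \<in> E \<Longrightarrow> i < j \<and> j < 10"
    and deg: "\<And>i. i < 10 \<Longrightarrow> card {k. (i, k) \<in> E} \<le> card {k. (k, i) \<in> E} + c"
  shows "c = 5 \<Longrightarrow> card E \<le> 39" "c = 3 \<Longrightarrow> card E \<le> 33"
    "c = 5 \<Longrightarrow> card E = 39 \<Longrightarrow> card {k. (0, k) \<in> E} = 5 \<and> card {k. (1, k) \<in> E} = 6 \<and>
       card {k. (2, k) \<in> E} = 7 \<and> (\<forall>i. 3 \<le> i \<and> i < 10 \<longrightarrow> card {k. (i, k) \<in> E} = 9 - i)"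
    "c = 3 \<Longrightarrow> card E = 33 \<Longrightarrow> card {k. (0, k) \<in> E} = 3 \<and> card {k. (1, k) \<in> E} = 4 \<and>
       card {k. (2, k) \<in> E} = 5 \<and> (\<forall>i. 3 \<le> i \<and> i < 10 \<longrightarrow> card {k. (i, k) \<in> E} = 9 - i) \<and>
       card {k. (k, 1) \<in> E} = 1 \<and> card {k. (k, 2) \<in> E} = 2 \<and> card {k. (k, 3) \<in> E} = 3"
proof -
  define o' where "o' i = card {k. (i, k) \<in> E}" for i
  define n' where "n' i = card {k. (k, i) \<in> E}" for i
  have oub: "o' i \<le> 9 - i" for i
  proof -
    have "o' i \<le> card {i + 1..<10}" unfolding o'_def by (rule card_mono) (auto dest: E)
    then show ?thesis by simp
  qed
  have nub: "n' i \<le> i" for i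
  proof -
    have "n' i \<le> card {..<i}" unfolding n'_def by (rule card_mono) (auto dest: E)
    then show ?thesis by simp
  qed
  have fin: "finite {k. (i, k) \<in> E}" for i by (rule finite_subset[of _ "{..<10}"]) (auto dest: E)
  have "E = (SIGMA i:{..<10}. {k. (i, k) \<in> E})" by (auto dest: E)
  then have "card E = card (SIGMA i:{..<10::nat}. {k. (i, k) \<in> E})" by simp
  also have "\<dots> = (\<Sum>i<10. o' i)" unfolding o'_def by (rule card_SigmaI) (use fin in auto)
  also have "\<dots> = o' 0 + o' 1 + o' 2 + o' 3 + o' 4 + o' 5 + o' 6 + o' 7 + o' 8 + o' 9"
    by (simp add: eval_nat_numeral)
  finally have cE: "card E = o' 0 + o' 1 + o' 2 + o' 3 + o' 4 + o' 5 + o' 6 + o' 7 + o' 8 + o' 9" .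
  have dg: "o' i \<le> n' i + c" if "i < 10" for i using deg[OF that] unfolding o'_def n'_def .
  have hi: "o' 3 \<le> 6" "o' 4 \<le> 5" "o' 5 \<le> 4" "o' 6 \<le> 3" "o' 7 \<le> 2" "o' 8 \<le> 1" "o' 9 \<le> 0"
    using oub[of 3] oub[of 4] oub[of 5] oub[of 6] oub[of 7] oub[of 8] oub[of 9] by simp_all
  have lo: "o' 0 \<le> c" "o' 1 \<le> 1 + c" "o' 2 \<le> 2 + c"
    using dg[of 0] dg[of 1] dg[of 2] nub[of 0] nub[of 1] nub[of 2] by simp_all
  show "c = 5 \<Longrightarrow> card E \<le> 39" "c = 3 \<Longrightarrow> card E \<le> 33" using cE hi lo by simp_all
  have split: "i = 3 \<or> i = 4 \<or> i = 5 \<or> i = 6 \<or> i = 7 \<or> i = 8 \<or> i = 9" if "3 \<le> i \<and> i < 10" for i :: nat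
    using that by linarith
  have eq: "o' 0 = c \<and> o' 1 = 1 + c \<and> o' 2 = 2 + c \<and> (\<forall>i. 3 \<le> i \<and> i < 10 \<longrightarrow> o' i = 9 - i)"
    if h: "card E = 24 + 3 * c"
  proof -
    have l: "o' 0 = c" "o' 1 = 1 + c" "o' 2 = 2 + c" using cE h lo hi by linarith+
    have u: "o' 3 = 6" "o' 4 = 5" "o' 5 = 4" "o' 6 = 3" "o' 7 = 2" "o' 8 = 1" "o' 9 = 0"
      using cE h lo hi by linarith+
    have "o' i = 9 - i" if "3 \<le> i \<and> i < 10" for i using split[OF that] u by auto
    then show ?thesis using l by blast
  qed
  show "card {k. (0, k) \<in> E} = 5 \<and> card {k. (1, k) \<in> E} = 6 \<and>
       card {k. (2, k) \<in> E} = 7 \<and> (\<forall>i. 3 \<le> i \<and> i < 10 \<longrightarrow> card {k. (i, k) \<in> E} = 9 - i)"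
    if h: "c = 5" "card E = 39"
    using eq h unfolding o'_def by simp
  show "card {k. (0, k) \<in> E} = 3 \<and> card {k. (1, k) \<in> E} = 4 \<and>
       card {k. (2, k) \<in> E} = 5 \<and> (\<forall>i. 3 \<le> i \<and> i < 10 \<longrightarrow> card {k. (i, k) \<in> E} = 9 - i) \<and>
       card {k. (k, 1) \<in> E} = 1 \<and> card {k. (k, 2) \<in> E} = 2 \<and> card {k. (k, 3) \<in> E} = 3"
    if h: "c = 3" "card E = 33"
  proof -
    have e: "o' 0 = 3" "o' 1 = 4" "o' 2 = 5" "\<forall>i. 3 \<le> i \<and> i < 10 \<longrightarrow> o' i = 9 - i" using eq h by simp_all
    have "o' 3 = 6" using e(4) by auto
    then have "n' 1 = 1" "n' 2 = 2" "n' 3 = 3"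
      using e dg[of 1] dg[of 2] dg[of 3] nub[of 1] nub[of 2] nub[of 3] h by simp_all
    then show ?thesis using e unfolding o'_def n'_def by simp
  qed
qed

context circular_seq
begin

lemma card_half_period:
  assumes "\<And>t. P (t + N) \<longleftrightarrow> P t"
  shows "card {t \<in> {a..<a + N}. P t} = card {t \<in> {b..<b + N}. P t}"
  by (rule card_period) (use assms N_pos in auto)

lemma swp_unique_half:
  assumes "swp t p q" "swp t' p q \<or> swp t' q p" "t \<in> {u..<u + N}" "t' \<in> {u..<u + N}"
  shows "t = t'"
proof (rule ccontr)
  assume "t \<noteq> t'"
  then consider "t < t'" | "t' < t" by linarith
  then show False
  proof cases
    case 1 then show False using swp_next[OF assms(1) 1] assms by auto
  next
    case 2 then show False using swp_next[of t' p q t] swp_next[of t' q p t] assms by auto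
  qed
qed

lemma pair_count: "card {t \<in> {u..<u + N}. \<exists>p q. swp t p q} = card V choose 2"
proof -
  let ?E = "{e. e \<subseteq> V \<and> card e = 2}"
  have ex: "\<exists>t. t \<in> {u..<u + N} \<and> (\<exists>p q. swp t p q \<and> e = {p, q})" if eE: "e \<in> ?E" for e
  proof -
    obtain p q where e: "e = {p, q}" "p \<noteq> q" using eE unfolding card_2_iff by blast
    have pq: "p \<in> V" "q \<in> V" using eE e by auto
    consider "bef u p q" | "bef u q p" using tot[OF pq e(2)] by blast
    then show ?thesis
    proof cases
      case 1
      obtain s where s: "u \<le> s" "s < u + N" "swp s p q" by (rule swap_time[OF pq 1])
      show ?thesis using s(3) e(1) by (intro exI[of _ s] conjI exI[of _ p] exI[of _ q]) (simp_all add: s(1,2))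
    next
      case 2
      obtain s where s: "u \<le> s" "s < u + N" "swp s q p" by (rule swap_time[OF pq(2,1) 2])
      show ?thesis using s(3) e(1) by (intro exI[of _ s] conjI exI[of _ q] exI[of _ p]) (auto simp: s(1,2))
    qed
  qed
  define f where "f e = (SOME t. t \<in> {u..<u + N} \<and> (\<exists>p q. swp t p q \<and> e = {p, q}))" for e
  have f: "f e \<in> {u..<u + N} \<and> (\<exists>p q. swp (f e) p q \<and> e = {p, q})" if "e \<in> ?E" for e
    unfolding f_def by (rule someI_ex[OF ex[OF that]])
  have inj: "inj_on f ?E"
  proof (rule inj_onI)
    fix d e assume de: "d \<in> ?E" "e \<in> ?E" "f d = f e"
    obtain p q where pq: "swp (f d) p q" "d = {p, q}" using f[OF de(1)] by blast
    obtain x y where xy: "swp (f d) x y" "e = {x, y}" using f[OF de(2)] de(3) by auto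
    show "d = e" using one[OF pq(1) xy(1)] pq xy by simp
  qed
  have im: "f ` ?E = {t \<in> {u..<u + N}. \<exists>p q. swp t p q}"
  proof
    show "f ` ?E \<subseteq> {t \<in> {u..<u + N}. \<exists>p q. swp t p q}" using f by blast
    show "{t \<in> {u..<u + N}. \<exists>p q. swp t p q} \<subseteq> f ` ?E"
    proof
      fix t assume "t \<in> {t \<in> {u..<u + N}. \<exists>p q. swp t p q}"
      then obtain p q where t: "t \<in> {u..<u + N}" "swp t p q" by blast
      have e: "{p, q} \<in> ?E" using swpD(1,2)[OF t(2)] swp_neq[OF t(2)] by simp
      obtain x y where xy: "swp (f {p, q}) x y" "{p, q} = {x, y}" using f[OF e] by blast
      have "p = x \<and> q = y \<or> p = y \<and> q = x" using xy(2) by (simp add: doubleton_eq_iff)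
      then have "swp (f {p, q}) p q \<or> swp (f {p, q}) q p" using xy(1) by blast
      then have "t = f {p, q}" using swp_unique_half[OF t(2)] t(1) f[OF e] by blast
      then show "t \<in> f ` ?E" using e by blast
    qed
  qed
  have "card {t \<in> {u..<u + N}. \<exists>p q. swp t p q} = card ?E" using card_image[OF inj] im by simp
  also have "\<dots> = card V choose 2" by (rule n_subsets[OF fin])
  finally show ?thesis .
qed

section \<open>Events at middle levels in a half period\<close>

definition mid :: "nat \<Rightarrow> int \<Rightarrow> bool" where
  "mid K t \<longleftrightarrow> (\<exists>j. K < j \<and> j < card V - K \<and> ev V j t)"

lemma mid_shift: "mid K (t + N) \<longleftrightarrow> mid K t"
proof -
  have *: "mid K t \<Longrightarrow> mid K (t + N)" for t
  proof -
    assume "mid K t"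
    then obtain j where j: "K < j" "j < card V - K" "ev V j t" unfolding mid_def by blast
    have "ev V (card V - j) (t + N)" using ev_flip[of V "card V - j" t] j by simp
    then show "mid K (t + N)" unfolding mid_def using j by (intro exI[of _ "card V - j"]) auto
  qed
  have "mid K (t + N + N) \<longleftrightarrow> mid K t" unfolding mid_def using ev_flip2[of V _ t] by (simp add: algebra_simps)
  then show ?thesis using * by blast
qed

lemma ev_swp: "swp t p q \<Longrightarrow> ev V (cnt V t q) t"
  unfolding ev_def using swpD(1,2) by blast

text \<open>A half turn maps low levels to high ones, so the low events of a full period are as many
  as the low and high events of a half period. Together with the middle events these exhaust all
  pairs, each of which is exchanged once.\<close>

lemma A_le_mid:
  assumes K: "2 * K < card V"
  shows "A_le V K + card {t \<in> {u..<u + N}. mid K t} = card V choose 2"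
proof -
  define L where "L t \<longleftrightarrow> (\<exists>j\<le>K. ev V j t)" for t
  define U where "U t \<longleftrightarrow> (\<exists>j\<ge>card V - K. ev V j t)" for t
  have LN: "L (t + N) \<longleftrightarrow> U t" for t
  proof
    assume "L (t + N)"
    then obtain j where "j \<le> K" "ev V j (t + N)" unfolding L_def by blast
    then have "ev V (card V - j) t" "card V - K \<le> card V - j" using ev_flip[of V j t] by auto
    then show "U t" unfolding U_def by blast
  next
    assume "U t"
    then obtain j where j: "card V - K \<le> j" "ev V j t" unfolding U_def by blast
    have "0 < j" "j < card V" using ev_bounds[OF subset_refl j(2)] by auto
    then have "ev V (card V - j) (t + N)" "card V - j \<le> K" using ev_flip[of V "card V - j" t] j by auto
    then show "L (t + N)" unfolding L_def by blast
  qed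
  have L2: "L (t + 2 * N) \<longleftrightarrow> L t" for t unfolding L_def using ev_flip2[of V] by simp
  have "A_le V K = card {t \<in> {u..<u + 2 * N}. L t}"
    unfolding A_le_def L_def[symmetric] using card_period[of L, OF L2, of 0 u] N_pos by simp
  also have "{t \<in> {u..<u + 2 * N}. L t} = {t \<in> {u..<u + N}. L t} \<union> (\<lambda>t. t + N) ` {t \<in> {u..<u + N}. U t}"
  proof -
    have "t \<in> (\<lambda>t. t + N) ` {t \<in> {u..<u + N}. U t}" if "L t" "u + N \<le> t" "t < u + 2 * N" for t
      using that LN[of "t - N"] by (intro image_eqI[of _ _ "t - N"]) auto
    then show ?thesis using LN N_pos by force
  qed
  also have "card \<dots> = card {t \<in> {u..<u + N}. L t} + card {t \<in> {u..<u + N}. U t}"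
    by (subst card_Un_disjoint) (auto simp: card_image inj_on_def)
  finally have A: "A_le V K = card {t \<in> {u..<u + N}. L t} + card {t \<in> {u..<u + N}. U t}" .
  have "{t \<in> {u..<u + N}. \<exists>p q. swp t p q} = {t \<in> {u..<u + N}. L t} \<union> {t \<in> {u..<u + N}. U t} \<union> {t \<in> {u..<u + N}. mid K t}"
  proof -
    have "(\<exists>p q. swp t p q) \<longleftrightarrow> L t \<or> U t \<or> mid K t" for t
    proof
      assume "\<exists>p q. swp t p q"
      then obtain j where "ev V j t" using ev_swp by blast
      then show "L t \<or> U t \<or> mid K t" unfolding L_def U_def mid_def by (meson not_le)
    qed (auto simp: L_def U_def mid_def ev_def)
    then show ?thesis by blast
  qed
  then have "card V choose 2 = card ({t \<in> {u..<u + N}. L t} \<union> {t \<in> {u..<u + N}. U t} \<union> {t \<in> {u..<u + N}. mid K t})"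
    using pair_count[of u] by simp
  also have "\<dots> = card {t \<in> {u..<u + N}. L t} + card {t \<in> {u..<u + N}. U t} + card {t \<in> {u..<u + N}. mid K t}"
  proof -
    have LU: "\<not> (L t \<and> U t)" for t
    proof
      assume "L t \<and> U t"
      then obtain i j where "i \<le> K" "ev V i t" "card V - K \<le> j" "ev V j t" unfolding L_def U_def by blast
      then show False using ev_unique[of V i t j] K by simp
    qed
    have LM: "\<not> (L t \<and> mid K t)" for t
    proof
      assume "L t \<and> mid K t"
      then obtain i j where "i \<le> K" "ev V i t" "K < j" "ev V j t" unfolding L_def mid_def by blast
      then show False using ev_unique[of V i t j] K by simp
    qed
    have UM: "\<not> (U t \<and> mid K t)" for t
    proof
      assume "U t \<and> mid K t"
      then obtain i j where "card V - K \<le> i" "ev V i t" "j < card V - K" "ev V j t" unfolding U_def mid_def by blast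
      then show False using ev_unique[of V i t j] K by simp
    qed
    have dj: "{t \<in> {u..<u + N}. L t} \<inter> {t \<in> {u..<u + N}. U t} = {}"
      "({t \<in> {u..<u + N}. L t} \<union> {t \<in> {u..<u + N}. U t}) \<inter> {t \<in> {u..<u + N}. mid K t} = {}"
      using LU LM UM by blast+
    show ?thesis by (subst card_Un_disjoint[OF _ _ dj(2)], simp, simp, subst card_Un_disjoint[OF _ _ dj(1)]) auto
  qed
  finally show ?thesis using A by simp
qed

text \<open>The indicator of \<open>j \<le> f t\<close> telescopes.\<close>

lemma cross_count:
  fixes f :: "int \<Rightarrow> nat"
  assumes "a \<le> b"
  shows "card {t \<in> {a..<b}. f t < j \<and> j \<le> f (t + 1)} + (if j \<le> f a then 1 else 0) =
    card {t \<in> {a..<b}. j \<le> f t \<and> f (t + 1) < j} + (if j \<le> f b then 1 else 0)"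
  using assms
proof (induction b rule: int_ge_induct)
  case (step b)
  have ins: "{t \<in> {a..<b + 1}. P t} = (if P b then insert b {t \<in> {a..<b}. P t} else {t \<in> {a..<b}. P t})" for P
    using step.hyps by (auto simp: order_le_less)
  have c: "card {t \<in> {a..<b + 1}. P t} = card {t \<in> {a..<b}. P t} + (if P b then 1 else 0)" for P
    unfolding ins by simp
  show ?case unfolding c using step.IH by auto
qed simp

end

section \<open>The blocks of a tight sequence\<close>

context circular_seq
begin

definition right_mover :: "int \<Rightarrow> 'a" where "right_mover t = (SOME p. \<exists>q. swp t p q)"
definition left_mover :: "int \<Rightarrow> 'a" where "left_mover t = (SOME q. \<exists>p. swp t p q)"

lemma mv: "swp t p q \<Longrightarrow> right_mover t = p" "swp t p q \<Longrightarrow> left_mover t = q"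
  unfolding right_mover_def left_mover_def using one by (blast intro: some_equality)+

lemma swp_half: "swp t x y \<Longrightarrow> u \<le> t \<Longrightarrow> t < u + N \<Longrightarrow> bef u x y"
proof (rule ccontr)
  assume a: "swp t x y" "u \<le> t" "t < u + N" "\<not> bef u x y"
  note D = swpD[OF a(1)]
  have "bef u y x" using a(4) not_bef[of x y u] D swp_neq[OF a(1)] by blast
  then have "bef (t + 1) x y" using bef_after[of y x u t "t + 1"] D a by auto
  then show False using asym D by blast
qed

lemma cnt_ge_1_swp: "swp t p q \<Longrightarrow> cnt V t q = cnt V t p + 1" "swp t p q \<Longrightarrow> cnt V (t + 1) p = cnt V t p + 1"
  "swp t p q \<Longrightarrow> cnt V (t + 1) q = cnt V t p"
  using cnt_step_adj[of t p q V] cnt_step_right[of t p q V] cnt_step_left[of t p q V] swpD(1,2)[of t p q] by simp_all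

lemma up_iff:
  assumes "v \<in> V"
  shows "cnt V t v < j \<and> j \<le> cnt V (t + 1) v \<longleftrightarrow> (\<exists>y. swp t v y \<and> cnt V t y = j)"
proof
  assume a: "cnt V t v < j \<and> j \<le> cnt V (t + 1) v"
  then show "\<exists>y. swp t v y \<and> cnt V t y = j" using swp_up[OF subset_refl assms, of t j] by blast
next
  assume "\<exists>y. swp t v y \<and> cnt V t y = j"
  then show "cnt V t v < j \<and> j \<le> cnt V (t + 1) v" using cnt_ge_1_swp by force
qed

lemma down_iff:
  assumes "v \<in> V"
  shows "j \<le> cnt V t v \<and> cnt V (t + 1) v < j \<longleftrightarrow> (\<exists>x. swp t x v \<and> cnt V t v = j)"
proof
  assume a: "j \<le> cnt V t v \<and> cnt V (t + 1) v < j"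
  then show "\<exists>x. swp t x v \<and> cnt V t v = j" using swp_down[OF subset_refl assms, of j t] by blast
next
  assume "\<exists>x. swp t x v \<and> cnt V t v = j"
  then show "j \<le> cnt V t v \<and> cnt V (t + 1) v < j" using cnt_ge_1_swp by force
qed

end

text \<open>In a tight sequence the points split into three classes that are consecutive at three times of a half
period. The locale looks at this from the class \<open>Z\<close>, which moves from the front at time \<open>u0\<close> to the
middle at time \<open>u1\<close> and to the end at time \<open>u0 + N\<close>.\<close>

locale block = circular_seq +
  fixes Z Y W :: "'a set" and u0 u1 :: int
  assumes cV: "card V = 30" and part: "V = Z \<union> Y \<union> W" "Z \<inter> Y = {}" "Z \<inter> W = {}" "Y \<inter> W = {}"
    and cZ: "card Z = 10" and cY: "card Y = 10" and cW: "card W = 10"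
    and first: "\<And>z x. z \<in> Z \<Longrightarrow> x \<in> Y \<union> W \<Longrightarrow> bef u0 z x"
    and dec1: "layered u1 Y Z W" and u01: "u0 \<le> u1" "u1 \<le> u0 + N"
begin

lemma ZV: "Z \<subseteq> V" "Y \<subseteq> V" "W \<subseteq> V" "V - Z = Y \<union> W" using part by auto

lemma idx_Z: "x \<in> V \<Longrightarrow> cnt V u0 x < 10 \<longleftrightarrow> x \<in> Z"
proof -
  assume x: "x \<in> V"
  have "fst_set V (card Z) u0 = Z" by (rule fst_set_eqI) (use ZV first in auto)
  then show ?thesis using x cZ unfolding fst_set_def by auto
qed

lemma last_Z: "z \<in> Z \<Longrightarrow> 20 \<le> cnt V (u0 + N) z"
  using cnt_flip_in[of V z u0] idx_Z[of z] ZV cV by auto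

lemma idx_inj: "x \<in> Z \<Longrightarrow> y \<in> Z \<Longrightarrow> cnt V u0 x = cnt V u0 y \<Longrightarrow> x = y"
  using cnt_inj[OF subset_refl, of u0] ZV(1) unfolding inj_on_def by blast

section \<open>Swaps of a class during its passage, inside the class and with the rest\<close>

definition I :: "int set" where "I = {u0..<u0 + N}"

lemma finI [simp]: "finite {t \<in> I. P t}" unfolding I_def by simp

text \<open>During the half turn from \<open>u0\<close> a pair is exchanged out of its order at
  \<open>u0\<close>, where the class is in front. A class token thus moves left only past its own
  class.\<close>

lemma nonZ_right: "t \<in> I \<Longrightarrow> swp t x z \<Longrightarrow> z \<in> Z \<Longrightarrow> x \<in> Z"
proof (rule ccontr)
  assume a: "t \<in> I" "swp t x z" "z \<in> Z" "x \<notin> Z"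
  have x: "x \<in> V" using swpD a by blast
  have "bef u0 x z" using swp_half[OF a(2)] a(1) unfolding I_def by auto
  moreover have "bef u0 z x" using first[of z x] a x ZV by auto
  ultimately show False using asym[of x z] x a ZV by blast
qed

text \<open>The letters stand for out, bichromatic and in: right moves past a class token, right
  moves past another token, and left moves. By \<open>nonZ_right\<close> the partner in a left move
  is always a class token.\<close>

definition so :: "nat \<Rightarrow> 'a \<Rightarrow> int set" where "so j v = {t \<in> I. \<exists>y\<in>Z. swp t v y \<and> cnt V t y = j}"
definition sb :: "nat \<Rightarrow> 'a \<Rightarrow> int set" where "sb j v = {t \<in> I. \<exists>y\<in>V - Z. swp t v y \<and> cnt V t y = j}"
definition sn :: "nat \<Rightarrow> 'a \<Rightarrow> int set" where "sn j v = {t \<in> I. \<exists>x\<in>Z. swp t x v \<and> cnt V t v = j}"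

lemma fin_s [simp]: "finite (so j v)" "finite (sb j v)" "finite (sn j v)"
  unfolding so_def sb_def sn_def by simp_all

lemma sn_down: "v \<in> Z \<Longrightarrow> sn j v = {t \<in> {u0..<u0 + N}. j \<le> cnt V t v \<and> cnt V (t + 1) v < j}"
proof -
  assume v: "v \<in> Z"
  have "(\<exists>x\<in>Z. swp t x v \<and> cnt V t v = j) \<longleftrightarrow> (\<exists>x. swp t x v \<and> cnt V t v = j)" if "t \<in> I" for t
    using nonZ_right[OF that _ v] by blast
  then have "sn j v = {t \<in> I. \<exists>x. swp t x v \<and> cnt V t v = j}" unfolding sn_def by blast
  moreover have "v \<in> V" using v ZV by blast
  ultimately show ?thesis by (simp only: down_iff[symmetric] I_def)
qed

text \<open>A class token starts before position 10 and ends at position 20 or later, so it passes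
  the level to the right once more often than to the left.\<close>

lemma level_balance:
  assumes v: "v \<in> Z" and j: "10 \<le> j" "j \<le> 20"
  shows "card (so j v) + card (sb j v) = card (sn j v) + 1"
proof -
  have vV: "v \<in> V" using v ZV by blast
  have "so j v \<inter> sb j v = {}" unfolding so_def sb_def using one by blast
  then have "card (so j v) + card (sb j v) = card (so j v \<union> sb j v)" by (simp add: card_Un_disjoint)
  also have "so j v \<union> sb j v = {t \<in> I. \<exists>y. swp t v y \<and> cnt V t y = j}"
    unfolding so_def sb_def using swpD(2) by blast
  also have "\<dots> = {t \<in> {u0..<u0 + N}. cnt V t v < j \<and> j \<le> cnt V (t + 1) v}"
    unfolding up_iff[OF vV] I_def ..
  finally show ?thesis using cross_count[of u0 "u0 + N" "\<lambda>t. cnt V t v" j] sn_down[OF v]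
      idx_Z[OF vV] last_Z[OF v] v j N_pos by simp
qed

definition win :: "nat \<Rightarrow> nat set" where "win K = {K<..<30 - K}"

definition inner_swap :: "nat \<Rightarrow> int \<Rightarrow> bool" where
  "inner_swap K t \<longleftrightarrow> (\<exists>x\<in>Z. \<exists>y\<in>Z. swp t x y \<and> cnt V t y \<in> win K)"

definition So :: "nat \<Rightarrow> 'a \<Rightarrow> int set" where "So K v = {t \<in> I. \<exists>y\<in>Z. swp t v y \<and> cnt V t y \<in> win K}"
definition Sb :: "nat \<Rightarrow> 'a \<Rightarrow> int set" where "Sb K v = {t \<in> I. \<exists>y\<in>V - Z. swp t v y \<and> cnt V t y \<in> win K}"
definition Sn :: "nat \<Rightarrow> 'a \<Rightarrow> int set" where "Sn K v = {t \<in> I. \<exists>x\<in>Z. swp t x v \<and> cnt V t v \<in> win K}"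

lemma S_sum: "card (So K v) = (\<Sum>j\<in>win K. card (so j v))" "card (Sb K v) = (\<Sum>j\<in>win K. card (sb j v))"
  "card (Sn K v) = (\<Sum>j\<in>win K. card (sn j v))"
proof -
  have f: "finite (win K)" unfolding win_def by simp
  have "So K v = (\<Union>j\<in>win K. so j v)" "Sb K v = (\<Union>j\<in>win K. sb j v)" "Sn K v = (\<Union>j\<in>win K. sn j v)"
    unfolding So_def Sb_def Sn_def so_def sb_def sn_def by blast+
  moreover have "so i v \<inter> so j v = {}" "sb i v \<inter> sb j v = {}" "sn i v \<inter> sn j v = {}" if "i \<noteq> j" for i j
    unfolding so_def sb_def sn_def using one that by blast+
  ultimately show "card (So K v) = (\<Sum>j\<in>win K. card (so j v))" "card (Sb K v) = (\<Sum>j\<in>win K. card (sb j v))"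
    "card (Sn K v) = (\<Sum>j\<in>win K. card (sn j v))" using f by (simp_all add: card_UN_disjoint)
qed

lemma win_balance:
  assumes "v \<in> Z" "10 \<le> K" "K \<le> 14"
  shows "card (So K v) + card (Sb K v) = card (Sn K v) + (29 - 2 * K)"
proof -
  have "(\<Sum>j\<in>win K. card (so j v)) + (\<Sum>j\<in>win K. card (sb j v)) = (\<Sum>j\<in>win K. card (sn j v) + 1)"
    unfolding sum.distrib[symmetric] by (rule sum.cong) (use level_balance[OF assms(1)] assms in \<open>auto simp: win_def\<close>)
  also have "\<dots> = (\<Sum>j\<in>win K. card (sn j v)) + card (win K)" by (simp only: sum.distrib card_eq_sum)
  also have "card (win K) = 29 - 2 * K" unfolding win_def using assms by simp
  finally show ?thesis unfolding S_sum .
qed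

definition ix :: "'a \<Rightarrow> nat" where "ix v = cnt V u0 v"
text \<open>Numbering the class by its order at \<open>u0\<close> turns swaps inside the class into
  edges from smaller to larger numbers, in the form required by
  \<open>digraph_bound\<close>.\<close>

definition E :: "nat \<Rightarrow> (nat \<times> nat) set" where "E K = (\<lambda>t. (ix (right_mover t), ix (left_mover t))) ` {t \<in> I. inner_swap K t}"

lemma E_iff: "(i, k) \<in> E K \<longleftrightarrow> (\<exists>t\<in>I. \<exists>x\<in>Z. \<exists>y\<in>Z. swp t x y \<and> cnt V t y \<in> win K \<and> i = ix x \<and> k = ix y)"
  unfolding E_def inner_swap_def using mv by (auto simp: image_iff) (metis mv)+

lemma ix_less: "t \<in> I \<Longrightarrow> swp t x y \<Longrightarrow> ix x < ix y"
proof -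
  assume a: "t \<in> I" "swp t x y"
  have "bef u0 x y" using swp_half[OF a(2)] a(1) unfolding I_def by auto
  then show ?thesis unfolding ix_def using cnt_less[OF subset_refl] swpD[OF a(2)] by blast
qed

lemma ix_Z: "x \<in> Z \<Longrightarrow> ix x < 10" unfolding ix_def using idx_Z ZV by auto

lemma ix_inj: "x \<in> Z \<Longrightarrow> y \<in> Z \<Longrightarrow> ix x = ix y \<Longrightarrow> x = y" unfolding ix_def by (rule idx_inj)

lemma card_E: "card (E K) = card {t \<in> I. inner_swap K t}"
  unfolding E_def
proof (rule card_image, rule inj_onI)
  fix t t' assume a: "t \<in> {t \<in> I. inner_swap K t}" "t' \<in> {t \<in> I. inner_swap K t}" "(ix (right_mover t), ix (left_mover t)) = (ix (right_mover t'), ix (left_mover t'))"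
  obtain x y where 1: "x \<in> Z" "y \<in> Z" "swp t x y" using a(1) unfolding inner_swap_def by blast
  obtain x' y' where 2: "x' \<in> Z" "y' \<in> Z" "swp t' x' y'" using a(2) unfolding inner_swap_def by blast
  have "x = x'" "y = y'" using a(3) mv[OF 1(3)] mv[OF 2(3)] ix_inj 1 2 by auto
  then show "t = t'" using swp_unique_half[OF 1(3), of t' u0] 2 a unfolding I_def by auto
qed

lemma card_out: "v \<in> Z \<Longrightarrow> card {k. (ix v, k) \<in> E K} = card (So K v)"
proof -
  assume v: "v \<in> Z"
  have "{k. (ix v, k) \<in> E K} = (\<lambda>t. ix (left_mover t)) ` So K v"
  proof (rule set_eqI)
    fix k
    have "(ix v, k) \<in> E K \<longleftrightarrow> (\<exists>t\<in>I. \<exists>y\<in>Z. swp t v y \<and> cnt V t y \<in> win K \<and> k = ix y)"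
      unfolding E_iff using v ix_inj by blast
    also have "\<dots> \<longleftrightarrow> k \<in> (\<lambda>t. ix (left_mover t)) ` So K v"
      unfolding So_def image_iff using mv(2) by blast
    finally show "k \<in> {k. (ix v, k) \<in> E K} \<longleftrightarrow> k \<in> (\<lambda>t. ix (left_mover t)) ` So K v" by simp
  qed
  moreover have "inj_on (\<lambda>t. ix (left_mover t)) (So K v)"
  proof (rule inj_onI)
    fix t t' assume a: "t \<in> So K v" "t' \<in> So K v" "ix (left_mover t) = ix (left_mover t')"
    obtain y where 1: "y \<in> Z" "swp t v y" "t \<in> I" using a(1) unfolding So_def by blast
    obtain y' where 2: "y' \<in> Z" "swp t' v y'" "t' \<in> I" using a(2) unfolding So_def by blast
    have "y = y'" using a(3) mv(2)[OF 1(2)] mv(2)[OF 2(2)] ix_inj 1 2 by auto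
    then show "t = t'" using swp_unique_half[OF 1(2), of t' u0] 1 2 unfolding I_def by auto
  qed
  ultimately show ?thesis by (simp add: card_image)
qed

lemma card_in: "v \<in> Z \<Longrightarrow> card {k. (k, ix v) \<in> E K} = card (Sn K v)"
proof -
  assume v: "v \<in> Z"
  have "{k. (k, ix v) \<in> E K} = (\<lambda>t. ix (right_mover t)) ` Sn K v"
  proof (rule set_eqI)
    fix k
    have "(k, ix v) \<in> E K \<longleftrightarrow> (\<exists>t\<in>I. \<exists>x\<in>Z. swp t x v \<and> cnt V t v \<in> win K \<and> k = ix x)"
      unfolding E_iff using v ix_inj by blast
    also have "\<dots> \<longleftrightarrow> k \<in> (\<lambda>t. ix (right_mover t)) ` Sn K v"
      unfolding Sn_def image_iff using mv(1) by blast
    finally show "k \<in> {k. (k, ix v) \<in> E K} \<longleftrightarrow> k \<in> (\<lambda>t. ix (right_mover t)) ` Sn K v" by simp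
  qed
  moreover have "inj_on (\<lambda>t. ix (right_mover t)) (Sn K v)"
  proof (rule inj_onI)
    fix t t' assume a: "t \<in> Sn K v" "t' \<in> Sn K v" "ix (right_mover t) = ix (right_mover t')"
    obtain y where 1: "y \<in> Z" "swp t y v" "t \<in> I" using a(1) unfolding Sn_def by blast
    obtain y' where 2: "y' \<in> Z" "swp t' y' v" "t' \<in> I" using a(2) unfolding Sn_def by blast
    have "y = y'" using a(3) mv(1)[OF 1(2)] mv(1)[OF 2(2)] ix_inj 1 2 by auto
    then show "t = t'" using swp_unique_half[OF 1(2), of t' u0] 1 2 unfolding I_def by auto
  qed
  ultimately show ?thesis by (simp add: card_image)
qed

lemma vt_ex: "i < 10 \<Longrightarrow> \<exists>v\<in>Z. ix v = i"
proof -
  assume i: "i < 10"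
  obtain x where "x \<in> V" "cnt V u0 x = i" by (rule tok_at[OF subset_refl, of i u0]) (use i cV in auto)
  then show ?thesis unfolding ix_def using idx_Z i by auto
qed

lemma E_range: "(i, j) \<in> E K \<Longrightarrow> i < j \<and> j < 10"
  unfolding E_iff using ix_less ix_Z by blast

text \<open>The surplus is the number of levels in the window, 5 for \<open>K = 12\<close> and 3 for
  \<open>K = 13\<close>; dropping the bichromatic swaps makes it an upper bound.\<close>

lemma E_deg:
  assumes "i < 10" "10 \<le> K" "K \<le> 14"
  shows "card {k. (i, k) \<in> E K} \<le> card {k. (k, i) \<in> E K} + (29 - 2 * K)"
proof -
  obtain v where v: "v \<in> Z" "ix v = i" using vt_ex[OF assms(1)] by blast
  show ?thesis using card_out[OF v(1), of K] card_in[OF v(1), of K] win_balance[OF v(1) assms(2,3)] v(2) by simp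
qed

lemma zz_bound: "card {t \<in> I. inner_swap 12 t} \<le> 39" "card {t \<in> I. inner_swap 13 t} \<le> 33"
  using digraph_bound(1)[of "E 12" 5] digraph_bound(2)[of "E 13" 3] E_range E_deg[of _ 12] E_deg[of _ 13] card_E by auto


text \<open>Summed over the class, out and in moves count the same swaps and cancel. What remains is
  one net right move per token and level.\<close>

lemma bich_count:
  assumes K: "10 \<le> K" "K \<le> 14"
  shows "card {t \<in> I. \<exists>x\<in>Z. \<exists>y\<in>V - Z. swp t x y \<and> cnt V t y \<in> win K} = 10 * (29 - 2 * K)"
proof -
  have fZ: "finite Z" using fin_sub ZV by blast
  have zo: "{t \<in> I. inner_swap K t} = (\<Union>v\<in>Z. So K v)" "{t \<in> I. inner_swap K t} = (\<Union>v\<in>Z. Sn K v)"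
    unfolding inner_swap_def So_def Sn_def by blast+
  have bb: "{t \<in> I. \<exists>x\<in>Z. \<exists>y\<in>V - Z. swp t x y \<and> cnt V t y \<in> win K} = (\<Union>v\<in>Z. Sb K v)"
    unfolding Sb_def by blast
  have d: "So K v \<inter> So K w = {}" "Sn K v \<inter> Sn K w = {}" "Sb K v \<inter> Sb K w = {}" if "v \<noteq> w" for v w
    unfolding So_def Sn_def Sb_def using one that by blast+
  have fS: "finite (So K v)" "finite (Sn K v)" "finite (Sb K v)" for v
    unfolding So_def Sn_def Sb_def by simp_all
  have 1: "card {t \<in> I. inner_swap K t} = (\<Sum>v\<in>Z. card (So K v))"
    unfolding zo(1) using fZ fS d by (simp add: card_UN_disjoint)
  have 2: "card {t \<in> I. inner_swap K t} = (\<Sum>v\<in>Z. card (Sn K v))"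
    unfolding zo(2) using fZ fS d by (simp add: card_UN_disjoint)
  have 3: "card (\<Union>v\<in>Z. Sb K v) = (\<Sum>v\<in>Z. card (Sb K v))"
    using fZ fS d by (simp add: card_UN_disjoint)
  have "(\<Sum>v\<in>Z. card (So K v)) + (\<Sum>v\<in>Z. card (Sb K v)) = (\<Sum>v\<in>Z. card (Sn K v) + (29 - 2 * K))"
    unfolding sum.distrib[symmetric] by (rule sum.cong) (use win_balance K in auto)
  also have "\<dots> = (\<Sum>v\<in>Z. card (Sn K v)) + 10 * (29 - 2 * K)" by (simp add: sum.distrib cZ)
  finally show ?thesis unfolding bb 3 using 1 2 by simp
qed

end

text \<open>Time and order are reversed together. Right-movers then remain right-movers, and a class
  that ends at the back becomes one that starts in front. This carries statements about the first
  half of a passage over to the second half.\<close>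

lemma (in circular_seq) circ_rev: "circular_seq V N (\<lambda>t p q. bef (- t) q p)"
proof
  show "finite V" "0 < N" using fin N_pos .
  show "\<not> bef (- t) p p" if "p \<in> V" for p t using irr that .
  show "bef (- t) q p \<or> bef (- t) p q" if "p \<in> V" "q \<in> V" "p \<noteq> q" for p q t using tot that by blast
  show "bef (- t) r p" if "p \<in> V" "q \<in> V" "r \<in> V" "bef (- t) q p" "bef (- t) r q" for p q r t
    using tr[of r q p] that by blast
  show "bef (- (t + N)) q p \<longleftrightarrow> bef (- t) p q" if "p \<in> V" "q \<in> V" for p q t
  proof -
    have "- (t + N) = - t - N" by simp
    then show ?thesis using flipm[of q p "- t"] that by simp
  qed
  show "p = r \<and> q = s" if "p \<in> V" "q \<in> V" "r \<in> V" "s \<in> V" "bef (- t) q p" "bef (- (t + 1)) p q"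
    "bef (- t) s r" "bef (- (t + 1)) r s" for p q r s t
    using one'[of p q r s "- t - 1"] that by simp
  show "bef (- t') p q" if "p \<in> V" "q \<in> V" "bef (- t) q p" "bef (- (t + 1)) p q" "t < t'" "t' \<le> t + N" for p q t t'
  proof -
    have "bef (- t' + N) q p" by (rule once'[of p q "- t - 1"]) (use that in auto)
    then show ?thesis using flip[of q p "- t'"] that by simp
  qed
qed

section \<open>The degree pattern of a class attaining both bounds\<close>

locale tight_block = block +
  assumes e12: "card {t \<in> I. inner_swap 12 t} = 39" and e13: "card {t \<in> I. inner_swap 13 t} = 33"
begin

definition tk :: "nat \<Rightarrow> 'a" where "tk i = (SOME v. v \<in> Z \<and> ix v = i)"

lemma tk: "i < 10 \<Longrightarrow> tk i \<in> Z" "i < 10 \<Longrightarrow> ix (tk i) = i"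
proof -
  assume "i < 10"
  then have "\<exists>v. v \<in> Z \<and> ix v = i" using vt_ex by blast
  then have "tk i \<in> Z \<and> ix (tk i) = i" unfolding tk_def by (rule someI_ex)
  then show "tk i \<in> Z" "ix (tk i) = i" by auto
qed

lemma tk_ix: "z \<in> Z \<Longrightarrow> tk (ix z) = z"
  using tk[of "ix z"] ix_Z ix_inj by blast

lemma D12: "card {k. (0, k) \<in> E 12} = 5" "card {k. (1, k) \<in> E 12} = 6" "card {k. (2, k) \<in> E 12} = 7"
    "3 \<le> i \<Longrightarrow> i < 10 \<Longrightarrow> card {k. (i, k) \<in> E 12} = 9 - i"
proof -
  have d: "card {k. (i, k) \<in> E 12} \<le> card {k. (k, i) \<in> E 12} + 5" if "i < 10" for i
    using E_deg[OF that, of 12] by simp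
  have c: "card (E 12) = 39" using card_E[of 12] e12 by simp
  have e: "i < j \<and> j < 10" if "(i, j) \<in> E 12" for i j using E_range that .
  note D = digraph_bound(3)[of "E 12" 5, OF e d refl c]
  show "card {k. (0, k) \<in> E 12} = 5" "card {k. (1, k) \<in> E 12} = 6" "card {k. (2, k) \<in> E 12} = 7"
    "3 \<le> i \<Longrightarrow> i < 10 \<Longrightarrow> card {k. (i, k) \<in> E 12} = 9 - i" using D by blast+
qed

lemma D13: "card {k. (0, k) \<in> E 13} = 3" "card {k. (1, k) \<in> E 13} = 4" "card {k. (2, k) \<in> E 13} = 5"
    "3 \<le> i \<Longrightarrow> i < 10 \<Longrightarrow> card {k. (i, k) \<in> E 13} = 9 - i"
    "card {k. (k, 1) \<in> E 13} = 1" "card {k. (k, 2) \<in> E 13} = 2" "card {k. (k, 3) \<in> E 13} = 3"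
proof -
  have d: "card {k. (i, k) \<in> E 13} \<le> card {k. (k, i) \<in> E 13} + 3" if "i < 10" for i
    using E_deg[OF that, of 13] by simp
  have c: "card (E 13) = 33" using card_E[of 13] e13 by simp
  have e: "i < j \<and> j < 10" if "(i, j) \<in> E 13" for i j using E_range that .
  note D = digraph_bound(4)[of "E 13" 3, OF e d refl c]
  show "card {k. (0, k) \<in> E 13} = 3" "card {k. (1, k) \<in> E 13} = 4" "card {k. (2, k) \<in> E 13} = 5"
    "3 \<le> i \<Longrightarrow> i < 10 \<Longrightarrow> card {k. (i, k) \<in> E 13} = 9 - i"
    "card {k. (k, 1) \<in> E 13} = 1" "card {k. (k, 2) \<in> E 13} = 2" "card {k. (k, 3) \<in> E 13} = 3"
    using D by blast+
qed

lemma fin_in: "finite {k. (k, i) \<in> E K}" "finite {k. (i, k) \<in> E K}"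
  by (rule finite_subset[of _ "{..<10}"]; use E_range in force)+

lemma pred_set: "i \<in> {1, 2, 3} \<Longrightarrow> {k. (k, i) \<in> E 13} = {..<i}"
proof -
  assume i: "i \<in> {1, 2, 3}"
  have "{k. (k, i) \<in> E 13} \<subseteq> {..<i}" using E_range by auto
  moreover have "card {k. (k, i) \<in> E 13} = card {..<i}" using i D13 by auto
  ultimately show ?thesis by (intro card_subset_eq) auto
qed

lemma succ3: "{k. (3, k) \<in> E 13} = {4..<10}"
proof -
  have "{k. (3, k) \<in> E 13} \<subseteq> {4..<10}" using E_range[of 3] by (auto simp: less_eq_Suc_le)
  moreover have "card {k. (3, k) \<in> E 13} = card {4..<10::nat}" using D13(4)[of 3] by simp
  ultimately show ?thesis by (intro card_subset_eq) auto
qed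

lemma succ0: "{k. (0, k) \<in> E 13} = {1, 2, 3}"
proof -
  have "(0, i) \<in> E 13" if i: "i \<in> {1, 2, 3}" for i
  proof -
    have "0 \<in> {..<i}" using i by auto
    then show ?thesis using pred_set[OF i] by blast
  qed
  then have "{1, 2, 3} \<subseteq> {k. (0, k) \<in> E 13}" by blast
  moreover have "card {1, 2, 3::nat} = card {k. (0, k) \<in> E 13}" using D13(1) by simp
  ultimately have "{1, 2, 3} = {k. (0, k) \<in> E 13}" by (rule card_subset_eq[OF fin_in(2)])
  then show ?thesis by simp
qed

lemma win12: "win 12 = insert 13 (insert 17 (win 13))" "13 \<notin> insert 17 (win 13)" "17 \<notin> win 13"
  unfolding win_def by auto

lemma S12: "card (So 12 v) = card (so 13 v) + (card (so 17 v) + card (So 13 v))"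
  "card (Sn 12 v) = card (sn 13 v) + (card (sn 17 v) + card (Sn 13 v))"
  unfolding S_sum win12(1) using win12(2,3) by (simp_all add: win_def)

lemma in_le: "v \<in> Z \<Longrightarrow> card (Sn K v) \<le> ix v"
proof -
  assume v: "v \<in> Z"
  have "card {k. (k, ix v) \<in> E K} \<le> card {..<ix v}" by (rule card_mono) (use E_range in auto)
  then show ?thesis using card_in[OF v] by simp
qed

text \<open>All class tokens in front of it already meet such a token at levels 14 to 16, so no left
  move is left over for the levels 13 and 17.\<close>

lemma sn_low: "v \<in> Z \<Longrightarrow> ix v \<le> 3 \<Longrightarrow> sn 13 v = {} \<and> sn 17 v = {}"
proof -
  assume v: "v \<in> Z" "ix v \<le> 3"
  have "ix v = 0 \<or> ix v = 1 \<or> ix v = 2 \<or> ix v = 3" using v(2) by linarith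
  then have "ix v \<le> card (Sn 13 v)" using D13(5-7) card_in[OF v(1), of 13] by auto
  then have "card (sn 13 v) = 0 \<and> card (sn 17 v) = 0" using S12(2)[of v] in_le[OF v(1), of 12] by linarith
  then show ?thesis by simp
qed

text \<open>For these tokens the out-degrees for \<open>K = 12\<close> and \<open>K = 13\<close>
  coincide, and the two windows differ exactly in the levels 13 and 17.\<close>

lemma so_high: "v \<in> Z \<Longrightarrow> 3 \<le> ix v \<Longrightarrow> so 13 v = {} \<and> so 17 v = {}"
proof -
  assume v: "v \<in> Z" "3 \<le> ix v"
  have "card (So 12 v) = card (So 13 v)"
    using D12(4)[of "ix v"] D13(4)[of "ix v"] v ix_Z card_out[OF v(1)] by metis
  then show ?thesis using S12(1)[of v] by simp
qed

text \<open>The two additional out-edges for \<open>K = 12\<close> are swaps at levels 13 and 17. As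
  there are no left moves, each of these levels is passed just once, so both passages are swaps
  inside the class.\<close>

lemma low_tok: "v \<in> Z \<Longrightarrow> ix v \<le> 2 \<Longrightarrow> card (so 13 v) = 1 \<and> card (so 17 v) = 1 \<and> sb 13 v = {} \<and> sb 17 v = {}"
proof -
  assume v: "v \<in> Z" "ix v \<le> 2"
  have "ix v = 0 \<or> ix v = 1 \<or> ix v = 2" using v(2) by linarith
  then have "card (So 12 v) = card (So 13 v) + 2"
    using D12(1-3) D13(1-3) card_out[OF v(1), of 12] card_out[OF v(1), of 13] by auto
  then have 1: "card (so 13 v) + card (so 17 v) = 2" using S12(1)[of v] by simp
  have n: "sn 13 v = {}" "sn 17 v = {}" using sn_low v by auto
  have "card (so 13 v) + card (sb 13 v) = 1" "card (so 17 v) + card (sb 17 v) = 1"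
    using level_balance[OF v(1), of 13] level_balance[OF v(1), of 17] n by auto
  then have "card (so 13 v) = 1" "card (so 17 v) = 1" "card (sb 13 v) = 0" "card (sb 17 v) = 0" using 1 by linarith+
  then show ?thesis by simp
qed

text \<open>Token 3 lies in the range of both \<open>sn_low\<close> and \<open>so_high\<close>: it
  has no swap inside the class at these levels, and the balance leaves one bichromatic swap at each.
  It separates the phases of the passage.\<close>

lemma tok3: "card (sb 13 (tk 3)) = 1" "card (sb 17 (tk 3)) = 1"
  using level_balance[OF tk(1), of 3 13] level_balance[OF tk(1), of 3 17] so_high[OF tk(1), of 3]
    sn_low[OF tk(1), of 3] tk(2)[of 3] by simp_all

text \<open>Nothing precedes token 0 in the class, so its net movement through the three levels 14
  to 16 is entirely spent on its three out-edges.\<close>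

lemma tok0_bich: "Sb 13 (tk 0) = {}"
proof -
  have z: "tk 0 \<in> Z" "ix (tk 0) = 0" using tk[of 0] by auto
  have fb: "finite (Sb 13 (tk 0))" unfolding Sb_def by simp
  have "card (So 13 (tk 0)) = 3" using card_out[OF z(1), of 13] z D13 by simp
  moreover have "card (Sn 13 (tk 0)) = 0" using in_le[OF z(1)] z by simp
  ultimately have "card (Sb 13 (tk 0)) = 0" using win_balance[OF z(1), of 13] by simp
  then show ?thesis using fb by simp
qed

lemma E_swap:
  assumes "(ix x, ix y) \<in> E 13" "x \<in> Z" "y \<in> Z" "t \<in> I" "swp t x y \<or> swp t y x"
  shows "cnt V t x \<in> win 13 \<or> cnt V t y \<in> win 13" "swp t x y" "cnt V t y \<in> win 13"
proof -
  obtain s x' y' where s: "s \<in> I" "x' \<in> Z" "y' \<in> Z" "swp s x' y'" "cnt V s y' \<in> win 13" "ix x = ix x'" "ix y = ix y'"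
    using assms(1) unfolding E_iff by blast
  have e: "x' = x" "y' = y" using ix_inj s assms by auto
  have "s = t" using swp_unique_half[of s x y t u0] s e assms(4,5) unfolding I_def by auto
  then show "swp t x y" "cnt V t y \<in> win 13" "cnt V t x \<in> win 13 \<or> cnt V t y \<in> win 13" using s e by auto
qed

lemma tok0_mono:
  assumes "t \<in> I" "swp t (tk 0) y \<or> swp t y (tk 0)" "cnt V t (tk 0) \<in> {13..16}" "cnt V t y \<in> {13..16}"
  shows "y \<in> {tk 1, tk 2, tk 3}"
proof -
  have z: "tk 0 \<in> Z" "ix (tk 0) = 0" using tk[of 0] by auto
  have "\<not> swp t y (tk 0)"
  proof
    assume s: "swp t y (tk 0)"
    have "y \<in> Z" using nonZ_right[OF assms(1) s z(1)] .
    then show False using ix_less[OF assms(1) s] z by simp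
  qed
  then have s: "swp t (tk 0) y" using assms by blast
  have "cnt V t y = cnt V t (tk 0) + 1" using cnt_ge_1_swp[OF s] by simp
  then have w: "cnt V t y \<in> win 13" using assms(3,4) unfolding win_def by auto
  have yZ: "y \<in> Z"
  proof (rule ccontr)
    assume "y \<notin> Z"
    then have "t \<in> Sb 13 (tk 0)" unfolding Sb_def using assms(1) s w swpD(2)[OF s] by blast
    then show False using tok0_bich by simp
  qed
  then have "(ix (tk 0), ix y) \<in> E 13" unfolding E_iff using assms(1) s w z by blast
  then have "ix y \<in> {1, 2, 3}" using succ0 z by auto
  then show ?thesis using tk_ix[OF yZ] by auto
qed

text \<open>In \<open>E 13\<close> token 3 is joined to every other class token. All its swaps
  inside the class therefore happen at levels 14 to 16.\<close>

lemma tok3_swap: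
  assumes "t \<in> I" "z \<in> Z" "swp t (tk 3) z \<or> swp t z (tk 3)"
  shows "13 \<le> cnt V t (tk 3)"
proof -
  have z3: "tk 3 \<in> Z" "ix (tk 3) = 3" using tk[of 3] by auto
  have "z \<noteq> tk 3" using assms(3) swp_neq[of t z z] by auto
  then have "ix z \<noteq> 3" using ix_inj[OF assms(2) z3(1)] z3(2) by auto
  then consider "ix z < 3" | "4 \<le> ix z" by linarith
  then show ?thesis
  proof cases
    case 1
    then have "(ix z, ix (tk 3)) \<in> E 13" using pred_set[of 3] z3 by auto
    then show ?thesis using E_swap(3)[OF _ assms(2) z3(1) assms(1)] assms(3) unfolding win_def by auto
  next
    case 2
    then have e: "(ix (tk 3), ix z) \<in> E 13" using succ3 z3 ix_Z[OF assms(2)] by auto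
    have "swp t (tk 3) z" "cnt V t z \<in> win 13" by (rule E_swap(2,3)[OF e z3(1) assms(2,1,3)])+
    then show ?thesis using cnt_ge_1_swp(1)[of t "tk 3" z] unfolding win_def by auto
  qed
qed

section \<open>The moment at which token 3 reaches position 13\<close>

lemma threshold:
  assumes v: "v \<in> Z" "sn j v = {}" and j: "10 \<le> j" "j \<le> 20"
  obtains s where "s \<in> I" "s \<in> so j v \<union> sb j v" "\<And>t. u0 \<le> t \<Longrightarrow> t \<le> s \<Longrightarrow> cnt V t v < j"
    "\<And>t. s < t \<Longrightarrow> t \<le> u0 + N \<Longrightarrow> j \<le> cnt V t v"
proof -
  have vV: "v \<in> V" using v ZV by blast
  have c: "cnt V u0 v < j" "j \<le> cnt V (u0 + N) v" using idx_Z[OF vV] last_Z[OF v(1)] v j by auto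
  obtain s where s: "u0 \<le> s" "s < u0 + N" "cnt V s v < j" "j \<le> cnt V (s + 1) v"
    using crossing_up[of u0 "u0 + N" "\<lambda>t. cnt V t v" j] c N_pos by auto
  have nodown: "\<not> (j \<le> cnt V t v \<and> cnt V (t + 1) v < j)" if "u0 \<le> t" "t < u0 + N" for t
    using sn_down[OF v(1), of j] v(2) that by auto
  have sI: "s \<in> I" unfolding I_def using s by simp
  obtain y where y: "swp s v y" "cnt V s y = j" using up_iff[OF vV, of s j] s by blast
  have "s \<in> so j v \<union> sb j v" unfolding so_def sb_def using sI y swpD(2)[OF y(1)] by blast
  moreover have "cnt V t v < j" if tt: "u0 \<le> t" "t \<le> s" for t
  proof (rule ccontr)
    assume "\<not> cnt V t v < j"
    then have l: "j \<le> cnt V t v" by simp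
    obtain r where "t \<le> r" "r < s" "j \<le> cnt V r v" "cnt V (r + 1) v < j"
      by (rule crossing_down[of t s j "\<lambda>t. cnt V t v"]) (use tt s(3) l in auto)
    then show False using nodown[of r] tt s by simp
  qed
  moreover have "j \<le> cnt V t v" if tt: "s < t" "t \<le> u0 + N" for t
  proof (rule ccontr)
    assume "\<not> j \<le> cnt V t v"
    then have l: "cnt V t v < j" by simp
    have st: "s + 1 \<le> t" using tt by simp
    obtain r where "s + 1 \<le> r" "r < t" "j \<le> cnt V r v" "cnt V (r + 1) v < j"
      by (rule crossing_down[of "s + 1" t j "\<lambda>t. cnt V t v"]) (use st s(4) l in auto)
    then show False using nodown[of r] tt s by simp
  qed
  ultimately show thesis using that sI by blast
qed

text \<open>By \<open>tok3_swap\<close> token 3 is not exchanged inside its class before it has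
  reached position 13, so its order relative to the class is still that of
  \<open>u0\<close>.\<close>

lemma bef3_before:
  assumes "z \<in> Z" "z \<noteq> tk 3" and "\<And>t. u0 \<le> t \<Longrightarrow> t \<le> s \<Longrightarrow> cnt V t (tk 3) < 13" "s \<in> I" "u0 \<le> t" "t \<le> s + 1"
  shows "bef t z (tk 3) \<longleftrightarrow> ix z < 3"
proof -
  have z3: "tk 3 \<in> Z" "ix (tk 3) = 3" using tk[of 3] by auto
  have V: "z \<in> V" "tk 3 \<in> V" using assms z3 ZV by auto
  have u: "bef u0 z (tk 3) \<longleftrightarrow> ix z < 3"
    using cnt_iff[OF subset_refl V assms(2), of u0] z3(2) unfolding ix_def by simp
  have late: "s < r" if r: "u0 \<le> r" "r < u0 + N" "swp r z (tk 3) \<or> swp r (tk 3) z" for r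
  proof (rule ccontr)
    assume "\<not> s < r"
    then have "cnt V r (tk 3) < 13" using assms(3) r by simp
    then show False using tok3_swap[of r z] r assms(1) unfolding I_def by auto
  qed
  show ?thesis
  proof (cases "ix z < 3")
    case True
    obtain r where r: "u0 \<le> r" "r < u0 + N" "swp r z (tk 3)" "\<forall>t. u0 \<le> t \<and> t \<le> r \<longrightarrow> bef t z (tk 3)"
      by (rule swap_time[of z "tk 3" u0]) (use V u True in auto)
    have "s < r" using late r by blast
    then show ?thesis using r(4) assms True by auto
  next
    case False
    then have b: "bef u0 (tk 3) z" using u not_bef[of z "tk 3" u0] V assms(2) by blast
    obtain r where r: "u0 \<le> r" "r < u0 + N" "swp r (tk 3) z" "\<forall>t. u0 \<le> t \<and> t \<le> r \<longrightarrow> bef t (tk 3) z"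
      by (rule swap_time[OF V(2,1) b])
    have "s < r" using late r by blast
    then have "bef t (tk 3) z" using r(4) assms by auto
    then show ?thesis using asym[of "tk 3" z t] V False by blast
  qed
qed

text \<open>Take for \<open>s\<close> the moment at which token 3 passes level 13. It then has
  tokens 0, 1, 2 in front and no token of \<open>W\<close>, so \<open>13 = 3 + 10\<close> means that
  all of \<open>Y\<close> has been passed. Swaps with \<open>Y\<close> at levels 13 and 17 involve
  only tokens from 3 on, which are behind \<open>Y\<close> by then, so they are over. Swaps inside
  the class at these levels move one of the tokens 0, 1, 2 to the right, and these are still in
  front of token 3, so they are yet to come.\<close>

lemma theta_ex:
  "\<exists>s. u0 \<le> s \<and> s < u1 \<and> (\<exists>y\<in>Y. swp s (tk 3) y \<and> cnt V s y = 13) \<and>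
     (\<forall>t\<in>I. \<forall>x\<in>Z. \<forall>y\<in>Y. swp t x y \<and> cnt V t y \<in> {13, 17} \<longrightarrow> t \<le> s) \<and>
     (\<forall>t\<in>I. \<forall>x\<in>Z. \<forall>y\<in>Z. swp t x y \<and> cnt V t y \<in> {13, 17} \<longrightarrow> s < t) \<and>
     (\<forall>z\<in>Z. 3 < ix z \<longrightarrow> bef (s + 1) (tk 3) z) \<and> (\<forall>y\<in>Y. bef (s + 1) y (tk 3)) \<and> cnt V (s + 1) (tk 3) = 13"
proof -
  have z3: "tk 3 \<in> Z" "ix (tk 3) = 3" using tk[of 3] by auto
  have v3V: "tk 3 \<in> V" using z3 ZV by auto
  have "sn 13 (tk 3) = {}" using sn_low[OF z3(1)] z3 by simp
  then obtain s where s: "s \<in> I" "s \<in> so 13 (tk 3) \<union> sb 13 (tk 3)" "\<And>t. u0 \<le> t \<Longrightarrow> t \<le> s \<Longrightarrow> cnt V t (tk 3) < 13"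
    "\<And>t. s < t \<Longrightarrow> t \<le> u0 + N \<Longrightarrow> 13 \<le> cnt V t (tk 3)"
    using threshold[OF z3(1), of 13] by auto
  have sI: "u0 \<le> s" "s < u0 + N" using s(1) unfolding I_def by auto
  have "s \<in> sb 13 (tk 3)" using s(2) so_high[OF z3(1)] z3 by auto
  then obtain y0 where y0: "y0 \<in> V - Z" "swp s (tk 3) y0" "cnt V s y0 = 13" unfolding sb_def by blast
  have c: "cnt V s (tk 3) = 12" "cnt V (s + 1) (tk 3) = 13" using cnt_ge_1_swp[OF y0(2)] y0(3) by auto
  note bz = bef3_before[OF _ _ s(3) s(1)]
  have Zcard: "card {z \<in> Z. bef t z (tk 3)} = 3" if "u0 \<le> t" "t \<le> s + 1" for t
  proof -
    have "{z \<in> Z. bef t z (tk 3)} = {z \<in> Z. ix z < 3}"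
      using bz[of _ t] that irr[OF v3V, of t] z3 by (metis (no_types, lifting) less_irrefl)
    also have "\<dots> = tk ` {..<3}"
    proof (rule set_eqI)
      fix z
      show "z \<in> {z \<in> Z. ix z < 3} \<longleftrightarrow> z \<in> tk ` {..<3}"
      proof
        assume "z \<in> {z \<in> Z. ix z < 3}"
        then show "z \<in> tk ` {..<3}" using tk_ix[of z] by (intro image_eqI[of _ _ "ix z"]) auto
      next
        assume "z \<in> tk ` {..<3}"
        then obtain i where "i < 3" "z = tk i" by auto
        then show "z \<in> {z \<in> Z. ix z < 3}" using tk[of i] by simp
      qed
    qed
    also have "card \<dots> = 3"
    proof -
      have "inj_on tk {..<3}" by (rule inj_on_inverseI[of _ ix]) (use tk in auto)
      then show ?thesis by (simp add: card_image)
    qed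
    finally show ?thesis .
  qed
  have b0: "bef u0 (tk 3) x" if "x \<in> Y \<union> W" for x using first[OF z3(1) that] .
  have fY: "finite Y" "finite Z" using fin_sub ZV by auto
  \<comment> \<open>At \<open>u1\<close> all of \<open>Y\<close> precedes the class. If
    \<open>s\<close> were not earlier, \<open>Y\<close> and three class tokens would precede token 3
    at \<open>s\<close>, where its position is only 12.\<close>
  have su: "s < u1"
  proof (rule ccontr)
    assume "\<not> s < u1"
    have "bef s y (tk 3)" if y: "y \<in> Y" for y
    proof (rule bef_after[of "tk 3" y u0 u1 s])
      show "bef u1 y (tk 3)" using dec1 y z3 unfolding layered_def by blast
    qed (use y ZV v3V b0 u01 sI \<open>\<not> s < u1\<close> in auto)
    then have sub: "{z \<in> Z. bef s z (tk 3)} \<union> Y \<subseteq> {x \<in> V. bef s x (tk 3)}" using ZV by blast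
    have "card ({z \<in> Z. bef s z (tk 3)} \<union> Y) = 13"
      using Zcard[of s] sI cY fY part by (subst card_Un_disjoint) auto
    then have "13 \<le> cnt V s (tk 3)" unfolding cnt_def using card_mono[OF _ sub] fin by simp
    then show False using c by simp
  qed
  have Wafter: "bef t z w" if "z \<in> Z" "w \<in> W" "u0 \<le> t" "t \<le> u1" for z w t
  proof (rule bef_between[of z w u0 u1])
    show "bef u1 z w" using dec1 that unfolding layered_def by blast
  qed (use that ZV first u01 in auto)
  have allY: "bef (s + 1) y (tk 3)" if y: "y \<in> Y" for y
  proof -
    have noW: "\<not> bef (s + 1) w (tk 3)" if w: "w \<in> W" for w
      using Wafter[OF z3(1) w, of "s + 1"] asym[of "tk 3" w "s + 1"] v3V w ZV su sI by auto
    have "{x \<in> V. bef (s + 1) x (tk 3)} = {z \<in> Z. bef (s + 1) z (tk 3)} \<union> {y \<in> Y. bef (s + 1) y (tk 3)}"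
      using part(1) noW by blast
    then have "13 = card ({z \<in> Z. bef (s + 1) z (tk 3)} \<union> {y \<in> Y. bef (s + 1) y (tk 3)})"
      using c(2) unfolding cnt_def by simp
    also have "\<dots> = 3 + card {y \<in> Y. bef (s + 1) y (tk 3)}"
      using Zcard[of "s + 1"] sI fY part(2) by (subst card_Un_disjoint) auto
    finally have "card {y \<in> Y. bef (s + 1) y (tk 3)} = card Y" using cY by simp
    then have "{y \<in> Y. bef (s + 1) y (tk 3)} = Y" using fY by (intro card_subset_eq) auto
    then show ?thesis using y by blast
  qed
  have y0Y: "y0 \<in> Y"
  proof (rule ccontr)
    assume "y0 \<notin> Y"
    then have "y0 \<in> W" using y0(1) part by blast
    then have "bef (s + 1) (tk 3) y0" using Wafter[OF z3(1), of y0 "s + 1"] su sI by auto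
    then show False using asym[of "tk 3" y0 "s + 1"] swpD[OF y0(2)] by blast
  qed
  have after3: "bef (s + 1) (tk 3) z" if "z \<in> Z" "3 < ix z" for z
  proof -
    have "z \<noteq> tk 3" using that z3 by auto
    then have "\<not> bef (s + 1) z (tk 3)" using bz[OF that(1), of "s + 1"] that sI by auto
    then show ?thesis using not_bef[of z "tk 3" "s + 1"] that ZV v3V \<open>z \<noteq> tk 3\<close> by blast
  qed
  have bich: "t \<le> s" if t: "t \<in> I" "x \<in> Z" "y \<in> Y" "swp t x y" "cnt V t y \<in> {13, 17}" for t x y
  proof (rule ccontr)
    assume ts: "\<not> t \<le> s"
    have "t \<in> sb (cnt V t y) x" unfolding sb_def using t ZV by auto
    then have "3 \<le> ix x" using low_tok[OF t(2)] t(5) by (metis empty_iff insertE le_less_linear less_Suc_eq_le numeral_2_eq_2 numeral_3_eq_3 singletonD)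
    then have "x = tk 3 \<or> 3 < ix x" using tk_ix[OF t(2)] by force
    then have yx: "bef (s + 1) y x"
    proof
      assume "x = tk 3" then show ?thesis using allY t by blast
    next
      assume "3 < ix x"
      then show ?thesis using tr[of y "tk 3" x "s + 1"] allY[OF t(3)] after3[OF t(2)] t ZV v3V by blast
    qed
    have "bef t y x"
      by (rule bef_after[of x y u0 "s + 1" t]) (use t ZV first yx sI ts in \<open>auto simp: I_def\<close>)
    then show False using asym[of x y t] swpD[OF t(4)] by blast
  qed
  have mono: "s < t" if t: "t \<in> I" "x \<in> Z" "y \<in> Z" "swp t x y" "cnt V t y \<in> {13, 17}" for t x y
  proof (rule ccontr)
    assume ts: "\<not> s < t"
    have tI: "u0 \<le> t" using t unfolding I_def by simp
    have "t \<in> so (cnt V t y) x" unfolding so_def using t by auto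
    then have ixx: "ix x < 3" using so_high[OF t(2)] t(5) by (metis empty_iff insertE le_less_linear singletonD)
    then have "x \<noteq> tk 3" using z3 by auto
    then have "bef (t + 1) x (tk 3)" using bz[OF t(2), of "t + 1"] ixx ts tI by auto
    then have "cnt V (t + 1) x < cnt V (t + 1) (tk 3)" using cnt_less[OF subset_refl] t ZV v3V by blast
    moreover have "13 \<le> cnt V (t + 1) x" using cnt_ge_1_swp[OF t(4)] t(5) by auto
    moreover have "cnt V (t + 1) (tk 3) \<le> 13" using s(3)[of "t + 1"] c(2) ts tI by (cases "t = s") auto
    ultimately show False by simp
  qed
  show ?thesis
    by (rule exI[of _ s]) (use sI su y0Y y0 allY after3 bich mono c in blast)
qed

end

section \<open>The four middle positions\<close>

context circular_seq
begin

definition window :: "int \<Rightarrow> 'a set" where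
  "window t = {v \<in> V. 13 \<le> cnt V t v \<and> cnt V t v \<le> 16}"

text \<open>The pairs that stay in the positions \<open>13..16\<close> until they are transposed. A token entering these positions
creates at most three such pairs and every transposition among them uses one up; in the tight case the totals
agree, so every token that enters is transposed with all three tokens that it meets there.\<close>

definition unswapped :: "int \<Rightarrow> 'a \<Rightarrow> 'a \<Rightarrow> bool" where
  "unswapped t x y \<longleftrightarrow> bef t x y \<and> (\<exists>s. t \<le> s \<and> s < t + N \<and> swp s x y \<and>
     (\<forall>r. t \<le> r \<and> r \<le> s \<longrightarrow> x \<in> window r \<and> y \<in> window r))"

definition U :: "int \<Rightarrow> ('a \<times> 'a) set" where "U t = {(x, y). unswapped t x y}"

lemma uns_V: "unswapped t x y \<Longrightarrow> x \<in> V \<and> y \<in> V" unfolding unswapped_def using swpD(1,2) by blast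

lemma finU: "finite (U t)"
  by (rule finite_subset[of _ "V \<times> V"]) (use uns_V fin in \<open>auto simp: U_def\<close>)

lemma uns_Win: "unswapped t x y \<Longrightarrow> x \<in> window t \<and> y \<in> window t" unfolding unswapped_def by blast

lemma cnt_unchanged: "swp t p q \<Longrightarrow> x \<in> V \<Longrightarrow> x \<noteq> p \<Longrightarrow> x \<noteq> q \<Longrightarrow> cnt V (t + 1) x = cnt V t x"
  by (rule cnt_step_swp[OF _ subset_refl])

lemma Win_same:
  assumes "x \<in> V" "\<And>p q. swp t p q \<Longrightarrow> cnt V t q \<noteq> 13 \<and> cnt V t q \<noteq> 17"
  shows "x \<in> window (t + 1) \<longleftrightarrow> x \<in> window t"
proof (cases "\<exists>y. swp t x y \<or> swp t y x")
  case False
  have "cnt V (t + 1) x = cnt V t x" by (rule cnt_step_other) (use False assms in auto)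
  then show ?thesis unfolding window_def by simp
next
  case True
  then obtain y where "swp t x y \<or> swp t y x" by blast
  then show ?thesis
  proof
    assume s: "swp t x y"
    have "cnt V t y \<noteq> 13 \<and> cnt V t y \<noteq> 17" using assms(2)[OF s] .
    then show ?thesis using cnt_ge_1_swp[OF s] unfolding window_def by auto
  next
    assume s: "swp t y x"
    have "cnt V t x \<noteq> 13 \<and> cnt V t x \<noteq> 17" using assms(2)[OF s] .
    then show ?thesis using cnt_ge_1_swp[OF s] unfolding window_def by auto
  qed
qed

end

text \<open>The numbers are \<open>435 - 291\<close> and \<open>435 - 243\<close>. Each of the
  \<open>192 - 144 = 48\<close> swaps at levels 13 and 17 lets one token in, and
  \<open>3 * 48 = 144\<close> is the equality everything here rests on. The assumption
  \<open>leave\<close> keeps a pair from remaining inside until its next swap half a turn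
  later.\<close>

locale tight_window = circular_seq +
  assumes c30: "card V = 30"
    and leave: "\<And>v a. v \<in> V \<Longrightarrow> \<exists>r. a \<le> r \<and> r < a + N \<and> v \<notin> window r"
    and m13: "\<And>u. card {t \<in> {u..<u + N}. mid 13 t} = 144"
    and m12: "\<And>u. card {t \<in> {u..<u + N}. mid 12 t} = 192"
begin

lemma card_Win: "card (window t) = 4"
proof -
  have "window t = fst_set V 17 t - fst_set V 13 t" unfolding window_def fst_set_def by auto
  moreover have "fst_set V 13 t \<subseteq> fst_set V 17 t" unfolding fst_set_def by auto
  moreover have "card (fst_set V 17 t) = 17" "card (fst_set V 13 t) = 13" using card_fst_set[of V] c30 by auto
  moreover have "finite (fst_set V 13 t)" unfolding fst_set_def using fin by simp
  ultimately show ?thesis by (simp add: card_Diff_subset)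
qed

lemma mid_iff: "swp t p q \<Longrightarrow> mid K t \<longleftrightarrow> K < cnt V t q \<and> cnt V t q < 30 - K"
  unfolding mid_def c30 using ev_swp ev_unique by blast

lemma mid_mono: "mid 13 t \<Longrightarrow> mid 12 t"
proof -
  assume "mid 13 t"
  then obtain j where "13 < j" "j < 17" "ev V j t" unfolding mid_def c30 by auto
  then show ?thesis unfolding mid_def c30 by (intro exI[of _ j]) auto
qed

section \<open>Counting the pending pairs without slack\<close>

lemma uns_stay: "unswapped t x y \<Longrightarrow> \<not> swp t x y \<Longrightarrow> unswapped (t + 1) x y"
proof -
  assume a: "unswapped t x y" "\<not> swp t x y"
  obtain s where s: "t \<le> s" "s < t + N" "swp s x y" "\<forall>r. t \<le> r \<and> r \<le> s \<longrightarrow> x \<in> window r \<and> y \<in> window r"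
    using a unfolding unswapped_def by blast
  have "s \<noteq> t" using s a by auto
  then have ts: "t + 1 \<le> s" using s by simp
  have "bef (t + 1) x y"
  proof (rule bef_between[of x y t s])
    show "bef t x y" using a unfolding unswapped_def by blast
  qed (use s ts swpD[OF s(3)] in auto)
  then show ?thesis unfolding unswapped_def using s ts by (intro conjI exI[of _ s]) auto
qed

text \<open>If both tokens were inside before, the pair was pending before, unless its swap came
  into reach only now, at distance exactly \<open>N\<close>. Then both would have been inside for
  half a turn, against \<open>leave\<close>.\<close>

lemma uns_new:
  assumes "unswapped (t + 1) x y" "\<not> unswapped t x y"
  shows "(x \<notin> window t \<or> y \<notin> window t) \<and> x \<in> window (t + 1) \<and> y \<in> window (t + 1) \<and> bef (t + 1) x y"
proof -
  have V: "x \<in> V" "y \<in> V" using uns_V assms(1) by auto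
  obtain s where s: "t + 1 \<le> s" "s < t + 1 + N" "swp s x y" "\<forall>r. t + 1 \<le> r \<and> r \<le> s \<longrightarrow> x \<in> window r \<and> y \<in> window r"
    using assms(1) unfolding unswapped_def by blast
  have b: "bef (t + 1) x y" using assms(1) unfolding unswapped_def by blast
  have sN: "s \<noteq> t + N"
  proof
    assume e: "s = t + N"
    obtain r where "t + 1 \<le> r" "r < t + 1 + N" "x \<notin> window r" using leave[OF V(1), of "t + 1"] by blast
    then show False using s(4) e by auto
  qed
  have "\<not> swp t y x"
  proof
    assume "swp t y x"
    then have "s = t + N" using swp_next[of t y x s] s by auto
    then show False using sN by simp
  qed
  moreover have "\<not> swp t x y" using b swpD(4)[of t x y] asym V by blast
  ultimately have bt: "bef t x y" using nochange[of x y t] V b by blast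
  have "x \<notin> window t \<or> y \<notin> window t"
  proof (rule ccontr)
    assume n: "\<not> (x \<notin> window t \<or> y \<notin> window t)"
    have "\<forall>r. t \<le> r \<and> r \<le> s \<longrightarrow> x \<in> window r \<and> y \<in> window r"
    proof (intro allI impI)
      fix r assume "t \<le> r \<and> r \<le> s"
      then show "x \<in> window r \<and> y \<in> window r" using n s(4) by (cases "r = t") auto
    qed
    then have "unswapped t x y" unfolding unswapped_def using bt s sN by (intro conjI exI[of _ s]) auto
    then show False using assms(2) by simp
  qed
  then show ?thesis using b uns_Win[OF assms(1)] by blast
qed

definition entrant :: "int \<Rightarrow> ('a \<times> 'a) set" where
  "entrant t = {(x, y). (x \<notin> window t \<or> y \<notin> window t) \<and> x \<in> window (t + 1) \<and> y \<in> window (t + 1) \<and> bef (t + 1) x y}"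

text \<open>The arriving token takes position 13, in front of the other three tokens inside, so it
  is the first component of each new pair.\<close>

lemma entrant_left:
  assumes "swp t p q" "cnt V t q = 13"
  shows "entrant t = Pair p ` (window (t + 1) - {p})" "p \<in> window (t + 1)" "p \<notin> window t"
proof -
  note c = cnt_ge_1_swp[OF assms(1)] and D = swpD[OF assms(1)]
  show pW: "p \<in> window (t + 1)" "p \<notin> window t" unfolding window_def using c assms(2) D by auto
  have other: "x \<in> window t" if "x \<in> window (t + 1)" "x \<noteq> p" for x
  proof -
    have "x \<noteq> q" using that(1) c assms(2) unfolding window_def by auto
    then show ?thesis using cnt_unchanged[OF assms(1), of x] that unfolding window_def by auto
  qed
  have bp: "bef (t + 1) p y" if y: "y \<in> window (t + 1)" "y \<noteq> p" for y
  proof (rule ccontr)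
    assume "\<not> bef (t + 1) p y"
    then have "bef (t + 1) y p" using not_bef[of p y "t + 1"] y D unfolding window_def by blast
    then have "cnt V (t + 1) y < cnt V (t + 1) p" using cnt_less[OF subset_refl] y D unfolding window_def by blast
    then show False using y c assms(2) unfolding window_def by simp
  qed
  show "entrant t = Pair p ` (window (t + 1) - {p})"
  proof (rule set_eqI)
    fix z :: "'a \<times> 'a"
    obtain x y where z: "z = (x, y)" by (cases z)
    have "(x, y) \<in> entrant t \<longleftrightarrow> x = p \<and> y \<in> window (t + 1) \<and> y \<noteq> p"
    proof
      assume e: "(x, y) \<in> entrant t"
      then have e': "x \<notin> window t \<or> y \<notin> window t" "x \<in> window (t + 1)" "y \<in> window (t + 1)" "bef (t + 1) x y"
        unfolding entrant_def by auto
      have "y \<noteq> p"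
      proof
        assume "y = p"
        moreover have "x \<noteq> p" using calculation e' irr[OF D(1)] by blast
        ultimately show False using bp[OF e'(2)] e'(4) asym[of p x "t + 1"] D(1) e'(2) unfolding window_def by blast
      qed
      moreover have "x = p" using other[OF e'(2)] other[OF e'(3)] e'(1) calculation by blast
      ultimately show "x = p \<and> y \<in> window (t + 1) \<and> y \<noteq> p" using e' by blast
    next
      assume e: "x = p \<and> y \<in> window (t + 1) \<and> y \<noteq> p"
      then show "(x, y) \<in> entrant t" unfolding entrant_def using pW bp by blast
    qed
    then show "z \<in> entrant t \<longleftrightarrow> z \<in> Pair p ` (window (t + 1) - {p})" unfolding z by auto
  qed
qed

lemma entrant_right:
  assumes "swp t p q" "cnt V t q = 17"
  shows "entrant t = (\<lambda>y. (y, q)) ` (window (t + 1) - {q})" "q \<in> window (t + 1)" "q \<notin> window t"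
proof -
  note c = cnt_ge_1_swp[OF assms(1)] and D = swpD[OF assms(1)]
  show pW: "q \<in> window (t + 1)" "q \<notin> window t" unfolding window_def using c assms(2) D by auto
  have other: "x \<in> window t" if "x \<in> window (t + 1)" "x \<noteq> q" for x
  proof -
    have "x \<noteq> p" using that(1) c assms(2) unfolding window_def by auto
    then show ?thesis using cnt_unchanged[OF assms(1), of x] that unfolding window_def by auto
  qed
  have bq: "bef (t + 1) y q" if y: "y \<in> window (t + 1)" "y \<noteq> q" for y
  proof (rule ccontr)
    assume "\<not> bef (t + 1) y q"
    then have "bef (t + 1) q y" using not_bef[of q y "t + 1"] y D unfolding window_def by blast
    then have "cnt V (t + 1) q < cnt V (t + 1) y" using cnt_less[OF subset_refl] y D unfolding window_def by blast
    then show False using y c assms(2) unfolding window_def by simp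
  qed
  show "entrant t = (\<lambda>y. (y, q)) ` (window (t + 1) - {q})"
  proof (rule set_eqI)
    fix z :: "'a \<times> 'a"
    obtain x y where z: "z = (x, y)" by (cases z)
    have "(x, y) \<in> entrant t \<longleftrightarrow> y = q \<and> x \<in> window (t + 1) \<and> x \<noteq> q"
    proof
      assume e: "(x, y) \<in> entrant t"
      then have e': "x \<notin> window t \<or> y \<notin> window t" "x \<in> window (t + 1)" "y \<in> window (t + 1)" "bef (t + 1) x y"
        unfolding entrant_def by auto
      have "x \<noteq> q"
      proof
        assume "x = q"
        moreover have "y \<noteq> q" using calculation e' irr[OF D(2)] by blast
        ultimately show False using bq[OF e'(3)] e'(4) asym[of q y "t + 1"] D(2) e'(3) unfolding window_def by blast
      qed
      moreover have "y = q" using other[OF e'(2)] other[OF e'(3)] e'(1) calculation by blast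
      ultimately show "y = q \<and> x \<in> window (t + 1) \<and> x \<noteq> q" using e' by blast
    next
      assume e: "y = q \<and> x \<in> window (t + 1) \<and> x \<noteq> q"
      then show "(x, y) \<in> entrant t" unfolding entrant_def using pW bq by blast
    qed
    then show "z \<in> entrant t \<longleftrightarrow> z \<in> (\<lambda>y. (y, q)) ` (window (t + 1) - {q})" unfolding z by auto
  qed
qed

text \<open>The largest possible change of \<open>card (U t)\<close>: a swap inside uses up one
  pending pair, and an entry creates at most three.\<close>

definition wt :: "int \<Rightarrow> int" where
  "wt t = (if mid 13 t then - 1 else if mid 12 t then 3 else 0)"

lemma U_sub: "U (t + 1) \<subseteq> (U t - {(x, y). swp t x y}) \<union> entrant t"
proof
  fix z assume z: "z \<in> U (t + 1)"
  obtain x y where xy: "z = (x, y)" by (cases z)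
  have u: "unswapped (t + 1) x y" using z xy unfolding U_def by simp
  show "z \<in> (U t - {(x, y). swp t x y}) \<union> entrant t"
  proof (cases "unswapped t x y")
    case True
    have "\<not> swp t x y" using u swpD(4)[of t x y] asym[of x y "t + 1"] uns_V[OF u] unfolding unswapped_def by blast
    then show ?thesis using True xy unfolding U_def by blast
  next
    case False
    then show ?thesis using uns_new[OF u False] xy unfolding entrant_def by blast
  qed
qed

lemma entrant_none:
  assumes "\<And>p q. swp t p q \<Longrightarrow> cnt V t q \<noteq> 13 \<and> cnt V t q \<noteq> 17"
  shows "entrant t = {}"
proof -
  have "x \<in> window t" if "x \<in> window (t + 1)" for x
  proof -
    have "x \<in> V" using that unfolding window_def by blast
    then show ?thesis using Win_same[of x t] assms that by blast
  qed
  then show ?thesis unfolding entrant_def by blast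
qed

lemma card_entrant: "card (entrant t) = (if mid 12 t \<and> \<not> mid 13 t then 3 else 0)"
proof (cases "\<exists>p q. swp t p q \<and> (cnt V t q = 13 \<or> cnt V t q = 17)")
  case True
  then obtain p q where s: "swp t p q" "cnt V t q = 13 \<or> cnt V t q = 17" by blast
  have m: "mid 12 t \<and> \<not> mid 13 t" using mid_iff[OF s(1), of 12] mid_iff[OF s(1), of 13] s(2) by auto
  have f: "finite (window (t + 1))" using card_Win[of "t + 1"] card_ge_0_finite[of "window (t + 1)"] by simp
  have "card (entrant t) = 3"
    using s(2)
  proof
    assume c: "cnt V t q = 13"
    show ?thesis unfolding entrant_left(1)[OF s(1) c]
      using entrant_left(2)[OF s(1) c] f card_Win[of "t + 1"] by (simp add: card_image inj_on_def)
  next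
    assume c: "cnt V t q = 17"
    show ?thesis unfolding entrant_right(1)[OF s(1) c]
      using entrant_right(2)[OF s(1) c] f card_Win[of "t + 1"] by (simp add: card_image inj_on_def)
  qed
  then show ?thesis using m by simp
next
  case False
  have "\<not> (mid 12 t \<and> \<not> mid 13 t)"
  proof
    assume m: "mid 12 t \<and> \<not> mid 13 t"
    then obtain p q where s: "swp t p q" unfolding mid_def ev_def by blast
    have "cnt V t q = 13 \<or> cnt V t q = 17" using m mid_iff[OF s, of 12] mid_iff[OF s, of 13] by auto
    then show False using False s by blast
  qed
  then show ?thesis using entrant_none[of t] False by auto
qed

lemma finE: "finite (entrant t)"
proof -
  have "entrant t \<subseteq> V \<times> V" unfolding entrant_def window_def by auto
  then show ?thesis using fin by (meson finite_SigmaI finite_subset)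
qed

lemma mid13_U: "mid 13 t \<Longrightarrow> \<exists>x y. swp t x y \<and> (x, y) \<in> U t"
proof -
  assume m: "mid 13 t"
  then obtain x y where s: "swp t x y" unfolding mid_def ev_def by blast
  have c: "13 < cnt V t y \<and> cnt V t y < 17" using m mid_iff[OF s, of 13] by simp
  have w: "x \<in> window t" "y \<in> window t" using c cnt_ge_1_swp(1)[OF s] swpD[OF s] unfolding window_def by auto
  have "unswapped t x y" unfolding unswapped_def using s w N_pos swpD(3)[OF s]
    by (intro conjI exI[of _ t]) auto
  then show ?thesis using s unfolding U_def by blast
qed

lemma U_step: "int (card (U (t + 1))) \<le> int (card (U t)) + wt t"
    "int (card (U (t + 1))) = int (card (U t)) + wt t \<Longrightarrow> mid 12 t \<Longrightarrow> \<not> mid 13 t \<Longrightarrow> entrant t \<subseteq> U (t + 1)"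
proof -
  let ?R = "U t - {(x, y). swp t x y}"
  have fR: "finite ?R" using finU by simp
  have cR: "int (card ?R) \<le> int (card (U t)) - (if mid 13 t then 1 else 0)"
  proof (cases "mid 13 t")
    case True
    then obtain x y where "swp t x y" "(x, y) \<in> U t" using mid13_U by blast
    then have "?R \<subset> U t" by blast
    then have "card ?R < card (U t)" using finU by (simp add: psubset_card_mono)
    then show ?thesis using True by simp
  next
    case False
    have "card ?R \<le> card (U t)" by (rule card_mono[OF finU]) blast
    then show ?thesis using False by simp
  qed
  have un: "card (?R \<union> entrant t) \<le> card ?R + card (entrant t)" by (rule card_Un_le)
  have le: "card (U (t + 1)) \<le> card (?R \<union> entrant t)" by (rule card_mono) (use fR finE U_sub in auto)
  note m = mid_mono[of t]
  show "int (card (U (t + 1))) \<le> int (card (U t)) + wt t"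
    using le un cR card_entrant[of t] m unfolding wt_def by (auto split: if_splits)
  assume e: "int (card (U (t + 1))) = int (card (U t)) + wt t" "mid 12 t" "\<not> mid 13 t"
  have "card (U (t + 1)) = card (?R \<union> entrant t)"
    using e le un cR card_entrant[of t] unfolding wt_def by auto
  then have "U (t + 1) = ?R \<union> entrant t" using U_sub fR finE by (intro card_subset_eq) auto
  then show "entrant t \<subseteq> U (t + 1)" by blast
qed

lemma Win_shift: "window (t + N) = window t"
proof -
  have "cnt V (t + N) v = 29 - cnt V t v" if "v \<in> V" for v using cnt_flip_in[of V v t] that c30 by simp
  moreover have "cnt V t v < 30" if "v \<in> V" for v using cnt_bound[of V v t] that c30 by simp
  ultimately show ?thesis unfolding window_def by force
qed

lemma uns_shift: "unswapped t x y \<Longrightarrow> unswapped (t + N) y x"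
proof -
  assume u: "unswapped t x y"
  obtain s where s: "t \<le> s" "s < t + N" "swp s x y" "\<forall>r. t \<le> r \<and> r \<le> s \<longrightarrow> x \<in> window r \<and> y \<in> window r"
    using u unfolding unswapped_def by blast
  have "bef (t + N) y x" using u flip[of y x t] uns_V[OF u] unfolding unswapped_def by blast
  moreover have "swp (s + N) y x" using s swp_flip by blast
  moreover have "y \<in> window r \<and> x \<in> window r" if "t + N \<le> r" "r \<le> s + N" for r
    using s(4) that Win_shift[of "r - N"] by auto
  ultimately show ?thesis unfolding unswapped_def using s by (intro conjI exI[of _ "s + N"]) auto
qed

lemma card_U_shift: "card (U (t + N)) \<ge> card (U t)"
proof -
  have "prod.swap ` U t \<subseteq> U (t + N)" using uns_shift unfolding U_def by auto
  moreover have "card (prod.swap ` U t) = card (U t)" by (rule card_image) (auto simp: inj_on_def)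
  ultimately show ?thesis using card_mono[OF finU, of "prod.swap ` U t" "t + N"] by simp
qed

lemma sum_wt: "(\<Sum>t\<in>{u..<u + N}. wt t) = 0"
proof -
  let ?A = "{t \<in> {u..<u + N}. mid 13 t}" and ?B = "{t \<in> {u..<u + N}. mid 12 t}"
  have sub: "?A \<subseteq> ?B" using mid_mono by blast
  have "(\<Sum>t\<in>{u..<u + N}. wt t) = (\<Sum>t\<in>{u..<u + N}. (if t \<in> ?B then 3 else 0) - (if t \<in> ?A then 4 else 0))"
    by (rule sum.cong) (use sub in \<open>auto simp: wt_def\<close>)
  also have "\<dots> = (\<Sum>t\<in>{u..<u + N}. if t \<in> ?B then 3 else 0) - (\<Sum>t\<in>{u..<u + N}. if t \<in> ?A then 4 else 0)"
    by (rule sum_subtractf)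
  also have "\<dots> = 3 * int (card ?B) - 4 * int (card ?A)"
    by (simp add: sum.If_cases Int_def conj_commute)
  also have "\<dots> = 0" unfolding m12 m13 by simp
  finally show ?thesis .
qed

text \<open>The defect \<open>d\<close> is nonnegative at each step. Over half a turn it sums to at
  most zero, because the weights cancel and every pair pending at \<open>t\<close> is pending,
  reversed, at \<open>t + N\<close>.\<close>

lemma U_tight: "int (card (U (t + 1))) = int (card (U t)) + wt t"
proof -
  define d where "d s = int (card (U s)) + wt s - int (card (U (s + 1)))" for s
  have d0: "0 \<le> d s" for s using U_step(1)[of s] unfolding d_def by simp
  have tele: "(\<Sum>s\<in>{t..<b}. int (card (U s)) - int (card (U (s + 1)))) = int (card (U t)) - int (card (U b))"
    if "t \<le> b" for b
    using that
  proof (induction b rule: int_ge_induct)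
    case (step b)
    have "{t..<b + 1} = insert b {t..<b}" using step.hyps by auto
    then show ?case using step.IH by simp
  qed simp
  have "(\<Sum>s\<in>{t..<t + N}. d s) = (\<Sum>s\<in>{t..<t + N}. (int (card (U s)) - int (card (U (s + 1)))) + wt s)"
    unfolding d_def by (rule sum.cong) auto
  also have "\<dots> = (int (card (U t)) - int (card (U (t + N)))) + 0"
    unfolding sum.distrib sum_wt using tele[of "t + N"] N_pos by simp
  also have "\<dots> \<le> 0" using card_U_shift[of t] by simp
  finally have "(\<Sum>s\<in>{t..<t + N}. d s) \<le> 0" .
  moreover have "d t \<le> (\<Sum>s\<in>{t..<t + N}. d s)"
    by (rule member_le_sum) (use d0 N_pos in auto)
  ultimately have "d t = 0" using d0[of t] by simp
  then show ?thesis unfolding d_def by simp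
qed

lemma enter_left: "swp t p q \<Longrightarrow> cnt V t q = 13 \<Longrightarrow> y \<in> window (t + 1) \<Longrightarrow> y \<noteq> p \<Longrightarrow> unswapped (t + 1) p y"
proof -
  assume a: "swp t p q" "cnt V t q = 13" "y \<in> window (t + 1)" "y \<noteq> p"
  have "entrant t \<subseteq> U (t + 1)" by (rule U_step(2)[OF U_tight]) (use mid_iff[OF a(1), of 12] mid_iff[OF a(1), of 13] a(2) in auto)
  then show ?thesis unfolding entrant_left(1)[OF a(1,2)] U_def using a by auto
qed

lemma enter_right: "swp t p q \<Longrightarrow> cnt V t q = 17 \<Longrightarrow> y \<in> window (t + 1) \<Longrightarrow> y \<noteq> q \<Longrightarrow> unswapped (t + 1) y q"
proof -
  assume a: "swp t p q" "cnt V t q = 17" "y \<in> window (t + 1)" "y \<noteq> q"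
  have "entrant t \<subseteq> U (t + 1)" by (rule U_step(2)[OF U_tight]) (use mid_iff[OF a(1), of 12] mid_iff[OF a(1), of 13] a(2) in auto)
  then show ?thesis unfolding entrant_right(1)[OF a(1,2)] U_def using a by auto
qed

text \<open>Go back to the last moment at which the two tokens were not both inside. One of them
  entered then and met the other, and by tightness an entering token is exchanged with all it meets
  before either leaves. The swap may lie before or after \<open>t\<close>, hence \<open>min\<close>
  and \<open>max\<close>.\<close>

lemma joint:
  assumes "x \<in> window t" "y \<in> window t" "x \<noteq> y"
  obtains s where "swp s x y \<or> swp s y x" "\<And>r. min s t \<le> r \<Longrightarrow> r \<le> max s t \<Longrightarrow> x \<in> window r \<and> y \<in> window r"
proof -
  have V: "x \<in> V" "y \<in> V" using assms unfolding window_def by auto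
  define A where "A = {r \<in> {t - N..t}. \<not> (x \<in> window r \<and> y \<in> window r)}"
  obtain r0 where "t - N \<le> r0" "r0 < t" "x \<notin> window r0" using leave[OF V(1), of "t - N"] by auto
  then have "r0 \<in> A" "finite A" unfolding A_def by auto
  define a where "a = Max A"
  have aA: "a \<in> A" unfolding a_def using \<open>r0 \<in> A\<close> \<open>finite A\<close> by (intro Max_in) auto
  have amax: "r \<le> a" if "r \<in> A" for r unfolding a_def using \<open>finite A\<close> that by simp
  have at: "a < t" "t - N \<le> a" "\<not> (x \<in> window a \<and> y \<in> window a)" using aA assms unfolding A_def by (auto simp: order_le_less)
  have both: "x \<in> window r \<and> y \<in> window r" if "a < r" "r \<le> t" for r
    using amax[of r] that at unfolding A_def by force
  have b1: "x \<in> window (a + 1)" "y \<in> window (a + 1)" using both[of "a + 1"] at by auto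
  have "\<exists>p q. swp a p q \<and> (cnt V a q = 13 \<or> cnt V a q = 17)"
  proof (rule ccontr)
    assume "\<not> ?thesis"
    then have "x \<in> window a" "y \<in> window a" using Win_same[OF V(1), of a] Win_same[OF V(2), of a] b1 by blast+
    then show False using at by blast
  qed
  then obtain p q where pq: "swp a p q" "cnt V a q = 13 \<or> cnt V a q = 17" by blast
  have "unswapped (a + 1) x y \<or> unswapped (a + 1) y x"
    using pq(2)
  proof
    assume c: "cnt V a q = 13"
    have "x = p \<or> y = p"
    proof (rule ccontr)
      assume n: "\<not> (x = p \<or> y = p)"
      have "x \<noteq> q" "y \<noteq> q" using b1 cnt_ge_1_swp[OF pq(1)] c unfolding window_def by auto
      then have "x \<in> window a" "y \<in> window a"
        using b1 cnt_unchanged[OF pq(1) V(1)] cnt_unchanged[OF pq(1) V(2)] n unfolding window_def by auto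
      then show False using at by blast
    qed
    then show ?thesis using enter_left[OF pq(1) c] b1 assms(3) by blast
  next
    assume c: "cnt V a q = 17"
    have "x = q \<or> y = q"
    proof (rule ccontr)
      assume n: "\<not> (x = q \<or> y = q)"
      have "x \<noteq> p" "y \<noteq> p" using b1 cnt_ge_1_swp[OF pq(1)] c unfolding window_def by auto
      then have "x \<in> window a" "y \<in> window a"
        using b1 cnt_unchanged[OF pq(1) V(1)] cnt_unchanged[OF pq(1) V(2)] n unfolding window_def by auto
      then show False using at by blast
    qed
    then show ?thesis using enter_right[OF pq(1) c] b1 assms(3) by blast
  qed
  then obtain s where s: "a + 1 \<le> s" "swp s x y \<or> swp s y x" "\<forall>r. a + 1 \<le> r \<and> r \<le> s \<longrightarrow> x \<in> window r \<and> y \<in> window r"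
    unfolding unswapped_def by blast
  show thesis
  proof (rule that[OF s(2)])
    fix r assume "min s t \<le> r" "r \<le> max s t"
    then show "x \<in> window r \<and> y \<in> window r" using s both[of r] at by (cases "r \<le> s") auto
  qed
qed

end

section \<open>The middle token of a block\<close>

context tight_block
begin

text \<open>Mirror image of \<open>theta_ex\<close>. Under \<open>circ_rev\<close> the class is a
  block with \<open>Y\<close> and \<open>W\<close> exchanged, and level \<open>j\<close> becomes
  \<open>30 - j\<close>, so 13 and 17 trade places.\<close>

lemma theta'_ex:
  "\<exists>s. u1 \<le> s \<and> s < u0 + N \<and> (\<exists>w\<in>W. swp s (tk 3) w \<and> cnt V s w = 17) \<and>
     (\<forall>t\<in>I. \<forall>x\<in>Z. \<forall>w\<in>W. swp t x w \<and> cnt V t w \<in> {13, 17} \<longrightarrow> s \<le> t) \<and>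
     (\<forall>t\<in>I. \<forall>x\<in>Z. \<forall>y\<in>Z. swp t x y \<and> cnt V t y \<in> {13, 17} \<longrightarrow> t < s) \<and>
     (\<forall>z\<in>Z. 3 < ix z \<longrightarrow> bef s z (tk 3)) \<and> (\<forall>w\<in>W. bef s (tk 3) w) \<and> cnt V s (tk 3) = 16"
proof -
  let ?b = "\<lambda>t p q. bef (- t) q p"
  interpret C: circular_seq V N ?b by (rule circ_rev)
  \<comment> \<open>A swap occupies the step from \<open>t\<close> to \<open>t + 1\<close>;
    reversing time therefore sends it to \<open>- t - 1\<close> and not to
    \<open>- t\<close>.\<close>
  have Cswp: "C.swp t p q \<longleftrightarrow> swp (- t - 1) p q" for t p q
  proof -
    have e: "- (t + 1) = - t - 1" "- t - 1 + 1 = - t" by auto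
    show ?thesis unfolding C.swp_def swp_def e by auto
  qed
  have Ccnt: "C.cnt V t q = 29 - cnt V (- t) q" if q: "q \<in> V" for t q
  proof -
    have e: "{x \<in> V. bef (- t) q x} = V - {q} - {x \<in> V. bef (- t) x q}"
      using not_bef[OF q, of _ "- t"] asym[OF q, of _ "- t"] irr[OF q, of "- t"] by blast
    have s: "{x \<in> V. bef (- t) x q} \<subseteq> V - {q}" using irr[OF q] by blast
    have "card (V - {q} - {x \<in> V. bef (- t) x q}) = card (V - {q}) - card {x \<in> V. bef (- t) x q}"
      by (rule card_Diff_subset) (use s fin in auto)
    then show ?thesis unfolding C.cnt_def cnt_def e using q cV fin by simp
  qed
  have le29: "cnt V t q \<le> 29" if "q \<in> V" for t q using cnt_bound[OF subset_refl that, of t] cV by simp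
  have Clev: "C.cnt V t q = 30 - cnt V (- t - 1) q" if s: "swp (- t - 1) p q" for t p q
  proof -
    have "cnt V (- t) q + 1 = cnt V (- t - 1) q" using cnt_ge_1_swp[OF s] by simp
    then show ?thesis using Ccnt[OF swpD(2)[OF s], of t] le29[OF swpD(2)[OF s], of "- t"] by simp
  qed
  have lev_pos: "1 \<le> cnt V t q \<and> cnt V t q \<le> 29" if s: "swp t p q" for t p q
    using cnt_ge_1_swp(1)[OF s] le29[OF swpD(2)[OF s], of t] by simp
  have dec': "C.layered (- u1) W Z Y" using dec1 unfolding C.layered_def layered_def by simp
  have first': "?b (- (u0 + N)) z x" if "z \<in> Z" "x \<in> W \<union> Y" for z x
  proof -
    have "x \<in> V" "z \<in> V" using that ZV by auto
    then have "bef (u0 + N) x z" using first[of z x] that flip[of x z u0] by blast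
    then show ?thesis by (simp only: minus_minus)
  qed
  interpret B: block V N ?b Z W Y "- (u0 + N)" "- u1"
    by unfold_locales (use cV part cZ cY cW first' dec' u01 in auto)
  have BI: "t \<in> B.I \<longleftrightarrow> - t - 1 \<in> I" for t unfolding B.I_def I_def by auto
  have Bzz: "B.inner_swap K t \<longleftrightarrow> inner_swap K (- t - 1)" for K t
  proof -
    have "C.swp t x y \<and> C.cnt V t y \<in> win K \<longleftrightarrow> swp (- t - 1) x y \<and> cnt V (- t - 1) y \<in> win K" for x y
      unfolding Cswp using Clev[of t x y] lev_pos[of "- t - 1" x y] unfolding win_def by auto
    then show ?thesis unfolding B.inner_swap_def inner_swap_def by simp
  qed
  have cc: "card {t \<in> B.I. B.inner_swap K t} = card {t \<in> I. inner_swap K t}" for K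
  proof (rule bij_betw_same_card[of "\<lambda>t. - t - 1"], rule bij_betwI[of _ _ _ "\<lambda>t. - t - 1"])
    show "(\<lambda>t. - t - 1) \<in> {t \<in> B.I. B.inner_swap K t} \<rightarrow> {t \<in> I. inner_swap K t}" using BI Bzz by auto
    show "(\<lambda>t. - t - 1) \<in> {t \<in> I. inner_swap K t} \<rightarrow> {t \<in> B.I. B.inner_swap K t}"
    proof
      fix t assume t: "t \<in> {t \<in> I. inner_swap K t}"
      have e: "- (- t - 1) - 1 = t" by simp
      show "- t - 1 \<in> {t \<in> B.I. B.inner_swap K t}" using t BI[of "- t - 1"] Bzz[of K "- t - 1"] unfolding e by simp
    qed
  qed auto
  interpret R: tight_block V N ?b Z W Y "- (u0 + N)" "- u1"
    by unfold_locales (use cc e12 e13 in auto)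
  \<comment> \<open>The class keeps its numbering: the order at \<open>u0 + N\<close>, read
    backwards, is the order at \<open>u0\<close>.\<close>
  have Rix: "B.ix v = ix v" if v: "v \<in> V" for v
    unfolding B.ix_def ix_def Ccnt[OF v] using cnt_flip_in[OF subset_refl v, of u0] cV le29[OF v, of u0] by (simp add: add.commute[of N u0])
  have Rtk: "R.tk i = tk i" for i
  proof -
    have "(v \<in> Z \<and> B.ix v = i) = (v \<in> Z \<and> ix v = i)" for v using Rix[of v] ZV by auto
    then show ?thesis unfolding R.tk_def tk_def by simp
  qed
  obtain s where s: "- (u0 + N) \<le> s" "s < - u1" "\<exists>y\<in>W. C.swp s (tk 3) y \<and> C.cnt V s y = 13"
     "\<forall>t\<in>B.I. \<forall>x\<in>Z. \<forall>y\<in>W. C.swp t x y \<and> C.cnt V t y \<in> {13, 17} \<longrightarrow> t \<le> s"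
     "\<forall>t\<in>B.I. \<forall>x\<in>Z. \<forall>y\<in>Z. C.swp t x y \<and> C.cnt V t y \<in> {13, 17} \<longrightarrow> s < t"
     "\<forall>z\<in>Z. 3 < B.ix z \<longrightarrow> bef (- (s + 1)) z (tk 3)" "\<forall>y\<in>W. bef (- (s + 1)) (tk 3) y"
     "C.cnt V (s + 1) (tk 3) = 13"
    using R.theta_ex unfolding Rtk by blast
  define r where "r = - s - 1"
  have es: "- (s + 1) = r" "s = - r - 1" unfolding r_def by auto
  have z3: "tk 3 \<in> Z" "tk 3 \<in> V" using tk[of 3] ZV by auto
  have lv: "C.cnt V (- t - 1) y \<in> {13, 17}" if "swp t x y" "cnt V t y \<in> {13, 17}" for t x y
    using Clev[of "- t - 1" x y] that by auto
  have sw: "C.swp (- t - 1) x y" if "swp t x y" for t x y unfolding Cswp using that by simp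
  have ri: "- t - 1 \<in> B.I" if "t \<in> I" for t using BI[of "- t - 1"] that by simp
  show ?thesis
  proof (intro exI[of _ r] conjI ballI impI)
    show "u1 \<le> r" "r < u0 + N" using s(1,2) unfolding r_def by auto
    obtain y where y: "y \<in> W" "C.swp s (tk 3) y" "C.cnt V s y = 13" using s(3) by blast
    have "swp r (tk 3) y" using y(2) unfolding Cswp r_def .
    moreover have "cnt V r y = 17" using Clev[of s "tk 3" y] y(2,3) lev_pos[OF calculation] unfolding Cswp r_def by auto
    ultimately show "\<exists>w\<in>W. swp r (tk 3) w \<and> cnt V r w = 17" using y(1) by blast
    show "r \<le> t" if "t \<in> I" "x \<in> Z" "w \<in> W" "swp t x w \<and> cnt V t w \<in> {13, 17}" for t x w
    proof -
      have "- t - 1 \<le> s" using s(4) ri[OF that(1)] that sw[of t x w] lv[of t x w] by blast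
      then show ?thesis unfolding r_def by simp
    qed
    show "t < r" if "t \<in> I" "x \<in> Z" "y \<in> Z" "swp t x y \<and> cnt V t y \<in> {13, 17}" for t x y
    proof -
      have "s < - t - 1" using s(5) ri[OF that(1)] that sw[of t x y] lv[of t x y] by blast
      then show ?thesis unfolding r_def by simp
    qed
    show "bef r z (tk 3)" if "z \<in> Z" "3 < ix z" for z
      using s(6) that Rix[of z] ZV unfolding es(1) by auto
    show "bef r (tk 3) w" if "w \<in> W" for w using s(7) that unfolding es(1) by blast
    have "C.cnt V (s + 1) (tk 3) = 29 - cnt V r (tk 3)" using Ccnt[OF z3(2), of "s + 1"] es by simp
    then show "cnt V r (tk 3) = 16" using s(8) le29[OF z3(2), of r] by simp
  qed
qed

end

section \<open>Between the two passages of token 3 through levels 13 and 17\<close>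

locale window_block = tight_block V N bef Z Y W u0 u1 + tight_window V N bef
  for V :: "'a set" and N bef Z Y W u0 u1
begin

text \<open>The moment at which token 3 passes level 13. Its counterpart \<open>th'\<close> belongs
  to level 17, and these two moments bound the phase in which the class has the middle to
  itself.\<close>

definition th where "th = (SOME s. u0 \<le> s \<and> s < u1 \<and> (\<exists>y\<in>Y. swp s (tk 3) y \<and> cnt V s y = 13) \<and>
     (\<forall>t\<in>I. \<forall>x\<in>Z. \<forall>y\<in>Y. swp t x y \<and> cnt V t y \<in> {13, 17} \<longrightarrow> t \<le> s) \<and>
     (\<forall>t\<in>I. \<forall>x\<in>Z. \<forall>y\<in>Z. swp t x y \<and> cnt V t y \<in> {13, 17} \<longrightarrow> s < t) \<and>
     (\<forall>z\<in>Z. 3 < ix z \<longrightarrow> bef (s + 1) (tk 3) z) \<and> (\<forall>y\<in>Y. bef (s + 1) y (tk 3)) \<and> cnt V (s + 1) (tk 3) = 13)"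

definition th' where "th' = (SOME s. u1 \<le> s \<and> s < u0 + N \<and> (\<exists>w\<in>W. swp s (tk 3) w \<and> cnt V s w = 17) \<and>
     (\<forall>t\<in>I. \<forall>x\<in>Z. \<forall>w\<in>W. swp t x w \<and> cnt V t w \<in> {13, 17} \<longrightarrow> s \<le> t) \<and>
     (\<forall>t\<in>I. \<forall>x\<in>Z. \<forall>y\<in>Z. swp t x y \<and> cnt V t y \<in> {13, 17} \<longrightarrow> t < s) \<and>
     (\<forall>z\<in>Z. 3 < ix z \<longrightarrow> bef s z (tk 3)) \<and> (\<forall>w\<in>W. bef s (tk 3) w) \<and> cnt V s (tk 3) = 16)"

lemma thD: "u0 \<le> th" "th < u1" "\<exists>y\<in>Y. swp th (tk 3) y \<and> cnt V th y = 13"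
     "\<And>t x y. t \<in> I \<Longrightarrow> x \<in> Z \<Longrightarrow> y \<in> Y \<Longrightarrow> swp t x y \<Longrightarrow> cnt V t y \<in> {13, 17} \<Longrightarrow> t \<le> th"
     "\<And>t x y. t \<in> I \<Longrightarrow> x \<in> Z \<Longrightarrow> y \<in> Z \<Longrightarrow> swp t x y \<Longrightarrow> cnt V t y \<in> {13, 17} \<Longrightarrow> th < t"
     "\<And>z. z \<in> Z \<Longrightarrow> 3 < ix z \<Longrightarrow> bef (th + 1) (tk 3) z" "\<And>y. y \<in> Y \<Longrightarrow> bef (th + 1) y (tk 3)"
     "cnt V (th + 1) (tk 3) = 13"
  using someI_ex[OF theta_ex] unfolding th_def[symmetric] by blast+

lemma th'D: "u1 \<le> th'" "th' < u0 + N" "\<exists>w\<in>W. swp th' (tk 3) w \<and> cnt V th' w = 17"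
     "\<And>t x w. t \<in> I \<Longrightarrow> x \<in> Z \<Longrightarrow> w \<in> W \<Longrightarrow> swp t x w \<Longrightarrow> cnt V t w \<in> {13, 17} \<Longrightarrow> th' \<le> t"
     "\<And>t x y. t \<in> I \<Longrightarrow> x \<in> Z \<Longrightarrow> y \<in> Z \<Longrightarrow> swp t x y \<Longrightarrow> cnt V t y \<in> {13, 17} \<Longrightarrow> t < th'"
     "\<And>z. z \<in> Z \<Longrightarrow> 3 < ix z \<Longrightarrow> bef th' z (tk 3)" "\<And>w. w \<in> W \<Longrightarrow> bef th' (tk 3) w"
     "cnt V th' (tk 3) = 16"
  using someI_ex[OF theta'_ex] unfolding th'_def[symmetric] by blast+

definition Z3 where "Z3 = {z \<in> Z. 3 \<le> ix z}"

lemma Z3_card: "card Z3 = 7"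
proof -
  have "Z3 = tk ` {3..<10}"
  proof (rule set_eqI)
    fix z show "z \<in> Z3 \<longleftrightarrow> z \<in> tk ` {3..<10}"
    proof
      assume "z \<in> Z3" then show "z \<in> tk ` {3..<10}"
        using tk_ix[of z] ix_Z[of z] unfolding Z3_def by (intro image_eqI[of _ _ "ix z"]) auto
    next
      assume "z \<in> tk ` {3..<10}"
      then obtain i where "3 \<le> i" "i < 10" "z = tk i" by auto
      then show "z \<in> Z3" using tk[of i] unfolding Z3_def by simp
    qed
  qed
  moreover have "inj_on tk {3..<10}" by (rule inj_on_inverseI[of _ ix]) (use tk in auto)
  ultimately show ?thesis by (simp add: card_image)
qed

lemma Z3_cases: "z \<in> Z3 \<Longrightarrow> z = tk 3 \<or> z \<in> Z \<and> 3 < ix z"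
  using tk_ix[of z] unfolding Z3_def by (cases "ix z = 3") auto

lemma Y_Z3: "y \<in> Y \<Longrightarrow> z \<in> Z3 \<Longrightarrow> th < t \<Longrightarrow> t \<le> u0 + N \<Longrightarrow> bef t y z"
proof -
  assume a: "y \<in> Y" "z \<in> Z3" "th < t" "t \<le> u0 + N"
  have V: "y \<in> V" "z \<in> V" "z \<in> Z" "tk 3 \<in> V" using a ZV tk[of 3] unfolding Z3_def by auto
  have b: "bef (th + 1) y z"
    using Z3_cases[OF a(2)]
  proof
    assume "z = tk 3" then show ?thesis using thD(7) a by blast
  next
    assume "z \<in> Z \<and> 3 < ix z"
    then show ?thesis using tr[of y "tk 3" z "th + 1"] thD(6)[of z] thD(7)[OF a(1)] V by blast
  qed
  show ?thesis by (rule bef_after[of z y u0 "th + 1" t]) (use V a b first thD(1) in auto)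
qed

lemma Z3_W: "w \<in> W \<Longrightarrow> z \<in> Z3 \<Longrightarrow> u0 \<le> t \<Longrightarrow> t \<le> th' \<Longrightarrow> bef t z w"
proof -
  assume a: "w \<in> W" "z \<in> Z3" "u0 \<le> t" "t \<le> th'"
  have V: "w \<in> V" "z \<in> V" "z \<in> Z" "tk 3 \<in> V" using a ZV tk[of 3] unfolding Z3_def by auto
  have b: "bef th' z w"
    using Z3_cases[OF a(2)]
  proof
    assume "z = tk 3" then show ?thesis using th'D(7) a by blast
  next
    assume "z \<in> Z \<and> 3 < ix z"
    then show ?thesis using tr[of z "tk 3" w th'] th'D(6)[of z] th'D(7)[OF a(1)] V by blast
  qed
  show ?thesis by (rule bef_between[of z w u0 th' t]) (use V a b first th'D(2) in auto)
qed

lemma th_le: "th < th'" using thD th'D by simp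

lemma Z3_V: "Z3 \<subseteq> V" unfolding Z3_def using ZV by auto

text \<open>The seven tokens of \<open>Z3\<close> and the ten of \<open>W\<close> are all behind,
  which leaves positions up to \<open>29 - 17 = 12\<close>.\<close>

lemma mid_Y: "y \<in> Y \<Longrightarrow> th < t \<Longrightarrow> t \<le> th' \<Longrightarrow> cnt V t y \<le> 12"
proof -
  assume a: "y \<in> Y" "th < t" "t \<le> th'"
  have yV: "y \<in> V" using a ZV by auto
  have t: "u0 \<le> t" "t \<le> u0 + N" using a thD(1) th'D(2) by auto
  have Z3ne: "Z3 \<noteq> {}" using Z3_card by auto
  then obtain z where z: "z \<in> Z3" by blast
  have "bef t y x" if x: "x \<in> Z3 \<union> W" for x
  proof (cases "x \<in> Z3")
    case True then show ?thesis using Y_Z3 a t by blast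
  next
    case False
    then have "x \<in> W" using x by blast
    then show ?thesis using tr[of y z x t] Y_Z3[OF a(1) z a(2) t(2)] Z3_W[OF _ z t(1) a(3)] yV z Z3_V ZV by blast
  qed
  then have sub: "{x \<in> V. bef t x y} \<subseteq> V - {y} - (Z3 \<union> W)" using asym[OF yV] irr[OF yV] Z3_V ZV by blast
  have "y \<notin> Z3 \<union> W" using a part unfolding Z3_def by auto
  moreover have "Z3 \<inter> W = {}" using part unfolding Z3_def by auto
  moreover have "finite Z3" "finite W" using fin_sub Z3_V ZV by auto
  ultimately have "card (V - {y} - (Z3 \<union> W)) = 29 - 17"
    using Z3_V ZV Z3_card cW cV yV fin
    by (subst card_Diff_subset) (auto simp: card_Un_disjoint)
  then show ?thesis unfolding cnt_def using card_mono[OF _ sub] fin by simp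
qed

lemma mid_W: "w \<in> W \<Longrightarrow> th < t \<Longrightarrow> t \<le> th' \<Longrightarrow> 17 \<le> cnt V t w"
proof -
  assume a: "w \<in> W" "th < t" "t \<le> th'"
  have wV: "w \<in> V" using a ZV by auto
  have t: "u0 \<le> t" "t \<le> u0 + N" using a thD(1) th'D(2) by auto
  have Z3ne: "Z3 \<noteq> {}" using Z3_card by auto
  then obtain z where z: "z \<in> Z3" by blast
  have "bef t x w" if x: "x \<in> Z3 \<union> Y" for x
  proof (cases "x \<in> Z3")
    case True then show ?thesis using Z3_W a t by blast
  next
    case False
    then have "x \<in> Y" using x by blast
    then show ?thesis using tr[of x z w t] Y_Z3[OF _ z a(2) t(2)] Z3_W[OF a(1) z t(1) a(3)] wV z Z3_V ZV by blast
  qed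
  then have sub: "Z3 \<union> Y \<subseteq> {x \<in> V. bef t x w}" using Z3_V ZV by blast
  have "Z3 \<inter> Y = {}" using part unfolding Z3_def by auto
  moreover have "finite Z3" "finite Y" using fin_sub Z3_V ZV by auto
  ultimately have "card (Z3 \<union> Y) = 17" using Z3_card cY by (simp add: card_Un_disjoint)
  then show ?thesis unfolding cnt_def using card_mono[OF _ sub] fin by simp
qed

lemma mid_entry:
  assumes "th < t" "t < th'" "swp t x y" "cnt V t y \<in> {13, 17}"
  shows "x \<in> Z" "y \<in> Z" "t \<in> I"
proof -
  note c = cnt_ge_1_swp[OF assms(3)] and D = swpD[OF assms(3)]
  show "t \<in> I" unfolding I_def using assms thD(1) th'D(2) by simp
  have r: "t \<le> th'" "th < t + 1" "t + 1 \<le> th'" using assms by auto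
  have mY: "\<not> (13 \<le> cnt V t v \<or> 13 \<le> cnt V (t + 1) v)" if "v \<in> Y" for v
    using mid_Y[OF that assms(1) r(1)] mid_Y[OF that r(2,3)] by simp
  have mW: "17 \<le> cnt V t v \<and> 17 \<le> cnt V (t + 1) v" if "v \<in> W" for v
    using mid_W[OF that assms(1) r(1)] mid_W[OF that r(2,3)] by simp
  have "x \<notin> Y" "y \<notin> Y" using mY[of x] mY[of y] c assms(4) by auto
  moreover have "x \<notin> W" "y \<notin> W" using mW[of x] mW[of y] c assms(4) by auto
  ultimately show "x \<in> Z" "y \<in> Z" using D part by auto
qed

definition ta where "ta i = (THE t. t \<in> so 13 (tk i))"
definition tb where "tb i = (THE t. t \<in> so 17 (tk i))"

lemma low_set: "i \<le> 2 \<Longrightarrow> so 13 (tk i) = {ta i}" "i \<le> 2 \<Longrightarrow> so 17 (tk i) = {tb i}"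
proof -
  assume i: "i \<le> 2"
  have "card (so 13 (tk i)) = 1" "card (so 17 (tk i)) = 1" using low_tok[OF tk(1), of i] tk(2)[of i] i by auto
  then obtain a b where ab: "so 13 (tk i) = {a}" "so 17 (tk i) = {b}" by (meson card_1_singletonE)
  then show "so 13 (tk i) = {ta i}" "so 17 (tk i) = {tb i}" unfolding ta_def tb_def by auto
qed

text \<open>Neither \<open>Y\<close> nor \<open>W\<close> reaches the middle in this phase, so the
  right-mover in such an event is a class token passing another one. Only tokens 0, 1 and 2 do that
  at levels 13 and 17, each of them once per level.\<close>

lemma mid_events:
  assumes "th < t" "t < th'"
  shows "ev V 13 t \<longleftrightarrow> t \<in> {ta 0, ta 1, ta 2}" "ev V 17 t \<longleftrightarrow> t \<in> {tb 0, tb 1, tb 2}"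
proof -
  have *: "ev V j t \<longleftrightarrow> (\<exists>i\<le>2. t \<in> so j (tk i))" if j: "j = 13 \<or> j = 17" for j
  proof
    assume "ev V j t"
    then obtain x y where s: "swp t x y" "cnt V t y = j" unfolding ev_def by blast
    have z: "x \<in> Z" "y \<in> Z" "t \<in> I" using mid_entry[OF assms s(1)] s j by auto
    have so: "t \<in> so j x" unfolding so_def using z s by blast
    have "ix x \<le> 2"
    proof (rule ccontr)
      assume "\<not> ix x \<le> 2"
      then have "so j x = {}" using so_high[OF z(1)] j by auto
      then show False using so by blast
    qed
    then show "\<exists>i\<le>2. t \<in> so j (tk i)" using so tk_ix[OF z(1)] by (intro exI[of _ "ix x"]) simp
  next
    assume "\<exists>i\<le>2. t \<in> so j (tk i)"
    then obtain v y where "swp t v y" "cnt V t y = j" unfolding so_def by blast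
    then show "ev V j t" using ev_swp by blast
  qed
  have i2: "(\<exists>i\<le>2::nat. P i) \<longleftrightarrow> P 0 \<or> P 1 \<or> P 2" for P
  proof
    assume "\<exists>i\<le>2. P i"
    then obtain i where "i \<le> 2" "P i" by blast
    moreover have "i = 0 \<or> i = 1 \<or> i = 2" using calculation by linarith
    ultimately show "P 0 \<or> P 1 \<or> P 2" by blast
  next
    assume "P 0 \<or> P 1 \<or> P 2"
    then consider "P 0" | "P 1" | "P 2" by blast
    then show "\<exists>i\<le>2. P i" 
    proof cases
      case 1 then show ?thesis by (intro exI[of _ 0]) simp
    next
      case 2 then show ?thesis by (intro exI[of _ 1]) simp
    next
      case 3 then show ?thesis by (intro exI[of _ 2]) simp
    qed
  qed
  show "ev V 13 t \<longleftrightarrow> t \<in> {ta 0, ta 1, ta 2}" using *[of 13] low_set(1)[of 0] low_set(1)[of 1] low_set(1)[of 2]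
    unfolding i2 by simp
  show "ev V 17 t \<longleftrightarrow> t \<in> {tb 0, tb 1, tb 2}" using *[of 17] low_set(2)[of 0] low_set(2)[of 1] low_set(2)[of 2]
    unfolding i2 by simp
qed

lemma ta_facts:
  assumes "i \<le> 2"
  shows "th < ta i" "ta i < th'" "th < tb i" "tb i < th'"
    "u0 \<le> t \<Longrightarrow> t \<le> ta i \<Longrightarrow> cnt V t (tk i) < 13" "ta i < t \<Longrightarrow> t \<le> u0 + N \<Longrightarrow> 13 \<le> cnt V t (tk i)"
    "u0 \<le> t \<Longrightarrow> t \<le> tb i \<Longrightarrow> cnt V t (tk i) < 17" "tb i < t \<Longrightarrow> t \<le> u0 + N \<Longrightarrow> 17 \<le> cnt V t (tk i)"
proof -
  have z: "tk i \<in> Z" "ix (tk i) = i" using tk assms by auto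
  have L: "sb 13 (tk i) = {}" "sb 17 (tk i) = {}" "sn 13 (tk i) = {}" "sn 17 (tk i) = {}"
    using low_tok[OF z(1)] sn_low[OF z(1)] z assms by auto
  have "\<exists>s. s \<in> so 13 (tk i) \<union> sb 13 (tk i) \<and> (\<forall>t. u0 \<le> t \<and> t \<le> s \<longrightarrow> cnt V t (tk i) < 13) \<and>
    (\<forall>t. s < t \<and> t \<le> u0 + N \<longrightarrow> 13 \<le> cnt V t (tk i))"
    by (rule threshold[OF z(1) L(3)]; simp; blast)
  then obtain s where s: "s \<in> so 13 (tk i) \<union> sb 13 (tk i)" "\<And>t. u0 \<le> t \<Longrightarrow> t \<le> s \<Longrightarrow> cnt V t (tk i) < 13"
    "\<And>t. s < t \<Longrightarrow> t \<le> u0 + N \<Longrightarrow> 13 \<le> cnt V t (tk i)"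
    by blast
  have e: "s = ta i" using s(1) L low_set(1)[OF assms] by simp
  have "\<exists>s. s \<in> so 17 (tk i) \<union> sb 17 (tk i) \<and> (\<forall>t. u0 \<le> t \<and> t \<le> s \<longrightarrow> cnt V t (tk i) < 17) \<and>
    (\<forall>t. s < t \<and> t \<le> u0 + N \<longrightarrow> 17 \<le> cnt V t (tk i))"
    by (rule threshold[OF z(1) L(4)]; simp; blast)
  then obtain r where r: "r \<in> so 17 (tk i) \<union> sb 17 (tk i)" "\<And>t. u0 \<le> t \<Longrightarrow> t \<le> r \<Longrightarrow> cnt V t (tk i) < 17"
    "\<And>t. r < t \<Longrightarrow> t \<le> u0 + N \<Longrightarrow> 17 \<le> cnt V t (tk i)"
    by blast
  have e': "r = tb i" using r(1) L low_set(2)[OF assms] by simp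
  have "ta i \<in> so 13 (tk i)" "tb i \<in> so 17 (tk i)" using low_set[OF assms] by auto
  then have "\<exists>y\<in>Z. ta i \<in> I \<and> swp (ta i) (tk i) y \<and> cnt V (ta i) y = 13"
    "\<exists>y\<in>Z. tb i \<in> I \<and> swp (tb i) (tk i) y \<and> cnt V (tb i) y = 17" unfolding so_def by blast+
  then show "th < ta i" "ta i < th'" "th < tb i" "tb i < th'"
    using thD(5)[OF _ z(1)] th'D(5)[OF _ z(1)] by blast+
  show "u0 \<le> t \<Longrightarrow> t \<le> ta i \<Longrightarrow> cnt V t (tk i) < 13" "ta i < t \<Longrightarrow> t \<le> u0 + N \<Longrightarrow> 13 \<le> cnt V t (tk i)"
    "u0 \<le> t \<Longrightarrow> t \<le> tb i \<Longrightarrow> cnt V t (tk i) < 17" "tb i < t \<Longrightarrow> t \<le> u0 + N \<Longrightarrow> 17 \<le> cnt V t (tk i)"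
    using s(2,3) r(2,3) unfolding e e' by blast+
qed

lemma ta_neq: "i \<le> 2 \<Longrightarrow> j \<le> 2 \<Longrightarrow> i \<noteq> j \<Longrightarrow> ta i \<noteq> ta j \<and> tb i \<noteq> tb j"
proof -
  assume a: "i \<le> 2" "j \<le> 2" "i \<noteq> j"
  have n: "tk i \<noteq> tk j" using tk(2)[of i] tk(2)[of j] a by force
  have "ta i \<in> so 13 (tk i)" "ta j \<in> so 13 (tk j)" "tb i \<in> so 17 (tk i)" "tb j \<in> so 17 (tk j)"
    using low_set a by auto
  then obtain y1 y2 y3 y4 where "swp (ta i) (tk i) y1" "swp (ta j) (tk j) y2" "swp (tb i) (tk i) y3" "swp (tb j) (tk j) y4"
    unfolding so_def by blast
  then show ?thesis using one[of "ta i" "tk i" y1 "tk j" y2] one[of "tb i" "tk i" y3 "tk j" y4] n by auto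
qed

lemma fin_Win: "finite (window t)" unfolding window_def using fin by simp

text \<open>Inside the window token 0 is exchanged only with tokens 1, 2 and 3, yet by tightness it
  is exchanged with everything it meets. So these three are its companions on arrival and on
  departure, and tokens 1 and 2 enter before it and leave after it.\<close>

lemma mid_order: "ta 1 < ta 0" "ta 2 < ta 0" "tb 0 < tb 1" "tb 0 < tb 2" "ta 0 < tb 0"
proof -
  have z: "tk 0 \<in> Z" "tk 0 \<in> V" using tk[of 0] ZV by auto
  note F = ta_facts[of 0]
  have rng: "th < ta 0" "ta 0 < th'" "th < tb 0" "tb 0 < th'" using F by auto
  have u: "u0 \<le> th" "th' < u0 + N" using thD(1) th'D(2) by auto
  show ab: "ta 0 < tb 0"
  proof (rule ccontr)
    assume "\<not> ta 0 < tb 0"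
    then have "cnt V (tb 0 + 1) (tk 0) < 13 \<or> tb 0 = ta 0" using F(5)[of "tb 0 + 1"] rng u by auto
    moreover have "17 \<le> cnt V (tb 0 + 1) (tk 0)" using F(8)[of "tb 0 + 1"] rng u by auto
    moreover have "cnt V (ta 0 + 1) (tk 0) \<le> cnt V (ta 0) (tk 0) + 1" using cnt_step_le[OF subset_refl z(2)] by blast
    moreover have "cnt V (ta 0) (tk 0) < 13" using F(5)[of "ta 0"] rng u by auto
    ultimately show False by auto
  qed
  have inW: "tk 0 \<in> window t \<Longrightarrow> u0 \<le> t \<Longrightarrow> t \<le> u0 + N \<Longrightarrow> ta 0 < t \<and> t \<le> tb 0" for t
    using F(5)[of t] F(8)[of t] unfolding window_def by force
  have swI: "y \<in> {tk 1, tk 2, tk 3}"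
    if "swp s (tk 0) y \<or> swp s y (tk 0)" "tk 0 \<in> window s" "y \<in> window s" "ta 0 < s" "s \<le> tb 0" for s y
  proof (rule tok0_mono[of s])
    show "s \<in> I" unfolding I_def using that rng u by simp
  qed (use that in \<open>auto simp: window_def\<close>)
  have c3: "card {tk 1, tk 2, tk 3} \<le> 3" by (simp add: card_insert_if)
  have full: "{tk 1, tk 2, tk 3} \<subseteq> window t" if w: "tk 0 \<in> window t" "\<And>y. y \<in> window t \<Longrightarrow> y \<noteq> tk 0 \<Longrightarrow> y \<in> {tk 1, tk 2, tk 3}" for t
  proof -
    have s: "window t - {tk 0} \<subseteq> {tk 1, tk 2, tk 3}" using w by blast
    have "card (window t - {tk 0}) = 3" using w(1) card_Win fin_Win by simp
    then have "window t - {tk 0} = {tk 1, tk 2, tk 3}" using c3 s by (intro card_seteq) auto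
    then show ?thesis by blast
  qed
  have "ta 0 \<in> so 13 (tk 0)" using low_set(1)[of 0] by simp
  then obtain y0 where y0: "swp (ta 0) (tk 0) y0" "cnt V (ta 0) y0 = 13" unfolding so_def by blast
  have W1: "{tk 1, tk 2, tk 3} \<subseteq> window (ta 0 + 1)"
  proof (rule full)
    show "tk 0 \<in> window (ta 0 + 1)" by (rule entrant_left(2)[OF y0])
    fix y assume y: "y \<in> window (ta 0 + 1)" "y \<noteq> tk 0"
    have "unswapped (ta 0 + 1) (tk 0) y" by (rule enter_left[OF y0 y])
    then obtain s where s: "ta 0 + 1 \<le> s" "swp s (tk 0) y" "\<forall>r. ta 0 + 1 \<le> r \<and> r \<le> s \<longrightarrow> tk 0 \<in> window r \<and> y \<in> window r"
      unfolding unswapped_def by blast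
    have "s \<le> tb 0"
    proof (rule ccontr)
      assume "\<not> s \<le> tb 0"
      then have "tk 0 \<in> window (tb 0 + 1)" using s(3) ab by auto
      then show False using inW[of "tb 0 + 1"] rng u by auto
    qed
    then show "y \<in> {tk 1, tk 2, tk 3}" using swI[of s y] s by auto
  qed
  have "tb 0 \<in> so 17 (tk 0)" using low_set(2)[of 0] by simp
  then obtain y1 where y1: "swp (tb 0) (tk 0) y1" "cnt V (tb 0) y1 = 17" unfolding so_def by blast
  have W2: "{tk 1, tk 2, tk 3} \<subseteq> window (tb 0)"
  proof (rule full)
    show w0: "tk 0 \<in> window (tb 0)" unfolding window_def using cnt_ge_1_swp(1)[OF y1(1)] y1(2) z(2) by simp
    fix y assume y: "y \<in> window (tb 0)" "y \<noteq> tk 0"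
    obtain s where s: "swp s (tk 0) y \<or> swp s y (tk 0)" "\<And>r. min s (tb 0) \<le> r \<Longrightarrow> r \<le> max s (tb 0) \<Longrightarrow> tk 0 \<in> window r \<and> y \<in> window r"
      by (rule joint[OF w0 y(1)]) (use y in auto)
    have "s \<le> tb 0"
    proof (rule ccontr)
      assume "\<not> s \<le> tb 0"
      then have "tk 0 \<in> window (tb 0 + 1)" using s(2)[of "tb 0 + 1"] by auto
      then show False using inW[of "tb 0 + 1"] rng u by auto
    qed
    moreover have "ta 0 < s"
    proof (rule ccontr)
      assume "\<not> ta 0 < s"
      then have "tk 0 \<in> window (ta 0)" using s(2)[of "ta 0"] ab by auto
      then show False using inW[of "ta 0"] rng u by auto
    qed
    ultimately show "y \<in> {tk 1, tk 2, tk 3}" using swI[of s y] s by auto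
  qed
  have "ta i < ta 0 \<and> tb 0 < tb i" if i: "i = 1 \<or> i = 2" for i
  proof -
    have i2: "i \<le> 2" "i \<noteq> 0" using i by auto
    note G = ta_facts[OF i2(1)]
    have "tk i \<in> window (ta 0 + 1)" "tk i \<in> window (tb 0)" using W1 W2 i by auto
    then have c: "13 \<le> cnt V (ta 0 + 1) (tk i)" "cnt V (tb 0) (tk i) \<le> 16" unfolding window_def by auto
    have "ta i \<le> ta 0" using G(5)[of "ta 0 + 1"] c(1) rng u by force
    moreover have "tb 0 \<le> tb i" using G(8)[of "tb 0"] c(2) rng u by force
    ultimately show ?thesis using ta_neq[OF i2(1), of 0] i2 by force
  qed
  then show "ta 1 < ta 0" "ta 2 < ta 0" "tb 0 < tb 1" "tb 0 < tb 2" by auto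
qed

end

context window_block
begin

section \<open>Departures to the right before token 3 arrives\<close>

lemma th_rng: "u0 \<le> th" "th < u1" "u1 \<le> th'" "th' < u0 + N" "th \<in> I" "th' \<in> I"
  using thD(1,2) th'D(1,2) unfolding I_def by auto

text \<open>Tokens 0, 1, 2 pass level 17 only inside the class, and token 3 passes it with another
  class only at \<open>th'\<close>. Coming back would require a swap inside the class at level 17,
  and those happen after \<open>th\<close>.\<close>

lemma exit17:
  assumes "t \<in> I" "t \<le> th" "swp t r y" "r \<in> Z" "y \<in> Y" "cnt V t y = 17"
  shows "3 < ix r" "t < s \<Longrightarrow> s \<le> th + 1 \<Longrightarrow> 17 \<le> cnt V s r"
proof -
  have t: "t \<in> sb 17 r" unfolding sb_def using assms ZV by blast
  show "3 < ix r"
  proof (rule ccontr)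
    assume "\<not> 3 < ix r"
    then have "ix r \<le> 2 \<or> ix r = 3" by linarith
    then show False
    proof
      assume "ix r \<le> 2" then show False using low_tok[OF assms(4)] t by simp
    next
      assume "ix r = 3"
      then have r: "r = tk 3" using tk_ix[OF assms(4)] by simp
      obtain w where w: "w \<in> W" "swp th' (tk 3) w" "cnt V th' w = 17" using th'D(3) by blast
      have "th' \<in> sb 17 (tk 3)" unfolding sb_def using w th_rng ZV by blast
      moreover obtain c where "sb 17 (tk 3) = {c}" using tok3(2) by (rule card_1_singletonE)
      ultimately have "t = th'" using t r by simp
      then show False using assms(2) th_le by simp
    qed
  qed
  assume s: "t < s" "s \<le> th + 1"
  show "17 \<le> cnt V s r"
  proof (rule ccontr)
    assume "\<not> 17 \<le> cnt V s r"
    then have l: "cnt V s r < 17" by simp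
    have a: "17 \<le> cnt V (t + 1) r" using cnt_ge_1_swp[OF assms(3)] assms(6) by simp
    obtain q where q: "t + 1 \<le> q" "q < s" "17 \<le> cnt V q r" "cnt V (q + 1) r < 17"
      by (rule crossing_down[of "t + 1" s 17 "\<lambda>t. cnt V t r"]) (use s a l in auto)
    have rV: "r \<in> V" using assms(4) ZV by blast
    obtain x where x: "swp q x r" "cnt V q r = 17" using down_iff[OF rV, of 17 q] q by blast
    have qI: "q \<in> I" using q s assms(1) th_rng unfolding I_def by auto
    have "x \<in> Z" by (rule nonZ_right[OF qI x(1) assms(4)])
    then have "th < q" using thD(5)[OF qI _ assms(4) x(1)] x(2) by simp
    then show False using q s by simp
  qed
qed

lemma card_ge: "j \<le> 30 \<Longrightarrow> card {v \<in> V. j \<le> cnt V t v} = 30 - j"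
proof -
  assume j: "j \<le> 30"
  have "{v \<in> V. j \<le> cnt V t v} = V - fst_set V j t" unfolding fst_set_def by auto
  moreover have "fst_set V j t \<subseteq> V" unfolding fst_set_def by auto
  moreover have "card (fst_set V j t) = j" using card_fst_set[of V j t] j c30 by simp
  moreover have "finite (fst_set V j t)" using calculation(2) fin finite_subset by blast
  ultimately show ?thesis using c30 by (simp add: card_Diff_subset)
qed

text \<open>Between \<open>th\<close> and \<open>tb 0\<close> there is no event at level 17, so the
  token waits outside. At \<open>th'\<close> the 13 positions from 17 on are filled by
  \<open>W\<close> and tokens 0, 1, 2, so it has come back. It cannot have fallen below 13, because
  the events at level 13 are over before \<open>tb 0\<close>.\<close>

lemma return17:
  assumes "r \<in> Z" "3 < ix r" "17 \<le> cnt V (th + 1) r"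
  shows "r \<in> window th'" "th < t \<Longrightarrow> t \<le> tb 0 \<Longrightarrow> 17 \<le> cnt V t r"
proof -
  have rV: "r \<in> V" using assms ZV by auto
  note F = ta_facts[of 0]
  have stay: "17 \<le> cnt V t r" if t: "th < t" "t \<le> tb 0" for t
  proof (rule ccontr)
    assume "\<not> 17 \<le> cnt V t r"
    then have l: "cnt V t r < 17" by simp
    obtain s where s: "th + 1 \<le> s" "s < t" "17 \<le> cnt V s r" "cnt V (s + 1) r < 17"
      by (rule crossing_down[of "th + 1" t 17 "\<lambda>t. cnt V t r"]) (use t assms(3) l in auto)
    obtain x where "swp s x r" "cnt V s r = 17" using down_iff[OF rV, of 17 s] s by blast
    then have "ev V 17 s" using ev_swp by metis
    moreover have "th < s" "s < th'" using s t F(4) by auto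
    ultimately have "s \<in> {tb 0, tb 1, tb 2}" using mid_events(2) by blast
    then show False using s t mid_order by auto
  qed
  then show "th < t \<Longrightarrow> t \<le> tb 0 \<Longrightarrow> 17 \<le> cnt V t r" .
  have hi: "13 \<le> cnt V th' r"
  proof (rule ccontr)
    assume "\<not> 13 \<le> cnt V th' r"
    then have l: "cnt V th' r < 13" by simp
    obtain s where s: "th + 1 \<le> s" "s < th'" "13 \<le> cnt V s r" "cnt V (s + 1) r < 13"
      by (rule crossing_down[of "th + 1" th' 13 "\<lambda>t. cnt V t r"]) (use th_le assms(3) l in auto)
    obtain x where x: "swp s x r" "cnt V s r = 13" using down_iff[OF rV, of 13 s] s by blast
    then have "ev V 13 s" using ev_swp by metis
    moreover have "th < s" using s by auto
    ultimately have "s \<in> {ta 0, ta 1, ta 2}" using mid_events(1) s by blast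
    then have "s \<le> tb 0" using mid_order by auto
    then show False using stay[of s] s x by simp
  qed
  have "cnt V th' r < 17"
  proof (rule ccontr)
    assume "\<not> cnt V th' r < 17"
    then have r17: "17 \<le> cnt V th' r" by simp
    have tk17: "17 \<le> cnt V th' (tk i)" if i: "i \<le> 2" for i
      using ta_facts(8)[OF i, of th'] ta_facts(4)[OF i] th_rng by auto
    have sub: "insert r (tk ` {0, 1, 2} \<union> W) \<subseteq> {v \<in> V. 17 \<le> cnt V th' v}"
      using r17 rV tk17[of 0] tk17[of 1] tk17[of 2] tk(1)[of 0] tk(1)[of 1] tk(1)[of 2] mid_W[OF _ th_le order_refl] ZV by auto
    have fW: "finite W" using fin_sub ZV by blast
    have tZ: "tk ` {0, 1, 2} \<subseteq> Z" using tk(1)[of 0] tk(1)[of 1] tk(1)[of 2] by auto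
    have "inj_on tk {0, 1, 2}" by (rule inj_on_inverseI[of _ ix]) (use tk(2) in auto)
    then have "card (tk ` {0, 1, 2}) = 3" by (simp add: card_image)
    moreover have "tk ` {0, 1, 2} \<inter> W = {}" using tZ part by blast
    moreover have "card (tk ` {0, 1, 2} \<union> W) = card (tk ` {0, 1, 2}) + card W"
      by (rule card_Un_disjoint) (use fW calculation(2) in \<open>simp_all only: finite_imageI finite.intros\<close>)
    ultimately have c13: "card (tk ` {0, 1, 2} \<union> W) = 13" using cW by (simp only:)
    have "r \<notin> tk ` {0, 1, 2}" using assms(2) tk(2)[of 0] tk(2)[of 1] tk(2)[of 2] by auto
    moreover have "r \<notin> W" using assms(1) part by blast
    ultimately have "card (insert r (tk ` {0, 1, 2} \<union> W)) = 14" using c13 fW by simp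
    then show False using card_mono[OF _ sub] fin card_ge[of 17 th'] by simp
  qed
  then show "r \<in> window th'" unfolding window_def using rV hi by simp
qed

text \<open>If \<open>r1\<close> and \<open>r2\<close> leave one directly after the other, they were
  inside together and hence have been exchanged. Both are back inside at \<open>th'\<close>, so by
  \<open>joint\<close> they would be exchanged again before \<open>u0 + N\<close>, a second time in
  the same half turn.\<close>

lemma noYY:
  assumes t: "t1 \<in> I" "t2 \<in> I" "t1 < t2" "t2 \<le> th"
    and s1: "swp t1 r1 y1" "r1 \<in> Z" "y1 \<in> Y" "cnt V t1 y1 = 17"
    and s2: "swp t2 r2 y2" "r2 \<in> Z" "y2 \<in> Y" "cnt V t2 y2 = 17"
    and no: "\<And>s. t1 < s \<Longrightarrow> s < t2 \<Longrightarrow> \<not> ev V 13 s \<and> \<not> ev V 17 s"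
  shows False
proof -
  have V: "r1 \<in> V" "r2 \<in> V" using s1 s2 ZV by auto
  have t1: "t1 \<le> th" using t by simp
  have ne: "r1 \<noteq> r2"
  proof
    assume e: "r1 = r2"
    have a: "17 \<le> cnt V (t1 + 1) r1" using cnt_ge_1_swp[OF s1(1)] s1(4) by simp
    have b: "cnt V t2 r1 < 17" using cnt_ge_1_swp[OF s2(1)] s2(4) e by simp
    obtain s where s: "t1 + 1 \<le> s" "s < t2" "17 \<le> cnt V s r1" "cnt V (s + 1) r1 < 17"
      by (rule crossing_down[of "t1 + 1" t2 17 "\<lambda>t. cnt V t r1"]) (use t a b in auto)
    obtain x where "swp s x r1" "cnt V s r1 = 17" using down_iff[OF V(1), of 17 s] s by blast
    then have "ev V 17 s" using ev_swp by metis
    then show False using no[of s] s by simp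
  qed
  have W2: "r2 \<in> window t2" unfolding window_def using cnt_ge_1_swp[OF s2(1)] s2(4) V by simp
  have same: "r2 \<in> window s \<longleftrightarrow> r2 \<in> window (t1 + 1)" if "t1 + 1 \<le> s" "s \<le> t2" for s
    using that
  proof (induction s rule: int_ge_induct)
    case (step s)
    have "r2 \<in> window (s + 1) \<longleftrightarrow> r2 \<in> window s"
    proof (rule Win_same[OF V(2)])
      fix p q assume pq: "swp s p q"
      have "\<not> ev V 13 s \<and> \<not> ev V 17 s" by (rule no) (use step in auto)
      then show "cnt V s q \<noteq> 13 \<and> cnt V s q \<noteq> 17" using ev_swp[OF pq] by auto
    qed
    then show ?case using step by auto
  qed simp
  have "r2 \<in> window (t1 + 1)" using same[of t2] W2 t by simp
  moreover have "r2 \<noteq> y1" using s1 s2 part by blast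
  ultimately have W1: "r2 \<in> window t1" using cnt_unchanged[OF s1(1) V(2)] ne unfolding window_def by auto
  have W1': "r1 \<in> window t1" "r1 \<notin> window (t1 + 1)" unfolding window_def using cnt_ge_1_swp[OF s1(1)] s1(4) V by auto
  have "\<exists>s. (swp s r1 r2 \<or> swp s r2 r1) \<and> (\<forall>r. min s t1 \<le> r \<longrightarrow> r \<le> max s t1 \<longrightarrow> r1 \<in> window r \<and> r2 \<in> window r)"
    by (rule joint[OF W1'(1) W1 ne], blast)
  then obtain s where s: "swp s r1 r2 \<or> swp s r2 r1" "\<And>r. min s t1 \<le> r \<Longrightarrow> r \<le> max s t1 \<Longrightarrow> r1 \<in> window r \<and> r2 \<in> window r"
    by blast
  have s_le: "s \<le> t1"
  proof (rule ccontr)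
    assume "\<not> s \<le> t1"
    then show False using s(2)[of "t1 + 1"] W1'(2) by auto
  qed
  have u0: "r1 \<notin> window u0" unfolding window_def using idx_Z[OF V(1)] s1(2) by simp
  have s_ge: "u0 \<le> s"
  proof (rule ccontr)
    assume "\<not> u0 \<le> s"
    then show False using s(2)[of u0] u0 t(1) unfolding I_def by auto
  qed
  note e1 = exit17[OF t(1) t1 s1(1,2,3,4)] and e2 = exit17[OF t(2,4) s2(1,2,3,4)]
  have h: "17 \<le> cnt V (th + 1) r1" "17 \<le> cnt V (th + 1) r2" using e1(2)[of "th + 1"] e2(2)[of "th + 1"] t t1 by auto
  note q1 = return17[OF s1(2) e1(1) h(1)] and q2 = return17[OF s2(2) e2(1) h(2)]
  have "\<exists>s'. (swp s' r1 r2 \<or> swp s' r2 r1) \<and> (\<forall>r. min s' th' \<le> r \<longrightarrow> r \<le> max s' th' \<longrightarrow> r1 \<in> window r \<and> r2 \<in> window r)"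
    by (rule joint[OF q1(1) q2(1) ne], blast)
  then obtain s' where s': "swp s' r1 r2 \<or> swp s' r2 r1" "\<And>r. min s' th' \<le> r \<Longrightarrow> r \<le> max s' th' \<Longrightarrow> r1 \<in> window r \<and> r2 \<in> window r"
    by blast
  have tb0: "th < tb 0" "tb 0 < th'" using ta_facts[of 0] by auto
  have "tb 0 < s'"
  proof (rule ccontr)
    assume "\<not> tb 0 < s'"
    then have "r1 \<in> window (tb 0)" using s'(2)[of "tb 0"] tb0 by auto
    then show False using q1(2)[of "tb 0"] tb0 unfolding window_def by simp
  qed
  moreover have "s' < u0 + N"
  proof (rule ccontr)
    assume "\<not> s' < u0 + N"
    then have "r1 \<in> window (u0 + N)" using s'(2)[of "u0 + N"] th_rng by auto
    then show False using last_Z[OF s1(2)] unfolding window_def by simp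
  qed
  ultimately have "s' \<in> {u0..<u0 + N}" "s < s'" "s \<in> {u0..<u0 + N}" using s_le s_ge t1 tb0 th_rng by auto
  then show False using s(1) s'(1) swp_unique_half[of s r1 r2 s' u0] swp_unique_half[of s r2 r1 s' u0] by auto
qed

lemma card_swap_elem:
  fixes A :: "'b set"
  assumes "finite A" "y \<in> A" "x \<notin> A"
  shows "card (insert x (A - {y})) = card A"
  using card_Suc_Diff1[OF assms(1,2)] assms by simp

definition bz :: "nat \<Rightarrow> int \<Rightarrow> bool" where
  "bz j s \<longleftrightarrow> (\<exists>x\<in>Z. \<exists>y\<in>V - Z. swp s x y \<and> cnt V s y = j)"

text \<open>Swaps inside the class do not change how many class tokens are beyond the level, and
  class tokens move left only inside the class. Each bichromatic swap at the level adds one.\<close>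

lemma bich_card:
  assumes "10 \<le> j" "u0 \<le> t" "t \<le> u0 + N"
  shows "card {z \<in> Z. j \<le> cnt V t z} = card {s \<in> {u0..<t}. bz j s}"
  using assms(2,3)
proof (induction t rule: int_ge_induct)
  case base
  have "{z \<in> Z. j \<le> cnt V u0 z} = {}" using idx_Z ZV assms(1) by force
  then have "card {z \<in> Z. j \<le> cnt V u0 z} = 0" by (simp only: card.empty)
  then show ?case by simp
next
  case (step t)
  have tI: "t \<in> I" unfolding I_def using step by simp
  have fZ: "finite {z \<in> Z. j \<le> cnt V s z}" for s using fin_sub[OF ZV(1)] by simp
  have ins: "{s \<in> {u0..<t + 1}. bz j s} = (if bz j t then insert t {s \<in> {u0..<t}. bz j s} else {s \<in> {u0..<t}. bz j s})"
    using step.hyps by (auto simp: order_le_less)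
  have fB: "finite {s \<in> {u0..<t}. bz j s}" by simp
  have c: "card {s \<in> {u0..<t + 1}. bz j s} = card {s \<in> {u0..<t}. bz j s} + (if bz j t then 1 else 0)"
    unfolding ins using fB by (simp del: finite_int_Collect)
  have "card {z \<in> Z. j \<le> cnt V (t + 1) z} = card {z \<in> Z. j \<le> cnt V t z} + (if bz j t then 1 else 0)"
  proof (cases "\<exists>x y. swp t x y")
    case False
    have "cnt V (t + 1) z = cnt V t z" if "z \<in> V" for z by (rule cnt_step_other) (use False that in auto)
    then have "{z \<in> Z. j \<le> cnt V (t + 1) z} = {z \<in> Z. j \<le> cnt V t z}" using ZV by auto
    moreover have "\<not> bz j t" unfolding bz_def using False by blast
    ultimately show ?thesis by simp
  next
    case True
    then obtain x y where s: "swp t x y" by blast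
    note D = swpD[OF s] and k = cnt_ge_1_swp[OF s]
    have oth: "cnt V (t + 1) z = cnt V t z" if "z \<in> Z" "z \<noteq> x" "z \<noteq> y" for z
      using cnt_unchanged[OF s, of z] that ZV by auto
    have bzi: "bz j t \<longleftrightarrow> x \<in> Z \<and> y \<notin> Z \<and> cnt V t y = j"
      unfolding bz_def using s one[OF s] D by blast
    show ?thesis
    proof (cases "x \<in> Z")
      case False
      have "y \<notin> Z" using nonZ_right[OF tI s] False by blast
      then have "cnt V (t + 1) z = cnt V t z" if "z \<in> Z" for z using oth[OF that] that False by metis
      then have "{z \<in> Z. j \<le> cnt V (t + 1) z} = {z \<in> Z. j \<le> cnt V t z}" by auto
      then show ?thesis using bzi False by simp
    next
      case xZ: True
      show ?thesis
      proof (cases "cnt V t y = j")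
        case False
        have "(j \<le> cnt V (t + 1) z) = (j \<le> cnt V t z)" if "z \<in> Z" for z
          using oth[OF that] k False by (cases "z = x"; cases "z = y") auto
        then have "{z \<in> Z. j \<le> cnt V (t + 1) z} = {z \<in> Z. j \<le> cnt V t z}" by auto
        then show ?thesis using bzi False by simp
      next
        case lj: True
        have nx: "x \<notin> {z \<in> Z. j \<le> cnt V t z}" using k lj by simp
        have "(j \<le> cnt V (t + 1) z) = (z = x \<or> j \<le> cnt V t z \<and> z \<noteq> y)" if "z \<in> Z" for z
          using oth[OF that] k lj swp_neq[OF s] by (cases "z = x"; cases "z = y") auto
        then have e: "{z \<in> Z. j \<le> cnt V (t + 1) z} = insert x ({z \<in> Z. j \<le> cnt V t z} - {y})"
          using xZ swp_neq[OF s] by auto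
        show ?thesis
        proof (cases "y \<in> Z")
          case True
          then have "y \<in> {z \<in> Z. j \<le> cnt V t z}" using lj by simp
          then have "card (insert x ({z \<in> Z. j \<le> cnt V t z} - {y})) = card {z \<in> Z. j \<le> cnt V t z}"
            using card_swap_elem[OF fZ[of t]] nx by blast
          then show ?thesis unfolding e using bzi True by simp
        next
          case False
          then have "{z \<in> Z. j \<le> cnt V t z} - {y} = {z \<in> Z. j \<le> cnt V t z}" by blast
          then show ?thesis unfolding e using nx fZ[of t] bzi xZ False lj by simp
        qed
      qed
    qed
  qed
  then show ?case unfolding c using step by simp
qed

text \<open>Just after \<open>th\<close>, all of \<open>W\<close> and nothing of \<open>Y\<close>
  lies at positions from \<open>j\<close> on, so the class occupies the other
  \<open>30 - j - 10\<close>.\<close>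

lemma bich_total: "card {s \<in> {u0..<th + 1}. bz 13 s} = 7" "card {s \<in> {u0..<th + 1}. bz 17 s} = 3"
proof -
  have *: "card {s \<in> {u0..<th + 1}. bz j s} = 20 - j" if j: "j = 13 \<or> j = 17" for j
  proof -
    have r: "u0 \<le> th + 1" "th + 1 \<le> u0 + N" "th < th + 1" "th + 1 \<le> th'" using th_rng by auto
    have "{v \<in> V. j \<le> cnt V (th + 1) v} = {z \<in> Z. j \<le> cnt V (th + 1) z} \<union> W"
      using mid_Y[OF _ r(3,4)] mid_W[OF _ r(3,4)] part(1) j by force
    moreover have "finite W" "finite Z" using fin_sub ZV by auto
    moreover have "{z \<in> Z. j \<le> cnt V (th + 1) z} \<inter> W = {}" using part by blast
    ultimately have "30 - j = card {z \<in> Z. j \<le> cnt V (th + 1) z} + 10"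
      using card_ge[of j "th + 1"] j cW by (auto simp: card_Un_disjoint)
    moreover have "card {z \<in> Z. j \<le> cnt V (th + 1) z} = card {s \<in> {u0..<th + 1}. bz j s}"
      by (rule bich_card) (use j r in auto)
    ultimately show ?thesis using j by auto
  qed
  show "card {s \<in> {u0..<th + 1}. bz 13 s} = 7" "card {s \<in> {u0..<th + 1}. bz 17 s} = 3" using *[of 13] *[of 17] by auto
qed

end

section \<open>A finite-state potential for the four middle positions\<close>

context tight_window
begin

text \<open>Pending pairs are addressed by positions instead of tokens; this is what makes the state
  finite.\<close>

definition Bt :: "int \<Rightarrow> nat \<Rightarrow> nat \<Rightarrow> bool" where
  "Bt t m n \<longleftrightarrow> (\<exists>x y. unswapped t x y \<and> cnt V t x = m \<and> cnt V t y = n)"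

lemma tok_eq: "x \<in> V \<Longrightarrow> y \<in> V \<Longrightarrow> cnt V t x = cnt V t y \<Longrightarrow> x = y"
  using inj_onD[OF cnt_inj[OF subset_refl, of t], of x y] by blast

lemma uns_step:
  assumes "\<And>p q. swp t p q \<Longrightarrow> cnt V t q \<noteq> 13 \<and> cnt V t q \<noteq> 17"
  shows "unswapped (t + 1) x y \<longleftrightarrow> unswapped t x y \<and> \<not> swp t x y"
proof
  assume u: "unswapped (t + 1) x y"
  have V: "x \<in> V" "y \<in> V" using uns_V[OF u] by auto
  have b: "bef (t + 1) x y" using u unfolding unswapped_def by blast
  have "unswapped t x y"
  proof (rule ccontr)
    assume n: "\<not> unswapped t x y"
    have "x \<in> window (t + 1) \<longleftrightarrow> x \<in> window t" "y \<in> window (t + 1) \<longleftrightarrow> y \<in> window t" using V assms by (auto intro!: Win_same)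
    then show False using uns_new[OF u n] by blast
  qed
  moreover have "\<not> swp t x y" using b swpD(4)[of t x y] asym[OF V] by blast
  ultimately show "unswapped t x y \<and> \<not> swp t x y" by blast
next
  assume "unswapped t x y \<and> \<not> swp t x y"
  then show "unswapped (t + 1) x y" using uns_stay by blast
qed

lemma Bt_less: "Bt t m n \<Longrightarrow> m < n"
proof -
  assume "Bt t m n"
  then obtain x y where u: "unswapped t x y" "cnt V t x = m" "cnt V t y = n" unfolding Bt_def by blast
  have "bef t x y" using u unfolding unswapped_def by blast
  then show ?thesis using cnt_less[OF subset_refl, of x y t] uns_V[OF u(1)] u by blast
qed

lemma Bt_none:
  assumes "\<And>k. k \<in> {13..17} \<Longrightarrow> \<not> ev V k t"
  shows "13 \<le> m \<Longrightarrow> m \<le> 16 \<Longrightarrow> 13 \<le> n \<Longrightarrow> n \<le> 16 \<Longrightarrow> Bt (t + 1) m n \<longleftrightarrow> Bt t m n"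
proof -
  assume mn: "13 \<le> m" "m \<le> 16" "13 \<le> n" "n \<le> 16"
  have lev: "cnt V t q \<notin> {13..17}" if "swp t p q" for p q using assms ev_swp[OF that] by blast
  have us: "unswapped (t + 1) x y \<longleftrightarrow> unswapped t x y \<and> \<not> swp t x y" for x y
    by (rule uns_step) (use lev in fastforce)
  have cn: "cnt V (t + 1) x = k \<longleftrightarrow> cnt V t x = k" if k: "x \<in> V" "13 \<le> k" "k \<le> 16" for x k
  proof (cases "\<exists>y. swp t x y \<or> swp t y x")
    case False
    have "cnt V (t + 1) x = cnt V t x" by (rule cnt_step_other) (use False k in auto)
    then show ?thesis by simp
  next
    case True
    then obtain y where "swp t x y \<or> swp t y x" by blast
    then show ?thesis
    proof
      assume s: "swp t x y"
      show ?thesis using lev[OF s] cnt_ge_1_swp[OF s] k by auto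
    next
      assume s: "swp t y x"
      show ?thesis using lev[OF s] cnt_ge_1_swp[OF s] k by auto
    qed
  qed
  have ns: "\<not> swp t x y" if "cnt V t x = m" for x y
  proof
    assume s: "swp t x y"
    show False using lev[OF s] cnt_ge_1_swp[OF s] that mn by auto
  qed
  show ?thesis
  proof
    assume "Bt (t + 1) m n"
    then obtain x y where u: "unswapped (t + 1) x y" "cnt V (t + 1) x = m" "cnt V (t + 1) y = n" unfolding Bt_def by blast
    have "unswapped t x y" using us u by blast
    moreover have "cnt V t x = m" "cnt V t y = n" using cn uns_V[OF u(1)] u mn by auto
    ultimately show "Bt t m n" unfolding Bt_def by blast
  next
    assume "Bt t m n"
    then obtain x y where u: "unswapped t x y" "cnt V t x = m" "cnt V t y = n" unfolding Bt_def by blast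
    have "unswapped (t + 1) x y" using us u ns by blast
    moreover have "cnt V (t + 1) x = m" "cnt V (t + 1) y = n" using cn uns_V[OF u(1)] u mn by auto
    ultimately show "Bt (t + 1) m n" unfolding Bt_def by blast
  qed
qed

definition sg :: "nat \<Rightarrow> nat \<Rightarrow> nat" where "sg k m = (if m = k - 1 then k else if m = k then k - 1 else m)"

text \<open>A pair exchanged inside the window is pending by definition. Afterwards the positions
  are relabelled by the transposition \<open>sg k\<close>, and this one pair is settled.\<close>

lemma Bt_swap:
  assumes e: "ev V k t" and k: "14 \<le> k" "k \<le> 16"
  shows "Bt t (k - 1) k" "Bt (t + 1) m n \<longleftrightarrow> Bt t (sg k m) (sg k n) \<and> \<not> (sg k m = k - 1 \<and> sg k n = k)"
proof -
  obtain p q where s: "swp t p q" "cnt V t q = k" using e unfolding ev_def by blast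
  note c = cnt_ge_1_swp[OF s(1)] and D = swpD[OF s(1)]
  have m: "mid 13 t" using mid_iff[OF s(1), of 13] s(2) k by simp
  obtain x y where xy: "swp t x y" "(x, y) \<in> U t" using mid13_U[OF m] by blast
  have pq: "unswapped t p q" using one[OF xy(1) s(1)] xy(2) unfolding U_def by simp
  show "Bt t (k - 1) k" unfolding Bt_def using pq s(2) c by (intro exI[of _ p] exI[of _ q]) auto
  have lv: "cnt V t q' \<noteq> 13 \<and> cnt V t q' \<noteq> 17" if "swp t p' q'" for p' q'
  proof -
    have "q' = q" using one[OF that s(1)] by simp
    then show ?thesis using s(2) k by simp
  qed
  have us: "unswapped (t + 1) x y \<longleftrightarrow> unswapped t x y \<and> \<not> swp t x y" for x y by (rule uns_step, rule lv)
  have sgi: "sg k (sg k a) = a" for a unfolding sg_def using k by auto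
  have cn: "cnt V (t + 1) z = sg k (cnt V t z)" if z: "z \<in> V" for z
  proof (cases "z = p \<or> z = q")
    case True
    then show ?thesis
    proof
      assume "z = p" then show ?thesis using c s(2) k unfolding sg_def by auto
    next
      assume "z = q" then show ?thesis using c s(2) k unfolding sg_def by auto
    qed
  next
    case False
    have "cnt V t z \<noteq> k - 1" using tok_eq[OF z D(1), of t] False c s(2) by auto
    moreover have "cnt V t z \<noteq> k" using tok_eq[OF z D(2), of t] False s(2) by auto
    ultimately show ?thesis using cnt_unchanged[OF s(1) z] False unfolding sg_def by auto
  qed
  show "Bt (t + 1) m n \<longleftrightarrow> Bt t (sg k m) (sg k n) \<and> \<not> (sg k m = k - 1 \<and> sg k n = k)"
  proof
    assume "Bt (t + 1) m n"
    then obtain x y where u: "unswapped (t + 1) x y" "cnt V (t + 1) x = m" "cnt V (t + 1) y = n" unfolding Bt_def by blast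
    note V = uns_V[OF u(1)]
    have u': "unswapped t x y" "\<not> swp t x y" using us u by blast+
    have cc: "cnt V t x = sg k m" "cnt V t y = sg k n" using cn[of x] cn[of y] V u(2,3) sgi by auto
    have "\<not> (sg k m = k - 1 \<and> sg k n = k)"
    proof
      assume a: "sg k m = k - 1 \<and> sg k n = k"
      have "x = p" using tok_eq[of x p t] V D cc a c s(2) by auto
      moreover have "y = q" using tok_eq[of y q t] V D cc a s(2) by auto
      ultimately show False using u' s(1) by simp
    qed
    moreover have "Bt t (sg k m) (sg k n)" unfolding Bt_def using u'(1) cc by blast
    ultimately show "Bt t (sg k m) (sg k n) \<and> \<not> (sg k m = k - 1 \<and> sg k n = k)" by blast
  next
    assume a: "Bt t (sg k m) (sg k n) \<and> \<not> (sg k m = k - 1 \<and> sg k n = k)"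
    then obtain x y where u: "unswapped t x y" "cnt V t x = sg k m" "cnt V t y = sg k n" unfolding Bt_def by blast
    have "\<not> swp t x y"
    proof
      assume "swp t x y"
      then have "x = p \<and> y = q" using one s(1) by blast
      then show False using a u c s(2) by auto
    qed
    then have "unswapped (t + 1) x y" using us u by blast
    moreover have "cnt V (t + 1) x = m" "cnt V (t + 1) y = n" using cn uns_V[OF u(1)] u sgi by auto
    ultimately show "Bt (t + 1) m n" unfolding Bt_def by blast
  qed
qed

lemma uns_keep:
  assumes s: "swp t p q" "cnt V t q = 13 \<or> cnt V t q = 17" and xy: "x \<in> window t" "y \<in> window t" "x \<in> window (t + 1)" "y \<in> window (t + 1)"
  shows "unswapped (t + 1) x y \<longleftrightarrow> unswapped t x y"
proof
  assume "unswapped (t + 1) x y"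
  then show "unswapped t x y" using uns_new xy by blast
next
  assume u: "unswapped t x y"
  have "\<not> swp t x y"
  proof
    assume "swp t x y"
    then have "x = p \<and> y = q" using one s(1) by blast
    then show False using s(2) xy cnt_ge_1_swp[OF s(1)] unfolding window_def by auto
  qed
  then show "unswapped (t + 1) x y" using u uns_stay by blast
qed

lemma Bt_keep:
  assumes s: "swp t p q" "cnt V t q = 13 \<or> cnt V t q = 17"
    and w: "\<And>z. z \<in> V \<Longrightarrow> (cnt V t z = m \<longleftrightarrow> cnt V (t + 1) z = m) \<and> (cnt V t z = n \<longleftrightarrow> cnt V (t + 1) z = n)"
    and mn: "13 \<le> m" "m \<le> 16" "13 \<le> n" "n \<le> 16"
  shows "Bt (t + 1) m n \<longleftrightarrow> Bt t m n"
proof -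
  have k: "unswapped (t + 1) x y \<longleftrightarrow> unswapped t x y" if "x \<in> V" "y \<in> V" "cnt V t x = m" "cnt V t y = n" for x y
    by (rule uns_keep[OF s]) (use w[of x] w[of y] that mn in \<open>auto simp: window_def\<close>)
  show ?thesis
  proof
    assume "Bt (t + 1) m n"
    then obtain x y where u: "unswapped (t + 1) x y" "cnt V (t + 1) x = m" "cnt V (t + 1) y = n" unfolding Bt_def by blast
    note V = uns_V[OF u(1)]
    have c: "cnt V t x = m" "cnt V t y = n" using w[of x] w[of y] V u by auto
    then have "unswapped t x y" using k V u by blast
    then show "Bt t m n" unfolding Bt_def using c by blast
  next
    assume "Bt t m n"
    then obtain x y where u: "unswapped t x y" "cnt V t x = m" "cnt V t y = n" unfolding Bt_def by blast
    note V = uns_V[OF u(1)]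
    have c: "cnt V (t + 1) x = m" "cnt V (t + 1) y = n" using w[of x] w[of y] V u by auto
    then have "unswapped (t + 1) x y" using k V u by blast
    then show "Bt (t + 1) m n" unfolding Bt_def using c by blast
  qed
qed

text \<open>A pending pair stays inside until its swap, so the token that leaves has none. The
  arriving token is pending with all three others by \<open>enter_left\<close>.\<close>

lemma Bt_left:
  assumes e: "ev V 13 t"
  shows "\<not> Bt t 13 n" "14 \<le> m \<Longrightarrow> m \<le> 16 \<Longrightarrow> 14 \<le> n \<Longrightarrow> n \<le> 16 \<Longrightarrow> Bt (t + 1) m n \<longleftrightarrow> Bt t m n"
    "14 \<le> n \<Longrightarrow> n \<le> 16 \<Longrightarrow> Bt (t + 1) 13 n"
proof -
  obtain p q where s: "swp t p q" "cnt V t q = 13" using e unfolding ev_def by blast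
  note c = cnt_ge_1_swp[OF s(1)] and D = swpD[OF s(1)]
  show "\<not> Bt t 13 n"
  proof
    assume "Bt t 13 n"
    then obtain x y where u: "unswapped t x y" "cnt V t x = 13" "cnt V t y = n" unfolding Bt_def by blast
    have x: "x = q" using tok_eq[of x q t] uns_V[OF u(1)] D u(2) s(2) by simp
    have "\<not> swp t q y" using one[OF s(1), of q y] swp_neq[OF s(1)] by blast
    then have "unswapped (t + 1) q y" using uns_stay u(1) x by blast
    then have "q \<in> window (t + 1)" using uns_Win by blast
    then show False using c s(2) unfolding window_def by simp
  qed
  have w: "cnt V t z = m \<longleftrightarrow> cnt V (t + 1) z = m" if z: "z \<in> V" "14 \<le> m" for z m
    using cnt_unchanged[OF s(1) z(1)] c s(2) z by (cases "z = p"; cases "z = q") auto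
  show "14 \<le> m \<Longrightarrow> m \<le> 16 \<Longrightarrow> 14 \<le> n \<Longrightarrow> n \<le> 16 \<Longrightarrow> Bt (t + 1) m n \<longleftrightarrow> Bt t m n"
    by (rule Bt_keep[OF s(1)]) (use s w in auto)
  assume n: "14 \<le> n" "n \<le> 16"
  obtain y where y: "y \<in> V" "cnt V (t + 1) y = n" by (rule tok_at[OF subset_refl, of n "t + 1"]) (use n c30 in auto)
  have "unswapped (t + 1) p y" by (rule enter_left[OF s]) (use y n c s(2) in \<open>auto simp: window_def\<close>)
  then show "Bt (t + 1) 13 n" unfolding Bt_def using y c s(2) by (intro exI[of _ p] exI[of _ y]) auto
qed

lemma Bt_right:
  assumes e: "ev V 17 t"
  shows "\<not> Bt t m 16" "13 \<le> m \<Longrightarrow> m \<le> 15 \<Longrightarrow> 13 \<le> n \<Longrightarrow> n \<le> 15 \<Longrightarrow> Bt (t + 1) m n \<longleftrightarrow> Bt t m n"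
    "13 \<le> m \<Longrightarrow> m \<le> 15 \<Longrightarrow> Bt (t + 1) m 16"
proof -
  obtain p q where s: "swp t p q" "cnt V t q = 17" using e unfolding ev_def by blast
  note c = cnt_ge_1_swp[OF s(1)] and D = swpD[OF s(1)]
  show "\<not> Bt t m 16"
  proof
    assume "Bt t m 16"
    then obtain x y where u: "unswapped t x y" "cnt V t x = m" "cnt V t y = 16" unfolding Bt_def by blast
    have y: "y = p" using tok_eq[of y p t] uns_V[OF u(1)] D u(3) s(2) c by simp
    have "\<not> swp t x p" using one[OF s(1), of x p] swp_neq[OF s(1)] by blast
    then have "unswapped (t + 1) x p" using uns_stay u(1) y by blast
    then have "p \<in> window (t + 1)" using uns_Win by blast
    then show False using c s(2) unfolding window_def by simp
  qed
  have w: "cnt V t z = m \<longleftrightarrow> cnt V (t + 1) z = m" if z: "z \<in> V" "m \<le> 15" for z m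
    using cnt_unchanged[OF s(1) z(1)] c s(2) z by (cases "z = p"; cases "z = q") auto
  show "13 \<le> m \<Longrightarrow> m \<le> 15 \<Longrightarrow> 13 \<le> n \<Longrightarrow> n \<le> 15 \<Longrightarrow> Bt (t + 1) m n \<longleftrightarrow> Bt t m n"
    by (rule Bt_keep[OF s(1)]) (use s w in auto)
  assume m: "13 \<le> m" "m \<le> 15"
  obtain x where x: "x \<in> V" "cnt V (t + 1) x = m" by (rule tok_at[OF subset_refl, of m "t + 1"]) (use m c30 in auto)
  have "unswapped (t + 1) x q" by (rule enter_right[OF s]) (use x m c s(2) in \<open>auto simp: window_def\<close>)
  then show "Bt (t + 1) m 16" unfolding Bt_def using x c s(2) by (intro exI[of _ x] exI[of _ q]) auto
qed

end

type_synonym st = "bool \<times> bool \<times> bool \<times> bool \<times> bool \<times> bool"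
type_synonym 'a dup = "'a \<times> 'a"
type_synonym tbl = "int dup dup dup dup dup dup"

definition pick :: "bool \<Rightarrow> 'a dup \<Rightarrow> 'a" where "pick b p = (if b then snd p else fst p)"

text \<open>The nested pairs form a binary tree with 64 leaves. The bits, outermost first, belong to
  the pairs of positions 13-14, 13-15, 13-16, 14-15, 14-16, 15-16.\<close>

definition tab_value :: "tbl \<Rightarrow> st \<Rightarrow> int" where
  "tab_value l = (\<lambda>(a, b, c, d, e, f). pick f (pick e (pick d (pick c (pick b (pick a l))))))"

text \<open>The state records for each pair of the four middle positions whether its tokens are still to be transposed.
The tables below are the outcome of a shortest-path computation over the 64 states: \<open>2\<close> is paid for each
transposition of the two outer pairs, and the value \<open>9\<close> marks states that do not occur. There is one table
for each phase of the passage of a block, the phases being separated by the tokens that enter the middle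
positions from the left or from the right.\<close>

definition tabT :: tbl where
  "tabT =
    ((((((4, 2), (9, 2)), ((4, 9), (2, 2))), (((9, 2), (9, 2)), ((9, 9), (2, 2)))), ((((4, 9), (9, 9)), ((4,
    9), (2, 2))), (((9, 9), (9, 9)), ((9, 9), (2, 2))))), (((((4, 2), (9, 2)), ((4, 9), (9, 9))), (((9, 2),
    (9, 2)), ((9, 9), (9, 9)))), ((((4, 9), (9, 9)), ((4, 9), (9, 9))), (((0, 0), (0, 0)), ((0, 0), (0,
    0))))))"

text \<open>In force after an entry from the right before \<open>th\<close>, until the next entry
  from the left.\<close>

definition tabY :: tbl where
  "tabY =
    ((((((4, 4), (4, 4)), ((4, 4), (4, 4))), (((9, 9), (9, 0)), ((9, 9), (9, 0)))), ((((9, 9), (9, 9)), ((2,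
    9), (2, 9))), (((9, 9), (9, 0)), ((2, 9), (2, 0))))), (((((2, 2), (9, 9)), ((9, 9), (9, 9))), (((2, 2),
    (9, 0)), ((9, 9), (9, 0)))), ((((2, 2), (9, 9)), ((2, 9), (2, 9))), (((2, 2), (9, 0)), ((2, 9), (2,
    0))))))"

text \<open>Used in two phases: after one and after all three of the tokens 0, 1, 2 have entered.
  Likewise \<open>tabM2\<close> serves after two of them have entered and again after all three have
  left.\<close>

definition tabM1 :: tbl where
  "tabM1 =
    ((((((4, 4), (9, 2)), ((4, 9), (4, 2))), (((9, 9), (9, 2)), ((9, 9), (9, 2)))), ((((9, 9), (9, 9)), ((4,
    9), (4, 9))), (((9, 9), (9, 9)), ((9, 9), (2, 2))))), (((((4, 4), (9, 9)), ((9, 9), (9, 9))), (((9, 2),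
    (9, 2)), ((9, 9), (9, 9)))), ((((4, 9), (9, 9)), ((4, 9), (9, 9))), (((2, 0), (9, 0)), ((2, 9), (0,
    0))))))"

definition tabM2 :: tbl where
  "tabM2 =
    ((((((6, 4), (9, 4)), ((6, 9), (4, 4))), (((9, 9), (9, 2)), ((9, 9), (9, 2)))), ((((9, 9), (9, 9)), ((4,
    9), (4, 9))), (((9, 9), (9, 9)), ((9, 9), (4, 2))))), (((((4, 4), (9, 9)), ((9, 9), (9, 9))), (((9, 4),
    (9, 2)), ((9, 9), (9, 9)))), ((((4, 9), (9, 9)), ((4, 9), (9, 9))), (((2, 2), (9, 0)), ((2, 9), (2,
    0))))))"

text \<open>In force after the first of the tokens 0, 1, 2 has left to the right;
  \<open>tabN2\<close> takes over after the second.\<close>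

definition tabN1 :: tbl where
  "tabN1 =
    ((((((4, 4), (9, 4)), ((4, 9), (4, 4))), (((9, 9), (9, 0)), ((9, 9), (9, 0)))), ((((9, 9), (9, 9)), ((2,
    9), (2, 9))), (((9, 9), (9, 9)), ((9, 9), (2, 0))))), (((((2, 2), (9, 9)), ((9, 9), (9, 9))), (((9, 2),
    (9, 0)), ((9, 9), (9, 9)))), ((((2, 9), (9, 9)), ((2, 9), (9, 9))), (((2, 2), (9, 0)), ((2, 9), (2,
    0))))))"

definition tabN2 :: tbl where
  "tabN2 =
    ((((((4, 4), (9, 4)), ((4, 9), (4, 4))), (((9, 9), (9, 2)), ((9, 9), (9, 2)))), ((((9, 9), (9, 9)), ((4,
    9), (4, 9))), (((9, 9), (9, 9)), ((9, 9), (2, 0))))), (((((4, 4), (9, 9)), ((9, 9), (9, 9))), (((9, 2),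
    (9, 0)), ((9, 9), (9, 9)))), ((((2, 9), (9, 9)), ((2, 9), (9, 9))), (((2, 2), (9, 0)), ((2, 9), (2,
    0))))))"

text \<open>The inequality of a feasible potential: \<open>d\<close> is negative for a transposition
  that is paid for and positive for a gain credited at an entry. The value 9 acts as infinity, so
  preserving \<open>< 9\<close> doubles as the proof that forbidden states are not reached.\<close>

definition descends :: "tbl \<Rightarrow> st \<Rightarrow> int \<Rightarrow> tbl \<Rightarrow> st \<Rightarrow> bool" where
  "descends l s d l' s' \<longleftrightarrow> (tab_value l s < 9 \<longrightarrow> tab_value l' s' < 9 \<and> d + tab_value l' s' \<le> tab_value l s)"

text \<open>The three clauses are the exchanges at levels 14, 15 and 16. Each settles its own pair
  and permutes the bits of the others; the middle exchange is free of charge.\<close>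

definition closed_tab :: "tbl \<Rightarrow> bool" where
  "closed_tab l \<longleftrightarrow> (\<forall>a b c d e f.
     (a \<longrightarrow> descends l (a, b, c, d, e, f) (- 2) l (False, d, e, b, c, f)) \<and>
     (d \<longrightarrow> descends l (a, b, c, d, e, f) 0 l (b, a, c, False, f, e)) \<and>
     (f \<longrightarrow> descends l (a, b, c, d, e, f) (- 2) l (a, c, b, e, d, False)))"

definition left_tab :: "tbl \<Rightarrow> int \<Rightarrow> tbl \<Rightarrow> bool" where
  "left_tab l k l' \<longleftrightarrow> (\<forall>d e f. descends l (False, False, False, d, e, f) k l' (True, True, True, d, e, f))"

definition right_tab :: "tbl \<Rightarrow> int \<Rightarrow> tbl \<Rightarrow> bool" where
  "right_tab l k l' \<longleftrightarrow> (\<forall>a b d. descends l (a, b, False, d, False, False) k l' (a, b, True, d, True, True))"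

lemma closed_tabs: "closed_tab tabT" "closed_tab tabY" "closed_tab tabM1" "closed_tab tabM2" "closed_tab tabN1" "closed_tab tabN2"
  unfolding closed_tab_def descends_def tab_value_def pick_def tabT_def tabY_def tabM1_def tabM2_def tabN1_def tabN2_def
  by (simp_all add: all_bool_eq)

lemma left_tabs: "left_tab tabT 2 tabT" "left_tab tabY 4 tabT" "left_tab tabT 2 tabM1" "left_tab tabM1 2 tabM2" "left_tab tabM2 4 tabM1"
  unfolding left_tab_def descends_def tab_value_def pick_def tabT_def tabY_def tabM1_def tabM2_def tabN1_def tabN2_def
  by (simp_all add: all_bool_eq)

lemma right_tabs: "right_tab tabT 4 tabY" "right_tab tabM1 4 tabN1" "right_tab tabN1 2 tabN2" "right_tab tabN2 2 tabM2"
  unfolding right_tab_def descends_def tab_value_def pick_def tabT_def tabY_def tabM1_def tabM2_def tabN1_def tabN2_def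
  by (simp_all add: all_bool_eq)

text \<open>The passage ends with a token leaving at position 16, whose three bits must be off. The
  potential left at that moment counts as a last gain.\<close>

lemma final_tab: "tab_value tabM2 (a, b, False, d, False, False) \<ge> 4"
  unfolding tab_value_def pick_def tabM2_def by (cases a; cases b; cases d) simp_all

lemma start_tab: "tab_value tabT (True, True, True, d, e, f) = 0"
  unfolding tab_value_def pick_def tabT_def by (cases d; cases e; cases f) simp_all

lemma closed_tabD:
  assumes "closed_tab l"
  shows "a \<Longrightarrow> descends l (a, b, c, d, e, f) (- 2) l (False, d, e, b, c, f)"
    "d \<Longrightarrow> descends l (a, b, c, d, e, f) 0 l (b, a, c, False, f, e)"
    "f \<Longrightarrow> descends l (a, b, c, d, e, f) (- 2) l (a, c, b, e, d, False)"
  using assms unfolding closed_tab_def by auto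

context tight_window
begin

section \<open>Following the state through time\<close>

definition st :: "int \<Rightarrow> st" where
  "st t = (Bt t 13 14, Bt t 13 15, Bt t 13 16, Bt t 14 15, Bt t 14 16, Bt t 15 16)"

definition lev :: "int \<Rightarrow> bool" where "lev t \<longleftrightarrow> ev V 14 t \<or> ev V 16 t"

definition lw :: "int \<Rightarrow> int \<Rightarrow> int" where "lw a t = 2 * int (card {s \<in> {a..<t}. lev s})"

lemma card_step:
  fixes P :: "int \<Rightarrow> bool"
  assumes "a \<le> t"
  shows "card {s \<in> {a..<t + 1}. P s} = card {s \<in> {a..<t}. P s} + (if P t then 1 else 0)"
proof -
  have "{s \<in> {a..<t + 1}. P s} = (if P t then insert t {s \<in> {a..<t}. P s} else {s \<in> {a..<t}. P s})"
    using assms by (auto simp: order_le_less)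
  moreover have "finite {s \<in> {a..<t}. P s}" by simp
  ultimately show ?thesis by (simp del: finite_int_Collect)
qed

lemma lw_step: "a \<le> t \<Longrightarrow> lw a (t + 1) = lw a t + (if lev t then 2 else 0)"
  unfolding lw_def using card_step[of a t lev] by simp

lemma st_step:
  assumes "closed_tab l" "\<not> ev V 13 t" "\<not> ev V 17 t"
  shows "descends l (st t) (if lev t then - 2 else 0) l (st (t + 1))"
proof -
  consider "ev V 14 t" | "ev V 15 t" | "ev V 16 t" | "\<not> ev V 14 t" "\<not> ev V 15 t" "\<not> ev V 16 t" by blast
  then show ?thesis
  proof cases
    case 1
    have k: "(14::nat) \<le> 14" "14 \<le> (16::nat)" by auto
    note S = Bt_swap[OF 1 k]
    have "st (t + 1) = (False, Bt t 14 15, Bt t 14 16, Bt t 13 15, Bt t 13 16, Bt t 15 16)"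
      unfolding st_def S(2) sg_def using Bt_less[of t 14 13] by auto
    moreover have "Bt t 13 14" using S(1) by simp
    ultimately have "descends l (st t) (- 2) l (st (t + 1))" unfolding st_def[of t] using closed_tabD(1)[OF assms(1)] by (simp only:)
    moreover have "lev t" unfolding lev_def using 1 by simp
    ultimately show ?thesis by simp
  next
    case 2
    have k: "(14::nat) \<le> 15" "15 \<le> (16::nat)" by auto
    note S = Bt_swap[OF 2 k]
    have "st (t + 1) = (Bt t 13 15, Bt t 13 14, Bt t 13 16, False, Bt t 15 16, Bt t 14 16)"
      unfolding st_def S(2) sg_def using Bt_less[of t 15 14] by auto
    moreover have "Bt t 14 15" using S(1) by simp
    ultimately have "descends l (st t) 0 l (st (t + 1))" unfolding st_def[of t] using closed_tabD(2)[OF assms(1)] by (simp only:)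
    moreover have "\<not> lev t" unfolding lev_def using 2 ev_unique by fastforce
    ultimately show ?thesis by simp
  next
    case 3
    have k: "(14::nat) \<le> 16" "16 \<le> (16::nat)" by auto
    note S = Bt_swap[OF 3 k]
    have "st (t + 1) = (Bt t 13 14, Bt t 13 16, Bt t 13 15, Bt t 14 16, Bt t 14 15, False)"
      unfolding st_def S(2) sg_def using Bt_less[of t 16 15] by auto
    moreover have "Bt t 15 16" using S(1) by simp
    ultimately have "descends l (st t) (- 2) l (st (t + 1))" unfolding st_def[of t] using closed_tabD(3)[OF assms(1)] by (simp only:)
    moreover have "lev t" unfolding lev_def using 3 by simp
    ultimately show ?thesis by simp
  next
    case 4
    have e: "\<not> ev V k t" if "k \<in> {13..17}" for k
    proof -
      have "k = 13 \<or> k = 14 \<or> k = 15 \<or> k = 16 \<or> k = 17" using that by auto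
      then show ?thesis using 4 assms by blast
    qed
    have b: "Bt (t + 1) m n \<longleftrightarrow> Bt t m n" if "13 \<le> m" "m \<le> 16" "13 \<le> n" "n \<le> 16" for m n
      by (rule Bt_none[OF _ that]) (rule e)
    have "st (t + 1) = st t" unfolding st_def by (simp add: b)
    then show ?thesis unfolding descends_def lev_def using 4 by simp
  qed
qed

lemma st_left:
  assumes "left_tab l k l'" "ev V 13 t"
  shows "descends l (st t) k l' (st (t + 1))" "\<not> lev t"
proof -
  note S = Bt_left[OF assms(2)]
  have "st t = (False, False, False, Bt t 14 15, Bt t 14 16, Bt t 15 16)" unfolding st_def using S(1) by simp
  moreover have "st (t + 1) = (True, True, True, Bt t 14 15, Bt t 14 16, Bt t 15 16)" unfolding st_def using S(2,3) by simp
  ultimately show "descends l (st t) k l' (st (t + 1))" using assms(1) unfolding left_tab_def by simp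
  show "\<not> lev t" unfolding lev_def using assms(2) ev_unique by fastforce
qed

lemma st_right:
  assumes "right_tab l k l'" "ev V 17 t"
  shows "descends l (st t) k l' (st (t + 1))" "\<not> lev t"
proof -
  note S = Bt_right[OF assms(2)]
  have "st t = (Bt t 13 14, Bt t 13 15, False, Bt t 14 15, False, False)" unfolding st_def using S(1) by simp
  moreover have "st (t + 1) = (Bt t 13 14, Bt t 13 15, True, Bt t 14 15, True, True)" unfolding st_def using S(2,3) by simp
  ultimately show "descends l (st t) k l' (st (t + 1))" using assms(1) unfolding right_tab_def by simp
  show "\<not> lev t" unfolding lev_def using assms(2) ev_unique by fastforce
qed

text \<open>The invariant: the credit \<open>c\<close> together with the potential of the current
  state has been paid for by exchanges at levels 14 and 16 since time \<open>a\<close>.\<close>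

definition holds :: "int \<Rightarrow> tbl \<Rightarrow> int \<Rightarrow> int \<Rightarrow> bool" where
  "holds a l c t \<longleftrightarrow> tab_value l (st t) < 9 \<and> c + tab_value l (st t) \<le> lw a t"

lemma holds_step:
  assumes "closed_tab l" "\<not> ev V 13 t" "\<not> ev V 17 t" "a \<le> t" "holds a l c t"
  shows "holds a l c (t + 1)"
  using st_step[OF assms(1-3)] assms(5) lw_step[OF assms(4)] unfolding holds_def descends_def by auto

lemma holds_left:
  assumes "left_tab l k l'" "ev V 13 t" "a \<le> t" "holds a l c t"
  shows "holds a l' (c + k) (t + 1)"
  using st_left[OF assms(1,2)] assms(4) lw_step[OF assms(3)] unfolding holds_def descends_def by auto

lemma holds_right:
  assumes "right_tab l k l'" "ev V 17 t" "a \<le> t" "holds a l c t"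
  shows "holds a l' (c + k) (t + 1)"
  using st_right[OF assms(1,2)] assms(4) lw_step[OF assms(3)] unfolding holds_def descends_def by auto

lemma holds_idle:
  assumes "closed_tab l" "a \<le> b" "b \<le> t" "\<And>s. b \<le> s \<Longrightarrow> s < t \<Longrightarrow> \<not> ev V 13 s \<and> \<not> ev V 17 s" "holds a l c b"
  shows "holds a l c t"
  using assms(3,4)
proof (induction t rule: int_ge_induct)
  case base
  then show ?case using assms(5) by simp
next
  case (step t)
  have "holds a l c t" by (rule step.IH) (use step.prems in auto)
  moreover have "\<not> ev V 13 t \<and> \<not> ev V 17 t" using step by simp
  ultimately show ?case using holds_step[OF assms(1)] step.hyps assms(2) by auto
qed

end

text \<open>\<open>\<tau>\<close> will be the end of the preceding passage seen half a turn earlier.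
  From \<open>\<tau>\<close> to \<open>th\<close> the middle is shared by \<open>Z\<close> and
  \<open>Y\<close> alone, all their exchanges at its borders lie in that stretch, and starting the
  count there keeps the three passages disjoint.\<close>

locale linked_block = window_block +
  fixes \<tau> :: int
  assumes t_rng: "u0 \<le> \<tau>" "\<tau> \<le> th"
    and t_ev: "ev V 13 \<tau>"
    and t_first: "\<And>s x y. u0 \<le> s \<Longrightarrow> s \<le> th \<Longrightarrow> swp s x y \<Longrightarrow> x \<in> Z \<Longrightarrow> y \<in> Y \<Longrightarrow> cnt V s y \<in> {13, 17} \<Longrightarrow> \<tau> \<le> s"
    and t_YY: "\<And>s x y. \<tau> \<le> s \<Longrightarrow> s \<le> th \<Longrightarrow> swp s x y \<Longrightarrow> x \<in> Y \<Longrightarrow> y \<in> Y \<Longrightarrow> cnt V s y \<notin> {13, 17}"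
    and YW: "\<And>y w. y \<in> Y \<Longrightarrow> w \<in> W \<Longrightarrow> bef u0 y w"
begin

lemma W_last:
  assumes "u0 \<le> t" "t \<le> u1" "w \<in> W"
  shows "20 \<le> cnt V t w"
proof -
  have b: "bef t v w" if v: "v \<in> V - W" for v
  proof -
    have "bef u0 v w" using v YW[OF _ assms(3)] first assms(3) part(1) by blast
    moreover have "bef u1 v w" using v dec1 assms(3) part(1) unfolding layered_def by blast
    ultimately show ?thesis using bef_between[of v w u0 u1 t] assms v ZV u01 by auto
  qed
  have "V - W \<subseteq> {q \<in> V. bef t q w}" using b by blast
  moreover have "card (V - W) = 20" using card_Diff_subset[of W V] fin_sub ZV cW c30 by simp
  ultimately show ?thesis unfolding cnt_def using card_mono[of "{q \<in> V. bef t q w}" "V - W"] fin by simp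
qed

text \<open>\<open>W\<close> is still at positions from 20 on, swaps inside \<open>Z\<close> at
  these levels come after \<open>th\<close>, swaps inside \<open>Y\<close> are excluded by
  \<open>t_YY\<close>, and a token of \<open>Z\<close> cannot move left past \<open>Y\<close>. Only
  swaps of \<open>Z\<close> with \<open>Y\<close> remain.\<close>

lemma T_ev:
  assumes s: "u0 \<le> s" "s \<le> th" "j = 13 \<or> j = 17"
  shows "bz j s \<Longrightarrow> \<tau> \<le> s" "\<tau> \<le> s \<Longrightarrow> ev V j s \<longleftrightarrow> bz j s"
proof -
  have sI: "s \<in> I" "s \<le> u1" "s + 1 \<le> u1" using s th_rng unfolding I_def by auto
  have noW: "y \<notin> W" "x \<notin> W" if "swp s x y" "cnt V s y = j" for x y
  proof -
    have l: "cnt V s y = j" "cnt V (s + 1) x = j" "cnt V s x = j - 1" using that cnt_ge_1_swp[OF that(1)] by auto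
    show "y \<notin> W" using W_last[OF s(1) sI(2), of y] l s(3) by auto
    show "x \<notin> W" using W_last[OF s(1) sI(2), of x] l s(3) by auto
  qed
  show "bz j s \<Longrightarrow> \<tau> \<le> s"
  proof -
    assume "bz j s"
    then obtain x y where xy: "x \<in> Z" "y \<in> V - Z" "swp s x y" "cnt V s y = j" unfolding bz_def by blast
    have "y \<in> Y" using noW[OF xy(3,4)] xy(2) part(1) by blast
    then show ?thesis using t_first[OF s(1,2) xy(3,1)] xy(4) s(3) by auto
  qed
  assume ts: "\<tau> \<le> s"
  show "ev V j s \<longleftrightarrow> bz j s"
  proof
    assume "ev V j s"
    then obtain x y where xy: "swp s x y" "cnt V s y = j" "x \<in> V" "y \<in> V" unfolding ev_def by blast
    have jj: "cnt V s y \<in> {13, 17}" using xy s(3) by auto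
    have "\<not> (x \<in> Z \<and> y \<in> Z)"
    proof
      assume "x \<in> Z \<and> y \<in> Z"
      then have "th < s" using thD(5)[OF sI(1) _ _ xy(1)] jj by blast
      then show False using s by simp
    qed
    moreover have "\<not> (x \<in> Y \<and> y \<in> Y)" using t_YY[OF ts s(2) xy(1)] jj by blast
    moreover have "y \<in> Z \<Longrightarrow> x \<in> Z" using nonZ_right[OF sI(1) xy(1)] by blast
    ultimately have "x \<in> Z \<and> y \<in> Y" using noW[OF xy(1,2)] xy(3,4) part(1) by blast
    then show "bz j s" unfolding bz_def using xy part by blast
  next
    assume "bz j s"
    then show "ev V j s" unfolding bz_def using ev_swp by blast
  qed
qed

definition nx :: "int \<Rightarrow> int" where "nx t = int (card {s \<in> {\<tau>..<t}. ev V 13 s})"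
definition ny :: "int \<Rightarrow> int" where "ny t = int (card {s \<in> {\<tau>..<t}. ev V 17 s})"

lemma n_total: "nx (th + 1) = 7" "ny (th + 1) = 3"
proof -
  have "{s \<in> {\<tau>..<th + 1}. ev V j s} = {s \<in> {u0..<th + 1}. bz j s}" if "j = 13 \<or> j = 17" for j
  proof (rule Collect_cong)
    fix s
    show "(s \<in> {\<tau>..<th + 1} \<and> ev V j s) = (s \<in> {u0..<th + 1} \<and> bz j s)"
      using T_ev[of s j] that t_rng by auto
  qed
  then show "nx (th + 1) = 7" "ny (th + 1) = 3" unfolding nx_def ny_def using bich_total by auto
qed

lemma n_step: "\<tau> \<le> t \<Longrightarrow> nx (t + 1) = nx t + (if ev V 13 t then 1 else 0)"
  "\<tau> \<le> t \<Longrightarrow> ny (t + 1) = ny t + (if ev V 17 t then 1 else 0)"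
  unfolding nx_def ny_def using card_step[of \<tau> t "ev V 13"] card_step[of \<tau> t "ev V 17"] by auto

text \<open>An entry from the left earns 2. An entry from the right earns 4 and leads to
  \<open>tabY\<close>, and the next entry from the left then earns 4 instead of 2; the pair is
  booked as 6 and 2. The offset \<open>- 2\<close> says that the event at \<open>\<tau>\<close>
  earns nothing, and \<open>- 4\<close> in \<open>T2\<close> that the last pair is still incomplete.
  The second conjunct of \<open>T2\<close> is what \<open>noYY\<close> needs.\<close>

definition T1 :: "int \<Rightarrow> bool" where "T1 t \<longleftrightarrow> holds \<tau> tabT (2 * nx t + 6 * ny t - 2) t"
definition T2 :: "int \<Rightarrow> bool" where
  "T2 t \<longleftrightarrow> holds \<tau> tabY (2 * nx t + 6 * ny t - 4) t \<and>
    (\<exists>r. \<tau> \<le> r \<and> r < t \<and> ev V 17 r \<and> (\<forall>s. r < s \<and> s < t \<longrightarrow> \<not> ev V 13 s \<and> \<not> ev V 17 s))"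

lemma T_step_X: "\<tau> \<le> t \<Longrightarrow> ev V 13 t \<Longrightarrow> T1 t \<or> T2 t \<Longrightarrow> T1 (t + 1)"
proof -
  assume a: "\<tau> \<le> t" "ev V 13 t" "T1 t \<or> T2 t"
  have "\<not> ev V 17 t" using a(2) ev_unique by fastforce
  then have n: "nx (t + 1) = nx t + 1" "ny (t + 1) = ny t" using n_step[OF a(1)] a(2) by auto
  show "T1 (t + 1)" using a(3)
  proof
    assume "T1 t"
    then show ?thesis using holds_left[OF left_tabs(1) a(2,1), of "2 * nx t + 6 * ny t - 2"] n
      unfolding T1_def by (simp add: algebra_simps)
  next
    assume "T2 t"
    then show ?thesis using holds_left[OF left_tabs(2) a(2,1), of "2 * nx t + 6 * ny t - 4"] n
      unfolding T1_def T2_def by (simp add: algebra_simps)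
  qed
qed

lemma T_step: 
  assumes t: "\<tau> \<le> t" "t \<le> th" and T: "T1 t \<or> T2 t"
  shows "T1 (t + 1) \<or> T2 (t + 1)"
proof -
  consider "ev V 13 t" | "ev V 17 t" | "\<not> ev V 13 t" "\<not> ev V 17 t" by blast
  then show ?thesis
  proof cases
    case 1
    then show ?thesis using T_step_X t T by blast
  next
    case 2
    have "\<not> ev V 13 t" using 2 ev_unique by fastforce
    then have n: "nx (t + 1) = nx t" "ny (t + 1) = ny t + 1" using n_step[OF t(1)] 2 by auto
    \<comment> \<open>In state \<open>T2\<close> the previous event was a departure past
      \<open>Y\<close> at level 17, and two of these in succession contradict \<open>noYY\<close>.
      Hence \<open>tabY\<close> needs no clause for an entry from the right.\<close>
    have "\<not> T2 t"
    proof
      assume "T2 t"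
      then obtain r where r: "\<tau> \<le> r" "r < t" "ev V 17 r" "\<And>s. r < s \<Longrightarrow> s < t \<Longrightarrow> \<not> ev V 13 s \<and> \<not> ev V 17 s"
        unfolding T2_def by blast
      have rI: "r \<in> I" "t \<in> I" using r t t_rng th_rng unfolding I_def by auto
      have bzY: "\<exists>x y. swp s x y \<and> x \<in> Z \<and> y \<in> Y \<and> cnt V s y = 17" if s: "\<tau> \<le> s" "s \<le> th" "ev V 17 s" for s
      proof -
        have "bz 17 s" using T_ev(2)[of s 17] s t_rng by simp
        then obtain x y where xy: "x \<in> Z" "y \<in> V - Z" "swp s x y" "cnt V s y = 17" unfolding bz_def by blast
        have "y \<notin> W" using W_last[of s y] xy s t_rng th_rng by auto
        then show ?thesis using xy part(1) by blast
      qed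
      obtain x y where xy: "swp r x y" "x \<in> Z" "y \<in> Y" "cnt V r y = 17" using bzY[of r] r t by auto
      obtain x' y' where xy': "swp t x' y'" "x' \<in> Z" "y' \<in> Y" "cnt V t y' = 17" using bzY[of t] t 2 by auto
      show False by (rule noYY[OF rI r(2) t(2) xy xy' r(4)])
    qed
    then have "T1 t" using T by blast
    then have "holds \<tau> tabY (2 * nx t + 6 * ny t - 2 + 4) (t + 1)"
      unfolding T1_def by (rule holds_right[OF right_tabs(1) 2 t(1)])
    then have "T2 (t + 1)" unfolding T2_def using n 2 t(1) by (intro conjI exI[of _ t]) (auto simp: algebra_simps)
    then show ?thesis ..
  next
    case 3
    have n: "nx (t + 1) = nx t" "ny (t + 1) = ny t" using n_step[OF t(1)] 3 by auto
    show ?thesis using T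
    proof
      assume "T1 t"
      then have "T1 (t + 1)" unfolding T1_def n by (rule holds_step[OF closed_tabs(1) 3 t(1)])
      then show ?thesis ..
    next
      assume a: "T2 t"
      then obtain r where r: "\<tau> \<le> r" "r < t" "ev V 17 r" "\<forall>s. r < s \<and> s < t \<longrightarrow> \<not> ev V 13 s \<and> \<not> ev V 17 s"
        unfolding T2_def by blast
      have "\<forall>s. r < s \<and> s < t + 1 \<longrightarrow> \<not> ev V 13 s \<and> \<not> ev V 17 s"
      proof (intro allI impI)
        fix s assume s: "r < s \<and> s < t + 1"
        then show "\<not> ev V 13 s \<and> \<not> ev V 17 s" using r(4) 3 by (cases "s = t") auto
      qed
      moreover have "holds \<tau> tabY (2 * nx t + 6 * ny t - 4) (t + 1)"
        using holds_step[OF closed_tabs(2) 3 t(1)] a unfolding T2_def by blast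
      ultimately have "T2 (t + 1)" unfolding T2_def n using r by (intro conjI exI[of _ r]) auto
      then show ?thesis ..
    qed
  qed
qed

lemma T_start: "T1 (\<tau> + 1)"
proof -
  have 17: "\<not> ev V 17 \<tau>" using t_ev ev_unique by fastforce
  have n: "nx (\<tau> + 1) = 1" "ny (\<tau> + 1) = 0" using n_step[of \<tau>] t_ev 17 by (auto simp: nx_def ny_def)
  have l: "\<not> lev \<tau>" unfolding lev_def using t_ev ev_unique by fastforce
  have "lw \<tau> (\<tau> + 1) = 0" using lw_step[of \<tau> \<tau>] l by (simp add: lw_def)
  moreover have "tab_value tabT (st (\<tau> + 1)) = 0" unfolding st_def using Bt_left(3)[OF t_ev] start_tab by simp
  ultimately show ?thesis unfolding T1_def holds_def n by simp
qed

text \<open>The credit is \<open>2 * 7 + 6 * 3 - 2\<close>. The event at \<open>th\<close> itself is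
  at level 13, which leads back to \<open>tabT\<close> in either case.\<close>

lemma T_end: "holds \<tau> tabT 30 (th + 1)"
proof -
  have e: "ev V 13 th"
  proof -
    obtain y where "swp th (tk 3) y" "cnt V th y = 13" using thD(3) by blast
    then show ?thesis using ev_swp by metis
  qed
  have "T1 (th + 1)"
  proof (cases "th = \<tau>")
    case True
    then show ?thesis using T_start by simp
  next
    case False
    then have le: "\<tau> + 1 \<le> th" using t_rng by simp
    have "t \<le> th \<longrightarrow> T1 t \<or> T2 t" if "\<tau> + 1 \<le> t" for t
      using that
    proof (induction t rule: int_ge_induct)
      case base
      show ?case using T_start by simp
    next
      case (step t)
      then show ?case using T_step[of t] by auto
    qed
    then have "T1 th \<or> T2 th" using le by blast
    then show ?thesis using T_step_X[OF t_rng(2) e] by blast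
  qed
  then show ?thesis unfolding T1_def n_total by simp
qed

text \<open>To the 30 at \<open>th\<close> come 2, 2, 4 when tokens 0, 1, 2 enter (token 0 last), 4,
  2, 2 when they leave (token 0 first), and a final potential of at least 4. The total is 50, and
  each transposition pays 2.\<close>

lemma level_count: "25 \<le> card {s \<in> {\<tau>..<th'}. lev s}"
proof -
  define a where "a = min (ta 1) (ta 2)"
  define a' where "a' = max (ta 1) (ta 2)"
  define b where "b = min (tb 1) (tb 2)"
  define b' where "b' = max (tb 1) (tb 2)"
  have o: "a < a'" "a' < ta 0" "ta 0 < tb 0" "tb 0 < b" "b < b'" "th < a" "b' < th'"
    using mid_order ta_neq[of 1 2] ta_facts(1,2,3,4)[of 1] ta_facts(1,2,3,4)[of 2] unfolding a_def a'_def b_def b'_def by auto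
  have A: "ev V 13 t \<longleftrightarrow> t \<in> {a, a', ta 0}" "ev V 17 t \<longleftrightarrow> t \<in> {b, b', tb 0}" if "th < t" "t < th'" for t
    unfolding mid_events[OF that] a_def a'_def b_def b'_def by auto
  have idle: "holds \<tau> l c t" if "closed_tab l" "holds \<tau> l c (s + 1)" "th \<le> s" "s < t" "t \<le> th'"
    "\<And>r. s < r \<Longrightarrow> r < t \<Longrightarrow> r \<notin> {a, a', ta 0, b, b', tb 0}" for l c s t
  proof (rule holds_idle[OF that(1), of \<tau> "s + 1"])
    fix r assume r: "s + 1 \<le> r" "r < t"
    have "th < r" "r < th'" using r that(3,5) by auto
    then show "\<not> ev V 13 r \<and> \<not> ev V 17 r" using A[of r] that(6)[of r] r by auto
  qed (use that t_rng in auto)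
  have "holds \<tau> tabT 30 a" by (rule idle[OF closed_tabs(1) T_end]) (use o in auto)
  then have "holds \<tau> tabM1 (30 + 2) (a + 1)" by (rule holds_left[OF left_tabs(3), rotated 2]) (use A(1)[of a] o t_rng in auto)
  then have "holds \<tau> tabM1 (30 + 2) a'" by (rule idle[OF closed_tabs(3)]) (use o in auto)
  then have "holds \<tau> tabM2 (30 + 2 + 2) (a' + 1)" by (rule holds_left[OF left_tabs(4), rotated 2]) (use A(1)[of a'] o t_rng in auto)
  then have "holds \<tau> tabM2 (30 + 2 + 2) (ta 0)" by (rule idle[OF closed_tabs(4)]) (use o in auto)
  then have "holds \<tau> tabM1 (30 + 2 + 2 + 4) (ta 0 + 1)" by (rule holds_left[OF left_tabs(5), rotated 2]) (use A(1)[of "ta 0"] o t_rng in auto)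
  then have "holds \<tau> tabM1 (30 + 2 + 2 + 4) (tb 0)" by (rule idle[OF closed_tabs(3)]) (use o in auto)
  then have "holds \<tau> tabN1 (30 + 2 + 2 + 4 + 4) (tb 0 + 1)" by (rule holds_right[OF right_tabs(2), rotated 2]) (use A(2)[of "tb 0"] o t_rng in auto)
  then have "holds \<tau> tabN1 (30 + 2 + 2 + 4 + 4) b" by (rule idle[OF closed_tabs(5)]) (use o in auto)
  then have "holds \<tau> tabN2 (30 + 2 + 2 + 4 + 4 + 2) (b + 1)" by (rule holds_right[OF right_tabs(3), rotated 2]) (use A(2)[of b] o t_rng in auto)
  then have "holds \<tau> tabN2 (30 + 2 + 2 + 4 + 4 + 2) b'" by (rule idle[OF closed_tabs(6)]) (use o in auto)
  then have "holds \<tau> tabM2 (30 + 2 + 2 + 4 + 4 + 2 + 2) (b' + 1)" by (rule holds_right[OF right_tabs(4), rotated 2]) (use A(2)[of b'] o t_rng in auto)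
  then have h: "holds \<tau> tabM2 (30 + 2 + 2 + 4 + 4 + 2 + 2) th'" by (rule idle[OF closed_tabs(4)]) (use o in auto)
  obtain w where "swp th' (tk 3) w" "cnt V th' w = 17" using th'D(3) by blast
  then have "ev V 17 th'" using ev_swp by metis
  then have "st th' = (Bt th' 13 14, Bt th' 13 15, False, Bt th' 14 15, False, False)" unfolding st_def using Bt_right(1) by simp
  then have "tab_value tabM2 (st th') \<ge> 4" using final_tab by simp
  then show ?thesis using h unfolding holds_def lw_def by simp
qed

end

section \<open>The three blocks together\<close>

context circular_seq
begin

definition mono_ev :: "'a set \<Rightarrow> nat \<Rightarrow> int \<Rightarrow> bool" where
  "mono_ev S K t \<longleftrightarrow> (\<exists>x\<in>S. \<exists>y\<in>S. swp t x y \<and> cnt V t y \<in> {K<..<30 - K})"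

definition bi_ev :: "'a set \<Rightarrow> nat \<Rightarrow> int \<Rightarrow> bool" where
  "bi_ev S K t \<longleftrightarrow> (\<exists>x\<in>V. \<exists>y\<in>V. (x \<in> S \<longleftrightarrow> y \<notin> S) \<and> swp t x y \<and> cnt V t y \<in> {K<..<30 - K})"

text \<open>The properties of \<open>th'\<close> that the next passage needs, stated without the
  block locales. Seen half a turn earlier, the same swap has level 13 and the roles of the two
  classes exchanged: it is the moment \<open>\<tau>\<close> of the following passage.\<close>

definition is_end :: "'a set \<Rightarrow> 'a set \<Rightarrow> int \<Rightarrow> int \<Rightarrow> bool" where
  "is_end Z W u e \<longleftrightarrow> u \<le> e \<and> e < u + N \<and> (\<exists>x\<in>Z. \<exists>w\<in>W. swp e x w \<and> cnt V e w = 17) \<and>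
     (\<forall>t x w. u \<le> t \<and> t < u + N \<and> x \<in> Z \<and> w \<in> W \<and> swp t x w \<and> cnt V t w \<in> {13, 17} \<longrightarrow> e \<le> t) \<and>
     (\<forall>t x y. u \<le> t \<and> t < u + N \<and> x \<in> Z \<and> y \<in> Z \<and> swp t x y \<and> cnt V t y \<in> {13, 17} \<longrightarrow> t < e)"

lemma swp_flip_cnt:
  assumes "swp t x y" "card V = 30"
  shows "swp (t + N) y x" "cnt V (t + N) x = 30 - cnt V t y" "0 < cnt V t y" "cnt V t y < 30"
proof -
  note D = swpD[OF assms(1)] and c = cnt_ge_1_swp[OF assms(1)]
  show "swp (t + N) y x" using swp_flip assms(1) by blast
  show "cnt V (t + N) x = 30 - cnt V t y" using cnt_flip_in[OF subset_refl D(1), of t] c assms(2) by simp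
  show "0 < cnt V t y" using c by simp
  show "cnt V t y < 30" using cnt_bound[OF subset_refl D(2), of t] assms(2) by simp
qed

lemma is_end_shift:
  assumes "is_end Z W u e"
  shows "is_end Z W (u + 2 * N) (e + 2 * N)"
proof -
  have c: "cnt V (t - 2 * N) x = cnt V t x" if "x \<in> V" for t x
    using cnt_flip2[OF subset_refl that, of "t - 2 * N"] by simp
  have s: "swp (t - 2 * N) x y \<longleftrightarrow> swp t x y" for t x y using swp_flip2[of "t - 2 * N" x y] by simp
  note E = assms[unfolded is_end_def]
  obtain x w where xw: "x \<in> Z" "w \<in> W" "swp e x w" "cnt V e w = 17" using E by blast
  have 1: "e + 2 * N \<le> t" if "u + 2 * N \<le> t" "t < u + 2 * N + N" "x \<in> Z" "w \<in> W" "swp t x w" "cnt V t w \<in> {13, 17}" for t x w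
  proof -
    have "e \<le> t - 2 * N" using E that s[of t x w] c[of w t] swpD(2)[OF that(5)] by (metis add_diff_cancel_right' diff_less_eq le_diff_eq diff_add_eq)
    then show ?thesis by simp
  qed
  have 2: "t < e + 2 * N" if "u + 2 * N \<le> t" "t < u + 2 * N + N" "x \<in> Z" "w \<in> Z" "swp t x w" "cnt V t w \<in> {13, 17}" for t x w
  proof -
    have "t - 2 * N < e" using E that s[of t x w] c[of w t] swpD(2)[OF that(5)] by (metis add_diff_cancel_right' diff_less_eq le_diff_eq diff_add_eq)
    then show ?thesis by simp
  qed
  have 3: "swp (e + 2 * N) x w" "cnt V (e + 2 * N) w = 17" using swp_flip2 xw cnt_flip2[OF subset_refl swpD(2)[OF xw(3)], of e] by auto
  show ?thesis unfolding is_end_def using 1 2 3 xw(1,2) E by (intro conjI) (auto simp: add.commute)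
qed

lemma mono_period: "card V = 30 \<Longrightarrow> mono_ev S K (t + N) \<longleftrightarrow> mono_ev S K t"
proof -
  assume c: "card V = 30"
  have 1: "mono_ev S K t \<Longrightarrow> mono_ev S K (t + N)" for t
  proof -
    assume "mono_ev S K t"
    then obtain x y where xy: "x \<in> S" "y \<in> S" "swp t x y" "cnt V t y \<in> {K<..<30 - K}" unfolding mono_ev_def by blast
    note f = swp_flip_cnt[OF xy(3) c]
    have "cnt V (t + N) x \<in> {K<..<30 - K}" using f xy(4) by auto
    then show ?thesis unfolding mono_ev_def using xy f by blast
  qed
  have "mono_ev S K (t + N + N) \<longleftrightarrow> mono_ev S K t"
  proof -
    have e: "t + N + N = t + 2 * N" by simp
    have "(swp (t + 2 * N) x y \<and> cnt V (t + 2 * N) y \<in> {K<..<30 - K}) = (swp t x y \<and> cnt V t y \<in> {K<..<30 - K})" for x y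
      using swp_flip2[of t x y] cnt_flip2[of V y t] swpD(2)[of t x y] by auto
    then show ?thesis unfolding mono_ev_def e by simp
  qed
  then show ?thesis using 1[of t] 1[of "t + N"] by blast
qed

lemma bi_period: "card V = 30 \<Longrightarrow> bi_ev S K (t + N) \<longleftrightarrow> bi_ev S K t"
proof -
  assume c: "card V = 30"
  have 1: "bi_ev S K t \<Longrightarrow> bi_ev S K (t + N)" for t
  proof -
    assume "bi_ev S K t"
    then obtain x y where xy: "x \<in> V" "y \<in> V" "(x \<in> S \<longleftrightarrow> y \<notin> S)" "swp t x y" "cnt V t y \<in> {K<..<30 - K}" unfolding bi_ev_def by blast
    note f = swp_flip_cnt[OF xy(4) c]
    have "cnt V (t + N) x \<in> {K<..<30 - K}" using f xy(5) by auto
    then show ?thesis unfolding bi_ev_def using xy f by blast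
  qed
  have "bi_ev S K (t + N + N) \<longleftrightarrow> bi_ev S K t"
  proof -
    have e: "t + N + N = t + 2 * N" by simp
    have "(swp (t + 2 * N) x y \<and> cnt V (t + 2 * N) y \<in> {K<..<30 - K}) = (swp t x y \<and> cnt V t y \<in> {K<..<30 - K})" for x y
      using swp_flip2[of t x y] cnt_flip2[of V y t] swpD(2)[of t x y] by auto
    then show ?thesis unfolding bi_ev_def e by simp
  qed
  then show ?thesis using 1[of t] 1[of "t + N"] by blast
qed

text \<open>The counts have period \<open>N\<close>, so the interval may start at any
  \<open>u\<close>. This permits the three classes, each with its own \<open>u0\<close>, to be
  compared over one and the same half turn.\<close>

lemma block_counts:
  assumes c: "card V = 30" and p: "V = Z \<union> Y \<union> W" "Z \<inter> Y = {}" "Z \<inter> W = {}" "Y \<inter> W = {}"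
    "card Z = 10" "card Y = 10" "card W = 10" and d: "layered u0 Z Y W" "layered u1 Y Z W" "u0 \<le> u1" "u1 \<le> u0 + N"
  shows "card {t \<in> {u..<u + N}. mono_ev Z 12 t} \<le> 39" "card {t \<in> {u..<u + N}. mono_ev Z 13 t} \<le> 33"
    "10 \<le> K \<Longrightarrow> K \<le> 14 \<Longrightarrow> card {t \<in> {u..<u + N}. bi_ev Z K t} = 10 * (29 - 2 * K)"
proof -
  interpret B: block V N bef Z Y W u0 u1
    by unfold_locales (use c p d in \<open>auto simp: layered_def\<close>)
  have m: "{t \<in> B.I. B.inner_swap K t} = {t \<in> {u0..<u0 + N}. mono_ev Z K t}" for K
    unfolding B.I_def B.inner_swap_def B.win_def mono_ev_def by simp
  show "card {t \<in> {u..<u + N}. mono_ev Z 12 t} \<le> 39" "card {t \<in> {u..<u + N}. mono_ev Z 13 t} \<le> 33"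
    using B.zz_bound card_half_period[of "mono_ev Z 12" u u0, OF mono_period[OF c]]
      card_half_period[of "mono_ev Z 13" u u0, OF mono_period[OF c]] unfolding m by simp_all
  assume K: "10 \<le> K" "K \<le> 14"
  have "{t \<in> B.I. \<exists>x\<in>Z. \<exists>y\<in>V - Z. swp t x y \<and> cnt V t y \<in> B.win K} = {t \<in> {u0..<u0 + N}. bi_ev Z K t}"
  proof (rule Collect_cong)
    fix t
    show "(t \<in> B.I \<and> (\<exists>x\<in>Z. \<exists>y\<in>V - Z. swp t x y \<and> cnt V t y \<in> B.win K)) = (t \<in> {u0..<u0 + N} \<and> bi_ev Z K t)"
    proof
      assume "t \<in> B.I \<and> (\<exists>x\<in>Z. \<exists>y\<in>V - Z. swp t x y \<and> cnt V t y \<in> B.win K)"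
      then show "t \<in> {u0..<u0 + N} \<and> bi_ev Z K t" unfolding B.I_def B.win_def bi_ev_def using B.ZV(1) by blast
    next
      assume a: "t \<in> {u0..<u0 + N} \<and> bi_ev Z K t"
      then obtain x y where xy: "x \<in> V" "y \<in> V" "x \<in> Z \<longleftrightarrow> y \<notin> Z" "swp t x y" "cnt V t y \<in> {K<..<30 - K}" unfolding bi_ev_def by blast
      have t: "t \<in> B.I" unfolding B.I_def using a by blast
      have "y \<notin> Z" using B.nonZ_right[OF t xy(4)] xy(3) by blast
      then show "t \<in> B.I \<and> (\<exists>x\<in>Z. \<exists>y\<in>V - Z. swp t x y \<and> cnt V t y \<in> B.win K)"
        unfolding B.win_def using t xy by blast
    qed
  qed
  then have "card {t \<in> {u0..<u0 + N}. bi_ev Z K t} = 10 * (29 - 2 * K)" using B.bich_count[OF K] by simp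
  then show "card {t \<in> {u..<u + N}. bi_ev Z K t} = 10 * (29 - 2 * K)"
    using card_half_period[of "bi_ev Z K" u u0, OF bi_period[OF c]] by simp
qed

text \<open>A swap between two classes is counted once for each of them, which is the reason for
  doubling.\<close>

lemma mid_split:
  assumes c: "card V = 30" and p: "V = P \<union> Q \<union> R" "P \<inter> Q = {}" "P \<inter> R = {}" "Q \<inter> R = {}"
  shows "2 * card {t \<in> {u..<u + N}. mid K t} = 2 * (card {t \<in> {u..<u + N}. mono_ev P K t} + card {t \<in> {u..<u + N}. mono_ev Q K t}
      + card {t \<in> {u..<u + N}. mono_ev R K t}) + (card {t \<in> {u..<u + N}. bi_ev P K t} + card {t \<in> {u..<u + N}. bi_ev Q K t}
      + card {t \<in> {u..<u + N}. bi_ev R K t})"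
proof -
  define A where "A = {u..<u + N}"
  have s: "card {t \<in> A. X t} = (\<Sum>t\<in>A. of_bool (X t))" for X
    using sum_of_bool_eq[of A X, where ?'a = nat] unfolding A_def by (simp add: Int_def del: sum_of_bool_eq)
  have pt: "2 * of_bool (mid K t) = 2 * (of_bool (mono_ev P K t) + of_bool (mono_ev Q K t) + of_bool (mono_ev R K t))
      + (of_bool (bi_ev P K t) + of_bool (bi_ev Q K t) + of_bool (bi_ev R K t) :: nat)" for t
  proof (cases "\<exists>x y. swp t x y \<and> cnt V t y \<in> {K<..<30 - K}")
    case False
    have "\<not> mid K t" unfolding mid_def ev_def c using False by fastforce
    moreover have "\<not> mono_ev S K t" "\<not> bi_ev S K t" for S unfolding mono_ev_def bi_ev_def using False by blast+
    ultimately show ?thesis by simp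
  next
    case True
    then obtain x y where xy: "swp t x y" "cnt V t y \<in> {K<..<30 - K}" by blast
    note D = swpD[OF xy(1)]
    have m: "mid K t" unfolding mid_def c using xy ev_swp[OF xy(1)] by auto
    have mo: "mono_ev S K t \<longleftrightarrow> x \<in> S \<and> y \<in> S" for S unfolding mono_ev_def using one[OF xy(1)] xy by blast
    have bi: "bi_ev S K t \<longleftrightarrow> (x \<in> S \<longleftrightarrow> y \<notin> S)" for S unfolding bi_ev_def using one[OF xy(1)] xy D(1,2) by blast
    have "x \<in> P \<and> x \<notin> Q \<and> x \<notin> R \<or> x \<notin> P \<and> x \<in> Q \<and> x \<notin> R \<or> x \<notin> P \<and> x \<notin> Q \<and> x \<in> R" using p D by blast
    moreover have "y \<in> P \<and> y \<notin> Q \<and> y \<notin> R \<or> y \<notin> P \<and> y \<in> Q \<and> y \<notin> R \<or> y \<notin> P \<and> y \<notin> Q \<and> y \<in> R" using p D by blast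
    ultimately show ?thesis unfolding mo bi using m by auto
  qed
  show ?thesis unfolding A_def[symmetric] s
    by (simp only: sum_distrib_left sum.distrib[symmetric] pt)
qed

end

section \<open>Chaining the three passages\<close>

locale three_blocks = tight_window V N bef for V :: "'a set" and N bef +
  fixes P Q R :: "'a set" and s1 s2 s3 :: int
  assumes pt: "V = P \<union> Q \<union> R" "P \<inter> Q = {}" "P \<inter> R = {}" "Q \<inter> R = {}"
    and cs: "card P = 10" "card Q = 10" "card R = 10"
    and s: "s1 < s2" "s2 < s3" "s3 < s1 + N"
    and d: "layered s1 Q P R" "layered s2 Q R P" "layered s3 R Q P"
    and mono_cnt: "\<And>S u. S \<in> {P, Q, R} \<Longrightarrow> card {t \<in> {u..<u + N}. mono_ev S 12 t} = 39 \<and> card {t \<in> {u..<u + N}. mono_ev S 13 t} = 33"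
begin

lemma sub: "P \<subseteq> V" "Q \<subseteq> V" "R \<subseteq> V" using pt by auto

lemma rotate: "three_blocks V N bef Q R P s3 (s1 + N) (s2 + N)"
proof
  show "V = Q \<union> R \<union> P" "Q \<inter> R = {}" "Q \<inter> P = {}" "R \<inter> P = {}" using pt by auto
  show "layered s3 R Q P" "layered (s1 + N) R P Q" "layered (s2 + N) P R Q" using d dec_flip(1) sub by simp_all
  show "s3 < s1 + N" "s1 + N < s2 + N" "s2 + N < s3 + N" using s by auto
  show "card {t \<in> {u..<u + N}. mono_ev S 12 t} = 39 \<and> card {t \<in> {u..<u + N}. mono_ev S 13 t} = 33" if "S \<in> {Q, R, P}" for S u
    using mono_cnt that by blast
qed (use cs in auto)

text \<open>The passage of \<open>Q\<close> runs with \<open>Y = R\<close> and \<open>W = P\<close>.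
  Given the end \<open>e\<close> of the passage of \<open>R\<close>, in which \<open>Q\<close> comes
  last, \<open>e - N\<close> is the first exchange of \<open>Q\<close> with \<open>R\<close> at the
  border of the middle and later than all swaps inside \<open>R\<close> there, as
  \<open>linked_block\<close> demands.\<close>

lemma ends: "\<exists>q. is_end Q P s2 q \<and> (\<forall>e. is_end R Q (s1 + N) e \<longrightarrow> e - N \<le> q \<and> 25 \<le> card {t \<in> {e - N..<q}. lev t})"
proof -
  interpret B: block V N bef Q R P s2 s3
    by unfold_locales (use pt cs c30 d s in \<open>auto simp: layered_def\<close>)
  have m: "{t \<in> B.I. B.inner_swap K t} = {t \<in> {s2..<s2 + N}. mono_ev Q K t}" for K
    unfolding B.I_def B.inner_swap_def B.win_def mono_ev_def by simp
  interpret B: tight_block V N bef Q R P s2 s3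
    by unfold_locales (use m mono_cnt[of Q s2] in auto)
  interpret B: window_block V N bef Q R P s2 s3 ..
  show ?thesis
  proof (intro exI[of _ B.th'] conjI allI impI)
    have "B.tk 3 \<in> Q" using B.tk(1)[of 3] by simp
    then have ex: "\<exists>x\<in>Q. \<exists>w\<in>P. swp B.th' x w \<and> cnt V B.th' w = 17" using B.th'D(3) by blast
    show "is_end Q P s2 B.th'"
      unfolding is_end_def using ex B.th'D(1,2) B.th'D(4,5) s unfolding B.I_def by auto
    fix e assume e: "is_end R Q (s1 + N) e"
    note E = e[unfolded is_end_def]
    define \<tau> where "\<tau> = e - N"
    have eN: "e = \<tau> + N" unfolding \<tau>_def by simp
    obtain x w where xw: "x \<in> R" "w \<in> Q" "swp e x w" "cnt V e w = 17" using E by blast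
    have V: "x \<in> V" "w \<in> V" using xw sub by auto
    have d': "layered (s1 + N) R P Q" "layered (s2 + N) P R Q" using d dec_flip(1) sub by simp_all
    have E1: "\<And>t x w. s1 + N \<le> t \<Longrightarrow> t < s1 + N + N \<Longrightarrow> x \<in> R \<Longrightarrow> w \<in> Q \<Longrightarrow> swp t x w \<Longrightarrow> cnt V t w \<in> {13, 17} \<Longrightarrow> e \<le> t"
      and E2: "\<And>t x w. s1 + N \<le> t \<Longrightarrow> t < s1 + N + N \<Longrightarrow> x \<in> R \<Longrightarrow> w \<in> R \<Longrightarrow> swp t x w \<Longrightarrow> cnt V t w \<in> {13, 17} \<Longrightarrow> t < e"
      using E by blast+
    have flp: "cnt V (t + N) x \<in> {13, 17}" if "swp t x y" "cnt V t y \<in> {13, 17}" for t x y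
      using swp_flip_cnt(2)[OF that(1) c30] that(2) by auto
    have first: "\<tau> \<le> t" if t: "s2 \<le> t" "t \<le> B.th" "swp t x y" "x \<in> Q" "y \<in> R" "cnt V t y \<in> {13, 17}" for t x y
    proof -
      have "e \<le> t + N" by (rule E1[of "t + N" y x]) (use t s B.th_rng swp_flip_cnt(1)[OF t(3) c30] flp[OF t(3,6)] in auto)
      then show ?thesis unfolding \<tau>_def by simp
    qed
    interpret B: linked_block V N bef Q R P s2 s3 \<tau>
    proof unfold_locales
      \<comment> \<open>At \<open>s1 + N\<close> and at \<open>s2 + N\<close> all of
        \<open>R\<close> is in front of \<open>Q\<close>, hence also in between. A swap at
        \<open>e\<close> before \<open>s2 + N\<close> would put a token of \<open>Q\<close> in front
        of one of \<open>R\<close>.\<close>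
      show "s2 \<le> \<tau>"
      proof (rule ccontr)
        assume "\<not> s2 \<le> \<tau>"
        then have lt: "e + 1 \<le> s2 + N" unfolding \<tau>_def by simp
        have "bef (e + 1) x w"
        proof (rule bef_between[OF V, of "s1 + N" "s2 + N"])
          show "bef (s1 + N) x w" "bef (s2 + N) x w" using d' xw unfolding layered_def by blast+
        qed (use lt E s in auto)
        then show False using swpD(4)[OF xw(3)] asym[OF V] by blast
      qed
      obtain y where y: "y \<in> R" "swp B.th (B.tk 3) y" "cnt V B.th y = 13" using B.thD(3) by blast
      show "\<tau> \<le> B.th" by (rule first[of _ "B.tk 3" y]) (use y B.th_rng B.tk(1)[of 3] in auto)
      have "ev V 17 (\<tau> + N)" using ev_swp[OF xw(3)] xw(4) eN by simp
      then show "ev V 13 \<tau>" using ev_flip[OF subset_refl, of 17 \<tau>] c30 by simp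
      show "\<tau> \<le> t" if "s2 \<le> t" "t \<le> B.th" "swp t x y" "x \<in> Q" "y \<in> R" "cnt V t y \<in> {13, 17}" for t x y
        by (rule first[OF that])
      show "cnt V t y \<notin> {13, 17}" if t: "\<tau> \<le> t" "t \<le> B.th" "swp t x y" "x \<in> R" "y \<in> R" for t x y
      proof
        assume c: "cnt V t y \<in> {13, 17}"
        have "t + N < e" by (rule E2[of "t + N" y x])
           (use t s B.th_rng E swp_flip_cnt(1)[OF t(3) c30] flp[OF t(3) c] \<tau>_def in auto)
        then show False using t(1) unfolding \<tau>_def by simp
      qed
      show "bef s2 y w" if "y \<in> R" "w \<in> P" for y w using d that unfolding layered_def by blast
    qed
    show "e - N \<le> B.th'" using B.t_rng B.th_le unfolding \<tau>_def by simp
    show "25 \<le> card {t \<in> {e - N..<B.th'}. lev t}" using B.level_count unfolding \<tau>_def .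
  qed
qed

lemma lev_shift: "lev (t + N) \<longleftrightarrow> lev t"
  unfolding lev_def using ev_flip[OF subset_refl, of 14 t] ev_flip[OF subset_refl, of 16 t] c30 by auto

text \<open>The passages of \<open>Q\<close>, \<open>R\<close>, \<open>P\<close> give the intervals
  from \<open>r - N\<close> to \<open>q\<close>, from \<open>p - N\<close> to \<open>r\<close>, and
  from \<open>q + N\<close> to \<open>p\<close>. The last one moved back by \<open>N\<close> runs
  from \<open>q\<close> to \<open>p - N\<close>, so the three tile exactly one half turn.\<close>

lemma lev_total: "75 \<le> card {t \<in> {u..<u + N}. lev t}"
proof -
  interpret A: three_blocks V N bef Q R P s3 "s1 + N" "s2 + N" by (rule rotate)
  interpret A2: three_blocks V N bef R P Q "s2 + N" "s3 + N" "s1 + N + N" by (rule A.rotate)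
  obtain q where q: "is_end Q P s2 q" "\<And>e. is_end R Q (s1 + N) e \<Longrightarrow> e - N \<le> q \<and> 25 \<le> card {t \<in> {e - N..<q}. lev t}"
    using ends by blast
  obtain r where r: "is_end R Q (s1 + N) r" "\<And>e. is_end P R (s3 + N) e \<Longrightarrow> e - N \<le> r \<and> 25 \<le> card {t \<in> {e - N..<r}. lev t}"
    using A.ends by blast
  obtain p where p: "is_end P R (s3 + N) p" "\<And>e. is_end Q P (s2 + N + N) e \<Longrightarrow> e - N \<le> p \<and> 25 \<le> card {t \<in> {e - N..<p}. lev t}"
    using A2.ends by blast
  have "s2 + N + N = s2 + 2 * N" by simp
  then have q': "is_end Q P (s2 + N + N) (q + 2 * N)" using is_end_shift[OF q(1)] by (simp only:)
  have e: "q + 2 * N - N = q + N" by simp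
  note 1 = q(2)[OF r(1)] and 2 = r(2)[OF p(1)] and 3 = p(2)[OF q', unfolded e]
  have c3: "card {t \<in> {q + N..<p}. lev t} = card {t \<in> {q..<p - N}. lev t}"
  proof (rule bij_betw_same_card[of "\<lambda>t. t - N"], rule bij_betwI[of _ _ _ "\<lambda>t. t + N"])
    show "(\<lambda>t. t - N) \<in> {t \<in> {q + N..<p}. lev t} \<rightarrow> {t \<in> {q..<p - N}. lev t}"
    proof
      fix t assume t: "t \<in> {t \<in> {q + N..<p}. lev t}"
      then show "t - N \<in> {t \<in> {q..<p - N}. lev t}" using lev_shift[of "t - N"] by auto
    qed
    show "(\<lambda>t. t + N) \<in> {t \<in> {q..<p - N}. lev t} \<rightarrow> {t \<in> {q + N..<p}. lev t}"
    proof
      fix t assume t: "t \<in> {t \<in> {q..<p - N}. lev t}"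
      then show "t + N \<in> {t \<in> {q + N..<p}. lev t}" using lev_shift[of t] by auto
    qed
  qed auto
  have dj: "card {t \<in> {a..<b}. lev t} + card {t \<in> {b..<c}. lev t} = card {t \<in> {a..<c}. lev t}" if "a \<le> b" "b \<le> c" for a b c
  proof -
    have "{t \<in> {a..<c}. lev t} = {t \<in> {a..<b}. lev t} \<union> {t \<in> {b..<c}. lev t}" using that by auto
    moreover have "{t \<in> {a..<b}. lev t} \<inter> {t \<in> {b..<c}. lev t} = {}" by auto
    ultimately show ?thesis using card_Un_disjoint[of "{t \<in> {a..<b}. lev t}" "{t \<in> {b..<c}. lev t}"] by simp
  qed
  have "card {t \<in> {r - N..<r}. lev t} \<ge> 75"
    using dj[of "r - N" q "p - N"] dj[of "r - N" "p - N" r] 1 2 3 c3 by auto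
  moreover have "card {t \<in> {u..<u + N}. lev t} = card {t \<in> {r - N..<r - N + N}. lev t}"
    by (rule card_half_period) (rule lev_shift)
  ultimately show ?thesis by simp
qed

end

context circular_seq
begin

text \<open>With no event in between, the two tokens stay at positions 14 and 15 and are themselves
  the next pair exchanged there, which takes half a turn. But within half a turn the foremost token
  travels to the other end and passes level 14.\<close>

lemma no_consecutive_middle:
  assumes c: "card V = 30" and e: "ev V 15 r" "ev V 15 t" and rt: "r < t" "t \<le> r + N"
    and no: "\<And>s k. r < s \<Longrightarrow> s < t \<Longrightarrow> k \<in> {14, 15, 16} \<Longrightarrow> \<not> ev V k s"
  shows False
proof -
  obtain p q where pq: "swp r p q" "cnt V r q = 15" using e(1) unfolding ev_def by blast
  obtain x y where xy: "swp t x y" "cnt V t y = 15" using e(2) unfolding ev_def by blast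
  note C = cnt_ge_1_swp[OF pq(1)] and C' = cnt_ge_1_swp[OF xy(1)] and D = swpD[OF pq(1)] and D' = swpD[OF xy(1)]
  have stay: "s \<le> t \<longrightarrow> cnt V s p = 15 \<and> cnt V s q = 14" if "r + 1 \<le> s" for s
    using that
  proof (induction s rule: int_ge_induct)
    case base
    then show ?case using C pq(2) by simp
  next
    case (step s)
    show ?case
    proof
      assume st: "s + 1 \<le> t"
      have h: "cnt V s p = 15" "cnt V s q = 14" using step st by auto
      have n: "\<not> ev V k s" if "k \<in> {14, 15, 16}" for k using no[of s k] step st that by auto
      have "cnt V (s + 1) v = cnt V s v" if v: "v \<in> V" "cnt V s v = 14 \<or> cnt V s v = 15" for v
      proof (rule ccontr)
        assume "cnt V (s + 1) v \<noteq> cnt V s v"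
        then show False
        proof (rule cnt_change[OF subset_refl v(1)])
          fix w assume "swp s v w"
          then show False using n ev_swp[of s v w] cnt_ge_1_swp(1)[of s v w] v(2) by auto
        next
          fix w assume "swp s w v"
          then show False using n ev_swp[of s w v] v(2) by auto
        qed
      qed
      then show "cnt V (s + 1) p = 15 \<and> cnt V (s + 1) q = 14" using h D by auto
    qed
  qed
  have "cnt V t p = 15" "cnt V t q = 14" using stay[of t] rt by auto
  then have "p = y" "q = x" using inj_onD[OF cnt_inj[OF subset_refl, of t]] D D' C' xy(2) by auto
  then have sw: "swp t q p" using xy by simp
  have "\<not> t < r + N"
  proof
    assume a: "t < r + N"
    have "r = t" by (rule swp_unique_half[OF pq(1), of t r]) (use sw a rt N_pos in auto)
    then show False using rt by simp
  qed
  then have t: "t = r + N" using rt(2) by linarith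
  obtain v where v: "v \<in> V" "cnt V (r + 1) v = 0" by (rule tok_at[OF subset_refl, of 0 "r + 1"]) (use c in auto)
  have "cnt V (r + 1 + N) v = 29" using cnt_flip_in[OF subset_refl v(1), of "r + 1"] v(2) c by simp
  then obtain s where s: "r + 1 \<le> s" "s < r + 1 + N" "cnt V s v < 14" "14 \<le> cnt V (s + 1) v"
    by - (rule crossing_up[of "r + 1" "r + 1 + N" "\<lambda>s. cnt V s v" 14], use v(2) N_pos in auto)
  have ev14: "ev V 14 s"
  proof (rule cnt_change[OF subset_refl v(1), of s])
    show "cnt V (s + 1) v \<noteq> cnt V s v" using s by simp
  next
    fix w assume w: "swp s v w" "cnt V (s + 1) v = cnt V s v + 1"
    then have "cnt V s w = 14" using s cnt_ge_1_swp(1)[OF w(1)] by simp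
    then show ?thesis using ev_swp[OF w(1)] by simp
  next
    fix w assume "cnt V s v = cnt V (s + 1) v + 1"
    then show ?thesis using s by simp
  qed
  have "s \<noteq> t" using ev14 e(2) ev_unique[of V 14 s 15] by auto
  then show False using no[of s 14] ev14 s t by auto
qed

text \<open>Each event at level 15 is paired with the next event at level 14 or 16. The flag
  \<open>h t\<close> says that the latest of these events was at level 15, so that one pairing is
  still open.\<close>

lemma middle_le: 
  assumes c: "card V = 30"
  shows "2 * card {t \<in> {u..<u + N}. mid 14 t} \<le> card {t \<in> {u..<u + N}. mid 13 t}"
proof (cases "\<exists>t. ev V 15 t")
  case False
  have "\<not> mid 14 t" for t
  proof
    assume "mid 14 t"
    then obtain j where "14 < j" "j < 16" "ev V j t" unfolding mid_def c by auto
    moreover then have "j = 15" by simp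
    ultimately show False using False by blast
  qed
  then show ?thesis by simp
next
  case True
  then obtain b where b: "ev V 15 b" by blast
  define h where "h t = (\<exists>r. b \<le> r \<and> r < t \<and> ev V 15 r \<and> (\<forall>s k. r < s \<and> s < t \<and> k \<in> {14, 15, 16} \<longrightarrow> \<not> ev V k s))" for t
  define f where "f P t = int (card {s \<in> {b..<t}. P s})" for P :: "int \<Rightarrow> bool" and t
  have fs: "f P (t + 1) = f P t + (if P t then 1 else 0)" if "b \<le> t" for P t
  proof -
    have "{s \<in> {b..<t + 1}. P s} = (if P t then insert t {s \<in> {b..<t}. P s} else {s \<in> {b..<t}. P s})"
      using that by (auto simp: order_le_less)
    moreover have "finite {s \<in> {b..<t}. P s}" by simp
    ultimately show ?thesis unfolding f_def by (simp del: finite_int_Collect)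
  qed
  have m13: "mid 13 t \<longleftrightarrow> ev V 14 t \<or> ev V 15 t \<or> ev V 16 t" for t
  proof
    assume "mid 13 t"
    then obtain j where j: "13 < j" "j < 17" "ev V j t" unfolding mid_def c by auto
    then have "j = 14 \<or> j = 15 \<or> j = 16" by auto
    then show "ev V 14 t \<or> ev V 15 t \<or> ev V 16 t" using j(3) by blast
  next
    assume "ev V 14 t \<or> ev V 15 t \<or> ev V 16 t"
    then show "mid 13 t" unfolding mid_def c
      by (elim disjE) (rule exI[of _ 14], simp, rule exI[of _ 15], simp, rule exI[of _ 16], simp)
  qed
  have m14: "mid 14 t \<longleftrightarrow> ev V 15 t" for t
  proof
    assume "mid 14 t"
    then obtain j where j: "14 < j" "j < 16" "ev V j t" unfolding mid_def c by auto
    then have "j = 15" by auto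
    then show "ev V 15 t" using j(3) by blast
  next
    assume "ev V 15 t"
    then show "mid 14 t" unfolding mid_def c by (intro exI[of _ 15]) simp
  qed
  have inv: "t \<le> b + N \<longrightarrow> 2 * f (mid 14) t \<le> f (mid 13) t + (if h t then 1 else 0)" if "b \<le> t" for t
    using that
  proof (induction t rule: int_ge_induct)
    case base
    show ?case unfolding f_def by simp
  next
    case (step t)
    show ?case
    proof
      assume tN: "t + 1 \<le> b + N"
      then have IH: "2 * f (mid 14) t \<le> f (mid 13) t + (if h t then 1 else 0)" using step by simp
      note F = fs[OF step.hyps, of "mid 14"] fs[OF step.hyps, of "mid 13"]
      consider "ev V 15 t" | "\<not> ev V 15 t" "mid 13 t" | "\<not> mid 13 t" by blast
      then show "2 * f (mid 14) (t + 1) \<le> f (mid 13) (t + 1) + (if h (t + 1) then 1 else 0)"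
      proof cases
        case 1
        have "\<not> h t"
        proof
          assume "h t"
          then obtain r where r: "b \<le> r" "r < t" "ev V 15 r" "\<And>s k. r < s \<Longrightarrow> s < t \<Longrightarrow> k \<in> {14, 15, 16} \<Longrightarrow> \<not> ev V k s"
            unfolding h_def by blast
          show False by (rule no_consecutive_middle[OF c r(3) 1 r(2) _ r(4)]) (use r tN in auto)
        qed
        moreover have "h (t + 1)" unfolding h_def using 1 step.hyps by (intro exI[of _ t]) auto
        moreover have "mid 13 t" "mid 14 t" using m13 m14 1 by auto
        ultimately show ?thesis using IH F by simp
      next
        case 2
        then have "\<not> mid 14 t" using m14 by simp
        then show ?thesis using IH F 2 by (simp split: if_splits)
      next
        case 3
        then have n: "\<not> ev V k t" if "k \<in> {14, 15, 16}" for k using m13[of t] that by auto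
        have "h (t + 1)" if ht: "h t"
        proof -
          obtain r where r: "b \<le> r" "r < t" "ev V 15 r" "\<forall>s k. r < s \<and> s < t \<and> k \<in> {14, 15, 16} \<longrightarrow> \<not> ev V k s"
            using ht unfolding h_def by blast
          have "\<forall>s k. r < s \<and> s < t + 1 \<and> k \<in> {14, 15, 16} \<longrightarrow> \<not> ev V k s"
          proof (intro allI impI)
            fix s k assume a: "r < s \<and> s < t + 1 \<and> k \<in> {14, 15, 16::nat}"
            show "\<not> ev V k s"
            proof (cases "s = t")
              case True then show ?thesis using n a by blast
            next
              case False then show ?thesis using r(4) a by auto
            qed
          qed
          then show ?thesis unfolding h_def using r by (intro exI[of _ r]) auto
        qed
        moreover have "\<not> mid 14 t" using n[of 15] m14 by simp
        ultimately show ?thesis using IH F 3 by (auto split: if_splits)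
      qed
    qed
  qed
  \<comment> \<open>The interval starts at a level-15 event on purpose: half a turn later there is
    another one, so no pairing can be open at its end.\<close>
  have bN: "ev V 15 (b + N)" using ev_flip[OF subset_refl, of 15 b] b c by simp
  have "\<not> h (b + N)"
  proof
    assume "h (b + N)"
    then obtain r where r: "b \<le> r" "r < b + N" "ev V 15 r" "\<And>s k. r < s \<Longrightarrow> s < b + N \<Longrightarrow> k \<in> {14, 15, 16} \<Longrightarrow> \<not> ev V k s"
      unfolding h_def by blast
    show False by (rule no_consecutive_middle[OF c r(3) bN r(2) _ r(4)]) (use r in auto)
  qed
  then have "2 * card {t \<in> {b..<b + N}. mid 14 t} \<le> card {t \<in> {b..<b + N}. mid 13 t}"
    using inv[of "b + N"] N_pos unfolding f_def by simp
  then show ?thesis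
    using card_half_period[of "mid 14" u b, OF mid_shift] card_half_period[of "mid 13" u b, OF mid_shift] by simp
qed

text \<open>Half a turn maps position \<open>i\<close> to \<open>29 - i\<close> and so preserves the
  window. One moment outside recurs in every half turn.\<close>

lemma leave30:
  assumes c: "card V = 30" and v: "v \<in> V" "v \<notin> window t0"
  shows "\<exists>r. a \<le> r \<and> r < a + N \<and> v \<notin> window r"
proof -
  have st: "v \<in> window (t + N) \<longleftrightarrow> v \<in> window t" for t
  proof -
    have "cnt V (t + N) v = 29 - cnt V t v" using cnt_flip_in[OF subset_refl v(1), of t] c by simp
    moreover have "cnt V t v < 30" using cnt_bound[OF subset_refl v(1), of t] c by simp
    ultimately show ?thesis unfolding window_def using v by auto
  qed
  have m: "v \<in> window (t + int n * N) \<longleftrightarrow> v \<in> window t" for n t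
  proof (induction n)
    case (Suc n)
    have "t + int (Suc n) * N = t + int n * N + N" by (simp add: algebra_simps)
    then show ?case using Suc st[of "t + int n * N"] by (simp only:)
  qed simp
  define r where "r = a + (t0 - a) mod N"
  have rr: "a \<le> r" "r < a + N" unfolding r_def using N_pos by auto
  define k where "k = (t0 - a) div N"
  have e: "t0 = r + k * N" unfolding r_def k_def using div_mult_mod_eq[of "t0 - a" N] by linarith
  have "v \<notin> window r"
  proof (cases "0 \<le> k")
    case True
    then show ?thesis using m[of r "nat k"] e v(2) by simp
  next
    case False
    then have "r = t0 + int (nat (- k)) * N" using e by simp
    then show ?thesis using m[of t0 "nat (- k)"] v(2) by simp
  qed
  then show ?thesis using rr by blast
qed

lemma notin_Win:
  assumes "layered t A B C" "V = A \<union> B \<union> C" "A \<inter> B = {}" "A \<inter> C = {}" "card A = 10" "v \<in> A"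
  shows "v \<notin> window t"
proof -
  have V: "A \<subseteq> V" "v \<in> V" using assms by auto
  have "{q \<in> V. bef t q v} \<subseteq> A"
  proof
    fix q assume q: "q \<in> {q \<in> V. bef t q v}"
    show "q \<in> A"
    proof (rule ccontr)
      assume "q \<notin> A"
      then have "bef t v q" using assms(1,2,6) q unfolding layered_def by blast
      then show False using asym[of v q t] V q by blast
    qed
  qed
  then have "cnt V t v \<le> 10" unfolding cnt_def using card_mono[OF fin_sub[OF V(1)]] assms(5) by metis
  then show ?thesis unfolding window_def by simp
qed

section \<open>The arithmetic of the contradiction\<close>

lemma tight_levels:
  assumes c: "card V = 30" and t: "A_le V 10 \<le> 165" "A_le V 12 = 243" "A_le V 13 = 291"
  shows "366 \<le> A_le V 14"
proof -
  have n: "card V = 3 * 9 + 3" using c by simp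
  have "A_bound (3 * 9) (9 - 1) = 108" by (simp add: numeral_eq_Suc)
  then have tt: "A_le V (9 + 1) \<le> 6 * 9 + 3 + A_bound (3 * 9) (9 - 1)" using t(1) by simp
  obtain P Q R s1 s2 s3 where p: "P \<union> Q \<union> R = V" "P \<inter> Q = {}" "P \<inter> R = {}" "Q \<inter> R = {}"
    and k: "card P = 9 + 1" "card Q = 9 + 1" "card R = 9 + 1"
    and s: "s1 \<le> s2" "s2 < s3" "s3 < s1 + N" and d: "layered s1 Q P R" "layered s2 Q R P" "layered s3 R Q P"
    by (rule tight_dec[OF n _ tt]) auto
  have k': "card P = 10" "card Q = 10" "card R = 10" using k by auto
  have V: "P \<subseteq> V" "Q \<subseteq> V" "R \<subseteq> V" using p by auto
  obtain x y where xy: "x \<in> P" "y \<in> R" using k' by (metis card.empty equals0I zero_neq_numeral)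
  have "s1 \<noteq> s2" using d(1,2) xy asym[of x y s1] V unfolding layered_def by blast
  then have s12: "s1 < s2" using s by simp
  have d': "layered (s1 + N) R P Q" "layered (s2 + N) P R Q" "layered (s3 + N) P Q R" "layered (s1 + N + N) Q P R"
    using d by (simp_all only: dec_flip(1) V)
  have ch: "card V choose 2 = 435" using c by (simp add: choose_two)
  have m: "card {t \<in> {u..<u + N}. mid 13 t} = 144" "card {t \<in> {u..<u + N}. mid 12 t} = 192" for u
    using A_le_mid[of 13 u] A_le_mid[of 12 u] t c ch by auto
  have pV: "V = P \<union> Q \<union> R" "V = Q \<union> R \<union> P" "V = R \<union> P \<union> Q" "V = R \<union> Q \<union> P" "V = P \<union> R \<union> Q" using p(1) by auto
  have p': "Q \<inter> P = {}" "R \<inter> P = {}" "R \<inter> Q = {}" using p by auto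
  have q1: "s2 \<le> s3" "s3 \<le> s2 + N" and q2: "s1 + N \<le> s2 + N" "s2 + N \<le> s1 + N + N"
    and q3: "s3 + N \<le> s1 + N + N" "s1 + N + N \<le> s3 + N + N" using s s12 by auto
  note BQ = block_counts[OF c pV(2) p(4) p'(1) p'(2) k'(2,3,1) d(2,3) q1]
  note BR = block_counts[OF c pV(3) p'(2) p'(3) p(2) k'(3,1,2) d'(1,2) q2]
  note BP = block_counts[OF c pV(1) p(2,3,4) k'(1,2,3) d'(3,4) q3]
  note M = mid_split[OF c pV(1) p(2,3,4)]
  \<comment> \<open>The bichromatic counts are 50 per class for \<open>K = 12\<close> and 30 for
    \<open>K = 13\<close>. Hence the swaps inside classes number \<open>192 - 75 = 3 * 39\<close>
    and \<open>144 - 45 = 3 * 33\<close>, so each class attains its upper bound.\<close>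
  have mono: "card {t \<in> {u..<u + N}. mono_ev S 12 t} = 39 \<and> card {t \<in> {u..<u + N}. mono_ev S 13 t} = 33"
    if S: "S \<in> {P, Q, R}" for S u
    using M[of u 12] M[of u 13] m[of u] BQ(1,2)[of u] BR(1,2)[of u] BP(1,2)[of u]
      BQ(3)[of 12 u] BR(3)[of 12 u] BP(3)[of 12 u] BQ(3)[of 13 u] BR(3)[of 13 u] BP(3)[of 13 u] S by auto
  interpret W: tight_window V N bef
  proof unfold_locales
    show "card V = 30" by (rule c)
    show "\<exists>r\<ge>a. r < a + N \<and> v \<notin> window r" if v: "v \<in> V" for v a
    proof -
      have "v \<in> P \<or> v \<in> Q \<or> v \<in> R" using v p(1) by blast
      then show ?thesis
      proof (elim disjE)
        assume a: "v \<in> P" show ?thesis using leave30[OF c v notin_Win[OF d'(2) pV(5) p(3,2) k'(1) a]] by blast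
      next
        assume a: "v \<in> Q" show ?thesis using leave30[OF c v notin_Win[OF d(2) pV(2) p(4) p'(1) k'(2) a]] by blast
      next
        assume a: "v \<in> R" show ?thesis using leave30[OF c v notin_Win[OF d(3) pV(4) p'(3,2) k'(3) a]] by blast
      qed
    qed
  qed (use m in auto)
  interpret T: three_blocks V N bef P Q R s1 s2 s3
    by unfold_locales (use pV(1) p k' s s12 d mono in auto)
  have "card {t \<in> {0..<0 + N}. W.lev t} + card {t \<in> {0..<0 + N}. mid 14 t} \<le> card {t \<in> {0..<0 + N}. mid 13 t}"
  proof -
    have "\<not> (W.lev t \<and> mid 14 t)" for t
    proof
      assume a: "W.lev t \<and> mid 14 t"
      then obtain j where j: "14 < j" "j < 16" "ev V j t" unfolding mid_def c by auto
      have "ev V 14 t \<or> ev V 16 t" using a unfolding W.lev_def by blast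
      then show False using ev_unique[of V 14 t j] ev_unique[of V 16 t j] j by auto
    qed
    then have dj: "{t \<in> {0..<0 + N}. W.lev t} \<inter> {t \<in> {0..<0 + N}. mid 14 t} = {}" by blast
    have "mid 13 t" if "W.lev t \<or> mid 14 t" for t
      using that unfolding W.lev_def mid_def c
    proof (elim disjE)
      assume "ev V 14 t" then show "\<exists>j>13. j < 30 - 13 \<and> ev V j t" by (intro exI[of _ 14]) simp
    next
      assume "ev V 16 t" then show "\<exists>j>13. j < 30 - 13 \<and> ev V j t" by (intro exI[of _ 16]) simp
    next
      assume "\<exists>j>14. j < 30 - 14 \<and> ev V j t"
      then obtain j where "14 < j" "j < 16" "ev V j t" by auto
      then show "\<exists>j>13. j < 30 - 13 \<and> ev V j t" by (intro exI[of _ j]) simp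
    qed
    then have "{t \<in> {0..<0 + N}. W.lev t} \<union> {t \<in> {0..<0 + N}. mid 14 t} \<subseteq> {t \<in> {0..<0 + N}. mid 13 t}" by blast
    then have "card ({t \<in> {0..<0 + N}. W.lev t} \<union> {t \<in> {0..<0 + N}. mid 14 t}) \<le> card {t \<in> {0..<0 + N}. mid 13 t}"
      by (rule card_mono[rotated]) simp
    then show ?thesis using card_Un_disjoint[OF _ _ dj] by simp
  qed
  \<comment> \<open>At most \<open>144 - 75 = 69\<close> swaps remain for level 15, and
    \<open>435 - 69 = 366\<close>.\<close>
  then show ?thesis using T.lev_total[of 0] m(1)[of 0] A_le_mid[of 14 0] ch c by simp
qed

lemma weighted_sum:
  assumes c: "card V = 30"
  shows "12771 \<le> (\<Sum>k = 1..14. (29 - 2 * k) * A_le V k)"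
proof (rule ccontr)
  assume "\<not> 12771 \<le> (\<Sum>k = 1..14. (29 - 2 * k) * A_le V k)"
  then have lt: "(\<Sum>k = 1..14. (29 - 2 * k) * A_le V k) < 12771" by simp
  have set: "{1..14::nat} = {1, 2, 3, 4, 5, 6, 7, 8, 9, 10, 11, 12, 13, 14}" by (rule set_eqI) (auto, presburger)
  have S: "27 * A_le V 1 + 25 * A_le V 2 + 23 * A_le V 3 + 21 * A_le V 4 + 19 * A_le V 5 + 17 * A_le V 6 + 15 * A_le V 7
    + 13 * A_le V 8 + 11 * A_le V 9 + 9 * A_le V 10 + 7 * A_le V 11 + 5 * A_le V 12 + 3 * A_le V 13 + A_le V 14 < 12771"
    using lt unfolding set by simp
  have L: "A_bound 30 K \<le> A_le V K" if "K \<le> 14" for K using A_lower[OF subset_refl, of K] that c by simp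
  \<comment> \<open>These are the values of
    \<open>3 * (K + 1 choose 2) + 3 * (K - 9 choose 2)\<close>; the second term begins at
    \<open>K = 11\<close>.\<close>
  have B: "A_bound 30 1 = 3" "A_bound 30 2 = 9" "A_bound 30 3 = 18" "A_bound 30 4 = 30" "A_bound 30 5 = 45"
    "A_bound 30 6 = 63" "A_bound 30 7 = 84" "A_bound 30 8 = 108" "A_bound 30 9 = 135" "A_bound 30 10 = 165"
    "A_bound 30 11 = 201" "A_bound 30 12 = 243" "A_bound 30 13 = 291"
    by (simp_all add: numeral_eq_Suc)
  note L' = L[of 1] L[of 2] L[of 3] L[of 4] L[of 5] L[of 6] L[of 7] L[of 8] L[of 9] L[of 10] L[of 11] L[of 12] L[of 13]
  have ch: "card V choose 2 = 435" using c by (simp add: choose_two)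
  have m: "435 + A_le V 13 \<le> 2 * A_le V 14"
    using middle_le[OF c, of 0] A_le_mid[of 13 0] A_le_mid[of 14 0] ch c by simp
  define d where "d k = A_le V k - A_bound 30 k" for k
  have D: "A_le V k = A_bound 30 k + d k" if "k \<le> 14" for k using L[OF that] unfolding d_def by simp
  note D' = D[of 1] D[of 2] D[of 3] D[of 4] D[of 5] D[of 6] D[of 7] D[of 8] D[of 9] D[of 10] D[of 11] D[of 12] D[of 13]
  have E: "A_le V 1 = 3 + d 1" "A_le V 2 = 9 + d 2" "A_le V 3 = 18 + d 3" "A_le V 4 = 30 + d 4" "A_le V 5 = 45 + d 5" "A_le V 6 = 63 + d 6" "A_le V 7 = 84 + d 7" "A_le V 8 = 108 + d 8" "A_le V 9 = 135 + d 9" "A_le V 10 = 165 + d 10" "A_le V 11 = 201 + d 11" "A_le V 12 = 243 + d 12" "A_le V 13 = 291 + d 13"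
    using D'[unfolded B] by simp_all
  have "27 * d 1 + 25 * d 2 + 23 * d 3 + 21 * d 4 + 19 * d 5 + 17 * d 6 + 15 * d 7 + 13 * d 8 + 11 * d 9 + 9 * d 10
    + 7 * d 11 + 5 * d 12 + 3 * d 13 + A_le V 14 < 366"
    using S unfolding E by simp
  moreover have "726 + d 13 \<le> 2 * A_le V 14" using m unfolding E by simp
  \<comment> \<open>\<open>A_le V 14\<close> is at least 363, which leaves less than 3 for the
    weighted excesses. The weights of \<open>d 10\<close>, \<open>d 12\<close> and
    \<open>d 13\<close> are 9, 5 and 3.\<close>
  ultimately have "d 10 = 0" "d 12 = 0" "d 13 = 0" "A_le V 14 < 366" by auto
  then have "A_le V 10 \<le> 165" "A_le V 12 = 243" "A_le V 13 = 291" "A_le V 14 < 366" using E by auto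
  then show False using tight_levels[OF c] by simp
qed

end

section \<open>Sweeping a point set\<close>

definition orient :: "('a \<Rightarrow> real) \<Rightarrow> ('a \<Rightarrow> real) \<Rightarrow> 'a \<Rightarrow> 'a \<Rightarrow> 'a \<Rightarrow> real" where
  "orient x y a b c = (x b - x a) * (y c - y a) - (x c - x a) * (y b - y a)"

lemma div_shift:
  fixes a b n :: int
  assumes "0 < n"
  shows "(a + b * n) div n = a div n + b"
  using assms by simp

lemma div_minus_1:
  fixes a n :: int
  assumes "0 < n" "- n \<le> a" "a < 0"
  shows "a div n = - 1"
proof -
  have "(a + 1 * n) div n = 0" using assms by (intro div_pos_pos_trivial) auto
  then show ?thesis unfolding div_shift[OF assms(1)] by simp
qed

text \<open>Elements are inserted by increasing value of \<open>f\<close>, each receiving the next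
  rank; equal values get different ranks in the order of insertion.\<close>

lemma ranking:
  fixes f :: "'b \<Rightarrow> real"
  assumes "finite E"
  shows "\<exists>\<tau> :: 'b \<Rightarrow> nat. inj_on \<tau> E \<and> (\<forall>e\<in>E. \<tau> e < card E) \<and> (\<forall>e\<in>E. \<forall>e'\<in>E. f e < f e' \<longrightarrow> \<tau> e < \<tau> e')"
  using assms
proof (induction rule: finite_ranking_induct[where f = f])
  case empty
  show ?case by simp
next
  case (insert e E)
  obtain \<tau> :: "'b \<Rightarrow> nat" where t: "inj_on \<tau> E" "\<forall>e\<in>E. \<tau> e < card E" "\<forall>e\<in>E. \<forall>e'\<in>E. f e < f e' \<longrightarrow> \<tau> e < \<tau> e'"
    using insert.IH by blast
  show ?case
  proof (cases "e \<in> E")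
    case True
    then show ?thesis using t by (intro exI[of _ \<tau>]) (simp add: insert_absorb)
  next
    case False
    have ne: "e' \<noteq> e" if "e' \<in> E" for e' using False that by blast
    have i: "inj_on (\<tau>(e := card E)) (insert e E)"
    proof (rule inj_onI)
      fix a b assume ab: "a \<in> insert e E" "b \<in> insert e E" "(\<tau>(e := card E)) a = (\<tau>(e := card E)) b"
      show "a = b" using ab t(2) inj_onD[OF t(1)] by (cases "a = e"; cases "b = e") (auto simp: less_irrefl)
    qed
    have m: "(\<tau>(e := card E)) a < (\<tau>(e := card E)) b" if ab: "a \<in> insert e E" "b \<in> insert e E" "f a < f b" for a b
    proof (cases "a = e")
      case True
      then show ?thesis using ab insert.hyps(2)[of b] by (cases "b = e") auto
    next
      case False
      then show ?thesis using ab t(2,3) by (cases "b = e") auto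
    qed
    have c: "(\<tau>(e := card E)) a < card (insert e E)" if "a \<in> insert e E" for a
      using that t(2) False insert.hyps(1) by (cases "a = e") (auto simp: less_Suc_eq)
    show ?thesis using i m c by blast
  qed
qed

locale sweep =
  fixes V :: "'a set" and x y :: "'a \<Rightarrow> real"
  assumes finV: "finite V" and cV: "card V = 30" and yinj: "inj_on y V"
    and gp: "\<And>a b c. a \<in> V \<Longrightarrow> b \<in> V \<Longrightarrow> c \<in> V \<Longrightarrow> distinct [a, b, c] \<Longrightarrow> orient x y a b c \<noteq> 0"
begin

definition E :: "('a \<times> 'a) set" where "E = {(p, q). p \<in> V \<and> q \<in> V \<and> y p < y q}"
text \<open>The reciprocal of the usual slope. The initial order is by \<open>y\<close>, whose
  values are distinct, so it is always defined, and pairs are exchanged in the order of increasing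
  \<open>slope\<close>.\<close>

definition slope :: "'a \<times> 'a \<Rightarrow> real" where "slope = (\<lambda>(p, q). (x q - x p) / (y q - y p))"
definition nn :: int where "nn = int (card E)"

end

text \<open>\<open>\<tau>\<close> breaks ties between parallel edges. Any tie-breaking will do, since edges with a common endpoint are
never parallel.\<close>

locale ranked_sweep = sweep V x y for V :: "'a set" and x y +
  fixes \<tau> :: "'a \<times> 'a \<Rightarrow> nat"
  assumes t_inj: "inj_on \<tau> E" and t_lt: "\<And>e. e \<in> E \<Longrightarrow> \<tau> e < card E"
    and t_mono: "\<And>e e'. e \<in> E \<Longrightarrow> e' \<in> E \<Longrightarrow> slope e < slope e' \<Longrightarrow> \<tau> e < \<tau> e'"
begin

lemma finE: "finite E"
  by (rule finite_subset[of _ "V \<times> V"]) (use finV in \<open>auto simp: E_def\<close>)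

lemma y_neq: "p \<in> V \<Longrightarrow> q \<in> V \<Longrightarrow> p \<noteq> q \<Longrightarrow> y p < y q \<or> y q < y p"
  using inj_onD[OF yinj, of p q] by (meson linorder_neqE)

definition tm :: "'a \<Rightarrow> 'a \<Rightarrow> int" where "tm p q = (if y p < y q then int (\<tau> (p, q)) else int (\<tau> (q, p)))"

lemma tm_sym: "tm p q = tm q p" if "p \<in> V" "q \<in> V"
  using y_neq[OF that] unfolding tm_def by (cases "p = q") auto

lemma tm_E: "(p, q) \<in> E \<Longrightarrow> tm p q = int (\<tau> (p, q))" unfolding E_def tm_def by simp

lemma tm_rng: "p \<in> V \<Longrightarrow> q \<in> V \<Longrightarrow> p \<noteq> q \<Longrightarrow> 0 \<le> tm p q \<and> tm p q < nn"
  using y_neq[of p q] t_lt[of "(p, q)"] t_lt[of "(q, p)"] unfolding tm_def nn_def E_def by auto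

lemma slope_lt: "(p, q) \<in> E \<Longrightarrow> (r, s) \<in> E \<Longrightarrow> (x q - x p) * (y s - y r) < (x s - x r) * (y q - y p) \<Longrightarrow> tm p q < tm r s"
proof -
  assume a: "(p, q) \<in> E" "(r, s) \<in> E" "(x q - x p) * (y s - y r) < (x s - x r) * (y q - y p)"
  have "slope (p, q) < slope (r, s)" using a unfolding slope_def E_def by (simp add: field_simps)
  then show ?thesis using t_mono[OF a(1,2)] tm_E a(1,2) by simp
qed

text \<open>The slope of \<open>pr\<close> is a weighted mean of those of \<open>pq\<close> and
  \<open>qr\<close>, and it lies strictly between them by general position. Ranks inherit the strict
  inequalities, and this is where the transitivity of the swept order comes from.\<close>

lemma between:
  assumes V: "p \<in> V" "q \<in> V" "r \<in> V" and o: "y p < y q" "y q < y r"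
  shows "0 < orient x y p q r \<Longrightarrow> tm q r < tm p r \<and> tm p r < tm p q" "orient x y p q r < 0 \<Longrightarrow> tm p q < tm p r \<and> tm p r < tm q r"
    "orient x y p q r \<noteq> 0"
proof -
  have e: "(p, q) \<in> E" "(q, r) \<in> E" "(p, r) \<in> E" using assms unfolding E_def by auto
  note L = slope_lt[OF e(1,3)] slope_lt[OF e(3,1)] slope_lt[OF e(2,3)] slope_lt[OF e(3,2)]
  have i: "orient x y p q r = (x q - x p) * (y r - y p) - (x r - x p) * (y q - y p)"
    "orient x y p q r = (x r - x p) * (y r - y q) - (x r - x q) * (y r - y p)"
    unfolding orient_def by (simp_all add: algebra_simps)
  show "0 < orient x y p q r \<Longrightarrow> tm q r < tm p r \<and> tm p r < tm p q" using L i by simp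
  show "orient x y p q r < 0 \<Longrightarrow> tm p q < tm p r \<and> tm p r < tm q r" using L i by simp
  have "distinct [p, q, r]" using o by auto
  then show "orient x y p q r \<noteq> 0" by (rule gp[OF V])
qed

lemma nn_pos: "0 < nn"
proof -
  obtain p q where "p \<in> V" "q \<in> V" "p \<noteq> q" using cV by (metis card_le_Suc0_iff_eq finV numeral_le_one_iff semiring_norm(69) One_nat_def)
  then show ?thesis using tm_rng[of p q] by simp
qed

text \<open>For \<open>t >= 0\<close> the number \<open>(t - 1 - tm p q) div nn + 1\<close> counts
  the exchanges of the pair at times from 0 up to \<open>t - 1\<close>; an even number means that
  the initial order holds. The formula extends to negative times.\<close>

definition par :: "int \<Rightarrow> 'a \<Rightarrow> 'a \<Rightarrow> bool" where "par t p q \<longleftrightarrow> even ((t - 1 - tm p q) div nn + 1)"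

definition bf :: "int \<Rightarrow> 'a \<Rightarrow> 'a \<Rightarrow> bool" where
  "bf t p q \<longleftrightarrow> p \<noteq> q \<and> (y p < y q \<longleftrightarrow> par t p q)"

lemma par_base: "p \<in> V \<Longrightarrow> q \<in> V \<Longrightarrow> p \<noteq> q \<Longrightarrow> 0 \<le> t \<Longrightarrow> t \<le> nn \<Longrightarrow> par t p q \<longleftrightarrow> t \<le> tm p q"
proof -
  assume a: "p \<in> V" "q \<in> V" "p \<noteq> q" "0 \<le> t" "t \<le> nn"
  note r = tm_rng[OF a(1-3)]
  show ?thesis
  proof (cases "t \<le> tm p q")
    case True
    then have "(t - 1 - tm p q) div nn = - 1" using r a by (intro div_minus_1 nn_pos) auto
    then show ?thesis unfolding par_def using True by simp
  next
    case False
    then have "(t - 1 - tm p q) div nn = 0" using r a by (intro div_pos_pos_trivial) auto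
    then show ?thesis unfolding par_def using False by simp
  qed
qed

lemma par_shift: "par (t + nn) p q \<longleftrightarrow> \<not> par t p q"
proof -
  have "t + nn - 1 - tm p q = (t - 1 - tm p q) + 1 * nn" by simp
  then have "(t + nn - 1 - tm p q) div nn = (t - 1 - tm p q) div nn + 1" by (simp only: div_shift[OF nn_pos])
  then show ?thesis unfolding par_def by simp
qed

lemma par_sym: "p \<in> V \<Longrightarrow> q \<in> V \<Longrightarrow> par t p q \<longleftrightarrow> par t q p"
  unfolding par_def using tm_sym[of p q] by simp

lemma par_mod: "par t p q \<longleftrightarrow> (par (t mod nn) p q \<longleftrightarrow> even (t div nn))"
proof -
  have "t - 1 - tm p q = (t mod nn - 1 - tm p q) + (t div nn) * nn"
    using div_mult_mod_eq[of t nn] by linarith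
  then have "(t - 1 - tm p q) div nn = (t mod nn - 1 - tm p q) div nn + t div nn" by (simp only: div_shift[OF nn_pos])
  then show ?thesis unfolding par_def by (cases "even (t div nn)") simp_all
qed

lemma bf_mod: "p \<in> V \<Longrightarrow> q \<in> V \<Longrightarrow> bf t p q \<longleftrightarrow> (if even (t div nn) then bf (t mod nn) p q else bf (t mod nn) q p)"
proof -
  assume V: "p \<in> V" "q \<in> V"
  show ?thesis using par_mod[of t p q] par_sym[OF V, of "t mod nn"] y_neq[OF V] unfolding bf_def by auto
qed

lemma par_change:
  assumes "par t p q \<noteq> par (t + 1) p q"
  shows "\<exists>k. t = tm p q + k * nn"
proof -
  define u where "u = t - tm p q"
  have "u mod nn = 0"
  proof (rule ccontr)
    assume a: "u mod nn \<noteq> 0"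
    have r: "0 \<le> u mod nn - 1" "u mod nn - 1 < nn" using a pos_mod_bound[OF nn_pos, of u] pos_mod_sign[OF nn_pos, of u] by linarith+
    have "u - 1 = (u mod nn - 1) + (u div nn) * nn" using div_mult_mod_eq[of u nn] by linarith
    then have "(u - 1) div nn = (u mod nn - 1) div nn + u div nn" by (simp only: div_shift[OF nn_pos])
    then have "(u - 1) div nn = u div nn" using div_pos_pos_trivial[OF r] by simp
    moreover have "t - 1 - tm p q = u - 1" "t + 1 - 1 - tm p q = u" unfolding u_def by auto
    ultimately have e: "(t - 1 - tm p q) div nn = u div nn" "(t + 1 - 1 - tm p q) div nn = u div nn" by (simp_all only:)
    show False using assms unfolding par_def e by simp
  qed
  then have "u = (u div nn) * nn" using div_mult_mod_eq[of u nn] by linarith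
  then show ?thesis unfolding u_def by (intro exI[of _ "(t - tm p q) div nn"]) linarith
qed

lemma bf_change: "p \<in> V \<Longrightarrow> q \<in> V \<Longrightarrow> bf t p q \<Longrightarrow> bf (t + 1) q p \<Longrightarrow> \<exists>k. t = tm p q + k * nn"
proof -
  assume a: "p \<in> V" "q \<in> V" "bf t p q" "bf (t + 1) q p"
  have "par t p q \<noteq> par (t + 1) p q" using a(3,4) y_neq[OF a(1,2)] par_sym[OF a(1,2), of "t + 1"] unfolding bf_def by auto
  then show ?thesis by (rule par_change)
qed

lemma btw:
  assumes "p \<in> V" "q \<in> V" "r \<in> V" "y p < y q" "y q < y r"
  shows "tm q r < tm p r \<and> tm p r < tm p q \<or> tm p q < tm p r \<and> tm p r < tm q r"
  using between[OF assms] by linarith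

text \<open>For three tokens sorted by \<open>y\<close> the exchange of the outer two comes between
  the other two exchanges. Every order passed through is therefore consistent.\<close>

lemma bf_trans0:
  assumes V: "p \<in> V" "q \<in> V" "r \<in> V" and t: "0 \<le> t" "t < nn" and b: "bf t p q" "bf t q r"
  shows "bf t p r"
proof -
  have ne: "p \<noteq> q" "q \<noteq> r" using b unfolding bf_def by auto
  have i: "bf t a b \<longleftrightarrow> a \<noteq> b \<and> (y a < y b \<longleftrightarrow> t \<le> tm a b)" if "a \<in> V" "b \<in> V" for a b
    using par_base[OF that _ t(1)] t(2) unfolding bf_def by auto
  note s = tm_sym[OF V(1,2)] tm_sym[OF V(2,3)] tm_sym[OF V(1,3)]
  have pr: "p \<noteq> r"
  proof
    assume "p = r"
    then show False using b i V s y_neq[OF V(1,2)] by auto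
  qed
  have h: "y p < y q \<longleftrightarrow> t \<le> tm p q" "y q < y r \<longleftrightarrow> t \<le> tm q r" using b i V by auto
  have o: "y p < y q \<or> y q < y p" "y q < y r \<or> y r < y q" "y p < y r \<or> y r < y p" using y_neq V ne pr by auto
  have "y p < y r \<longleftrightarrow> t \<le> tm p r"
  proof (cases "y p < y q")
    case pq: True
    show ?thesis
    proof (cases "y q < y r")
      case True then show ?thesis using btw[OF V] pq h by auto
    next
      case False
      then have rq: "y r < y q" using o by simp
      show ?thesis using btw[OF V(1,3,2)] btw[OF V(3,1,2)] pq rq h o(3) s by auto
    qed
  next
    case False
    then have qp: "y q < y p" using o by simp
    show ?thesis
    proof (cases "y q < y r")
      case True then show ?thesis using btw[OF V(2,1,3)] btw[OF V(2,3,1)] qp h o(3) s by auto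
    next
      case False
      then have "y r < y q" using o by simp
      then show ?thesis using btw[OF V(3,2,1)] qp h s by auto
    qed
  qed
  then show ?thesis using i[OF V(1,3)] pr by simp
qed

lemma t_inj': "p \<in> V \<Longrightarrow> q \<in> V \<Longrightarrow> r \<in> V \<Longrightarrow> s \<in> V \<Longrightarrow> p \<noteq> q \<Longrightarrow> r \<noteq> s \<Longrightarrow> tm p q = tm r s \<Longrightarrow> p = r \<and> q = s \<or> p = s \<and> q = r"
proof -
  assume a: "p \<in> V" "q \<in> V" "r \<in> V" "s \<in> V" "p \<noteq> q" "r \<noteq> s" "tm p q = tm r s"
  have E: "(if y p < y q then (p, q) else (q, p)) \<in> E" "(if y r < y s then (r, s) else (s, r)) \<in> E"
    using a y_neq[of p q] y_neq[of r s] unfolding E_def by auto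
  have "\<tau> (if y p < y q then (p, q) else (q, p)) = \<tau> (if y r < y s then (r, s) else (s, r))"
    using a(7) unfolding tm_def by (auto split: if_splits)
  from inj_onD[OF t_inj this E] show ?thesis by (auto split: if_splits)
qed

sublocale circular_seq V nn bf
proof
  show "finite V" "0 < nn" by (rule finV, rule nn_pos)
  show "\<not> bf t p p" for t p unfolding bf_def by simp
  show "bf t p q \<or> bf t q p" if "p \<in> V" "q \<in> V" "p \<noteq> q" for p q t
    using that y_neq[of p q] par_sym[of p q t] unfolding bf_def by auto
  show "bf (t + nn) p q \<longleftrightarrow> bf t q p" if "p \<in> V" "q \<in> V" for p q t
    using that y_neq[of p q] par_sym[of p q t] par_shift[of t p q] unfolding bf_def by auto
  show "bf t p r" if a: "p \<in> V" "q \<in> V" "r \<in> V" "bf t p q" "bf t q r" for p q r t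
  proof -
    have t: "0 \<le> t mod nn" "t mod nn < nn" using nn_pos by auto
    show ?thesis
      using a(4,5) bf_trans0[OF a(1,2,3) t] bf_trans0[OF a(3,2,1) t] bf_mod[OF a(1,2), of t] bf_mod[OF a(2,3), of t]
        bf_mod[OF a(1,3), of t] by (auto split: if_splits)
  qed
  show "p = r \<and> q = s" if a: "p \<in> V" "q \<in> V" "r \<in> V" "s \<in> V" "bf t p q" "bf (t + 1) q p" "bf t r s" "bf (t + 1) s r" for p q r s t
  proof -
    obtain k k' where k: "t = tm p q + k * nn" "t = tm r s + k' * nn" using bf_change a by meson
    have ne: "p \<noteq> q" "r \<noteq> s" using a unfolding bf_def by auto
    have "t mod nn = tm p q" "t mod nn = tm r s"
      unfolding k(1) using tm_rng[OF a(1,2) ne(1)] apply simp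
      unfolding k(1)[symmetric] k(2) using tm_rng[OF a(3,4) ne(2)] by simp
    then have "p = r \<and> q = s \<or> p = s \<and> q = r" using t_inj'[OF a(1-4) ne] by simp
    moreover have "\<not> (p = s \<and> q = r)" using a(5,7) y_neq[OF a(1,2)] par_sym[OF a(1,2), of t] unfolding bf_def by auto
    ultimately show ?thesis by blast
  qed
  show "bf t' q p" if a: "p \<in> V" "q \<in> V" "bf t p q" "bf (t + 1) q p" "t < t'" "t' \<le> t + nn" for p q t t'
  proof -
    obtain k where k: "t = tm p q + k * nn" using bf_change a by blast
    have "t' - 1 - tm p q = (t' - t - 1) + k * nn" "t - 1 - tm p q = - 1 + k * nn" using k by auto
    then have "(t' - 1 - tm p q) div nn = (t' - t - 1) div nn + k" "(t - 1 - tm p q) div nn = - 1 div nn + k" by (simp_all only: div_shift[OF nn_pos])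
    moreover have "(t' - t - 1) div nn = 0" using a by (intro div_pos_pos_trivial) auto
    moreover have "- 1 div nn = - 1" using nn_pos by (intro div_minus_1) auto
    ultimately have "par t' p q \<noteq> par t p q" unfolding par_def by simp
    then show ?thesis using a(3) y_neq[OF a(1,2)] par_sym[OF a(1,2), of t'] unfolding bf_def by auto
  qed
qed

section \<open>From levels to numbers of points on either side of an edge\<close>

definition lf :: "'a \<Rightarrow> 'a \<Rightarrow> nat" where "lf p q = card {r \<in> V. 0 < orient x y p q r}"
definition rt :: "'a \<Rightarrow> 'a \<Rightarrow> nat" where "rt p q = card {r \<in> V. orient x y p q r < 0}"

lemma lf_rt: "p \<in> V \<Longrightarrow> q \<in> V \<Longrightarrow> p \<noteq> q \<Longrightarrow> lf p q + rt p q = 28"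
proof -
  assume a: "p \<in> V" "q \<in> V" "p \<noteq> q"
  have "{r \<in> V. 0 < orient x y p q r} \<union> {r \<in> V. orient x y p q r < 0} = V - {p, q}"
  proof (rule set_eqI)
    fix r
    have "orient x y p q p = 0" "orient x y p q q = 0" unfolding orient_def by simp_all
    moreover have "r \<in> V - {p, q} \<Longrightarrow> orient x y p q r \<noteq> 0" using gp[of p q r] a by auto
    ultimately show "r \<in> {r \<in> V. 0 < orient x y p q r} \<union> {r \<in> V. orient x y p q r < 0} \<longleftrightarrow> r \<in> V - {p, q}"
      using a by (cases "r = p"; cases "r = q") auto
  qed
  moreover have "card (V - {p, q}) = 28" using card_Diff_subset[of "{p, q}" V] a cV by simp
  moreover have dj: "{r \<in> V. 0 < orient x y p q r} \<inter> {r \<in> V. orient x y p q r < 0} = {}" by auto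
  ultimately show ?thesis unfolding lf_def rt_def using card_Un_disjoint[OF _ _ dj] finV by simp
qed

lemma swp_E: "0 \<le> t \<Longrightarrow> t < nn \<Longrightarrow> swp t p q \<longleftrightarrow> (p, q) \<in> E \<and> tm p q = t"
proof -
  assume t: "0 \<le> t" "t < nn"
  show ?thesis
  proof (cases "p \<in> V \<and> q \<in> V \<and> p \<noteq> q")
    case True
    then have V: "p \<in> V" "q \<in> V" "p \<noteq> q" by auto
    have "par t p q \<longleftrightarrow> t \<le> tm p q" "par (t + 1) p q \<longleftrightarrow> t + 1 \<le> tm p q" using par_base[OF V] t by auto
    then show ?thesis unfolding swp_def E_def bf_def using V y_neq[OF V] par_sym[OF V(1,2), of "t + 1"] by auto
  next
    case False
    then show ?thesis unfolding swp_def E_def bf_def by auto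
  qed
qed

text \<open>When an edge is about to be exchanged, the order compares points with \<open>p\<close>
  by the side of the line \<open>pq\<close> on which they lie. Strict slope comparisons decide each
  case, so ties between parallel edges do no harm.\<close>

lemma cnt_E: assumes e: "(p, q) \<in> E" shows "cnt V (tm p q) p = lf p q"
proof -
  have V: "p \<in> V" "q \<in> V" "p \<noteq> q" and o: "y p < y q" using e unfolding E_def by auto
  define t where "t = tm p q"
  have t: "0 \<le> t" "t \<le> nn" using tm_rng[OF V] unfolding t_def by auto
  have "bf t r p \<longleftrightarrow> 0 < orient x y p q r" if r: "r \<in> V" for r
  proof (cases "r = p \<or> r = q")
    case True
    have "\<not> bf t q p" using par_base[OF V(2,1) V(3)[symmetric] t] tm_sym[OF V(1,2)] o unfolding bf_def t_def by simp
    then show ?thesis using True unfolding orient_def bf_def by auto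
  next
    case False
    then have ne: "r \<noteq> p" "p \<noteq> r" "r \<noteq> q" by auto
    have g: "orient x y p q r \<noteq> 0" using gp[OF V(1,2) r] V ne by simp
    have b: "bf t r p \<longleftrightarrow> (y r < y p \<longleftrightarrow> t \<le> tm r p)" using par_base[OF r V(1) ne(1) t] ne unfolding bf_def by simp
    show ?thesis
    proof (cases "y p < y r")
      case True
      then have e': "(p, r) \<in> E" unfolding E_def using V r by simp
      have "0 < orient x y p q r \<Longrightarrow> tm p r < tm p q" using slope_lt[OF e' e] unfolding orient_def by simp
      moreover have "orient x y p q r < 0 \<Longrightarrow> tm p q < tm p r" using slope_lt[OF e e'] unfolding orient_def by simp
      ultimately show ?thesis using b True tm_sym[OF V(1) r] g unfolding t_def by (cases "0 < orient x y p q r") auto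
    next
      case False
      then have o': "y r < y p" using y_neq[OF r V(1) ne(1)] by simp
      then have e': "(r, p) \<in> E" unfolding E_def using V r by simp
      have "0 < orient x y p q r \<Longrightarrow> tm p q < tm r p" using slope_lt[OF e e'] unfolding orient_def by (simp add: algebra_simps)
      moreover have "orient x y p q r < 0 \<Longrightarrow> tm r p < tm p q" using slope_lt[OF e' e] unfolding orient_def by (simp add: algebra_simps)
      ultimately show ?thesis using b o' g unfolding t_def by (cases "0 < orient x y p q r") auto
    qed
  qed
  then show ?thesis unfolding cnt_def lf_def t_def by (intro arg_cong[of _ _ card]) auto
qed

lemma ev_E: "0 \<le> t \<Longrightarrow> t < nn \<Longrightarrow> ev V j t \<longleftrightarrow> (\<exists>p q. (p, q) \<in> E \<and> tm p q = t \<and> lf p q + 1 = j)"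
proof -
  assume t: "0 \<le> t" "t < nn"
  have c: "cnt V t q = lf p q + 1" if "(p, q) \<in> E" "tm p q = t" for p q
    using cnt_ge_1_swp(1)[of t p q] swp_E[OF t, of p q] cnt_E[OF that(1)] that by simp
  show ?thesis
  proof
    assume "ev V j t"
    then obtain p q where pq: "swp t p q" "cnt V t q = j" unfolding ev_def by blast
    then show "\<exists>p q. (p, q) \<in> E \<and> tm p q = t \<and> lf p q + 1 = j" using swp_E[OF t, of p q] c[of p q] by auto
  next
    assume "\<exists>p q. (p, q) \<in> E \<and> tm p q = t \<and> lf p q + 1 = j"
    then obtain p q where pq: "(p, q) \<in> E" "tm p q = t" "lf p q + 1 = j" by blast
    then have "swp t p q" using swp_E[OF t] by simp
    then show "ev V j t" using ev_swp[of t p q] c[OF pq(1,2)] pq(3) by simp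
  qed
qed

lemma inj_tm: "inj_on (\<lambda>(p, q). tm p q) E"
proof (rule inj_onI)
  fix e e' assume e: "e \<in> E" "e' \<in> E" "(\<lambda>(p, q). tm p q) e = (\<lambda>(p, q). tm p q) e'"
  obtain p q r s where pq: "e = (p, q)" "e' = (r, s)" by (cases e; cases e')
  have h: "p \<in> V" "q \<in> V" "r \<in> V" "s \<in> V" "y p < y q" "y r < y s" "tm p q = tm r s" using e unfolding pq E_def by auto
  have "p \<noteq> q" "r \<noteq> s" using h by auto
  then show "e = e'" using t_inj'[OF h(1-4) _ _ h(7)] h(5,6) unfolding pq by auto
qed

lemma card_times:
  assumes "T = {t \<in> {0..<nn}. \<exists>e\<in>E. (\<lambda>(p, q). tm p q) e = t \<and> X e}"
  shows "card T = card {e \<in> E. X e}"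
proof -
  have "T = (\<lambda>(p, q). tm p q) ` {e \<in> E. X e}"
  proof
    show "(\<lambda>(p, q). tm p q) ` {e \<in> E. X e} \<subseteq> T" unfolding assms using tm_rng unfolding E_def by fastforce
  qed (use assms in auto)
  then show ?thesis using card_image[OF inj_on_subset[OF inj_tm, of "{e \<in> E. X e}"]] by auto
qed

text \<open>The first half of the period shows every edge from one side, with \<open>lf p q\<close>
  points in front, and the second half shows it from the other side, with \<open>rt p q\<close>
  points.\<close>

lemma A_le_E:
  assumes K: "K \<le> 14"
  shows "A_le V K = card {e \<in> E. (case e of (p, q) \<Rightarrow> lf p q) < K} + card {e \<in> E. (case e of (p, q) \<Rightarrow> rt p q) < K}"
proof -
  let ?A = "{t \<in> {0..<nn}. \<exists>j\<le>K. ev V j t}" and ?B = "{t \<in> {0..<nn}. \<exists>j\<le>K. ev V j (t + nn)}"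
  have B: "card {t \<in> {nn..<2 * nn}. \<exists>j\<le>K. ev V j t} = card ?B"
  proof (rule bij_betw_same_card[of "\<lambda>t. t - nn"], rule bij_betwI[of _ _ _ "\<lambda>t. t + nn"])
    show "(\<lambda>t. t - nn) \<in> {t \<in> {nn..<2 * nn}. \<exists>j\<le>K. ev V j t} \<rightarrow> ?B" by simp
    show "(\<lambda>t. t + nn) \<in> ?B \<rightarrow> {t \<in> {nn..<2 * nn}. \<exists>j\<le>K. ev V j t}" using nn_pos by simp
  qed auto
  have sp: "{t \<in> {0..<2 * nn}. \<exists>j\<le>K. ev V j t} = ?A \<union> {t \<in> {nn..<2 * nn}. \<exists>j\<le>K. ev V j t}"
    using nn_pos by auto
  have "A_le V K = card ?A + card ?B"
    unfolding A_le_def sp B[symmetric] by (rule card_Un_disjoint) auto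
  moreover have "card ?A = card {e \<in> E. (case e of (p, q) \<Rightarrow> lf p q) < K}"
  proof (rule card_times, rule Collect_cong, rule conj_cong[OF refl])
    fix t assume "t \<in> {0..<nn}"
    then have t: "0 \<le> t" "t < nn" by auto
    show "(\<exists>j\<le>K. ev V j t) = (\<exists>e\<in>E. (case e of (p, q) \<Rightarrow> tm p q) = t \<and> (case e of (p, q) \<Rightarrow> lf p q) < K)"
    proof
      assume "\<exists>j\<le>K. ev V j t"
      then obtain j p q where "j \<le> K" "(p, q) \<in> E" "tm p q = t" "lf p q + 1 = j" unfolding ev_E[OF t] by blast
      then show "\<exists>e\<in>E. (case e of (p, q) \<Rightarrow> tm p q) = t \<and> (case e of (p, q) \<Rightarrow> lf p q) < K" by (intro bexI[of _ "(p, q)"]) auto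
    next
      assume "\<exists>e\<in>E. (case e of (p, q) \<Rightarrow> tm p q) = t \<and> (case e of (p, q) \<Rightarrow> lf p q) < K"
      then obtain p q where pq: "(p, q) \<in> E" "tm p q = t" "lf p q < K" by auto
      have "ev V (lf p q + 1) t" unfolding ev_E[OF t] using pq by blast
      then show "\<exists>j\<le>K. ev V j t" using pq by (intro exI[of _ "lf p q + 1"]) simp
    qed
  qed
  moreover have "card ?B = card {e \<in> E. (case e of (p, q) \<Rightarrow> rt p q) < K}"
  proof (rule card_times, rule Collect_cong, rule conj_cong[OF refl])
    fix t assume "t \<in> {0..<nn}"
    then have t: "0 \<le> t" "t < nn" by auto
    have f: "ev V j (t + nn) \<longleftrightarrow> j < 30 \<and> 0 < j \<and> (\<exists>p q. (p, q) \<in> E \<and> tm p q = t \<and> lf p q + 1 = 30 - j)" for j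
      using ev_flip[OF subset_refl, of j t] ev_E[OF t, of "30 - j"] cV by simp
    have lr: "lf p q + rt p q = 28" if "(p, q) \<in> E" for p q using lf_rt[of p q] that unfolding E_def by auto
    show "(\<exists>j\<le>K. ev V j (t + nn)) = (\<exists>e\<in>E. (case e of (p, q) \<Rightarrow> tm p q) = t \<and> (case e of (p, q) \<Rightarrow> rt p q) < K)"
    proof
      assume "\<exists>j\<le>K. ev V j (t + nn)"
      then obtain j p q where j: "j \<le> K" "j < 30" "0 < j" "(p, q) \<in> E" "tm p q = t" "lf p q + 1 = 30 - j" unfolding f by blast
      then have "rt p q < K" using lr[of p q] by simp
      then show "\<exists>e\<in>E. (case e of (p, q) \<Rightarrow> tm p q) = t \<and> (case e of (p, q) \<Rightarrow> rt p q) < K" using j by (intro bexI[of _ "(p, q)"]) auto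
    next
      assume "\<exists>e\<in>E. (case e of (p, q) \<Rightarrow> tm p q) = t \<and> (case e of (p, q) \<Rightarrow> rt p q) < K"
      then obtain p q where pq: "(p, q) \<in> E" "tm p q = t" "rt p q < K" by auto
      have "ev V (rt p q + 1) (t + nn)" unfolding f using pq lr[of p q] by (intro conjI exI[of _ p] exI[of _ q]) auto
      then show "\<exists>j\<le>K. ev V j (t + nn)" using pq by (intro exI[of _ "rt p q + 1"]) simp
    qed
  qed
  ultimately show ?thesis by simp
qed

text \<open>For \<open>m = min l r\<close> the odd numbers \<open>29 - 2 * k\<close> with
  \<open>m < k <= 14\<close> add up to \<open>(14 - m)^2\<close>, and
  \<open>(14 - m)^2 + m * (28 - m) = 14^2\<close>. This is the origin of the weights.\<close>

lemma weights: "l + r = 28 \<Longrightarrow> (\<Sum>k = 1..14. (29 - 2 * k) * (of_bool (l < k) + of_bool (r < k))) + l * r = (196 :: nat)"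
proof -
  assume a: "l + r = (28::nat)"
  have "\<forall>l\<in>set [0..<29]. (\<Sum>k\<leftarrow>[1..<15]. (29 - 2 * k) * ((if l < k then 1 else 0) + (if 28 - l < k then 1 else 0))) + l * (28 - l) = (196::nat)"
    by code_simp
  moreover have "r = 28 - l" "l \<in> set [0..<29]" using a by auto
  moreover have "set [1..<15] = {1..14::nat}" by auto
  ultimately show ?thesis by (simp add: sum_list_distinct_conv_sum_set of_bool_def)
qed

lemma swap_E: "{(p, q). p \<in> V \<and> q \<in> V \<and> p \<noteq> q} = E \<union> prod.swap ` E" "E \<inter> prod.swap ` E = {}"
  using y_neq unfolding E_def by (force simp: image_iff)+

lemma card_E: "card E = 435"
proof -
  have "{(p, q). p \<in> V \<and> q \<in> V \<and> p \<noteq> q} = Sigma V (\<lambda>p. V - {p})" by auto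
  then have "card {(p, q). p \<in> V \<and> q \<in> V \<and> p \<noteq> q} = 870" using finV cV by simp
  moreover have "card (prod.swap ` E) = card E" by (rule card_image) (auto simp: inj_on_def)
  ultimately show ?thesis unfolding swap_E(1) using card_Un_disjoint[OF finE _ swap_E(2)] finE by simp
qed

text \<open>\<open>435 * 196 - 12771 = 72489\<close>, by summing the identity \<open>weights\<close>
  over all edges.\<close>

lemma lr_bound: "(\<Sum>(p, q)\<in>E. lf p q * rt p q) \<le> 72489"
proof -
  have c: "card {e \<in> E. g e < k} = (\<Sum>e\<in>E. of_bool (g e < k))" for g :: "'a \<times> 'a \<Rightarrow> nat" and k
  proof -
    have "E \<inter> {e. g e < k} = {e \<in> E. g e < k}" by auto
    then show ?thesis by (simp add: finE)
  qed
  have "(\<Sum>k = 1..14. (29 - 2 * k) * A_le V k) =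
    (\<Sum>k = 1..14. \<Sum>e\<in>E. (29 - 2 * k) * (of_bool ((case e of (p, q) \<Rightarrow> lf p q) < k) + of_bool ((case e of (p, q) \<Rightarrow> rt p q) < k)))"
    by (rule sum.cong[OF refl]) (simp only: A_le_E atLeastAtMost_iff c sum_distrib_left[symmetric] sum.distrib)
  also have "\<dots> = (\<Sum>e\<in>E. \<Sum>k = 1..14. (29 - 2 * k) * (of_bool ((case e of (p, q) \<Rightarrow> lf p q) < k) + of_bool ((case e of (p, q) \<Rightarrow> rt p q) < k)))"
    by (rule sum.swap)
  finally have "(\<Sum>k = 1..14. (29 - 2 * k) * A_le V k) + (\<Sum>(p, q)\<in>E. lf p q * rt p q) = (\<Sum>e\<in>E. 196)"
    unfolding sum.distrib[symmetric]
  proof (simp only: sum.distrib[symmetric], intro sum.cong[OF refl])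
    fix e assume "e \<in> E"
    then obtain p q where e: "e = (p, q)" "(p, q) \<in> E" by (cases e) auto
    then have "lf p q + rt p q = 28" using lf_rt[of p q] unfolding E_def by auto
    from weights[OF this]
    show "(\<Sum>k = 1..14. (29 - 2 * k) * (of_bool ((case e of (p, q) \<Rightarrow> lf p q) < k) + of_bool ((case e of (p, q) \<Rightarrow> rt p q) < k))) +
       (case e of (p, q) \<Rightarrow> lf p q * rt p q) = 196" unfolding e by simp
  qed
  then show ?thesis using weighted_sum[OF cV] card_E by simp
qed

lemma lr_total: "(\<Sum>(p, q)\<in>{(p, q). p \<in> V \<and> q \<in> V \<and> p \<noteq> q}. lf p q * rt p q) \<le> 144978"
proof -
  have o: "orient x y q p r = - orient x y p q r" for p q r unfolding orient_def by (simp add: algebra_simps)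
  have sw: "lf q p = rt p q" "rt q p = lf p q" for p q unfolding lf_def rt_def o[of q p] by simp_all
  have "(\<Sum>(p, q)\<in>prod.swap ` E. lf p q * rt p q) = (\<Sum>e\<in>E. (\<lambda>(p, q). lf p q * rt p q) (prod.swap e))"
    by (rule sum.reindex_cong[of prod.swap]) (auto simp: inj_on_def)
  also have "\<dots> = (\<Sum>(p, q)\<in>E. lf p q * rt p q)" 
  proof (rule sum.cong[OF refl])
    fix e :: "'a \<times> 'a"
    obtain p q where e: "e = (p, q)" by (cases e)
    show "(\<lambda>(p, q). lf p q * rt p q) (prod.swap e) = (case e of (p, q) \<Rightarrow> lf p q * rt p q)" unfolding e using sw[of p q] by simp
  qed
  finally show ?thesis unfolding swap_E(1) 
    using sum.union_disjoint[OF finE finite_imageI[OF finE] swap_E(2), of "\<lambda>(p, q). lf p q * rt p q"] lr_bound by simp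
qed

end

text \<open>Adding \<open>c\<close> times the first coordinate to the second is a shear and leaves
  all orientations unchanged. Avoiding the finitely many values in \<open>B\<close> makes the second
  coordinates distinct, as the sweep requires.\<close>

theorem separation_bound:
  fixes x y :: "'a \<Rightarrow> real"
  assumes V: "finite V" "card V = 30"
    and gp: "\<And>a b c. a \<in> V \<Longrightarrow> b \<in> V \<Longrightarrow> c \<in> V \<Longrightarrow> distinct [a, b, c] \<Longrightarrow> orient x y a b c \<noteq> 0"
  shows "(\<Sum>(p, q)\<in>{(p, q). p \<in> V \<and> q \<in> V \<and> p \<noteq> q}. card {r \<in> V. 0 < orient x y p q r} * card {r \<in> V. orient x y p q r < 0}) \<le> 144978"
proof -
  define B where "B = (\<lambda>(p, q). (y q - y p) / (x p - x q)) ` (V \<times> V)"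
  have "finite B" unfolding B_def using V by simp
  then obtain c where c: "c \<notin> B" using ex_new_if_finite[OF infinite_UNIV_char_0] by blast
  define z where "z a = y a + c * x a" for a
  have o: "orient x z a b d = orient x y a b d" for a b d unfolding orient_def z_def by (simp add: algebra_simps)
  have inj: "inj_on z V"
  proof (rule inj_onI, rule ccontr)
    fix a b assume ab: "a \<in> V" "b \<in> V" "z a = z b" "a \<noteq> b"
    show False
    proof (cases "x a = x b")
      case True
      then have y: "y a = y b" using ab(3) unfolding z_def by simp
      have "\<not> V \<subseteq> {a, b}" using V card_mono[of "{a, b}" V] ab(4) by auto
      then obtain d where d: "d \<in> V" "d \<noteq> a" "d \<noteq> b" by blast
      have "orient x y a b d = 0" unfolding orient_def using True y by simp
      then show False using gp[OF ab(1,2) d(1)] d ab by auto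
    next
      case False
      then have "c = (y b - y a) / (x a - x b)" using ab(3) unfolding z_def by (simp add: field_simps)
      then have "c \<in> B" unfolding B_def using ab by auto
      then show False using c by simp
    qed
  qed
  interpret S: sweep V x z using V gp inj by unfold_locales (auto simp: o)
  have "finite S.E" by (rule finite_subset[of _ "V \<times> V"]) (use V in \<open>auto simp: S.E_def\<close>)
  then obtain \<tau> :: "'a \<times> 'a \<Rightarrow> nat" where t: "inj_on \<tau> S.E" "\<forall>e\<in>S.E. \<tau> e < card S.E"
    "\<forall>e\<in>S.E. \<forall>e'\<in>S.E. S.slope e < S.slope e' \<longrightarrow> \<tau> e < \<tau> e'" using ranking[of S.E S.slope] by blast
  interpret R: ranked_sweep V x z \<tau> by unfold_locales (use t in auto)
  show ?thesis using R.lr_total unfolding R.lf_def R.rt_def o .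
qed

section \<open>Counting crossings\<close>

definition ori :: "real^2 \<Rightarrow> real^2 \<Rightarrow> real^2 \<Rightarrow> real" where
  "ori a b c = (b$1 - a$1) * (c$2 - a$2) - (c$1 - a$1) * (b$2 - a$2)"

lemma collinear_ori: "collinear {a, b, c} \<longleftrightarrow> ori a b c = 0"
proof -
  define u v where "u = a - b" and "v = c - b"
  have o: "ori a b c = u$2 * v$1 - u$1 * v$2" unfolding ori_def u_def v_def by (simp add: algebra_simps)
  have "collinear {a, b, c} \<longleftrightarrow> collinear {0, u, v}" unfolding u_def v_def by (rule collinear_3) (simp add: NO_MATCH_def)
  also have "\<dots> \<longleftrightarrow> u = 0 \<or> v = 0 \<or> (\<exists>k. v = k *\<^sub>R u)" by (rule collinear_lemma)
  also have "\<dots> \<longleftrightarrow> u$2 * v$1 - u$1 * v$2 = 0"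
  proof
    assume "u = 0 \<or> v = 0 \<or> (\<exists>k. v = k *\<^sub>R u)"
    then show "u$2 * v$1 - u$1 * v$2 = 0" by auto
  next
    assume z: "u$2 * v$1 - u$1 * v$2 = 0"
    show "u = 0 \<or> v = 0 \<or> (\<exists>k. v = k *\<^sub>R u)"
    proof (cases "u$1 = 0")
      case False
      have "v = (v$1 / u$1) *\<^sub>R u" using z False by (simp add: vec_eq_iff forall_2 field_simps)
      then show ?thesis by blast
    next
      case u1: True
      show ?thesis
      proof (cases "u$2 = 0")
        case True
        then show ?thesis using u1 by (simp add: vec_eq_iff forall_2)
      next
        case False
        then have "v = (v$2 / u$2) *\<^sub>R u" using z u1 by (simp add: vec_eq_iff forall_2)
        then show ?thesis by blast
      qed
    qed
  qed
  finally show ?thesis unfolding o .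
qed

lemma mix_sign:
  fixes F G t :: real
  assumes "(1 - t) * F + t * G = 0" "0 \<le> t" "t \<le> 1" "F \<noteq> 0" "G \<noteq> 0"
  shows "F * G < 0"
proof (rule ccontr)
  assume "\<not> F * G < 0"
  then have "0 < F * G" using assms by (simp add: less_le)
  have "((1 - t) * F + t * G) * F = (1 - t) * F^2 + t * (F * G)" by (simp add: power2_eq_square algebra_simps)
  then have e: "(1 - t) * F^2 + t * (F * G) = 0" using assms(1) by simp
  have "0 \<le> (1 - t) * F^2" "0 \<le> t * (F * G)" using assms \<open>0 < F * G\<close> by auto
  then have "(1 - t) * F^2 = 0" "t * (F * G) = 0" using e by linarith+
  then show False using assms \<open>0 < F * G\<close> by auto
qed

text \<open>On the line through one segment the orientation is zero, and a convex combination of two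
  numbers vanishes only if their signs differ. Conversely Cramer's rule gives the parameters of the
  intersection point, with the common denominator \<open>K\<close> up to sign.\<close>

lemma segments_meet:
  assumes n: "ori a b c \<noteq> 0" "ori a b d \<noteq> 0" "ori c d a \<noteq> 0" "ori c d b \<noteq> 0"
  shows "convex hull {a, b} \<inter> convex hull {c, d} \<noteq> {} \<longleftrightarrow> ori a b c * ori a b d < 0 \<and> ori c d a * ori c d b < 0"
proof
  assume "convex hull {a, b} \<inter> convex hull {c, d} \<noteq> {}"
  then obtain z where z: "z \<in> closed_segment a b" "z \<in> closed_segment c d" unfolding segment_convex_hull by blast
  obtain s where s: "0 \<le> s" "s \<le> 1" "z = (1 - s) *\<^sub>R a + s *\<^sub>R b" using z(1) unfolding in_segment by blast
  obtain t where t: "0 \<le> t" "t \<le> 1" "z = (1 - t) *\<^sub>R c + t *\<^sub>R d" using z(2) unfolding in_segment by blast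
  have "ori a b z = 0" unfolding s(3) ori_def by (simp add: algebra_simps)
  moreover have "ori a b z = (1 - t) * ori a b c + t * ori a b d" unfolding t(3) ori_def by (simp add: algebra_simps)
  ultimately have 1: "ori a b c * ori a b d < 0" using mix_sign[of t] t n by simp
  have "ori c d z = 0" unfolding t(3) ori_def by (simp add: algebra_simps)
  moreover have "ori c d z = (1 - s) * ori c d a + s * ori c d b" unfolding s(3) ori_def by (simp add: algebra_simps)
  ultimately have "ori c d a * ori c d b < 0" using mix_sign[of s] s n by simp
  with 1 show "ori a b c * ori a b d < 0 \<and> ori c d a * ori c d b < 0" ..
next
  assume h: "ori a b c * ori a b d < 0 \<and> ori c d a * ori c d b < 0"
  have ratio: "0 \<le> F / (F - G) \<and> F / (F - G) \<le> 1 \<and> F - G \<noteq> 0" if "F * G < 0" for F G :: real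
    using that by (auto simp: mult_less_0_iff divide_simps)
  define K where "K = ori a b c - ori a b d"
  define t where "t = ori a b c / K"
  define s where "s = ori c d a / (ori c d a - ori c d b)"
  have t: "0 \<le> t" "t \<le> 1" "K \<noteq> 0" using ratio[of "ori a b c" "ori a b d"] h unfolding t_def K_def by auto
  have s: "0 \<le> s" "s \<le> 1" using ratio[of "ori c d a" "ori c d b"] h unfolding s_def by auto
  have K: "ori c d a - ori c d b = - K" unfolding K_def ori_def by (simp add: algebra_simps)
  have tK: "t * K = ori a b c" "s * K = - ori c d a" unfolding t_def s_def K using t(3) by simp_all
  have co: "(1 - s) * a$i + s * b$i = (1 - t) * c$i + t * d$i" if "i = 1 \<or> i = 2" for i
  proof -
    have "K * ((1 - s) * a$i + s * b$i) = K * a$i + (s * K) * (b$i - a$i)" by (simp add: algebra_simps)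
    also have "\<dots> = K * c$i + (t * K) * (d$i - c$i)"
      unfolding tK using that unfolding K_def ori_def by (elim disjE) (simp_all add: algebra_simps)
    also have "\<dots> = K * ((1 - t) * c$i + t * d$i)" by (simp add: algebra_simps)
    finally show ?thesis using t(3) by simp
  qed
  have "(1 - s) *\<^sub>R a + s *\<^sub>R b = (1 - t) *\<^sub>R c + t *\<^sub>R d" using co[of 1] co[of 2] by (simp add: vec_eq_iff forall_2)
  moreover have "(1 - s) *\<^sub>R a + s *\<^sub>R b \<in> closed_segment a b" "(1 - t) *\<^sub>R c + t *\<^sub>R d \<in> closed_segment c d"
    unfolding in_segment using s t by blast+
  ultimately show "convex hull {a, b} \<inter> convex hull {c, d} \<noteq> {}" unfolding segment_convex_hull by (metis IntI empty_iff)
qed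

text \<open>Ordered quadruples make the symmetries into permutations of the index set. For 30 points
  there are \<open>30 * 29 * 28 * 27 = 657720\<close> of them.\<close>

definition quads :: "'a set \<Rightarrow> ('a \<times> 'a \<times> 'a \<times> 'a) set" where
  "quads V = {(a, b, c, d). a \<in> V \<and> b \<in> V \<and> c \<in> V \<and> d \<in> V \<and> distinct [a, b, c, d]}"

lemma quads_Sigma: "quads V = (SIGMA a:V. SIGMA b:V - {a}. SIGMA c:V - {a, b}. V - {a, b, c})"
  unfolding quads_def by auto

lemma card_quads: "finite V \<Longrightarrow> card V = 30 \<Longrightarrow> card (quads V) = 657720"
proof -
  assume V: "finite V" "card V = 30"
  have 3: "card (V - {a, b, c}) = 27" if "a \<in> V" "b \<in> V - {a}" "c \<in> V - {a, b}" for a b c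
    using card_Diff_subset[of "{a, b, c}" V] that V by auto
  have 2: "card (V - {a, b}) = 28" if "a \<in> V" "b \<in> V - {a}" for a b
    using card_Diff_subset[of "{a, b}" V] that V by auto
  have 1: "card (V - {a}) = 29" if "a \<in> V" for a using that V by simp
  have "card (SIGMA c:V - {a, b}. V - {a, b, c}) = 756" if "a \<in> V" "b \<in> V - {a}" for a b
    using V 3[OF that] 2[OF that] by simp
  then have "card (SIGMA b:V - {a}. SIGMA c:V - {a, b}. V - {a, b, c}) = 21924" if "a \<in> V" for a
    using V 1[OF that] that by simp
  then show ?thesis unfolding quads_Sigma using V by simp
qed

lemma finite_quads: "finite V \<Longrightarrow> finite (quads V)" unfolding quads_Sigma by simp

section \<open>Crossings as a function of the numbers of points on either side of the edges\<close>

locale drawing =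
  fixes V :: "'a set" and p :: "'a \<Rightarrow> real^2"
  assumes V: "finite V" "card V = 30" and draw: "geometric_drawing V p"
begin

definition O3 :: "'a \<Rightarrow> 'a \<Rightarrow> 'a \<Rightarrow> real" where "O3 a b c = ori (p a) (p b) (p c)"

lemma O3_nz: "a \<in> V \<Longrightarrow> b \<in> V \<Longrightarrow> c \<in> V \<Longrightarrow> distinct [a, b, c] \<Longrightarrow> O3 a b c \<noteq> 0"
  using draw unfolding geometric_drawing_def O3_def collinear_ori by blast

definition separates :: "'a \<times> 'a \<times> 'a \<times> 'a \<Rightarrow> bool" where "separates = (\<lambda>(a, b, c, d). O3 a b c * O3 a b d < 0)"
definition meet :: "'a \<times> 'a \<times> 'a \<times> 'a \<Rightarrow> bool" where
  "meet = (\<lambda>(a, b, c, d). convex hull {p a, p b} \<inter> convex hull {p c, p d} \<noteq> {})"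

lemma meet_iff: "(a, b, c, d) \<in> quads V \<Longrightarrow> meet (a, b, c, d) \<longleftrightarrow> separates (a, b, c, d) \<and> separates (c, d, a, b)"
proof -
  assume q: "(a, b, c, d) \<in> quads V"
  have "ori (p a) (p b) (p c) \<noteq> 0" "ori (p a) (p b) (p d) \<noteq> 0" "ori (p c) (p d) (p a) \<noteq> 0" "ori (p c) (p d) (p b) \<noteq> 0"
    using q O3_nz unfolding quads_def O3_def by auto
  then show ?thesis unfolding meet_def separates_def O3_def using segments_meet by simp
qed

text \<open>Four points span either a convex quadrilateral (one crossing, two separating diagonals) or a triangle with
an interior point (no crossing, three separating edges).\<close>

lemma four_points:
  assumes q: "(a, b, c, d) \<in> quads V"
  shows "of_bool (meet (a, b, c, d)) + of_bool (meet (a, c, b, d)) + of_bool (meet (a, d, b, c)) +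
    of_bool (separates (a, b, c, d)) + of_bool (separates (c, d, a, b)) + of_bool (separates (a, c, b, d)) + of_bool (separates (b, d, a, c)) +
    of_bool (separates (a, d, b, c)) + of_bool (separates (b, c, a, d)) = (3 :: nat)"
proof -
  define A B C D where "A = O3 b c d" and "B = O3 a c d" and "C = O3 a b d" and "D = O3 a b c"
  have nz: "A \<noteq> 0" "B \<noteq> 0" "C \<noteq> 0" "D \<noteq> 0" using q O3_nz unfolding A_def B_def C_def D_def quads_def by auto
  have rel: "A - B + C - D = 0" unfolding A_def B_def C_def D_def O3_def ori_def by (simp add: algebra_simps)
  have o: "O3 c d a = B" "O3 c d b = A" "O3 a c b = - D" "O3 b d a = C" "O3 b d c = - A" "O3 a d b = - C" "O3 a d c = - B"
     "O3 b c a = D" "O3 a c d = B" "O3 a b d = C" "O3 b c d = A" "O3 a b c = D"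
    unfolding A_def B_def C_def D_def O3_def ori_def by (simp_all add: algebra_simps)
  have q': "(a, c, b, d) \<in> quads V" "(a, d, b, c) \<in> quads V" using q unfolding quads_def by auto
  show ?thesis
    unfolding meet_iff[OF q] meet_iff[OF q'(1)] meet_iff[OF q'(2)] separates_def prod.case o
    using nz rel
    by (cases "0 < A"; cases "0 < B"; cases "0 < C"; cases "0 < D")
      (simp_all add: mult_less_0_iff zero_less_mult_iff not_less order_le_less)
qed

text \<open>Summing \<open>four_points\<close> over all ordered quadruples, each of the nine terms
  is a rearranged sum of \<open>meet\<close> or of \<open>separates\<close>. The result is three
  times the one and six times the other.\<close>

lemma count_identity: "card {q \<in> quads V. meet q} + 2 * card {q \<in> quads V. separates q} = 657720"
proof -
  have f: "finite (quads V)" by (rule finite_quads[OF V(1)])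
  have c: "card {q \<in> quads V. X q} = (\<Sum>q\<in>quads V. of_bool (X q))" for X
  proof -
    have "quads V \<inter> {q. X q} = {q \<in> quads V. X q}" by auto
    then show ?thesis by (simp add: f)
  qed
  have perm: "(\<Sum>q\<in>quads V. of_bool (X (g q))) = card {q \<in> quads V. X q}"
    if "\<And>q. q \<in> quads V \<Longrightarrow> g q \<in> quads V \<and> h (g q) = q" "\<And>q. q \<in> quads V \<Longrightarrow> h q \<in> quads V \<and> g (h q) = q" for X g h
    unfolding c by (rule sum.reindex_bij_witness[of _ h g]) (use that in auto)
  define g1 g2 g3 g4 g5 :: "'a \<times> 'a \<times> 'a \<times> 'a \<Rightarrow> 'a \<times> 'a \<times> 'a \<times> 'a" where
    "g1 = (\<lambda>(a, b, c, d). (a, c, b, d))" and "g2 = (\<lambda>(a, b, c, d). (a, d, b, c))" and "g3 = (\<lambda>(a, b, c, d). (c, d, a, b))"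
    and "g4 = (\<lambda>(a, b, c, d). (b, d, a, c))" and "g5 = (\<lambda>(a, b, c, d). (b, c, a, d))"
  note G = g1_def g2_def g3_def g4_def g5_def
  define h2 h5 :: "'a \<times> 'a \<times> 'a \<times> 'a \<Rightarrow> 'a \<times> 'a \<times> 'a \<times> 'a" where
    "h2 = (\<lambda>(a, b, c, d). (a, c, d, b))" and "h5 = (\<lambda>(a, b, c, d). (c, a, b, d))"
  have P1: "(\<Sum>q\<in>quads V. of_bool (X (g1 q))) = card {q \<in> quads V. X q}" for X
    by (rule perm[of g1 g1]) (auto simp: G quads_def)
  have P2: "(\<Sum>q\<in>quads V. of_bool (X (g2 q))) = card {q \<in> quads V. X q}" for X
    by (rule perm[of g2 h2]) (auto simp: G h2_def quads_def)
  have P3: "(\<Sum>q\<in>quads V. of_bool (X (g3 q))) = card {q \<in> quads V. X q}" for X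
    by (rule perm[of g3 g3]) (auto simp: G quads_def)
  have P4: "(\<Sum>q\<in>quads V. of_bool (X (g4 q))) = card {q \<in> quads V. X q}" for X
    by (rule perm[of g4 "\<lambda>(a, b, c, d). (c, a, d, b)"]) (auto simp: G quads_def)
  have P5: "(\<Sum>q\<in>quads V. of_bool (X (g5 q))) = card {q \<in> quads V. X q}" for X
    by (rule perm[of g5 h5]) (auto simp: G h5_def quads_def)
  have "(\<Sum>q\<in>quads V. of_bool (meet q) + of_bool (meet (g1 q)) + of_bool (meet (g2 q)) + of_bool (separates q) + of_bool (separates (g3 q))
     + of_bool (separates (g1 q)) + of_bool (separates (g4 q)) + of_bool (separates (g2 q)) + of_bool (separates (g5 q))) = (\<Sum>q\<in>quads V. 3 :: nat)"
  proof (rule sum.cong[OF refl])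
    fix q assume q: "q \<in> quads V"
    obtain a b c d where e: "q = (a, b, c, d)" by (cases q)
    show "of_bool (meet q) + of_bool (meet (g1 q)) + of_bool (meet (g2 q)) + of_bool (separates q) + of_bool (separates (g3 q))
     + of_bool (separates (g1 q)) + of_bool (separates (g4 q)) + of_bool (separates (g2 q)) + of_bool (separates (g5 q)) = (3 :: nat)"
      using four_points[of a b c d] q unfolding e G prod.case .
  qed
  then have "3 * card {q \<in> quads V. meet q} + 6 * card {q \<in> quads V. separates q} = 3 * 657720"
    unfolding sum.distrib P1 P2 P3 P4 P5 c[symmetric] using card_quads[OF V] by simp
  then show ?thesis by simp
qed

definition lft :: "'a \<Rightarrow> 'a \<Rightarrow> 'a set" where "lft a b = {c \<in> V. 0 < O3 a b c}"
definition rgt :: "'a \<Rightarrow> 'a \<Rightarrow> 'a set" where "rgt a b = {c \<in> V. O3 a b c < 0}"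

text \<open>Two points separated by a line are one on the left and one on the right, in either
  order; hence the factor 2.\<close>

lemma card_spl: "card {q \<in> quads V. separates q} = (\<Sum>(a, b)\<in>{(a, b). a \<in> V \<and> b \<in> V \<and> a \<noteq> b}. 2 * (card (lft a b) * card (rgt a b)))"
proof -
  let ?P = "{(a, b). a \<in> V \<and> b \<in> V \<and> a \<noteq> b}"
  let ?S = "\<lambda>(a, b). lft a b \<times> rgt a b \<union> rgt a b \<times> lft a b"
  have fP: "finite ?P" by (rule finite_subset[of _ "V \<times> V"]) (use V in auto)
  have fin: "finite (lft a b)" "finite (rgt a b)" for a b unfolding lft_def rgt_def using V by simp_all
  have z: "O3 a b a = 0" "O3 a b b = 0" for a b unfolding O3_def ori_def by simp_all
  have "bij_betw (\<lambda>(a, b, c, d). ((a, b), (c, d))) {q \<in> quads V. separates q} (Sigma ?P ?S)"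
  proof (rule bij_betwI[of _ _ _ "\<lambda>((a, b), (c, d)). (a, b, c, d)"])
    show "(\<lambda>(a, b, c, d). ((a, b), (c, d))) \<in> {q \<in> quads V. separates q} \<rightarrow> Sigma ?P ?S"
      unfolding quads_def separates_def lft_def rgt_def by (auto simp: mult_less_0_iff)
    show "(\<lambda>((a, b), (c, d)). (a, b, c, d)) \<in> Sigma ?P ?S \<rightarrow> {q \<in> quads V. separates q}"
    proof
      fix u assume u: "u \<in> Sigma ?P ?S"
      obtain a b c d where e: "u = ((a, b), (c, d))" by (metis surj_pair)
      have h: "a \<in> V" "b \<in> V" "a \<noteq> b" "c \<in> V" "d \<in> V" "O3 a b c * O3 a b d < 0"
        using u unfolding e lft_def rgt_def by (auto simp: mult_less_0_iff)
      have "c \<noteq> a" "c \<noteq> b" "d \<noteq> a" "d \<noteq> b" using h(6) z[of a b] by auto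
      moreover have "c \<noteq> d" using h(6) by (auto simp: mult_less_0_iff)
      ultimately show "(\<lambda>((a, b), (c, d)). (a, b, c, d)) u \<in> {q \<in> quads V. separates q}" unfolding e quads_def separates_def using h by auto
    qed
  qed auto
  then have "card {q \<in> quads V. separates q} = card (Sigma ?P ?S)" by (rule bij_betw_same_card)
  also have "\<dots> = (\<Sum>u\<in>?P. card (?S u))" by (rule card_SigmaI[OF fP]) (use fin in auto)
  also have "\<dots> = (\<Sum>(a, b)\<in>?P. 2 * (card (lft a b) * card (rgt a b)))"
  proof (rule sum.cong[OF refl])
    fix u :: "'a \<times> 'a"
    obtain a b where e: "u = (a, b)" by (cases u)
    have dj: "(lft a b \<times> rgt a b) \<inter> (rgt a b \<times> lft a b) = {}" unfolding lft_def rgt_def by auto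
    show "card (?S u) = (\<lambda>(a, b). 2 * (card (lft a b) * card (rgt a b))) u"
      unfolding e using card_Un_disjoint[OF _ _ dj] fin by (simp add: card_cartesian_product)
  qed
  finally show ?thesis .
qed

text \<open>A crossing comes from eight ordered quadruples: two orders within each edge and two
  orders of the edges.\<close>

lemma card_meet: "card {q \<in> quads V. meet q} = 8 * crossings (complete_graph_edges V) p"
proof -
  let ?M = "{q \<in> quads V. meet q}"
  define g :: "'a \<times> 'a \<times> 'a \<times> 'a \<Rightarrow> 'a set set" where "g = (\<lambda>(a, b, c, d). {{a, b}, {c, d}})"
  have f: "finite ?M" using finite_quads[OF V(1)] by simp
  have fib: "card {q \<in> ?M. g q = z} = 8" if zM: "z \<in> g ` ?M" for z
  proof -
    obtain u where u: "u \<in> ?M" "z = g u" using zM by blast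
    obtain a b c d where e: "u = (a, b, c, d)" by (cases u)
    have q: "(a, b, c, d) \<in> quads V" "meet (a, b, c, d)" "z = {{a, b}, {c, d}}"
      using u unfolding e g_def by simp_all
    have ds: "a \<noteq> b" "a \<noteq> c" "a \<noteq> d" "b \<noteq> c" "b \<noteq> d" "c \<noteq> d" using q(1) unfolding quads_def by auto
    have "{q \<in> ?M. g q = z} = {(a, b, c, d), (b, a, c, d), (a, b, d, c), (b, a, d, c), (c, d, a, b), (d, c, a, b), (c, d, b, a), (d, c, b, a)}"
      (is "_ = ?R")
    proof
      show "{q \<in> ?M. g q = z} \<subseteq> ?R"
      proof
        fix u assume u: "u \<in> {q \<in> ?M. g q = z}"
        obtain a' b' c' d' where e: "u = (a', b', c', d')" by (cases u)
        have "{{a', b'}, {c', d'}} = {{a, b}, {c, d}}" using u unfolding e g_def q(3) by simp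
        then have "{a', b'} = {a, b} \<and> {c', d'} = {c, d} \<or> {a', b'} = {c, d} \<and> {c', d'} = {a, b}"
          by (simp only: doubleton_eq_iff)
        then show "u \<in> ?R" unfolding e doubleton_eq_iff by auto
      qed
      have m: "meet (b, a, c, d)" "meet (a, b, d, c)" "meet (b, a, d, c)" "meet (c, d, a, b)" "meet (d, c, a, b)" "meet (c, d, b, a)" "meet (d, c, b, a)"
        using q(2) unfolding meet_def by (auto simp: insert_commute Int_commute)
      have g: "g (a, b, c, d) = z" "g (b, a, c, d) = z" "g (a, b, d, c) = z" "g (b, a, d, c) = z" "g (c, d, a, b) = z" "g (d, c, a, b) = z" "g (c, d, b, a) = z" "g (d, c, b, a) = z"
        unfolding g_def q(3) by (simp_all add: insert_commute)
      show "?R \<subseteq> {q \<in> ?M. g q = z}" using q(1,2) m g unfolding quads_def by auto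
    qed
    then show ?thesis using ds by simp
  qed
  have "card ?M = (\<Sum>q\<in>?M. 1)" by simp
  also have "\<dots> = (\<Sum>z\<in>g ` ?M. \<Sum>q\<in>{q \<in> ?M. g q = z}. 1)" by (rule sum.image_gen[OF f])
  also have "\<dots> = (\<Sum>z\<in>g ` ?M. 8)" by (rule sum.cong[OF refl]) (use fib in simp)
  also have "\<dots> = 8 * card (g ` ?M)" by simp
  also have "g ` ?M = {{e, f} |e f. e \<in> complete_graph_edges V \<and> f \<in> complete_graph_edges V \<and> e \<inter> f = {} \<and>
       convex hull (p ` e) \<inter> convex hull (p ` f) \<noteq> {}}" (is "_ = ?X")
  proof
    show "g ` ?M \<subseteq> ?X"
    proof
      fix z assume "z \<in> g ` ?M"
      then obtain u where u: "u \<in> ?M" "z = g u" by blast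
      obtain a b c d where e: "u = (a, b, c, d)" by (cases u)
      have q: "(a, b, c, d) \<in> quads V" "meet (a, b, c, d)" "z = {{a, b}, {c, d}}"
        using u unfolding e g_def by simp_all
      show "z \<in> ?X" using q unfolding quads_def meet_def complete_graph_edges_def
        by (intro CollectI exI[of _ "{a, b}"] exI[of _ "{c, d}"]) auto
    qed
    show "?X \<subseteq> g ` ?M"
    proof
      fix z assume "z \<in> ?X"
      then obtain e f where ef: "z = {e, f}" "e \<subseteq> V" "card e = 2" "f \<subseteq> V" "card f = 2" "e \<inter> f = {}"
        "convex hull (p ` e) \<inter> convex hull (p ` f) \<noteq> {}" unfolding complete_graph_edges_def by blast
      obtain a b where a: "e = {a, b}" "a \<noteq> b" using ef(3) unfolding card_2_iff by blast
      obtain c d where c: "f = {c, d}" "c \<noteq> d" using ef(5) unfolding card_2_iff by blast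
      have "(a, b, c, d) \<in> ?M" using ef a c unfolding quads_def meet_def by auto
      moreover have "z = g (a, b, c, d)" unfolding g_def ef(1) a c by simp
      ultimately show "z \<in> g ` ?M" by blast
    qed
  qed
  finally show ?thesis unfolding crossings_def .
qed

lemma crossings_eq: "8 * crossings (complete_graph_edges V) p
    + 4 * (\<Sum>(a, b)\<in>{(a, b). a \<in> V \<and> b \<in> V \<and> a \<noteq> b}. card (lft a b) * card (rgt a b)) = 657720"
proof -
  have "(\<Sum>(a, b)\<in>{(a, b). a \<in> V \<and> b \<in> V \<and> a \<noteq> b}. 2 * (card (lft a b) * card (rgt a b))) =
    2 * (\<Sum>(a, b)\<in>{(a, b). a \<in> V \<and> b \<in> V \<and> a \<noteq> b}. card (lft a b) * card (rgt a b))"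
    by (simp add: sum_distrib_left case_prod_unfold)
  then show ?thesis using count_identity unfolding card_meet card_spl by simp
qed

text \<open>\<open>657720 - 4 * 144978 = 8 * 9726\<close>.\<close>

lemma crossings_ge: "9726 \<le> crossings (complete_graph_edges V) p"
proof -
  have o: "orient (\<lambda>a. p a $ 1) (\<lambda>a. p a $ 2) a b c = O3 a b c" for a b c unfolding orient_def O3_def ori_def by simp
  have "(\<Sum>(a, b)\<in>{(a, b). a \<in> V \<and> b \<in> V \<and> a \<noteq> b}. card (lft a b) * card (rgt a b)) \<le> 144978"
    using separation_bound[OF V, of "\<lambda>a. p a $ 1" "\<lambda>a. p a $ 2"] O3_nz unfolding o lft_def rgt_def by blast
  then show ?thesis using crossings_eq by linarith
qed

end

section \<open>A drawing with 9726 crossings\<close>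

text \<open>The set is the union of an orbit of a linear map of order three; the ten representatives come from a
computer search.\<close>

definition best_points :: "(int \<times> int) list" where
  "best_points = concat (map (\<lambda>f. map f [(7647, 930), (- 257, 3152), (- 1106, 8310), (5193, 642), (- 6515, - 7416), (1603, 796),
     (6343, 881), (- 802, - 526), (1770, 786), (7924, 955)]) [\<lambda>(x, y). (x, y), \<lambda>(x, y). (- y, x - y), \<lambda>(x, y). (y - x, - x)])"

definition idet :: "int \<times> int \<Rightarrow> int \<times> int \<Rightarrow> int \<times> int \<Rightarrow> int" where
  "idet a b c = (fst b - fst a) * (snd c - snd a) - (fst c - fst a) * (snd b - snd a)"

definition n_pos :: "int list \<Rightarrow> int" where "n_pos ds = (\<Sum>d\<leftarrow>ds. if 0 < d then 1 else 0)"
definition n_neg :: "int list \<Rightarrow> int" where "n_neg ds = (\<Sum>d\<leftarrow>ds. if d < 0 then 1 else 0)"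
definition sides :: "int list \<Rightarrow> int \<times> int" where "sides ds = (n_pos ds, n_neg ds)"

text \<open>A list program over the integers that visits every unordered pair once, so that the
  certificate can be evaluated.\<close>

fun pair_sides :: "(int \<times> int) list \<Rightarrow> (int \<times> int) list \<Rightarrow> (int \<times> int) list" where
  "pair_sides P [] = []"
| "pair_sides P (a # as) = map (\<lambda>b. sides (map (idet a b) P)) as @ pair_sides P as"

text \<open>One evaluation serves two ends: \<open>l + r = 28\<close> for every pair amounts to
  general position, and the sum, equal to the bound of \<open>lr_bound\<close>, determines the
  number of crossings.\<close>

definition balanced :: "(int \<times> int) list \<Rightarrow> bool" where
  "balanced M \<longleftrightarrow> list_all (\<lambda>(l, r). l + r = 28) M \<and> (\<Sum>(l, r)\<leftarrow>M. l * r) = 72489"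

lemma balanced_pts: "balanced (pair_sides best_points best_points)"
  by code_simp

lemma n_pos_filter: "n_pos ds = int (length (filter (\<lambda>d. 0 < d) ds))"
  unfolding n_pos_def by (induction ds) auto

lemma n_neg_filter: "n_neg ds = int (length (filter (\<lambda>d. d < 0) ds))"
  unfolding n_neg_def by (induction ds) auto

lemma pair_sides_sum:
  "(\<Sum>(l, r)\<leftarrow>pair_sides P as. l * r) =
    (\<Sum>j<length as. \<Sum>i<j. n_pos (map (idet (as ! i) (as ! j)) P) * n_neg (map (idet (as ! i) (as ! j)) P))"
proof (induction as)
  case (Cons a as)
  have h: "(\<Sum>(l, r)\<leftarrow>map (\<lambda>b. sides (map (idet a b) P)) as. l * r) =
    (\<Sum>j<length as. n_pos (map (idet a (as ! j)) P) * n_neg (map (idet a (as ! j)) P))"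
  proof -
    have "(\<Sum>(l, r)\<leftarrow>map (\<lambda>b. sides (map (idet a b) P)) as. l * r) =
      (\<Sum>b\<leftarrow>as. n_pos (map (idet a b) P) * n_neg (map (idet a b) P))"
      by (simp add: sides_def comp_def)
    also have "\<dots> = (\<Sum>j<length as. n_pos (map (idet a (as ! j)) P) * n_neg (map (idet a (as ! j)) P))"
      by (simp add: sum_list_sum_nth atLeast0LessThan)
    finally show ?thesis .
  qed
  show ?case using h Cons.IH
    by (simp add: sum.lessThan_Suc_shift sum.distrib del: sum.lessThan_Suc)
qed simp

lemma pair_sides_all:
  "list_all Q (pair_sides P as) \<Longrightarrow> i < j \<Longrightarrow> j < length as \<Longrightarrow> Q (sides (map (idet (as ! i) (as ! j)) P))"
proof (induction as arbitrary: i j)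
  case (Cons a as)
  obtain j' where j: "j = Suc j'" using Cons.prems(2) by (cases j) auto
  show ?case
  proof (cases i)
    case 0
    then show ?thesis using Cons.prems(1,3) j by (auto simp: list_all_iff)
  next
    case (Suc i')
    then show ?thesis using Cons.IH[of i' j'] Cons.prems j by simp
  qed
qed simp

definition best_drawing :: "nat \<Rightarrow> real^2" where
  "best_drawing i = vector [real_of_int (fst (best_points ! i)), real_of_int (snd (best_points ! i))]"

lemma ori_pl: "ori (best_drawing i) (best_drawing j) (best_drawing k) = real_of_int (idet (best_points ! i) (best_points ! j) (best_points ! k))"
  unfolding ori_def idet_def best_drawing_def by simp

definition Lc :: "nat \<Rightarrow> nat \<Rightarrow> nat" where "Lc i j = card {k \<in> {..<30}. 0 < idet (best_points ! i) (best_points ! j) (best_points ! k)}"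
definition Rc :: "nat \<Rightarrow> nat \<Rightarrow> nat" where "Rc i j = card {k \<in> {..<30}. idet (best_points ! i) (best_points ! j) (best_points ! k) < 0}"

lemma length_pts: "length best_points = 30" unfolding best_points_def by simp

lemma n_Lc: "n_pos (map (idet (best_points ! i) (best_points ! j)) best_points) = int (Lc i j)" "n_neg (map (idet (best_points ! i) (best_points ! j)) best_points) = int (Rc i j)"
  unfolding n_pos_filter n_neg_filter length_filter_conv_card length_map length_pts Lc_def Rc_def
  by (intro arg_cong[of _ _ "\<lambda>S. int (card S)"] Collect_cong; use length_pts in auto)+

lemma Lc_Rc: "i < j \<Longrightarrow> j < 30 \<Longrightarrow> Lc i j + Rc i j = 28"
proof -
  assume a: "i < j" "j < 30"
  have "list_all (\<lambda>(l, r). l + r = 28) (pair_sides best_points best_points)" using balanced_pts unfolding balanced_def by blast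
  from pair_sides_all[OF this a(1)] have "int (Lc i j) + int (Rc i j) = 28" using a(2) length_pts n_Lc unfolding sides_def by simp
  then show ?thesis by linarith
qed

lemma Lc_sum: "(\<Sum>j<30. \<Sum>i<j. Lc i j * Rc i j) = 72489"
proof -
  have "(\<Sum>j<30. \<Sum>i<j. int (Lc i j) * int (Rc i j)) = 72489"
    using balanced_pts pair_sides_sum[of best_points best_points] unfolding balanced_def n_Lc length_pts by simp
  then have "int (\<Sum>j<30. \<Sum>i<j. Lc i j * Rc i j) = int 72489" by simp
  then show ?thesis by (simp only: of_nat_eq_iff)
qed

lemma idet_swap: "idet b a c = - idet a b c" unfolding idet_def by (simp add: algebra_simps)

text \<open>A third point on the line through two others would leave at most 27 points for the two
  sides, but these contain 28.\<close>

lemma idet_nz_less: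
  assumes "i < j" "j < 30" "k < 30" "k \<noteq> i" "k \<noteq> j"
  shows "idet (best_points ! i) (best_points ! j) (best_points ! k) \<noteq> 0"
proof
  assume z: "idet (best_points ! i) (best_points ! j) (best_points ! k) = 0"
  let ?P = "{k \<in> {..<30}. 0 < idet (best_points ! i) (best_points ! j) (best_points ! k)}" and ?N = "{k \<in> {..<30}. idet (best_points ! i) (best_points ! j) (best_points ! k) < 0}"
  have "idet (best_points ! i) (best_points ! j) (best_points ! i) = 0" "idet (best_points ! i) (best_points ! j) (best_points ! j) = 0" unfolding idet_def by simp_all
  then have "?P \<union> ?N \<subseteq> {..<30} - {i, j, k}" using z by auto
  then have "card (?P \<union> ?N) \<le> card ({..<30} - {i, j, k})" by (rule card_mono[rotated]) simp
  moreover have "card ({..<30} - {i, j, k}) = 27" using card_Diff_subset[of "{i, j, k}" "{..<30}"] assms by auto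
  moreover have "card (?P \<union> ?N) = 28"
  proof -
    have "card (?P \<union> ?N) = card ?P + card ?N" by (rule card_Un_disjoint) auto
    then show ?thesis using Lc_Rc[OF assms(1,2)] unfolding Lc_def Rc_def by (simp only:)
  qed
  ultimately show False by simp
qed

lemma idet_nz: "i < 30 \<Longrightarrow> j < 30 \<Longrightarrow> k < 30 \<Longrightarrow> distinct [i, j, k] \<Longrightarrow> idet (best_points ! i) (best_points ! j) (best_points ! k) \<noteq> 0"
  using idet_nz_less[of i j k] idet_nz_less[of j i k] idet_swap[of "best_points ! j" "best_points ! i" "best_points ! k"]
  by (cases "i < j") auto

lemma drawing_pl: "geometric_drawing {..<30} best_drawing"
  unfolding geometric_drawing_def
proof (intro conjI ballI impI)
  show "inj_on best_drawing {..<30}"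
  proof (rule inj_onI, rule ccontr)
    fix i j :: nat assume a: "i \<in> {..<30}" "j \<in> {..<30}" "best_drawing i = best_drawing j" "i \<noteq> j"
    have "\<not> {..<30} \<subseteq> {i, j}" using card_mono[of "{i, j}" "{..<30}"] a(4) by auto
    then obtain k where k: "k < 30" "k \<noteq> i" "k \<noteq> j" by blast
    have "real_of_int (idet (best_points ! i) (best_points ! j) (best_points ! k)) = 0" unfolding ori_pl[symmetric] a(3) ori_def by simp
    then show False using idet_nz[of i j k] a k by simp
  qed
  fix i j k :: nat assume a: "i \<in> {..<30}" "j \<in> {..<30}" "k \<in> {..<30}" "distinct [i, j, k]"
  show "\<not> collinear {best_drawing i, best_drawing j, best_drawing k}" unfolding collinear_ori ori_pl using idet_nz[of i j k] a by simp
qed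

lemma crossings_pl: "crossings (complete_graph_edges {..<30}) best_drawing = 9726"
proof -
  interpret drawing "{..<30}" best_drawing by unfold_locales (use drawing_pl in auto)
  have lr: "card (lft a b) = Lc a b" "card (rgt a b) = Rc a b" for a b
    unfolding lft_def rgt_def O3_def ori_pl Lc_def Rc_def by simp_all
  have sw: "Lc b a = Rc a b" "Rc b a = Lc a b" for a b unfolding Lc_def Rc_def idet_swap[of "best_points ! b" "best_points ! a"] by simp_all
  let ?T = "SIGMA j:{..<30::nat}. {..<j}"
  have s: "{(a, b). a \<in> {..<30} \<and> b \<in> {..<30} \<and> a \<noteq> b} = ?T \<union> prod.swap ` ?T"
  proof
    show "{(a, b). a \<in> {..<30} \<and> b \<in> {..<30} \<and> a \<noteq> b} \<subseteq> ?T \<union> prod.swap ` ?T"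
    proof
      fix u assume u: "u \<in> {(a, b). a \<in> {..<30::nat} \<and> b \<in> {..<30::nat} \<and> a \<noteq> b}"
      obtain a b where e: "u = (a, b)" by (cases u)
      show "u \<in> ?T \<union> prod.swap ` ?T"
      proof (cases "b < a")
        case False
        then have "prod.swap (b, a) \<in> prod.swap ` ?T" using u unfolding e by (intro imageI) auto
        then show ?thesis unfolding e by simp
      qed (use u e in auto)
    qed
  qed auto
  have d: "?T \<inter> prod.swap ` ?T = {}" by auto
  let ?f = "\<lambda>(a, b). Lc a b * Rc a b"
  have 1: "sum ?f (prod.swap ` ?T) = 72489"
  proof -
    have "sum ?f (prod.swap ` ?T) = (\<Sum>u\<in>?T. ?f (prod.swap u))"
      by (rule sum.reindex_cong[of prod.swap]) (auto simp: inj_on_def)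
    also have "\<dots> = (\<Sum>(j, i)\<in>?T. Lc i j * Rc i j)" by (rule sum.cong) auto
    also have "\<dots> = (\<Sum>j<30. \<Sum>i<j. Lc i j * Rc i j)" by (rule sum.Sigma[symmetric]) auto
    finally show ?thesis using Lc_sum by simp
  qed
  have 2: "sum ?f ?T = 72489"
  proof -
    have "sum ?f ?T = (\<Sum>j<30. \<Sum>i<j. Lc j i * Rc j i)" by (rule sum.Sigma[symmetric]) auto
    also have "\<dots> = (\<Sum>j<30. \<Sum>i<j. Lc i j * Rc i j)"
    proof (intro sum.cong refl)
      fix i j :: nat
      show "Lc j i * Rc j i = Lc i j * Rc i j" using sw[of j i] by simp
    qed
    finally show ?thesis using Lc_sum by simp
  qed
  have "sum ?f {(a, b). a \<in> {..<30} \<and> b \<in> {..<30} \<and> a \<noteq> b} = 144978"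
    unfolding s using sum.union_disjoint[OF _ _ d, of ?f] 1 2 by simp
  then show ?thesis using crossings_eq unfolding lr by simp
qed

theorem theorem2:
  shows "rect_crossing_number {..<(30::nat)} (complete_graph_edges {..<30}) = 9726"
  unfolding rect_crossing_number_def
proof (rule Least_equality)
  show "\<exists>p. geometric_drawing {..<30::nat} p \<and> crossings (complete_graph_edges {..<30}) p = 9726"
    using drawing_pl crossings_pl by blast
next
  fix k assume "\<exists>p. geometric_drawing {..<30::nat} p \<and> crossings (complete_graph_edges {..<30}) p = k"
  then obtain p where p: "geometric_drawing {..<30::nat} p" "crossings (complete_graph_edges {..<30}) p = k" by blast
  interpret drawing "{..<30}" p by unfold_locales (use p in auto)
  show "9726 \<le> k" using crossings_ge p(2) by simp
qed

end
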